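(* Let $\Lambda$ be an even, unimodular, indefinite lattice, let $T$ be an even lattice admitting at least one primitive embedding $\iota_0: T\hookrightarrow\Lambda$, and let $G\subset O(T)$ be a (not necessarily finite) subgroup. Let $S$ be a lattice isomorphic to the orthogonal lattice $\iota_0(T)^\perp$ in $\Lambda$, and let $\mathcal{G}(S)=\{S_1=S,S_2,\dots,S_m\}$ be the genus of $S$. For each $j$ fix an isometry $\varphi_j:(A_T,-q_T)\to(A_{S_j},q_{S_j})$. Then for each $j=1,\dots,m$, $$|\mathcal{P}^{G\text{-eq}}_j(T,\Lambda)| = |O(S_j)\setminus O(A_{S_j})/G|.$$ In particular, $$|\mathcal{P}^{G\text{-eq}}(T,\Lambda)|=\sum_{j=1}^m |O(S_j)\setminus O(A_{S_j})/G|.$$ Here $O(S_j)$ acts on $O(A_{S_j})$ through the natural map $O(S_j)\to O(A_{S_j})$, $h\mapsto\bar h$, and $G$ acts on $O(A_{S_j})$ through the composite of the natural map $G\subset O(T)\to O(A_T)$, $g\mapsto \bar g$, and the adjoint map $\mathrm{ad}(\varphi_j):O(A_T)\to O(A_{S_j})$, $\tau\mapsto\varphi_j\circ\tau\circ\varphi_j^{-1}$.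
   Context: A lattice $L$ is a free $\mathbf{Z}$-module of finite rank with a non-degenerate symmetric $\mathbf{Z}$-valued bilinear form $(\,,\,)_L$; $O(L)$ is its isometry group, $L^*=\mathrm{Hom}(L,\mathbf{Z})$, viewed inside $L\otimes\mathbf{Q}$ via the form. For an even lattice $L$, the discriminant group is $A_L=L^*/L$ with the quadratic form $q_L:A_L\to\mathbf{Q}/2\mathbf{Z}$, $q_L(x \bmod L)=(x,x)_{L\otimes\mathbf{Q}}\bmod 2\mathbf{Z}$; $O(A_L)$ denotes the group of automorphisms of $A_L$ preserving $q_L$. An embedding of lattices preserves the bilinear forms; it is primitive if its cokernel is torsion-free. The genus $\mathcal{G}(M)$ of an even lattice $M$ is the (finite) set of isomorphism classes of even lattices $M'$ with $(A_{M'},q_{M'})\cong(A_M,q_M)$ and the same signature as $M$ (equivalently, $M'\otimes\mathbf{Z}_p\cong M\otimes\mathbf{Z}_p$ for all primes $p$ and $M'\otimes\mathbf{R}\cong M\otimes\mathbf{R}$). Isometries $\varphi_j:(A_T,-q_T)\to(A_{S_j},q_{S_j})$ exist for every $j$ (since $\Lambda$ is unimodular). $\mathcal{P}(T,\Lambda)$ is the set of all primitive embeddings $\iota:T\hookrightarrow\Lambda$. Two primitive embeddings $\iota,\iota':T\hookrightarrow\Lambda$ are $G$-equivalent if there exist $\Phi\in O(\Lambda)$ and $g\in G$ with $\Phi\circ\iota=\iota'\circ g$. $\mathcal{P}^{G\text{-eq}}(T,\Lambda)$ is the set of $G$-equivalence classes, and $\mathcal{P}^{G\text{-eq}}_j(T,\Lambda)$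 is the subset of classes $[\iota]$ with $\iota(T)^\perp\cong S_j$ (this is well defined on classes). The double coset space $O(S_j)\setminus O(A_{S_j})/G$ is the quotient of $O(A_{S_j})$ by the relation $\sigma\sim \bar h\circ\sigma\circ(\varphi_j\circ\bar g\circ\varphi_j^{-1})$ for $h\in O(S_j)$, $g\in G$. *)

theory Defs
  imports Complex_Main "HOL-Algebra.Free_Abelian_Groups" "HOL-Algebra.Bij"
begin

section \<open>Lattices\<close>

text \<open>
  A lattice is an abelian group (written multiplicatively, as always in HOL-Algebra, so that
  \<open>x \<otimes> y\<close> is the sum of two lattice vectors and \<open>\<one>\<close> is the zero vector) together with an
  integer-valued form. A free \<open>\<int>\<close>-module of finite rank is an abelian group isomorphic to the
  free abelian group on \<open>{..<n}\<close>. Rank 0 is allowed. All maps between carriers are taken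
  extensional, so that equality of maps is equality on the carrier.
\<close>

record 'a zlat = "'a monoid" +
  form :: "'a \<Rightarrow> 'a \<Rightarrow> int"

definition zlattice :: "'a zlat \<Rightarrow> bool" where
  "zlattice L \<longleftrightarrow>
     comm_group L \<and>
     (\<exists>n::nat. free_Abelian_group {..<n} \<cong> L) \<and>
     (\<forall>x\<in>carrier L. form L x \<in> hom L integer_group) \<and>
     (\<forall>x\<in>carrier L. \<forall>y\<in>carrier L. form L x y = form L y x) \<and>
     (\<forall>x\<in>carrier L. (\<forall>y\<in>carrier L. form L x y = 0) \<longrightarrow> x = \<one>\<^bsub>L\<^esub>)"

definition even_lattice :: "'a zlat \<Rightarrow> bool" where
  "even_lattice L \<longleftrightarrow> zlattice L \<and> (\<forall>x\<in>carrier L. even (form L x x))"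

definition indefinite :: "'a zlat \<Rightarrow> bool" where
  "indefinite L \<longleftrightarrow>
     (\<exists>x\<in>carrier L. form L x x > 0) \<and> (\<exists>x\<in>carrier L. form L x x < 0)"

definition lattice_basis :: "'a zlat \<Rightarrow> nat \<Rightarrow> (nat \<Rightarrow> 'a) \<Rightarrow> bool" where
  "lattice_basis L n e \<longleftrightarrow>
     (\<exists>\<phi>\<in>iso (free_Abelian_group {..<n}) L. \<forall>i<n. e i = \<phi> (frag_of i))"

text \<open>
  The signature is that of the real quadratic space \<open>L \<otimes> \<real>\<close>: there are vectors
  \<open>v\<^sub>k = (\<Sum>i. a k i e\<^sub>i)\<close> of \<open>L \<otimes> \<real>\<close>, for \<open>k < p + q = rank L\<close>, whose Gram matrix is
  \<open>diag(1,\<dots>,1,-1,\<dots>,-1)\<close> with \<open>p\<close> entries \<open>1\<close> and \<open>q\<close> entries \<open>-1\<close>; such vectors are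
  automatically a basis of \<open>L \<otimes> \<real>\<close>.
\<close>

definition has_signature :: "'a zlat \<Rightarrow> nat \<Rightarrow> nat \<Rightarrow> bool" where
  "has_signature L p q \<longleftrightarrow>
     (\<exists>e. \<exists>a :: nat \<Rightarrow> nat \<Rightarrow> real. lattice_basis L (p + q) e \<and>
        (\<forall>k<p + q. \<forall>l<p + q.
           (\<Sum>i<p + q. \<Sum>j<p + q. a k i * a l j * real_of_int (form L (e i) (e j))) =
           (if k \<noteq> l then 0 else if k < p then 1 else - 1)))"

definition isometries :: "'a zlat \<Rightarrow> 'b zlat \<Rightarrow> ('a \<Rightarrow> 'b) set" where
  "isometries L M =
     {f \<in> iso L M. f \<in> extensional (carrier L) \<and>
        (\<forall>x\<in>carrier L. \<forall>y\<in>carrier L. form M (f x) (f y) = form L x y)}"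

definition isometric :: "'a zlat \<Rightarrow> 'b zlat \<Rightarrow> bool" where
  "isometric L M \<longleftrightarrow> isometries L M \<noteq> {}"

definition orth_group :: "'a zlat \<Rightarrow> ('a \<Rightarrow> 'a) monoid" where
  "orth_group L = BijGroup (carrier L) \<lparr>carrier := isometries L L\<rparr>"

definition orth_compl :: "'a zlat \<Rightarrow> 'a set \<Rightarrow> 'a zlat" where
  "orth_compl L K = L \<lparr>carrier := {y \<in> carrier L. \<forall>x\<in>K. form L x y = 0}\<rparr>"


section \<open>Discriminant forms\<close>

definition dual_group :: "'a zlat \<Rightarrow> ('a \<Rightarrow> int) monoid" where
  "dual_group L =
     \<lparr>carrier = hom L integer_group \<inter> extensional (carrier L),
      monoid.mult = (\<lambda>f g. \<lambda>x\<in>carrier L. f x + g x),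
      one = (\<lambda>x\<in>carrier L. 0)\<rparr>"

definition to_dual :: "'a zlat \<Rightarrow> 'a \<Rightarrow> 'a \<Rightarrow> int" where
  "to_dual L x = (\<lambda>y\<in>carrier L. form L x y)"

definition unimodular :: "'a zlat \<Rightarrow> bool" where
  "unimodular L \<longleftrightarrow> bij_betw (to_dual L) (carrier L) (carrier (dual_group L))"

definition disc_group :: "'a zlat \<Rightarrow> ('a \<Rightarrow> int) set monoid" where
  "disc_group L = dual_group L Mod (to_dual L ` carrier L)"

text \<open>
  A functional \<open>f \<in> L\<^sup>*\<close> with \<open>n f = (x, _)\<close>, where \<open>x \<in> L\<close> and \<open>n > 0\<close>, is the element
  \<open>x / n\<close> of \<open>L \<otimes> \<rat>\<close>; its square there is \<open>(x, x) / n\<^sup>2\<close>. By non-degeneracy, every \<open>f\<close>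
  is of this form, and the value does not depend on the choice of \<open>x\<close> and \<open>n\<close>.
\<close>

definition dual_norm :: "'a zlat \<Rightarrow> ('a \<Rightarrow> int) \<Rightarrow> rat" where
  "dual_norm L f =
     (THE r. \<exists>x\<in>carrier L. \<exists>n::int. n > 0 \<and>
        (\<forall>y\<in>carrier L. n * f y = form L x y) \<and> r = of_int (form L x x) / (of_int n)\<^sup>2)"

text \<open>
  An element of \<open>\<rat> / 2\<int>\<close> is represented by the coset it is. The union below is over the
  representatives of a class in the discriminant group; for an even lattice all of them give
  the same coset.
\<close>

definition mod_2Z :: "rat \<Rightarrow> rat set" where
  "mod_2Z r = range (\<lambda>k::int. r + 2 * of_int k)"

definition disc_quad :: "'a zlat \<Rightarrow> ('a \<Rightarrow> int) set \<Rightarrow> rat set" where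
  "disc_quad L c = (\<Union>f\<in>c. mod_2Z (dual_norm L f))"

definition neg_disc_quad :: "'a zlat \<Rightarrow> ('a \<Rightarrow> int) set \<Rightarrow> rat set" where
  "neg_disc_quad L c = uminus ` disc_quad L c"

definition quad_isometries ::
    "'a monoid \<Rightarrow> ('a \<Rightarrow> rat set) \<Rightarrow> 'b monoid \<Rightarrow> ('b \<Rightarrow> rat set) \<Rightarrow> ('a \<Rightarrow> 'b) set" where
  "quad_isometries A q B q' =
     {f \<in> iso A B. f \<in> extensional (carrier A) \<and> (\<forall>c\<in>carrier A. q' (f c) = q c)}"

definition disc_orth :: "'a zlat \<Rightarrow> (('a \<Rightarrow> int) set \<Rightarrow> ('a \<Rightarrow> int) set) set" where
  "disc_orth L = quad_isometries (disc_group L) (disc_quad L) (disc_group L) (disc_quad L)"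

text \<open>
  The natural map \<open>O(L) \<rightarrow> O(A\<^sub>L)\<close>. The extension of \<open>h\<close> to \<open>L \<otimes> \<rat>\<close> sends the functional
  \<open>(x, _)\<close> to \<open>(h x, _) = (x, h\<^sup>-\<^sup>1 _)\<close>, so it acts on \<open>L\<^sup>*\<close> by composition with the inverse of \<open>h\<close>.
\<close>

definition disc_map :: "'a zlat \<Rightarrow> ('a \<Rightarrow> 'a) \<Rightarrow> ('a \<Rightarrow> int) set \<Rightarrow> ('a \<Rightarrow> int) set" where
  "disc_map L h =
     (\<lambda>c\<in>carrier (disc_group L). (\<lambda>f. \<lambda>y\<in>carrier L. f (inv_into (carrier L) h y)) ` c)"

definition disc_ad ::
    "'b zlat \<Rightarrow> 'c zlat \<Rightarrow> (('b \<Rightarrow> int) set \<Rightarrow> ('c \<Rightarrow> int) set) \<Rightarrow>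
     (('b \<Rightarrow> int) set \<Rightarrow> ('b \<Rightarrow> int) set) \<Rightarrow> ('c \<Rightarrow> int) set \<Rightarrow> ('c \<Rightarrow> int) set" where
  "disc_ad T S \<phi> \<tau> =
     (\<lambda>c\<in>carrier (disc_group S). \<phi> (\<tau> (inv_into (carrier (disc_group T)) \<phi> c)))"


section \<open>The genus\<close>

text \<open>
  The genus is a set of isometry classes of lattices on the type \<open>'c\<close>. Nothing is lost by fixing
  this type: the carrier of \<open>M\<close> can carry every lattice of the rank of \<open>M\<close>, up to isometry.
\<close>

definition same_genus :: "'a zlat \<Rightarrow> 'b zlat \<Rightarrow> bool" where
  "same_genus M M' \<longleftrightarrow>
     quad_isometries (disc_group M') (disc_quad M') (disc_group M) (disc_quad M) \<noteq> {} \<and>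
     (\<exists>p q. has_signature M p q \<and> has_signature M' p q)"

definition isometry_class :: "'c zlat \<Rightarrow> 'c zlat set" where
  "isometry_class M = {M'. even_lattice M' \<and> isometric M M'}"

definition genus :: "'c zlat \<Rightarrow> 'c zlat set set" where
  "genus M = isometry_class ` {M'. even_lattice M' \<and> same_genus M M'}"


section \<open>Primitive embeddings and double cosets\<close>

definition torsion_free :: "('a, 'b) monoid_scheme \<Rightarrow> bool" where
  "torsion_free A \<longleftrightarrow>
     (\<forall>x\<in>carrier A. \<forall>n::nat. n > 0 \<and> x [^]\<^bsub>A\<^esub> n = \<one>\<^bsub>A\<^esub> \<longrightarrow> x = \<one>\<^bsub>A\<^esub>)"

definition prim_embeddings :: "'b zlat \<Rightarrow> 'a zlat \<Rightarrow> ('b \<Rightarrow> 'a) set" where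
  "prim_embeddings T L =
     {\<iota> \<in> mon T L. \<iota> \<in> extensional (carrier T) \<and>
        (\<forall>x\<in>carrier T. \<forall>y\<in>carrier T. form L (\<iota> x) (\<iota> y) = form T x y) \<and>
        torsion_free (L Mod (\<iota> ` carrier T))}"

definition G_equiv ::
    "'b zlat \<Rightarrow> 'a zlat \<Rightarrow> ('b \<Rightarrow> 'b) set \<Rightarrow> (('b \<Rightarrow> 'a) \<times> ('b \<Rightarrow> 'a)) set" where
  "G_equiv T L G =
     {(\<iota>, \<iota>'). \<iota> \<in> prim_embeddings T L \<and> \<iota>' \<in> prim_embeddings T L \<and>
        (\<exists>\<Phi>\<in>isometries L L. \<exists>g\<in>G. compose (carrier T) \<Phi> \<iota> = compose (carrier T) \<iota>' g)}"

definition emb_classes ::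
    "'b zlat \<Rightarrow> 'a zlat \<Rightarrow> ('b \<Rightarrow> 'b) set \<Rightarrow> ('b \<Rightarrow> 'a) set set" where
  "emb_classes T L G = prim_embeddings T L // G_equiv T L G"

definition emb_classes_with ::
    "'b zlat \<Rightarrow> 'a zlat \<Rightarrow> ('b \<Rightarrow> 'b) set \<Rightarrow> 'c zlat \<Rightarrow> ('b \<Rightarrow> 'a) set set" where
  "emb_classes_with T L G S =
     {C \<in> emb_classes T L G. \<exists>\<iota>\<in>C. isometric (orth_compl L (\<iota> ` carrier T)) S}"

definition double_coset_rel ::
    "'b zlat \<Rightarrow> ('b \<Rightarrow> 'b) set \<Rightarrow> 'c zlat \<Rightarrow> (('b \<Rightarrow> int) set \<Rightarrow> ('c \<Rightarrow> int) set) \<Rightarrow>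
     ((('c \<Rightarrow> int) set \<Rightarrow> ('c \<Rightarrow> int) set) \<times> (('c \<Rightarrow> int) set \<Rightarrow> ('c \<Rightarrow> int) set)) set" where
  "double_coset_rel T G S \<phi> =
     {(\<sigma>, \<sigma>'). \<sigma> \<in> disc_orth S \<and> \<sigma>' \<in> disc_orth S \<and>
        (\<exists>h\<in>isometries S S. \<exists>g\<in>G.
           \<sigma>' = compose (carrier (disc_group S)) (disc_map S h)
                  (compose (carrier (disc_group S)) \<sigma> (disc_ad T S \<phi> (disc_map T g))))}"

definition double_cosets ::
    "'b zlat \<Rightarrow> ('b \<Rightarrow> 'b) set \<Rightarrow> 'c zlat \<Rightarrow> (('b \<Rightarrow> int) set \<Rightarrow> ('c \<Rightarrow> int) set) \<Rightarrow>
     (('c \<Rightarrow> int) set \<Rightarrow> ('c \<Rightarrow> int) set) set set" where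
  "double_cosets T G S \<phi> = disc_orth S // double_coset_rel T G S \<phi>"

end

theory Submission
  imports Defs
    "HOL-Computational_Algebra.Primes"
    "HOL-Library.Multiset"
    "HOL-Library.Function_Algebras"
    "HOL-Library.Product_Plus"
begin

text \<open>
  A primitive embedding \<open>\<iota>\<close> of \<open>T\<close>, together with an isometry \<open>j\<close> of \<open>S\<close> onto the orthogonal complement of its
  image, makes \<open>\<Lambda>\<close> an overlattice of \<open>T \<oplus> S\<close>. Since \<open>\<Lambda>\<close> is unimodular, restricting \<open>(x, _)\<close> to \<open>T\<close> and to \<open>S\<close>
  gives an isometry \<open>\<gamma>\<close> from \<open>(A\<^sub>T, -q\<^sub>T)\<close> to \<open>(A\<^sub>S, q\<^sub>S)\<close>, and \<open>\<gamma>\<close> determines the overlattice. So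
  \<open>\<sigma> = \<gamma> \<circ> \<phi>\<^sup>-\<^sup>1\<close> identifies classes of embeddings with double cosets, provided that every \<open>\<gamma>\<close> occurs.
  The overlattice glued from \<open>T\<close> and \<open>S\<close> along \<open>\<gamma>\<close> is even, unimodular and of the signature of \<open>\<Lambda>\<close>, hence
  isometric to \<open>\<Lambda>\<close>, because an even indefinite unimodular lattice is determined by its signature.

  That uniqueness follows Serre's argument once indefinite unimodular lattices are known to contain
  isotropic vectors. Instead of the Hasse-Minkowski theorem, Milnor's computation of the Witt group of
  \<open>\<rat>\<close> is used: after adding hyperbolic planes, the norms of a rational orthogonal basis can be made
  \<open>1\<close> or \<open>-1\<close>, or else the norms divisible by some prime \<open>p\<close> form an anisotropic form modulo \<open>p\<close>, which is
  impossible for a lattice that is unimodular at \<open>p\<close>.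
\<close>

section \<open>Norms of rational orthogonal bases\<close>

text \<open>The norms can be reduced only after planes have been added, so the result has to be
  brought back to the original space. Two facts do this. Unimodularity at \<open>p\<close> passes to
  orthogonal sums with lines of norm \<open>1\<close> or \<open>-1\<close>, so the anisotropic
  alternative is refuted in the larger space. And if all norms are signs, Witt cancellation removes
  the added lines one at a time, because each of them finds a basis vector of its own norm.

  In Serre's argument an odd indefinite unimodular lattice gets an orthogonal basis of norms
  \<open>1\<close> and \<open>-1\<close>, which leaves only the signature as an invariant. An even
  one has an odd neighbour \<open>N\<close> and is recovered from the vectors of even norm in
  \<open>N\<close> by adjoining one of two classes of vectors outside \<open>N\<close>. The choice
  is harmless, since the reflection in a vector of norm \<open>-1\<close> exchanges the two classes.

  Signatures are defined over the reals, but everything else is rational arithmetic. They are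
  therefore read off from complete orthogonal sets of lattice vectors, which also makes their
  additivity under gluing visible.\<close>

text \<open>
  Operations on the norms of an orthogonal basis. All but \<open>hyp\<close> preserve the rational quadratic
  space; \<open>hyp\<close> adds a hyperbolic plane, and the index counts how often this happens.
\<close>

inductive stab :: "nat \<Rightarrow> rat multiset \<Rightarrow> rat multiset \<Rightarrow> bool" where
  refl: "stab 0 A A"
| scale: "c \<noteq> 0 \<Longrightarrow> stab 0 (add_mset x A) (add_mset (c\<^sup>2 * x) A)"
| pair: "x + y \<noteq> 0 \<Longrightarrow> stab 0 (add_mset x (add_mset y A)) (add_mset (x + y) (add_mset (x * y * (x + y)) A))"
| hyp: "stab 1 A (add_mset 1 (add_mset (-1) A))"
| trans: "stab m A B \<Longrightarrow> stab n B C \<Longrightarrow> stab (m + n) A C"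

definition reach :: "rat multiset \<Rightarrow> rat multiset \<Rightarrow> bool" where
  "reach A B \<longleftrightarrow> (\<exists>n. stab n A B)"

lemma reach_refl [simp]: "reach A A"
  using stab.refl reach_def by blast

lemma reach_trans [trans]: "reach A B \<Longrightarrow> reach B C \<Longrightarrow> reach A C"
  unfolding reach_def using stab.trans by blast

lemma reach_scale: "c \<noteq> 0 \<Longrightarrow> y = c\<^sup>2 * x \<Longrightarrow> reach (add_mset x A) (add_mset y A)"
  using stab.scale reach_def by blast

lemma reach_pair: "x + y \<noteq> 0 \<Longrightarrow> s = x + y \<Longrightarrow> t = x * y * (x + y) \<Longrightarrow>
   reach (add_mset x (add_mset y A)) (add_mset s (add_mset t A))"
  using stab.pair reach_def by blast

lemma stab_add: "stab n A B \<Longrightarrow> stab n (A + D) (B + D)"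
proof (induction rule: stab.induct)
  case (hyp A)
  show ?case using stab.hyp[of "A + D"] by simp
next
  case (trans m A B n C)
  then show ?case using stab.trans by blast
qed (auto intro: stab.refl stab.scale stab.pair)

lemma reach_add: "reach A B \<Longrightarrow> reach C D \<Longrightarrow> reach (A + C) (B + D)"
proof -
  assume "reach A B" "reach C D"
  then have "reach (A + C) (B + C)" "reach (C + B) (D + B)"
    using stab_add reach_def by blast+
  then show ?thesis by (metis add.commute reach_trans)
qed

lemma reach_add_mset: "reach A B \<Longrightarrow> reach (add_mset x A) (add_mset x B)"
  using reach_add[of "{#x#}" "{#x#}" A B] by simp

text \<open>\<open>pair\<close> is its own inverse up to squares: suitable square multiples
  \<open>X\<close> and \<open>Y\<close> of the two norms have sum \<open>a\<close>, and
  \<open>X * Y * (X + Y)\<close> is \<open>b\<close> up to a square.\<close>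

lemma reach_pair_inv:
  assumes "a \<noteq> 0" "b \<noteq> 0" "a + b \<noteq> 0"
  shows "reach (add_mset (a + b) (add_mset (a * b * (a + b)) A)) (add_mset a (add_mset b A))"
proof -
  define X where "X = (a / (a + b))\<^sup>2 * (a + b)"
  define Y where "Y = (1 / (a + b))\<^sup>2 * (a * b * (a + b))"
  have XY: "X = a\<^sup>2 / (a + b)" "Y = a * b / (a + b)"
    using assms(3) by (auto simp: X_def Y_def power2_eq_square)
  have s: "X + Y = a"
  proof -
    have "X + Y = a * (a + b) / (a + b)" unfolding XY by (simp add: power2_eq_square algebra_simps add_divide_distrib)
    then show ?thesis using assms(3) by simp
  qed
  have t: "b = ((a + b) / a\<^sup>2)\<^sup>2 * (X * Y * (X + Y))"
  proof -
    have "((a + b) / a\<^sup>2)\<^sup>2 * (a\<^sup>2 / d * (a * b / d) * a) = b" if "d = a + b" for d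
      using assms that by (simp add: power2_eq_square)
    then show ?thesis unfolding s unfolding XY by simp
  qed
  have "reach (add_mset (a + b) (add_mset (a * b * (a + b)) A)) (add_mset X (add_mset (a * b * (a + b)) A))"
    using assms by (intro reach_scale[of "a / (a + b)"]) (auto simp: X_def)
  also have "reach \<dots> (add_mset X (add_mset Y A))"
    using assms by (intro reach_add_mset reach_scale[of "1 / (a + b)"]) (auto simp: Y_def)
  also have "reach \<dots> (add_mset a (add_mset (X * Y * (X + Y)) A))"
    using assms s by (intro reach_pair) auto
  also have "reach \<dots> (add_mset a (add_mset b A))"
    using assms t by (intro reach_add_mset reach_scale[of "(a + b) / a\<^sup>2"]) auto
  finally show ?thesis .
qed

text \<open>Every \<open>q\<close> is a difference of two squares, those of
  \<open>(q + 1) / 2\<close> and \<open>(q - 1) / 2\<close>, so the plane \<open>1, -1\<close>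
  represents it; the second norm is then \<open>-q\<close> up to a square. For \<open>q = 1\<close>
  and \<open>q = -1\<close> one of the two numbers vanishes and cannot be used for scaling.\<close>

lemma reach_hyp:
  assumes "q \<noteq> 0"
  shows "reach A (add_mset q (add_mset (- q) A))"
proof -
  have h: "reach A (add_mset 1 (add_mset (- 1) A))"
    using stab.hyp reach_def by blast
  consider "q = 1" | "q = -1" | "q \<noteq> 1" "q \<noteq> -1" by blast
  then show ?thesis
  proof cases
    case 3
    define s t where "s = (q + 1) / 2" and "t = (q - 1) / 2"
    have nz: "s \<noteq> 0" "t \<noteq> 0" using 3 by (auto simp: s_def t_def add_eq_0_iff)
    have q: "s\<^sup>2 + (- t\<^sup>2) = q" by (simp add: s_def t_def power2_eq_square field_simps)
    note h
    also have "reach (add_mset 1 (add_mset (- 1) A)) (add_mset (s\<^sup>2) (add_mset (- 1) A))"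
      using nz by (intro reach_scale[of s]) auto
    also have "reach \<dots> (add_mset (s\<^sup>2) (add_mset (- t\<^sup>2) A))"
      using nz by (intro reach_add_mset reach_scale[of t]) auto
    also have "reach \<dots> (add_mset q (add_mset (s\<^sup>2 * (- t\<^sup>2) * q) A))"
      using q assms by (intro reach_pair) auto
    also have "reach \<dots> (add_mset q (add_mset (- q) A))"
      using nz by (intro reach_add_mset reach_scale[of "1 / (s * t)"]) (auto simp: power2_eq_square)
    finally show ?thesis .
  qed (use h in \<open>auto simp: add_mset_commute\<close>)
qed

text \<open>The same computation from the other side: \<open>s + t = 1 / x\<close> and
  \<open>s - t = 1\<close>, so the difference of the squares of \<open>s\<close> and
  \<open>t\<close> is \<open>1 / x\<close>, and the plane \<open>x, -x\<close> represents
  \<open>1\<close>.\<close>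

lemma reach_unhyp:
  assumes "x \<noteq> 0"
  shows "reach (add_mset x (add_mset (- x) A)) (add_mset 1 (add_mset (- 1) A))"
proof -
  consider "x = 1" | "x = -1" | "x \<noteq> 1" "x \<noteq> -1" by blast
  then show ?thesis
  proof cases
    case 3
    define s t where "s = (1 / x + 1) / 2" and "t = (1 / x - 1) / 2"
    have nz: "s \<noteq> 0" "t \<noteq> 0" using 3 assms by (auto simp: s_def t_def field_simps)
    have q: "s\<^sup>2 * x + (t\<^sup>2 * (- x)) = 1" using assms by (simp add: s_def t_def power2_eq_square field_simps)
    have "reach (add_mset x (add_mset (- x) A)) (add_mset (s\<^sup>2 * x) (add_mset (- x) A))"
      using nz by (intro reach_scale[of s]) auto
    also have "reach \<dots> (add_mset (s\<^sup>2 * x) (add_mset (t\<^sup>2 * (- x)) A))"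
      using nz by (intro reach_add_mset reach_scale[of t]) auto
    also have "reach \<dots> (add_mset 1 (add_mset (s\<^sup>2 * x * (t\<^sup>2 * (- x)) * 1) A))"
      using q by (intro reach_pair) auto
    also have "reach \<dots> (add_mset 1 (add_mset (- 1) A))"
      using nz assms by (intro reach_add_mset reach_scale[of "1 / (s * t * x)"]) (auto simp: power2_eq_square)
    finally show ?thesis .
  qed (auto simp: add_mset_commute)
qed

text \<open>Scaling the whole form by \<open>q\<close> commutes with the operations up to squares.
  The one substantial case is \<open>hyp\<close>, where the scaled plane \<open>q, -q\<close> must
  again be reached from nothing.\<close>

lemma reach_mult:
  assumes "reach A B" "q \<noteq> 0"
  shows "reach (image_mset ((*) q) A) (image_mset ((*) q) B)"
proof -
  obtain n where "stab n A B" using assms reach_def by blast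
  then show ?thesis
  proof (induction rule: stab.induct)
    case (scale c x A)
    then show ?case by (auto intro: reach_scale)
  next
    case (pair x y A)
    have "reach (image_mset ((*) q) (add_mset x (add_mset y A)))
       (add_mset (q * (x + y)) (add_mset ((q * x) * (q * y) * (q * (x + y))) (image_mset ((*) q) A)))"
      using pair assms(2) by (auto intro!: reach_pair simp: algebra_simps)
         (metis distrib_left mult_eq_0_iff)
    also have "reach \<dots> (image_mset ((*) q) (add_mset (x + y) (add_mset (x * y * (x + y)) A)))"
      using assms(2) by (simp, intro reach_add_mset reach_scale[of "1 / q"]) (auto simp: power2_eq_square)
    finally show ?case .
  next
    case (hyp A)
    then show ?case using reach_hyp[OF assms(2), of "image_mset ((*) q) A"] by simp
  next
    case (trans m A B n C)
    then show ?case using reach_trans by blast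
  qed simp
qed

section \<open>Norms with small prime factors, and residues modulo a prime\<close>

definition smooth :: "nat \<Rightarrow> int \<Rightarrow> bool" where
  "smooth p w \<longleftrightarrow> w \<noteq> 0 \<and> (\<forall>q. prime q \<longrightarrow> q dvd w \<longrightarrow> q < int p)"

definition smooth_mset :: "nat \<Rightarrow> rat multiset \<Rightarrow> bool" where
  "smooth_mset p C \<longleftrightarrow> (\<forall>x\<in>#C. \<exists>w. x = of_int w \<and> smooth p w)"

lemma smooth_mult: "smooth p a \<Longrightarrow> smooth p b \<Longrightarrow> smooth p (a * b)"
  by (auto simp: smooth_def prime_dvd_mult_iff)

lemma smooth_uminus [simp]: "smooth p (- a) \<longleftrightarrow> smooth p a"
  by (auto simp: smooth_def)

lemma smooth_less: "a \<noteq> 0 \<Longrightarrow> \<bar>a\<bar> < int p \<Longrightarrow> smooth p a"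
  unfolding smooth_def by (metis dvd_abs_iff le_less_trans zdvd_imp_le zero_less_abs_iff)

text \<open>The bound on the prime factors is strict, so \<open>p\<close> itself is excluded: norms
  in \<open>smooth_mset p\<close> are units at \<open>p\<close>.\<close>

lemma smooth_not_dvd: "prime (int p) \<Longrightarrow> smooth p w \<Longrightarrow> \<not> int p dvd w"
  unfolding smooth_def by (metis less_irrefl)

lemma smooth_mset_empty [simp]: "smooth_mset p {#}" by (simp add: smooth_mset_def)
lemma smooth_mset_add [simp]: "smooth_mset p (A + B) \<longleftrightarrow> smooth_mset p A \<and> smooth_mset p B"
  by (auto simp: smooth_mset_def)
lemma smooth_mset_add_mset [simp]: "smooth_mset p (add_mset x A) \<longleftrightarrow> (\<exists>w. x = of_int w \<and> smooth p w) \<and> smooth_mset p A"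
  by (auto simp: smooth_mset_def)
lemma smooth_mset_memberI: "smooth p w \<Longrightarrow> x = of_int w \<Longrightarrow> \<exists>w. x = rat_of_int w \<and> smooth p w" by blast

lemma smooth_mset_mult: "smooth_mset p A \<Longrightarrow> smooth p q \<Longrightarrow> smooth_mset p (image_mset ((*) (of_int q)) A)"
  by (force simp: smooth_mset_def smooth_mult simp flip: of_int_mult)

text \<open>\<open>p * x\<close> is the sum of \<open>a = l * p^2\<close> and
  \<open>b = p * r\<close>. Splitting it into these two needs a companion norm
  \<open>a * b * (a + b)\<close>, which is \<open>q = l * r * x\<close> up to a square. Adding the
  plane \<open>q, -q\<close> supplies the companion and leaves \<open>-q\<close> behind.\<close>

lemma reach_division:
  assumes "x = p * l + r" "p \<noteq> 0" "x \<noteq> 0" "l \<noteq> 0" "r \<noteq> 0"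
  shows "reach {#of_int (p * x)#} {#rat_of_int (p * r), of_int l, of_int (- (l * r * x))#}"
proof -
  have nz: "rat_of_int p \<noteq> 0" "rat_of_int x \<noteq> 0" "rat_of_int l \<noteq> 0" "rat_of_int r \<noteq> 0"
    using assms(2-5) by simp_all
  define a b where "a = rat_of_int (l * p\<^sup>2)" and "b = rat_of_int (p * r)"
  have ab: "a + b = of_int (p * x)" unfolding a_def b_def assms(1) by (simp add: algebra_simps power2_eq_square)
  define q where "q = rat_of_int (l * r * x)"
  have q: "q \<noteq> 0" using nz by (simp add: q_def)
  have "reach {#of_int (p * x)#} (add_mset q (add_mset (- q) {#of_int (p * x)#}))"
    by (rule reach_hyp[OF q])
  also have "\<dots> = {#q, a + b, -q#}" unfolding ab by simp
  also have "reach \<dots> {#a * b * (a + b), a + b, -q#}"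
    using nz unfolding ab by (intro reach_scale[of "of_int p ^ 2"]) (simp_all add: a_def b_def q_def power2_eq_square)
  also have "\<dots> = {#a + b, a * b * (a + b), -q#}" by simp
  also have "reach \<dots> {#a, b, -q#}"
  proof (rule reach_pair_inv)
    show "a + b \<noteq> 0" unfolding ab using assms(2,3) by (metis mult_eq_0_iff of_int_eq_0_iff)
    show "a \<noteq> 0" "b \<noteq> 0" using nz by (auto simp: a_def b_def)
  qed
  also have "reach \<dots> {#of_int l, b, -q#}"
    using nz by (intro reach_scale[of "1 / of_int p"]) (auto simp: a_def power2_eq_square)
  finally show ?thesis by (simp add: b_def q_def add_mset_commute)
qed

lemma pos_mod_unit: "prime p \<Longrightarrow> \<not> int p dvd w \<Longrightarrow> w mod int p \<in> {0<..<int p}"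
  using prime_gt_0_nat[of p] by (simp add: dvd_eq_mod_eq_0 order.not_eq_order_implies_strict)

text \<open>Dividing a large \<open>w\<close> by \<open>p\<close> at once would leave a quotient
  that need not be smooth. So a prime factor \<open>q\<close> of \<open>w\<close> is removed, the
  cofactor is reduced to its residue by induction, and the result is multiplied by \<open>q\<close>
  and divided again.\<close>

lemma reach_remainder:
  assumes p: "prime p"
  shows "smooth p w \<Longrightarrow> \<exists>C. smooth_mset p C \<and> reach {#of_int (int p * w)#} (add_mset (of_int (int p * (w mod int p))) C)"
proof (induction "nat \<bar>w\<bar>" arbitrary: w rule: less_induct)
  case less
  have p0: "int p > 0" "prime (int p)" using p prime_gt_0_nat by auto
  have wnz: "w \<noteq> 0" using less.prems by (auto simp: smooth_def)
  show ?case
  proof (cases "\<bar>w\<bar> < int p")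
    case True
    show ?thesis
    proof (cases "w > 0")
      case pos: True
      then have "w mod int p = w" using True by simp
      then show ?thesis by (intro exI[of _ "{#}"]) simp
    next
      case neg: False
      have wm: "w mod int p = w + int p"
        using neg True wnz by (metis abs_of_neg add.commute add_less_same_cancel1 linorder_neqE_linordered_idom
            minus_less_iff mod_add_self2 mod_pos_pos_trivial not_less less_imp_le neg_0_less_iff_less
            add_increasing2 diff_gt_0_iff_gt diff_minus_eq_add le_less zero_less_abs_iff)
      \<comment> \<open>Division with quotient \<open>-1\<close>: for negative \<open>w\<close>
        above \<open>-p\<close> the residue is \<open>w + p\<close>.\<close>
      have "reach {#of_int (int p * w)#} {#rat_of_int (int p * (w + int p)), of_int (-1), of_int ((w + int p) * w)#}"
        using neg True wnz p0 reach_division[of w "int p" "-1" "w + int p"] by (simp add: algebra_simps)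
      moreover have "smooth p (-1)" "smooth p (((w + int p) * w))"
        using wnz neg True p0 smooth_mult[of p "w + int p" w] smooth_less[of "w + int p" p] smooth_less[of w p]
          prime_gt_1_int[of "int p"] smooth_less[of 1 p] by (auto simp del: mult_minus_left)
      ultimately show ?thesis unfolding wm
        by (intro exI[of _ "{#of_int (-1), of_int ((w + int p) * w)#}"])
          (auto simp del: of_int_mult of_int_minus of_int_add intro: smooth_mset_memberI)
    qed
  next
    case False
    then have "\<not> is_unit w" using p0 prime_gt_1_int[of "int p"] by auto
    then obtain q where q: "prime q" "q dvd w" using wnz
      by (metis prime_divisorE)
    then obtain w' where w': "w = q * w'" by blast
    have ql: "q < int p" using less.prems q by (auto simp: smooth_def)
    have q1: "q > 1" using q prime_gt_1_int by blast
    have lw': "smooth p w'" "smooth p q" using less.prems w' by (auto simp: smooth_def)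
    have "nat \<bar>w'\<bar> < nat \<bar>w\<bar>" using w' q1 wnz by (simp add: abs_mult)
    from less.hyps[OF this lw'(1)] obtain C where C: "smooth_mset p C"
      "reach {#of_int (int p * w')#} (add_mset (of_int (int p * (w' mod int p))) C)" by blast
    define r' where "r' = w' mod int p"
    have r': "0 < r'" "r' < int p"
      using pos_mod_unit[OF p smooth_not_dvd[OF p0(2) lw'(1)]] by (auto simp: r'_def)
    define x where "x = q * r'"
    define l r where "l = x div int p" and "r = x mod int p"
    have x: "x = int p * l + r" by (simp add: l_def r_def)
    have rw: "r = w mod int p" by (simp add: r_def x_def r'_def w' mod_mult_right_eq)
    have r: "0 < r" "r < int p"
      using pos_mod_unit[OF p smooth_not_dvd[OF p0(2) less.prems]] by (auto simp: rw)
    \<comment> \<open>Both factors of \<open>x\<close> lie below \<open>p\<close>, hence so does the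
      quotient \<open>l\<close>, and every by-product of this division is smooth.\<close>
    have xp: "x > 0" "x < int p * int p" using r' q1 ql mult_strict_mono[of q "int p" r' "int p"] by (simp_all add: x_def)
    have "int p * l < int p * int p" using x xp(2) r by linarith
    then have l: "0 \<le> l" "l < int p" using xp p0 unfolding l_def
      by (simp_all add: pos_imp_zdiv_nonneg_iff)
    have lx: "smooth p x" using r' lw' smooth_less[of r' p] by (auto simp: x_def intro!: smooth_mult)
    have e: "rat_of_int q * of_int (int p * w') = of_int (int p * w)" "rat_of_int q * of_int (int p * r') = of_int (int p * x)"
      by (simp_all add: w' x_def)
    have 1: "reach {#of_int (int p * w)#} (add_mset (of_int (int p * x)) (image_mset ((*) (of_int q)) C))"
      using reach_mult[OF C(2), of "of_int q"] q1 unfolding r'_def[symmetric] by (simp only: image_mset_add_mset image_mset_empty e)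
    have lC: "smooth_mset p (image_mset ((*) (of_int q)) C)" using smooth_mset_mult C lw' by blast
    show ?thesis
    proof (cases "l = 0")
      case True
      then show ?thesis using 1 lC rw x by auto
    next
      case False
      have "reach {#of_int (int p * x)#} {#rat_of_int (int p * r), of_int l, of_int (- (l * r * x))#}"
        using x p0 xp r False by (intro reach_division) auto
      from reach_add[OF this reach_refl[of "image_mset ((*) (of_int q)) C"]]
      have "reach (add_mset (of_int (int p * x)) (image_mset ((*) (of_int q)) C))
        (add_mset (rat_of_int (int p * r)) (add_mset (of_int l) (add_mset (of_int (- (l * r * x))) (image_mset ((*) (of_int q)) C))))"
        by (simp add: ac_simps)
      from reach_trans[OF 1 this]
      show ?thesis using lC smooth_less[of l p] smooth_less[of r p] lx l r False
        by (intro exI[of _ "add_mset (of_int l) (add_mset (of_int (- (l * r * x))) (image_mset ((*) (of_int q)) C))"])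
          (auto simp: rw simp del: of_int_mult of_int_minus intro!: smooth_mset_memberI smooth_mult)
    qed
  qed
qed

text \<open>The coefficient \<open>c\<close> may have large prime factors, so the scaling is by the
  square of \<open>c mod p\<close>; this keeps the norm smooth and does not change the
  residue.\<close>

lemma reach_remainder_square:
  assumes p: "prime p" and w: "smooth p w" and c: "\<not> int p dvd c"
  shows "\<exists>C. smooth_mset p C \<and> reach {#of_int (int p * w)#} (add_mset (of_int (int p * ((w * c\<^sup>2) mod int p))) C)"
proof -
  define c' where "c' = c mod int p"
  have c': "0 < c'" "c' < int p" using pos_mod_unit[OF p c] by (auto simp: c'_def)
  have l: "smooth p (w * c'\<^sup>2)" using c' w smooth_less[of c' p] by (auto simp: power2_eq_square intro!: smooth_mult)
  have m: "(w * c'\<^sup>2) mod int p = (w * c\<^sup>2) mod int p"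
    unfolding c'_def by (metis mod_mult_right_eq power_mod)
  have "reach {#of_int (int p * w)#} {#of_int (int p * (w * c'\<^sup>2))#}"
    using c' by (intro reach_scale[of "of_int c'"]) auto
  with reach_remainder[OF p l] show ?thesis unfolding m using reach_trans by blast
qed

text \<open>A list instead of a multiset, so that coefficients of a vector can be paired with the
  norms by position.\<close>

definition prime_multiples :: "nat \<Rightarrow> int list \<Rightarrow> rat multiset" where
  "prime_multiples p ws = image_mset (\<lambda>w. of_int (int p * w)) (mset ws)"

lemma prime_multiples_simps [simp]: "prime_multiples p [] = {#}" "prime_multiples p (w # ws) = add_mset (of_int (int p * w)) (prime_multiples p ws)"
  by (simp_all add: prime_multiples_def)

text \<open>The coefficients \<open>c\<close> are those of an isotropic vector modulo
  \<open>p\<close>. Entries with \<open>c\<close> divisible by \<open>p\<close> are set aside. Two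
  of the others are rescaled to \<open>w1 * c1^2\<close> and \<open>w2 * c2^2\<close> modulo
  \<open>p\<close> and added. If the sum \<open>s\<close> vanishes, a hyperbolic plane has been
  found; otherwise \<open>s\<close> enters a shorter isotropic vector with coefficient
  \<open>1\<close>, while the second norm \<open>t\<close> of the pair is kept, reduced modulo
  \<open>p\<close>. The induction then makes the total list shorter.\<close>

lemma reach_cancel_isotropic:
  assumes p: "prime p"
  shows "(\<forall>(w,c)\<in>set xs. w \<in> {0<..<int p}) \<Longrightarrow> int p dvd (\<Sum>(w,c)\<leftarrow>xs. w * c\<^sup>2) \<Longrightarrow>
    \<exists>(w,c)\<in>set xs. \<not> int p dvd c \<Longrightarrow>
    \<exists>ws C. set ws \<subseteq> {0<..<int p} \<and> length ws < length xs \<and> smooth_mset p C \<and>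
       reach (prime_multiples p (map fst xs)) (prime_multiples p ws + C)"
proof (induction "length xs" arbitrary: xs rule: less_induct)
  case less
  have pp: "prime (int p)" "int p > 0" using p prime_gt_0_nat by auto
  have lows: "smooth p w" if "w \<in> {0<..<int p}" for w using that smooth_less[of w p] by auto
  show ?case
  proof (cases "\<exists>(w,c)\<in>set xs. int p dvd c")
    case True
    then obtain w c as bs where wc: "xs = as @ (w,c) # bs" "int p dvd c"
      by (auto dest: split_list)
    let ?ys = "as @ bs"
    have "int p dvd w * c\<^sup>2" using wc(2) by (simp add: power2_eq_square)
    then have "int p dvd (\<Sum>(w,c)\<leftarrow>?ys. w * c\<^sup>2)"
      using less.prems(2) unfolding wc(1) by (simp add: algebra_simps) (metis dvd_add_right_iff add.left_commute)
    moreover have "\<exists>(w,c)\<in>set ?ys. \<not> int p dvd c" using less.prems(3) wc by auto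
    ultimately obtain ws C where IH: "set ws \<subseteq> {0<..<int p}" "length ws < length ?ys" "smooth_mset p C"
       "reach (prime_multiples p (map fst ?ys)) (prime_multiples p ws + C)" using less.hyps[of ?ys] less.prems(1) wc(1) by auto
    have "reach (prime_multiples p (map fst xs)) (prime_multiples p (w # ws) + C)"
      using reach_add_mset[OF IH(4), of "of_int (int p * w)"] by (simp add: wc(1) prime_multiples_def)
    then show ?thesis using IH less.prems(1) wc(1)
      by (intro exI[of _ "w # ws"] exI[of _ C]) auto
  next
    case False
    obtain w1 c1 ys where xs1: "xs = (w1,c1) # ys" using less.prems(3) by (cases xs) auto
    have w1: "w1 \<in> {0<..<int p}" "\<not> int p dvd c1" using less.prems(1) False xs1 by auto
    have u: "\<not> int p dvd w * c\<^sup>2" if "w \<in> {0<..<int p}" "\<not> int p dvd c" for w c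
      using that pp lows[OF that(1)] smooth_not_dvd by (auto simp: prime_dvd_mult_iff prime_dvd_power_iff)
    obtain w2 c2 zs where ys: "ys = (w2,c2) # zs"
      using less.prems(2) u[OF w1] xs1 by (cases ys) auto
    have w2: "w2 \<in> {0<..<int p}" "\<not> int p dvd c2" using less.prems(1) False xs1 ys by auto
    define r1 r2 where "r1 = (w1 * c1\<^sup>2) mod int p" and "r2 = (w2 * c2\<^sup>2) mod int p"
    have r: "r1 \<in> {0<..<int p}" "r2 \<in> {0<..<int p}"
      using pos_mod_unit[OF p] u w1 w2 by (auto simp only: r1_def r2_def)
    obtain C1 where C1: "smooth_mset p C1" "reach {#of_int (int p * w1)#} (add_mset (of_int (int p * r1)) C1)"
      using reach_remainder_square[OF p lows[OF w1(1)] w1(2)] r1_def by auto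
    obtain C2 where C2: "smooth_mset p C2" "reach {#of_int (int p * w2)#} (add_mset (of_int (int p * r2)) C2)"
      using reach_remainder_square[OF p lows[OF w2(1)] w2(2)] r2_def by auto
    \<comment> \<open>Lowering one residue by \<open>p\<close> keeps the sum \<open>s\<close>
      strictly between \<open>-p\<close> and \<open>p\<close>, hence smooth unless it is
      zero.\<close>
    define C3 where "C3 = {#rat_of_int 1, of_int (- ((r2 - int p) * r2))#}"
    have C3: "reach {#of_int (int p * r2)#} (add_mset (of_int (int p * (r2 - int p))) C3)"
      using reach_division[of r2 "int p" 1 "r2 - int p"] r pp unfolding C3_def by auto
    have "smooth p 1" "smooth p (- ((r2 - int p) * r2))"
      using r pp smooth_less[of 1 p] prime_gt_1_int[OF pp(1)] smooth_mult[OF smooth_less smooth_less, of "r2 - int p" p r2]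
      by (auto simp del: mult_minus_left)
    then have lC3: "smooth_mset p C3" unfolding C3_def by (auto simp del: of_int_mult of_int_minus of_int_diff intro: smooth_mset_memberI)
    define s where "s = r1 + (r2 - int p)"
    have smod: "s mod int p = (w1 * c1\<^sup>2 + w2 * c2\<^sup>2) mod int p"
      unfolding s_def r1_def r2_def by (simp add: mod_simps add_diff_eq)
    define P where "P = prime_multiples p (map fst zs)"
    have X: "prime_multiples p (map fst xs) = {#of_int (int p * w1)#} + ({#of_int (int p * w2)#} + P)"
      unfolding xs1 ys P_def by simp
    note X
    also have "reach \<dots> (add_mset (of_int (int p * r1)) C1 + (add_mset (of_int (int p * r2)) C2 + P))"
      by (intro reach_add C1 C2 reach_refl)
    also have "\<dots> = {#of_int (int p * r2)#} + (add_mset (of_int (int p * r1)) (C1 + C2 + P))" by simp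
    also have "reach \<dots> (add_mset (of_int (int p * (r2 - int p))) C3 + (add_mset (of_int (int p * r1)) (C1 + C2 + P)))"
      by (intro reach_add C3 reach_refl)
    also have "\<dots> = add_mset (of_int (int p * r1)) (add_mset (of_int (int p * (r2 - int p))) (C1 + C2 + C3 + P))" by simp
    finally have 1: "reach (prime_multiples p (map fst xs)) \<dots>" .
    show ?thesis
    proof (cases "s = 0")
      case True
      then have e: "r2 - int p = - r1" unfolding s_def by simp
      have "rat_of_int (int p * r1) \<noteq> 0" using r pp by auto
      from reach_unhyp[OF this, of "C1 + C2 + C3 + P"]
      have "reach (prime_multiples p (map fst xs)) (P + add_mset (of_int 1) (add_mset (of_int (-1)) (C1 + C2 + C3)))"
        using reach_trans[OF 1, unfolded e] by (simp add: ac_simps)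
      moreover have "smooth_mset p (add_mset (of_int 1) (add_mset (of_int (-1)) (C1 + C2 + C3)))"
        using C1 C2 lC3 \<open>smooth p 1\<close> by (auto simp del: of_int_1 of_int_minus intro!: smooth_mset_memberI)
      moreover have "set (map fst zs) \<subseteq> {0<..<int p}" using less.prems(1) xs1 ys by auto
      moreover have "length (map fst zs) < length xs" by (simp add: xs1 ys)
      ultimately show ?thesis unfolding P_def by blast
    next
      case False
      have sl: "smooth p s" using r False by (intro smooth_less) (auto simp: s_def)
      have snd: "\<not> int p dvd s" using smooth_not_dvd[OF pp(1) sl] .
      define t where "t = r1 * (r2 - int p) * s"
      have tl: "smooth p t" unfolding t_def using r sl smooth_less[of r1 p] smooth_less[of "r2 - int p" p]
        by (intro smooth_mult) auto
      obtain C4 where C4: "smooth_mset p C4" "reach {#of_int (int p * s)#} (add_mset (of_int (int p * (s mod int p))) C4)"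
        using reach_remainder[OF p sl] by blast
      obtain C5 where C5: "smooth_mset p C5" "reach {#of_int (int p * t)#} (add_mset (of_int (int p * (t mod int p))) C5)"
        using reach_remainder[OF p tl] by blast
      note 1
      also have "reach (add_mset (of_int (int p * r1)) (add_mset (of_int (int p * (r2 - int p))) (C1 + C2 + C3 + P)))
         (add_mset (of_int (int p * s)) (add_mset (of_int (int p * int p * int p * t)) (C1 + C2 + C3 + P)))"
      proof -
        have e: "rat_of_int (int p * r1) + of_int (int p * (r2 - int p)) = of_int (int p * s)"
          by (simp add: s_def algebra_simps)
        show ?thesis
        proof (rule reach_pair)
          show "rat_of_int (int p * r1) + of_int (int p * (r2 - int p)) \<noteq> 0"
            unfolding e using False pp by simp
        qed (simp_all only: e, simp add: t_def)
      qed
      also have "reach \<dots> (add_mset (of_int (int p * s)) (add_mset (of_int (int p * t)) (C1 + C2 + C3 + P)))"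
        using pp by (intro reach_add_mset reach_scale[of "1 / of_nat p"]) (auto simp: power2_eq_square)
      also have "\<dots> = {#of_int (int p * s)#} + ({#of_int (int p * t)#} + (C1 + C2 + C3 + P))" by simp
      also have "reach \<dots> (add_mset (of_int (int p * (s mod int p))) C4 + (add_mset (of_int (int p * (t mod int p))) C5 + (C1 + C2 + C3 + P)))"
        by (intro reach_add C4 C5 reach_refl)
      also have "\<dots> = prime_multiples p (map fst ((s mod int p, 1) # zs)) + (add_mset (of_int (int p * (t mod int p))) (C1 + C2 + C3 + C4 + C5))"
        unfolding P_def by (simp add: ac_simps)
      finally have 2: "reach (prime_multiples p (map fst xs)) \<dots>" .
      let ?xs = "(s mod int p, 1) # zs"
      have "int p dvd (\<Sum>(w,c)\<leftarrow>?xs. w * c\<^sup>2)"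
        using less.prems(2) unfolding xs1 ys by (simp add: smod dvd_eq_mod_eq_0 mod_add_left_eq add.assoc)
      moreover have "\<forall>(w,c)\<in>set ?xs. w \<in> {0<..<int p}"
        using less.prems(1) xs1 ys pos_mod_unit[OF p snd] by auto
      moreover have "\<exists>(w,c)\<in>set ?xs. \<not> int p dvd c" using pp prime_gt_1_int by auto
      moreover have "length ?xs < length xs" using xs1 ys by simp
      ultimately obtain ws C where IH: "set ws \<subseteq> {0<..<int p}" "length ws < length ?xs" "smooth_mset p C"
         "reach (prime_multiples p (map fst ?xs)) (prime_multiples p ws + C)" using less.hyps[of ?xs] by blast
      note 2
      also have "reach (prime_multiples p (map fst ?xs) + (add_mset (of_int (int p * (t mod int p))) (C1 + C2 + C3 + C4 + C5)))
          ((prime_multiples p ws + C) + (add_mset (of_int (int p * (t mod int p))) (C1 + C2 + C3 + C4 + C5)))"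
        by (intro reach_add IH reach_refl)
      also have "\<dots> = prime_multiples p ((t mod int p) # ws) + (C + (C1 + C2 + C3 + C4 + C5))" by (simp add: ac_simps)
      finally have "reach (prime_multiples p (map fst xs)) \<dots>" .
      moreover have "smooth_mset p (C + (C1 + C2 + C3 + C4 + C5))" using C1 C2 lC3 C4 C5 IH by simp
      moreover have "set ((t mod int p) # ws) \<subseteq> {0<..<int p}"
        using IH pos_mod_unit[OF p smooth_not_dvd[OF pp(1) tl]] by auto
      moreover have "length ((t mod int p) # ws) < length xs" using IH(2) xs1 ys by simp
      ultimately show ?thesis by blast
    qed
  qed
qed

definition anisotropic_mod :: "nat \<Rightarrow> int list \<Rightarrow> bool" where
  "anisotropic_mod p ws \<longleftrightarrow> (\<forall>cs. length cs = length ws \<longrightarrow>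
     int p dvd (\<Sum>(w,c)\<leftarrow>zip ws cs. w * c\<^sup>2) \<longrightarrow> (\<forall>c\<in>set cs. int p dvd c))"

lemma reach_anisotropic:
  assumes p: "prime p"
  shows "set ws \<subseteq> {0<..<int p} \<Longrightarrow> \<exists>vs C. set vs \<subseteq> {0<..<int p} \<and> anisotropic_mod p vs \<and>
     smooth_mset p C \<and> reach (prime_multiples p ws) (prime_multiples p vs + C)"
proof (induction "length ws" arbitrary: ws rule: less_induct)
  case less
  show ?case
  proof (cases "anisotropic_mod p ws")
    case True
    then show ?thesis using less.prems by (intro exI[of _ ws] exI[of _ "{#}"]) auto
  next
    case False
    then obtain cs where cs: "length cs = length ws" "int p dvd (\<Sum>(w,c)\<leftarrow>zip ws cs. w * c\<^sup>2)"
       "\<exists>c\<in>set cs. \<not> int p dvd c" by (auto simp: anisotropic_mod_def)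
    have "\<exists>(w,c)\<in>set (zip ws cs). \<not> int p dvd c"
      using cs(1,3) by (metis (no_types, lifting) case_prodI in_set_impl_in_set_zip2)
    moreover have "\<forall>(w,c)\<in>set (zip ws cs). w \<in> {0<..<int p}"
      using less.prems by (auto dest!: set_zip_leftD)
    ultimately obtain ws' C where 1: "set ws' \<subseteq> {0<..<int p}" "length ws' < length ws" "smooth_mset p C"
       "reach (prime_multiples p ws) (prime_multiples p ws' + C)"
      using reach_cancel_isotropic[OF p, of "zip ws cs"] cs by auto
    from less.hyps[OF 1(2,1)] obtain vs C' where 2: "set vs \<subseteq> {0<..<int p}" "anisotropic_mod p vs"
     "smooth_mset p C'" "reach (prime_multiples p ws') (prime_multiples p vs + C')" by blast
    have "reach (prime_multiples p ws) (prime_multiples p vs + (C' + C))"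
      using reach_trans[OF 1(4) reach_add[OF 2(4) reach_refl]] by (simp add: ac_simps)
    then show ?thesis using 1 2 by (intro exI[of _ vs] exI[of _ "C' + C"]) auto
  qed
qed

text \<open>Modulo squares only the parity of the exponent of \<open>p\<close> counts.\<close>

lemma smooth_Suc_cases:
  assumes "smooth (Suc p) w" "prime p"
  shows "\<exists>c u. c \<noteq> 0 \<and> smooth p u \<and> (w = c\<^sup>2 * u \<or> w = c\<^sup>2 * (int p * u))"
proof -
  have pp: "prime (int p)" "int p \<noteq> 0" using assms(2) prime_gt_0_nat by auto
  have w: "w \<noteq> 0" using assms smooth_def by auto
  obtain u where u: "w = int p ^ multiplicity (int p) w * u" "\<not> int p dvd u"
    using multiplicity_decompose'[of w "int p"] w pp not_prime_unit by metis
  have "smooth p u" unfolding smooth_def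
  proof (intro conjI allI impI)
    fix q :: int assume q: "prime q" "q dvd u"
    moreover have "q dvd w" using q(2) by (subst u(1)) (rule dvd_mult)
    ultimately have "q < int (Suc p)" using assms(1) unfolding smooth_def by blast
    moreover have "q \<noteq> int p" using q u by auto
    ultimately show "q < int p" by auto
  qed (use u in auto)
  moreover define k where "k = multiplicity (int p) w div 2"
  have "w = (int p ^ k)\<^sup>2 * u \<or> w = (int p ^ k)\<^sup>2 * (int p * u)"
  proof (cases "even (multiplicity (int p) w)")
    case True
    then show ?thesis using u(1) unfolding k_def by (simp flip: power_mult)
  next
    case False
    then have "multiplicity (int p) w = Suc (k * 2)" unfolding k_def by presburger
    then show ?thesis using u(1) by (simp flip: power_mult)
  qed
  ultimately show ?thesis using pp by (intro exI[of _ "int p ^ k"] exI[of _ u]) auto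
qed

lemma reach_split_prime:
  assumes p: "prime p"
  shows "smooth_mset (Suc p) A \<Longrightarrow> \<exists>ws C. set ws \<subseteq> {0<..<int p} \<and> smooth_mset p C \<and> reach A (prime_multiples p ws + C)"
proof (induction A)
  case empty
  show ?case by (intro exI[of _ "[]"] exI[of _ "{#}"]) auto
next
  case (add x A)
  then obtain ws C where IH: "set ws \<subseteq> {0<..<int p}" "smooth_mset p C" "reach A (prime_multiples p ws + C)" by auto
  obtain w where w: "x = of_int w" "smooth (Suc p) w" using add.prems by auto
  obtain c u where cu: "c \<noteq> 0" "smooth p u" "w = c\<^sup>2 * u \<or> w = c\<^sup>2 * (int p * u)"
    using smooth_Suc_cases[OF w(2) p] by blast
  have "\<exists>y. reach (add_mset x A) (add_mset y A) \<and> (y = of_int u \<or> y = of_int (int p * u))"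
  proof -
    have "reach (add_mset x A) (add_mset (of_int v) A)" if "w = c\<^sup>2 * v" for v
      using cu(1) by (intro reach_scale[of "1 / of_int c"]) (auto simp: w(1) that power2_eq_square)
    then show ?thesis using cu(3) by blast
  qed
  then obtain y where y: "reach (add_mset x A) (add_mset y A)" "y = of_int u \<or> y = of_int (int p * u)" by blast
  from y(2) show ?case
  proof
    assume yu: "y = of_int u"
    have "reach (add_mset x A) (prime_multiples p ws + add_mset (of_int u) C)"
      using reach_trans[OF y(1) reach_add_mset[OF IH(3)]] by (simp add: yu)
    then show ?thesis using IH cu by (intro exI[of _ ws] exI[of _ "add_mset (of_int u) C"]) auto
  next
    assume yu: "y = of_int (int p * u)"
    obtain D where D: "smooth_mset p D" "reach {#of_int (int p * u)#} (add_mset (of_int (int p * (u mod int p))) D)"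
      using reach_remainder[OF p cu(2)] by blast
    have "reach (add_mset x A) ({#of_int (int p * u)#} + A)" using y yu by simp
    also have "reach \<dots> (add_mset (of_int (int p * (u mod int p))) D + (prime_multiples p ws + C))"
      by (intro reach_add D IH)
    also have "\<dots> = prime_multiples p ((u mod int p) # ws) + (D + C)" by (simp add: ac_simps)
    finally have "reach (add_mset x A) \<dots>" .
    moreover have "set ((u mod int p) # ws) \<subseteq> {0<..<int p}"
      using IH pos_mod_unit[OF p smooth_not_dvd[OF _ cu(2)]] p by auto
    ultimately show ?thesis using IH D smooth_mset_add by blast
  qed
qed

text \<open>
  Milnor's descent on the largest prime: the norms divisible by \<open>p\<close> form a quadratic form over
  \<open>\<int> / p\<close>, and an isotropic vector of it allows replacing two of them by one, up to norms with smaller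
  prime factors.
\<close>

lemma reach_reduced:
  "smooth_mset n A \<Longrightarrow> \<exists>B. reach A B \<and> (set_mset B \<subseteq> {1, -1} \<or>
     (\<exists>p ws C. prime p \<and> ws \<noteq> [] \<and> set ws \<subseteq> {0<..<int p} \<and> anisotropic_mod p ws \<and> smooth_mset p C \<and> B = prime_multiples p ws + C))"
proof (induction n arbitrary: A)
  case 0
  have "set_mset A \<subseteq> {1, -1}"
  proof
    fix x assume "x \<in># A"
    then obtain w where w: "x = of_int w" "smooth 0 w" using 0 by (auto simp: smooth_mset_def)
    have "is_unit w"
    proof (rule ccontr)
      assume "\<not> is_unit w"
      then obtain q where "prime q" "q dvd w" using w prime_divisorE[of w] by (auto simp: smooth_def)
      then show False using w prime_gt_0_int[of q] by (auto simp: smooth_def)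
    qed
    then show "x \<in> {1,-1}" using w by auto
  qed
  then show ?case by (intro exI[of _ A]) auto
next
  case (Suc p)
  show ?case
  proof (cases "prime p")
    case False
    have "smooth p w" if "smooth (Suc p) w" for w
      using that False unfolding smooth_def by (metis less_antisym nat_int of_nat_Suc prime_nat_iff_prime
        order.strict_iff_order add.commute zless_add1_eq)
    then have "smooth_mset p A" using Suc.prems unfolding smooth_mset_def by blast
    then show ?thesis using Suc.IH by blast
  next
    case True
    obtain ws C where 1: "set ws \<subseteq> {0<..<int p}" "smooth_mset p C" "reach A (prime_multiples p ws + C)"
      using reach_split_prime[OF True Suc.prems] by blast
    obtain vs C' where 2: "set vs \<subseteq> {0<..<int p}" "anisotropic_mod p vs" "smooth_mset p C'"
        "reach (prime_multiples p ws) (prime_multiples p vs + C')" using reach_anisotropic[OF True 1(1)] by blast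
    have 3: "reach A (prime_multiples p vs + (C' + C))"
      using reach_trans[OF 1(3) reach_add[OF 2(4) reach_refl]] by (simp add: ac_simps)
    have 4: "smooth_mset p (C' + C)" using 1 2 by simp
    show ?thesis
    proof (cases "vs = []")
      case True
      then have "reach A (C' + C)" using 3 by simp
      with Suc.IH[OF 4] show ?thesis using reach_trans by blast
    next
      case False
      then show ?thesis using 2 3 4 True by blast
    qed
  qed
qed

section \<open>Quadratic spaces\<close>

text \<open>Stated over any ordered field because frames are used over \<open>rat\<close> for the
  arithmetic of lattices and over \<open>real\<close> for signatures.\<close>

locale quad_space = vector_space scale
  for scale :: "'k::linordered_field \<Rightarrow> 'v::ab_group_add \<Rightarrow> 'v" (infixr "*s" 75) +
  fixes B :: "'v \<Rightarrow> 'v \<Rightarrow> 'k"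
  assumes B_add_left: "B (x + y) z = B x z + B y z"
    and B_scale_left: "B (c *s x) z = c * B x z"
    and B_sym: "B x y = B y x"
begin

lemma B_add_right: "B z (x + y) = B z x + B z y"
  using B_add_left B_sym by metis

lemma B_scale_right: "B z (c *s x) = c * B z x"
  using B_scale_left B_sym by metis

lemma B_zero_left [simp]: "B 0 x = 0"
  using B_scale_left[of 0 0 x] by simp

lemma B_zero_right [simp]: "B x 0 = 0"
  using B_zero_left B_sym by metis

lemma B_minus_left: "B (- x) z = - B x z"
  using B_add_left[of x "- x" z] by (simp add: eq_neg_iff_add_eq_0 add.commute)

lemma B_minus_right: "B z (- x) = - B z x"
  using B_minus_left B_sym by metis

lemma B_diff_left: "B (x - y) z = B x z - B y z"
  using B_add_left[of x "- y" z] by (simp add: B_minus_left)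

lemma B_diff_right: "B z (x - y) = B z x - B z y"
  using B_diff_left B_sym by metis

lemma B_sum_left: "B (sum f I) z = (\<Sum>i\<in>I. B (f i) z)"
  by (induction I rule: infinite_finite_induct) (auto simp: B_add_left)

lemma B_sum_right: "B z (sum f I) = (\<Sum>i\<in>I. B z (f i))"
  by (induction I rule: infinite_finite_induct) (auto simp: B_add_right)

lemmas B_simps = B_add_left B_add_right B_scale_left B_scale_right B_minus_left B_minus_right
  B_diff_left B_diff_right

definition orth_set :: "'v set \<Rightarrow> bool" where
  "orth_set F \<longleftrightarrow> finite F \<and> (\<forall>x\<in>F. B x x \<noteq> 0) \<and> (\<forall>x\<in>F. \<forall>y\<in>F. x \<noteq> y \<longrightarrow> B x y = 0)"

text \<open>Completeness is a trivial orthogonal complement inside \<open>U\<close>;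
  \<open>frame_expansion\<close> turns this into the expansion of every vector of
  \<open>U\<close>.\<close>

definition frame :: "'v set \<Rightarrow> 'v set \<Rightarrow> bool" where
  "frame U F \<longleftrightarrow> orth_set F \<and> F \<subseteq> U \<and> (\<forall>v\<in>U. (\<forall>f\<in>F. B v f = 0) \<longrightarrow> v = 0)"

definition norms :: "'v set \<Rightarrow> 'k multiset" where
  "norms F = image_mset (\<lambda>v. B v v) (mset_set F)"

definition has_frame :: "'v set \<Rightarrow> 'k multiset \<Rightarrow> bool" where
  "has_frame U A \<longleftrightarrow> (\<exists>F. frame U F \<and> norms F = A)"

definition perp :: "'v set \<Rightarrow> 'v \<Rightarrow> 'v set" where
  "perp U x = {v\<in>U. B v x = 0}"

lemma subspace_perp: "subspace U \<Longrightarrow> subspace (perp U x)"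
  by (auto simp: perp_def subspace_def B_simps)

lemma frame_expansion:
  assumes "frame U F" "subspace U" "v \<in> U"
  shows "v = (\<Sum>f\<in>F. (B v f / B f f) *s f)"
proof -
  let ?w = "v - (\<Sum>f\<in>F. (B v f / B f f) *s f)"
  have fin: "finite F" using assms by (auto simp: frame_def orth_set_def)
  have "?w \<in> U" using assms by (intro subspace_diff subspace_sum subspace_scale) (auto simp: frame_def)
  moreover have "B ?w g = 0" if g: "g \<in> F" for g
  proof -
    have "B (\<Sum>f\<in>F. (B v f / B f f) *s f) g = (\<Sum>f\<in>F. if f = g then B v g else 0)"
      unfolding B_sum_left using assms(1) g
      by (intro sum.cong) (auto simp: B_simps frame_def orth_set_def)
    then show ?thesis using g fin by (simp add: B_simps)
  qed
  ultimately show ?thesis using assms by (auto simp: frame_def)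
qed

lemma frame_norm:
  assumes "frame U F" "subspace U" "v \<in> U" "w \<in> U"
  shows "B v w = (\<Sum>f\<in>F. B v f * B w f / B f f)"
proof -
  have "B v w = B (\<Sum>f\<in>F. (B v f / B f f) *s f) w" using frame_expansion[OF assms(1-3)] by simp
  also have "\<dots> = (\<Sum>f\<in>F. B v f * B w f / B f f)"
    unfolding B_sum_left by (intro sum.cong) (auto simp: B_simps B_sym[of w])
  finally show ?thesis .
qed

lemma frame_perp:
  assumes "frame U F" "f \<in> F"
  shows "frame (perp U f) (F - {f})" "norms F = add_mset (B f f) (norms (F - {f}))"
proof -
  show "frame (perp U f) (F - {f})" using assms by (auto simp: frame_def orth_set_def perp_def)
  have "finite F" using assms by (auto simp: frame_def orth_set_def)
  then show "norms F = add_mset (B f f) (norms (F - {f}))"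
    unfolding norms_def using assms(2) by (simp add: mset_set.remove)
qed

section \<open>Reflections and Witt cancellation\<close>

definition refl :: "'v \<Rightarrow> 'v \<Rightarrow> 'v" where
  "refl w v = v - (2 * B v w / B w w) *s w"

lemma refl_B:
  assumes "B w w \<noteq> 0" shows "B (refl w u) (refl w v) = B u v"
proof -
  define a b where "a = 2 * B u w / B w w" and "b = 2 * B v w / B w w"
  have ab: "a * B w w = 2 * B u w" "b * B w w = 2 * B v w" using assms by (simp_all add: a_def b_def)
  have "B (u - a *s w) (v - b *s w) = B u v - b * B u w - a * B v w + b * (a * B w w)"
    by (simp add: B_simps B_sym[of w v] algebra_simps)
  also have "\<dots> = B u v + b * B u w - a * B v w" unfolding ab by simp
  also have "\<dots> = B u v" by (simp add: a_def b_def)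
  finally show ?thesis by (simp add: refl_def a_def b_def)
qed

lemma refl_refl: "B w w \<noteq> 0 \<Longrightarrow> refl w (refl w v) = v"
proof -
  assume w: "B w w \<noteq> 0"
  have "B (refl w v) w = - B v w" using w by (simp add: refl_def B_simps)
  then have "refl w (refl w v) = refl w v + (2 * B v w / B w w) *s w"
    unfolding refl_def[of w "refl w v"] by simp
  then show ?thesis unfolding refl_def by simp
qed

lemma refl_in: "subspace U \<Longrightarrow> w \<in> U \<Longrightarrow> v \<in> U \<Longrightarrow> refl w v \<in> U"
  by (simp add: refl_def subspace_diff subspace_scale)

text \<open>The norms of \<open>g - f\<close> and \<open>g + f\<close> add up to
  \<open>4 * B f f\<close>, so at least one of these vectors is not isotropic, and the reflection in
  it does what is wanted.\<close>

lemma refl_exchange: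
  assumes "B f f \<noteq> 0" "B g g = B f f" "subspace U" "f \<in> U" "g \<in> U"
  shows "\<exists>w\<in>U. B w w \<noteq> 0 \<and> (refl w f = g \<or> refl w f = - g)"
proof (cases "B (g - f) (g - f) = 0")
  case False
  have "2 * B f (g - f) = - B (g - f) (g - f)" using assms(2) by (simp add: B_simps B_sym[of g f])
  then have "2 * B f (g - f) / B (g - f) (g - f) = -1" using False by (simp add: field_simps)
  then have "refl (g - f) f = g" by (simp add: refl_def)
  then show ?thesis using False assms subspace_diff by blast
next
  case True
  then have fg: "B f g = B f f" using assms(2) by (simp add: B_simps B_sym[of g f])
  have "2 * B f (g + f) = B (g + f) (g + f)" using assms(2) by (simp add: B_simps B_sym[of g f])
  moreover have nz: "B (g + f) (g + f) \<noteq> 0" using assms(1,2) fg by (simp add: B_simps B_sym[of g f])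
  ultimately have "refl (g + f) f = - g" by (simp add: refl_def)
  then show ?thesis using nz assms subspace_add by blast
qed

text \<open>A reflection taking \<open>f\<close> to \<open>g\<close> or \<open>- g\<close> takes the
  rest of the frame into the complement of \<open>g\<close>, with the same norms. The sign is
  irrelevant for the complement.\<close>

lemma witt_cancel:
  assumes F: "frame U F" "f \<in> F" and g: "g \<in> U" "B g g = B f f" and U: "subspace U"
  shows "has_frame (perp U g) (norms (F - {f}))"
proof -
  have f: "B f f \<noteq> 0" "f \<in> U" using F by (auto simp: frame_def orth_set_def)
  obtain w where w: "w \<in> U" "B w w \<noteq> 0" "refl w f = g \<or> refl w f = - g"
    using refl_exchange[OF f(1) g(2) U f(2) g(1)] by blast
  have inj: "inj (refl w)" using refl_refl[OF w(2)] by (metis injI)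
  have pg: "B v g = 0 \<longleftrightarrow> B v (refl w f) = 0" for v using w(3) by (auto simp: B_simps)
  have "frame (perp U g) (refl w ` (F - {f}))"
    unfolding frame_def
  proof (intro conjI ballI impI)
    show "orth_set (refl w ` (F - {f}))"
      using F w unfolding frame_def orth_set_def by (auto simp: refl_B)
    show "refl w ` (F - {f}) \<subseteq> perp U g"
      using F w(1,2) U refl_in unfolding frame_def orth_set_def perp_def by (auto simp: refl_B pg)
    fix v assume v: "v \<in> perp U g" "\<forall>x\<in>refl w ` (F - {f}). B v x = 0"
    then have "B (refl w v) x = 0" if "x \<in> F" for x
      using that pg[of v] refl_B[OF w(2), of "refl w v" x] unfolding refl_refl[OF w(2)] perp_def by (cases "x = f") auto
    moreover have "refl w v \<in> U" using v U w by (auto simp: perp_def intro: refl_in)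
    ultimately have "refl w v = 0" using F by (auto simp: frame_def)
    then show "v = 0" using refl_refl[OF w(2), of v] by (simp add: refl_def)
  qed
  moreover have "norms (refl w ` (F - {f})) = norms (F - {f})"
    unfolding norms_def using inj inj_on_subset
    by (subst image_mset_mset_set[symmetric]) (auto simp: image_mset.compositionality comp_def refl_B w)
  ultimately show ?thesis unfolding has_frame_def by blast
qed

section \<open>The norm operations realized on frames\<close>

lemma frame_scale:
  assumes "frame U F" "x \<in> F" "c \<noteq> 0" "subspace U"
  shows "frame U (insert (c *s x) (F - {x}))"
    "norms (insert (c *s x) (F - {x})) = add_mset (c\<^sup>2 * B x x) (norms (F - {x}))"
proof -
  have o: "B (c *s x) y = 0" if "y \<in> F - {x}" for y
    using that assms unfolding frame_def orth_set_def by (auto simp: B_simps)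
  have n: "B (c *s x) x \<noteq> 0" "B (c *s x) (c *s x) \<noteq> 0" using assms by (auto simp: frame_def orth_set_def B_simps)
  then have ni: "c *s x \<notin> F - {x}" using o by blast
  show "frame U (insert (c *s x) (F - {x}))"
    unfolding frame_def
  proof (intro conjI ballI impI)
    show "orth_set (insert (c *s x) (F - {x}))"
      using assms(1) o n B_sym unfolding frame_def orth_set_def by auto
    show "insert (c *s x) (F - {x}) \<subseteq> U" using assms subspace_scale by (auto simp: frame_def)
    fix v assume "v \<in> U" "\<forall>f\<in>insert (c *s x) (F - {x}). B v f = 0"
    then have "v \<in> U" "\<forall>f\<in>F. B v f = 0" using assms by (auto simp: B_simps)
    then show "v = 0" using assms(1) by (auto simp: frame_def)
  qed
  have "finite F" using assms by (auto simp: frame_def orth_set_def)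
  then show "norms (insert (c *s x) (F - {x})) = add_mset (c\<^sup>2 * B x x) (norms (F - {x}))"
    using ni by (simp add: norms_def B_simps power2_eq_square)
qed

lemma frame_pair:
  assumes "frame U F" "x \<in> F" "y \<in> F" "x \<noteq> y" "B x x + B y y \<noteq> 0" "subspace U"
  defines "z \<equiv> B y y *s x - B x x *s y"
  shows "frame U (insert (x + y) (insert z (F - {x} - {y})))"
    "norms (insert (x + y) (insert z (F - {x} - {y}))) =
      add_mset (B x x + B y y) (add_mset (B x x * B y y * (B x x + B y y)) (norms (F - {x} - {y})))"
proof -
  have xy: "B x y = 0" "B y x = 0" "B x x \<noteq> 0" "B y y \<noteq> 0" "x \<in> U" "y \<in> U"
    using assms by (auto simp: frame_def orth_set_def)
  have o: "B (x + y) u = 0 \<and> B z u = 0" if "u \<in> F - {x} - {y}" for u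
    using that assms unfolding frame_def orth_set_def by (auto simp: B_simps)
  have n: "B (x + y) (x + y) = B x x + B y y" "B z z = B x x * B y y * (B x x + B y y)" "B (x + y) z = 0"
    using xy by (auto simp: z_def B_simps algebra_simps)
  have nz: "B (x + y) (x + y) \<noteq> 0" "B z z \<noteq> 0" using n xy assms by auto
  have ni: "x + y \<notin> insert z (F - {x} - {y})" "z \<notin> F - {x} - {y}" using o nz n by fastforce+
  show "frame U (insert (x + y) (insert z (F - {x} - {y})))"
    unfolding frame_def
  proof (intro conjI ballI impI)
    show "orth_set (insert (x + y) (insert z (F - {x} - {y})))"
      using assms(1) o n nz B_sym unfolding frame_def orth_set_def by auto
    show "insert (x + y) (insert z (F - {x} - {y})) \<subseteq> U"
      using assms xy unfolding z_def by (auto simp: frame_def intro!: subspace_add subspace_diff subspace_scale)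
    fix v assume v: "v \<in> U" "\<forall>f\<in>insert (x + y) (insert z (F - {x} - {y})). B v f = 0"
    then have "B v x + B v y = 0" "B y y * B v x = B x x * B v y" by (auto simp: z_def B_simps)
    then have vy: "B v y = - B v x" and "B y y * B v x = B x x * B v y"
      by (auto simp: eq_neg_iff_add_eq_0 add.commute)
    then have "(B x x + B y y) * B v x = 0" by (simp add: algebra_simps)
    then have "B v x = 0" "B v y = 0" using assms(5) vy by auto
    then have "v \<in> U" "\<forall>f\<in>F. B v f = 0" using v by auto
    then show "v = 0" using assms(1) by (auto simp: frame_def)
  qed
  have "finite F" using assms by (auto simp: frame_def orth_set_def)
  then show "norms (insert (x + y) (insert z (F - {x} - {y}))) =
      add_mset (B x x + B y y) (add_mset (B x x * B y y * (B x x + B y y)) (norms (F - {x} - {y})))"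
    using ni by (simp add: norms_def n)
qed

lemma has_frame_add_msetE:
  assumes "has_frame U (add_mset a A)"
  obtains F f where "frame U F" "f \<in> F" "B f f = a" "norms (F - {f}) = A"
proof -
  obtain F where F: "frame U F" "norms F = add_mset a A" using assms by (auto simp: has_frame_def)
  then have fin: "finite F" by (auto simp: frame_def orth_set_def)
  have "a \<in># norms F" using F by simp
  then obtain f where f: "f \<in> F" "B f f = a" using fin by (auto simp: norms_def)
  then show ?thesis using that F frame_perp[OF F(1) f(1)] by auto
qed

lemma has_frame_scale:
  assumes "has_frame U (add_mset a A)" "c \<noteq> 0" "subspace U"
  shows "has_frame U (add_mset (c\<^sup>2 * a) A)"
proof -
  obtain F f where "frame U F" "f \<in> F" "B f f = a" "norms (F - {f}) = A"
    using has_frame_add_msetE[OF assms(1)] .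
  then show ?thesis using frame_scale[of U F f c] assms unfolding has_frame_def by metis
qed

lemma has_frame_pair:
  assumes "has_frame U (add_mset a (add_mset b A))" "a + b \<noteq> 0" "subspace U"
  shows "has_frame U (add_mset (a + b) (add_mset (a * b * (a + b)) A))"
proof -
  obtain F f where F: "frame U F" "f \<in> F" "B f f = a" "norms (F - {f}) = add_mset b A"
    using has_frame_add_msetE[OF assms(1)] .
  then have "has_frame (perp U f) (add_mset b A)" using frame_perp(1) has_frame_def by blast
  have fin: "finite F" using F by (auto simp: frame_def orth_set_def)
  have "b \<in># norms (F - {f})" using F by simp
  then obtain g where g: "g \<in> F" "g \<noteq> f" "B g g = b" using fin by (auto simp: norms_def)
  then have "norms (F - {f} - {g}) = A" using F(4) frame_perp[OF frame_perp(1)[OF F(1,2)], of g] by auto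
  then show ?thesis using frame_pair[OF F(1,2) g(1)] g F assms unfolding has_frame_def by metis
qed

section \<open>Adjoining orthogonal lines and cancelling them again\<close>

definition line_ext :: "'v set \<Rightarrow> 'v \<Rightarrow> 'v set" where
  "line_ext U h = {u + c *s h |u c. u \<in> U}"

lemma subspace_line_ext:
  assumes "subspace U" shows "subspace (line_ext U h)"
  unfolding subspace_def line_ext_def
proof (intro conjI ballI allI)
  show "0 \<in> {u + c *s h |u c. u \<in> U}" using subspace_0[OF assms] by (force intro: exI[of _ 0])
  fix x y c assume "x \<in> {u + c *s h |u c. u \<in> U}"
  then obtain u a where x: "x = u + a *s h" "u \<in> U" by auto
  have "c *s x = c *s u + (c * a) *s h" by (simp add: x algebra_simps)
  then show "c *s x \<in> {u + c *s h |u c. u \<in> U}" using x subspace_scale[OF assms] by blast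
  assume "y \<in> {u + c *s h |u c. u \<in> U}"
  then obtain v b where y: "y = v + b *s h" "v \<in> U" by auto
  have "x + y = (u + v) + (a + b) *s h" by (simp add: x y algebra_simps)
  then show "x + y \<in> {u + c *s h |u c. u \<in> U}" using x y subspace_add[OF assms] by blast
qed

lemma line_ext_sub: "U \<subseteq> line_ext U h"
  unfolding line_ext_def by (force intro: exI[of _ 0])

lemma in_line_ext: "subspace U \<Longrightarrow> h \<in> line_ext U h"
  using subspace_0 unfolding line_ext_def by (force intro: exI[of _ 1])

lemma has_frame_line_ext:
  assumes "has_frame U A" "subspace U" "\<forall>u\<in>U. B h u = 0" "B h h \<noteq> 0"
  shows "has_frame (line_ext U h) (add_mset (B h h) A)"
proof -
  have hs: "B u h = 0" if "u \<in> U" for u using assms(3) that B_sym by metis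
  obtain F where F: "frame U F" "norms F = A" using assms by (auto simp: has_frame_def)
  have "frame (line_ext U h) (insert h F)"
    unfolding frame_def
  proof (intro conjI ballI impI)
    show "orth_set (insert h F)"
      using assms F unfolding frame_def orth_set_def by (auto simp: hs)
    show "insert h F \<subseteq> line_ext U h" using F line_ext_sub[of U h] in_line_ext[OF assms(2)] by (auto simp: frame_def)
    fix v assume v: "v \<in> line_ext U h" "\<forall>f\<in>insert h F. B v f = 0"
    then obtain u c where u: "v = u + c *s h" "u \<in> U" by (auto simp: line_ext_def)
    have "c = 0" using v(2) assms u by (auto simp: B_simps hs)
    then show "v = 0" using v u F by (auto simp: frame_def)
  qed
  moreover have "h \<notin> F" "finite F" using F assms by (auto simp: frame_def orth_set_def)
  ultimately show ?thesis using F unfolding has_frame_def by (intro exI[of _ "insert h F"]) (auto simp: norms_def)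
qed

lemma perp_line_ext:
  assumes "\<forall>u\<in>U. B h u = 0" "B h h \<noteq> 0"
  shows "perp (line_ext U h) h = U"
proof -
  have hs: "B u h = 0" if "u \<in> U" for u using assms(1) that B_sym by metis
  have "u + c *s h \<in> U" if "u \<in> U" "B (u + c *s h) h = 0" for u c
  proof -
    have "c = 0" using that assms by (auto simp: B_simps hs)
    then show ?thesis using that by simp
  qed
  then show ?thesis using assms line_ext_sub[of U h] by (auto simp: perp_def line_ext_def hs)
qed

text \<open>A definite space has no vector of the opposite sign, so some member of the orthogonal basis
  has the norm of \<open>h\<close>.\<close>

lemma signs_cancel_line:
  assumes "has_frame (line_ext U h) A" "set_mset A \<subseteq> {1, -1}" "subspace U"
    "\<forall>u\<in>U. B h u = 0" "B h h \<in> {1, -1}"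
  shows "\<exists>A'. has_frame U A' \<and> set_mset A' \<subseteq> {1, -1}"
proof -
  obtain F where F: "frame (line_ext U h) F" "norms F = A" using assms by (auto simp: has_frame_def)
  have fin: "finite F" using F by (auto simp: frame_def orth_set_def)
  have sg: "B f f \<in> {1, -1}" if "f \<in> F" for f
  proof -
    have "B f f \<in># norms F" using that fin by (auto simp: norms_def)
    then show ?thesis using assms(2) F(2) by blast
  qed
  have sub: "subspace (line_ext U h)" using assms subspace_line_ext by auto
  have h: "h \<in> line_ext U h" using assms in_line_ext by auto
  have "\<exists>f\<in>F. B f f = B h h"
  proof (rule ccontr)
    assume "\<not> (\<exists>f\<in>F. B f f = B h h)"
    then have e: "\<forall>f\<in>F. B f f = - B h h" using sg assms(5) by force
    have "B h h = (\<Sum>f\<in>F. B h f * B h f / B f f)" by (rule frame_norm[OF F(1) sub h h])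
    also have "\<dots> = - B h h * (\<Sum>f\<in>F. B h f * B h f)"
      unfolding sum_distrib_left using e assms(5) by (intro sum.cong) auto
    finally have "(\<Sum>f\<in>F. B h f * B h f) = -1" using assms(5) by auto
    moreover have "(\<Sum>f\<in>F. B h f * B h f) \<ge> 0" by (intro sum_nonneg) auto
    ultimately show False by simp
  qed
  then obtain f where f: "f \<in> F" "B f f = B h h" by blast
  have hn: "B h h \<noteq> 0" using assms(5) by auto
  from witt_cancel[OF F(1) f(1) h f(2)[symmetric] sub]
  have "has_frame U (norms (F - {f}))" using perp_line_ext[OF assms(4) hn] by simp
  moreover have "set_mset (norms (F - {f})) \<subseteq> {1, -1}" using sg fin by (auto simp: norms_def)
  ultimately show ?thesis by blast
qed

fun ext :: "'v set \<Rightarrow> (nat \<Rightarrow> 'v) \<Rightarrow> nat \<Rightarrow> 'v set" where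
  "ext U h 0 = U"
| "ext U h (Suc n) = line_ext (ext U h n) (h n)"

lemma subspace_ext: "subspace U \<Longrightarrow> subspace (ext U h n)"
  by (induction n) (auto intro: subspace_line_ext)

lemma ext_perp:
  assumes "\<And>i. i < m \<Longrightarrow> \<forall>u\<in>U. B (h i) u = 0" "\<And>i j. i < m \<Longrightarrow> j < m \<Longrightarrow> i \<noteq> j \<Longrightarrow> B (h i) (h j) = 0"
  shows "n \<le> i \<Longrightarrow> i < m \<Longrightarrow> u \<in> ext U h n \<Longrightarrow> B (h i) u = 0"
  using assms by (induction n arbitrary: u) (auto simp: line_ext_def B_simps)

text \<open>Dimension enters only through the size of orthogonal sets of non-isotropic vectors: this
  yields a maximal one, and the bound drops by one whenever such a vector is split off.\<close>

definition bounded_dim :: "'v set \<Rightarrow> nat \<Rightarrow> bool" where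
  "bounded_dim U n \<longleftrightarrow> (\<forall>F. orth_set F \<longrightarrow> F \<subseteq> U \<longrightarrow> card F \<le> n)"

definition nondegenerate :: "'v set \<Rightarrow> bool" where
  "nondegenerate U \<longleftrightarrow> (\<forall>v\<in>U. (\<forall>u\<in>U. B v u = 0) \<longrightarrow> v = 0)"

text \<open>In the complement of a maximal orthogonal set every vector is isotropic. By polarization
  the form vanishes identically there, and nondegeneracy leaves only zero.\<close>

lemma frame_exists:
  assumes "bounded_dim U n" "nondegenerate U" "subspace U"
  shows "\<exists>F. frame U F"
proof -
  have "orth_set {} \<and> {} \<subseteq> U" by (auto simp: orth_set_def)
  moreover have "\<forall>F. orth_set F \<and> F \<subseteq> U \<longrightarrow> card F \<le> n" using assms by (auto simp: bounded_dim_def)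
  ultimately obtain F where F: "orth_set F" "F \<subseteq> U" "\<And>G. orth_set G \<Longrightarrow> G \<subseteq> U \<Longrightarrow> card G \<le> card F"
    using ex_has_greatest_nat[of "\<lambda>F. orth_set F \<and> F \<subseteq> U" "{}" card "Suc n"] by (meson le_imp_less_Suc)
  have fin: "finite F" using F by (auto simp: orth_set_def)
  have iso: "B v v = 0" if "v \<in> U" "\<forall>f\<in>F. B v f = 0" for v
  proof (rule ccontr)
    assume "B v v \<noteq> 0"
    then have "orth_set (insert v F)" "insert v F \<subseteq> U" "v \<notin> F"
      using F that B_sym by (fastforce simp: orth_set_def)+
    then show False using F(3) fin by fastforce
  qed
  have "v = 0" if v: "v \<in> U" "\<forall>f\<in>F. B v f = 0" for v
  proof -
    have "B v u = 0" if u: "u \<in> U" for u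
    proof -
      define u' where "u' = u - (\<Sum>f\<in>F. (B u f / B f f) *s f)"
      have u'U: "u' \<in> U" unfolding u'_def using F u assms
        by (intro subspace_diff subspace_sum subspace_scale) auto
      have u'F: "B u' g = 0" if g: "g \<in> F" for g
      proof -
        have "B (\<Sum>f\<in>F. (B u f / B f f) *s f) g = (\<Sum>f\<in>F. if f = g then B u g else 0)"
          unfolding B_sum_left using F(1) g
          by (intro sum.cong) (auto simp: B_simps orth_set_def)
        then show ?thesis using g fin by (simp add: u'_def B_simps)
      qed
      have "B (v + u') (v + u') = 0" using v u'U u'F assms
        by (intro iso) (auto simp: B_simps intro: subspace_add)
      then have "B v u' = 0" using iso[OF v] iso[of u'] u'U u'F by (simp add: B_simps B_sym[of u' v])
      moreover have "B v u = B v u'" unfolding u'_def using v by (simp add: B_simps B_sum_right)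
      ultimately show ?thesis by simp
    qed
    then show ?thesis using assms v by (auto simp: nondegenerate_def)
  qed
  then show ?thesis using F unfolding frame_def by blast
qed

end

section \<open>Unimodular lattices at a prime\<close>

text \<open>The localization of the integers at \<open>p\<close>, inside the rationals; it stands in
  for the ring of p-adic integers.\<close>

definition Zloc :: "nat \<Rightarrow> rat set" where
  "Zloc p = {x. \<exists>a b. \<not> int p dvd b \<and> x = of_int a / of_int b}"

lemma Zloc_int [simp]: "prime p \<Longrightarrow> of_int a \<in> Zloc p"
  unfolding Zloc_def by (intro CollectI exI[of _ a] exI[of _ 1]) (auto simp: prime_nat_iff)

lemma Zloc_Ints: "prime p \<Longrightarrow> x \<in> \<int> \<Longrightarrow> x \<in> Zloc p"
  by (auto elim: Ints_cases)

lemma Zloc_0 [simp]: "prime p \<Longrightarrow> 0 \<in> Zloc p" and Zloc_1 [simp]: "prime p \<Longrightarrow> 1 \<in> Zloc p"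
  and Zloc_nat [simp]: "prime p \<Longrightarrow> of_nat n \<in> Zloc p"
  using Zloc_int[of p 0] Zloc_int[of p 1] Zloc_int[of p "int n"] by simp_all

lemma Zloc_mult:
  assumes "prime p" "x \<in> Zloc p" "y \<in> Zloc p" shows "x * y \<in> Zloc p"
proof -
  obtain a b c d where "\<not> int p dvd b" "x = of_int a / of_int b" "\<not> int p dvd d" "y = of_int c / of_int d"
    using assms by (auto simp: Zloc_def)
  then show ?thesis using assms(1) unfolding Zloc_def
    by (intro CollectI exI[of _ "a * c"] exI[of _ "b * d"]) (auto simp: prime_dvd_mult_iff)
qed

lemma Zloc_add:
  assumes "prime p" "x \<in> Zloc p" "y \<in> Zloc p" shows "x + y \<in> Zloc p"
proof -
  obtain a b c d where "\<not> int p dvd b" "x = of_int a / of_int b" "\<not> int p dvd d" "y = of_int c / of_int d"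
    using assms by (auto simp: Zloc_def)
  moreover from this have "b \<noteq> 0" "d \<noteq> 0" by auto
  ultimately show ?thesis using assms(1) unfolding Zloc_def
    by (intro CollectI exI[of _ "a * d + c * b"] exI[of _ "b * d"]) (auto simp: prime_dvd_mult_iff field_simps)
qed

lemma Zloc_uminus: "prime p \<Longrightarrow> x \<in> Zloc p \<Longrightarrow> - x \<in> Zloc p"
  using Zloc_mult[of p "-1" x] Zloc_int[of p "-1"] by simp

lemma Zloc_inverse_unit: "prime p \<Longrightarrow> \<not> int p dvd b \<Longrightarrow> 1 / of_int b \<in> Zloc p"
  unfolding Zloc_def by (intro CollectI exI[of _ 1] exI[of _ b]) auto

text \<open>The valuation property: a rational outside the ring has \<open>p\<close> in its reduced
  denominator, so its inverse lies in the maximal ideal.\<close>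

lemma Zloc_valuation:
  assumes "prime p" "x \<notin> Zloc p"
  shows "\<exists>y\<in>Zloc p. x * (of_nat p * y) = 1"
proof -
  obtain a b where q: "quotient_of x = (a, b)" by force
  have ab: "x = of_int a / of_int b" "coprime a b" "b > 0"
    using q quotient_of_div quotient_of_coprime quotient_of_denom_pos by auto
  have "int p dvd b" using assms(2) ab by (auto simp: Zloc_def)
  then obtain b' where b': "b = int p * b'" by auto
  have "\<not> int p dvd a"
  proof
    assume "int p dvd a"
    then have "is_unit (int p)" using ab(2) b' by (metis coprime_common_divisor dvd_triv_left)
    then show False using assms(1) by auto
  qed
  moreover from this have "a \<noteq> 0" by auto
  ultimately show ?thesis using ab b' prime_gt_0_nat[OF assms(1)]
    by (intro bexI[of _ "of_int b' / of_int a"]) (auto simp: Zloc_def)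
qed

lemma inverse_prime_notin_Zloc: "prime p \<Longrightarrow> 1 / of_nat p \<notin> Zloc p"
proof
  assume p: "prime p" and "1 / of_nat p \<in> Zloc p"
  then obtain a b where ab: "\<not> int p dvd b" "1 / rat_of_nat p = of_int a / of_int b" by (auto simp: Zloc_def)
  then have "b \<noteq> 0" "p \<noteq> 0" using p by auto
  then have "rat_of_int b = of_int (int p * a)" using ab(2) by (simp add: field_simps)
  then show False using ab(1) by (metis dvd_triv_left of_int_eq_iff)
qed

lemma Zloc_int_dvd:
  assumes "prime p" "of_int a / of_nat p \<in> Zloc p" shows "int p dvd a"
proof (rule ccontr)
  assume n: "\<not> int p dvd a"
  then have "a \<noteq> 0" by auto
  then have "1 / of_nat p = (of_int a / of_nat p) * (1 / rat_of_int a)" by simp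
  also have "\<dots> \<in> Zloc p" using assms n by (intro Zloc_mult Zloc_inverse_unit)
  finally show False using inverse_prime_notin_Zloc assms by blast
qed

lemma nat_prime_decompose:
  assumes "prime p" "(n::nat) > 0"
  obtains a b where "n = p ^ a * b" "\<not> p dvd b"
  using multiplicity_decompose'[of n p] assms not_prime_unit[of p] by (metis gr_implies_not0)

lemma Zloc_power_clear:
  assumes "prime p" shows "\<exists>a. of_nat p ^ a * x \<in> Zloc p"
proof -
  obtain c d where q: "quotient_of x = (c, d)" by force
  have cd: "x = of_int c / of_int d" "d > 0" using q quotient_of_div quotient_of_denom_pos by auto
  obtain a b where ab: "nat d = p ^ a * b" "\<not> p dvd b" using nat_prime_decompose[OF assms, of "nat d"] cd by auto
  have "d = int p ^ a * int b" using ab cd by (metis int_nat_eq less_imp_le of_nat_mult of_nat_power)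
  then have "of_nat p ^ a * x = of_int c * (1 / of_int (int b))" using cd assms by (auto simp: field_simps)
  moreover have "\<dots> \<in> Zloc p" using assms ab by (intro Zloc_mult Zloc_inverse_unit) auto
  ultimately show ?thesis by metis
qed

lemma Zloc_power_clear_all:
  assumes "prime p" "finite I"
  shows "\<exists>a. \<forall>i\<in>I. of_nat p ^ a * f i \<in> Zloc p"
  using assms(2)
proof (induction I)
  case (insert i I)
  then obtain a where a: "\<forall>i\<in>I. of_nat p ^ a * f i \<in> Zloc p" by blast
  obtain b where b: "of_nat p ^ b * f i \<in> Zloc p" using Zloc_power_clear assms by blast
  have pw: "of_nat p ^ k \<in> Zloc p" for k using assms(1) Zloc_nat[of p "p ^ k"] by simp
  have "of_nat p ^ (a + b) * f j \<in> Zloc p" if "j \<in> insert i I" for j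
  proof (cases "j = i")
    case True
    then show ?thesis using Zloc_mult[OF assms(1) pw[of a] b] by (simp add: power_add mult_ac)
  next
    case False
    then have "of_nat p ^ a * f j \<in> Zloc p" using that a by blast
    then have "of_nat p ^ b * (of_nat p ^ a * f j) \<in> Zloc p" using Zloc_mult[OF assms(1) pw[of b]] by blast
    then show ?thesis by (simp add: power_add mult_ac)
  qed
  then show ?case by blast
qed auto

lemma of_int_sum_list': "of_int (sum_list xs) = sum_list (map of_int xs)"
  by (induction xs) auto

lemma mset_map_eq_list:
  assumes "image_mset g M = mset ys"
  shows "\<exists>xs. mset xs = M \<and> map g xs = ys"
  using assms
proof (induction ys arbitrary: M)
  case (Cons y ys)
  then obtain x M' where M: "M = add_mset x M'" "g x = y" "image_mset g M' = mset ys"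
    by (auto dest!: msed_map_invR)
  then show ?case using Cons.IH[of M'] by (metis list.simps(9) mset.simps(2))
qed auto

section \<open>Self-dual lattices over the localization at a prime\<close>

locale rat_quad_space = quad_space scale B
  for scale :: "rat \<Rightarrow> 'v::ab_group_add \<Rightarrow> 'v" (infixr "*s" 75) and B :: "'v \<Rightarrow> 'v \<Rightarrow> rat"
begin

text \<open>Self-duality inside \<open>U\<close> makes \<open>L\<close> closed under addition and
  under multiplication by \<open>Zloc p\<close>; the last clause says that \<open>L\<close> spans
  \<open>U\<close>.\<close>

definition local_unimodular :: "nat \<Rightarrow> 'v set \<Rightarrow> 'v set \<Rightarrow> bool" where
  "local_unimodular p U L \<longleftrightarrow> L \<subseteq> U \<and> (\<forall>v\<in>U. v \<in> L \<longleftrightarrow> (\<forall>l\<in>L. B v l \<in> Zloc p)) \<and>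
     (\<forall>v\<in>U. \<exists>a. of_nat p ^ a *s v \<in> L)"

context
  fixes p :: nat and U L :: "'v set"
  assumes p: "prime p" and L: "local_unimodular p U L" and U: "subspace U"
begin

lemma local_sub: "L \<subseteq> U" using L by (auto simp: local_unimodular_def)

lemma local_integral: "x \<in> L \<Longrightarrow> y \<in> L \<Longrightarrow> B x y \<in> Zloc p"
  using L by (auto simp: local_unimodular_def)

lemma local_dual: "v \<in> U \<Longrightarrow> (\<And>l. l \<in> L \<Longrightarrow> B v l \<in> Zloc p) \<Longrightarrow> v \<in> L"
  using L by (auto simp: local_unimodular_def)

lemma local_add: "x \<in> L \<Longrightarrow> y \<in> L \<Longrightarrow> x + y \<in> L"
  using local_sub local_integral p U by (intro local_dual) (auto simp: B_simps intro: subspace_add Zloc_add)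

lemma local_scale: "x \<in> L \<Longrightarrow> c \<in> Zloc p \<Longrightarrow> c *s x \<in> L"
  using local_sub local_integral p U by (intro local_dual) (auto simp: B_simps intro: subspace_scale Zloc_mult)

lemma local_diff: "x \<in> L \<Longrightarrow> y \<in> L \<Longrightarrow> x - y \<in> L"
  using local_add[of x "- y"] local_scale[of y "-1"] Zloc_uminus[OF p Zloc_1[OF p]] by simp

lemma local_full: "v \<in> U \<Longrightarrow> \<exists>a. of_nat p ^ a *s v \<in> L"
  using L by (auto simp: local_unimodular_def)

text \<open>The values \<open>B x y\<close> for \<open>y \<in> L\<close> generate a cyclic module over the valuation ring modulo the
  ring itself, so a functional that is integral wherever \<open>B x\<close> is agrees on \<open>L\<close> with a multiple of
  \<open>B x\<close> up to integral values.\<close>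

lemma local_cyclic:
  assumes x: "x \<in> U" and v: "v \<in> U" "\<And>y. y \<in> L \<Longrightarrow> B x y \<in> Zloc p \<Longrightarrow> B v y \<in> Zloc p"
  shows "\<exists>r\<in>Zloc p. v - r *s x \<in> L"
proof -
  have P: "rat_of_nat p \<noteq> 0" using p by auto
  define a where "a = (LEAST a. \<forall>y\<in>L. of_nat p ^ a * B x y \<in> Zloc p)"
  obtain a0 where "of_nat p ^ a0 *s x \<in> L" using local_full x by blast
  then have "\<forall>y\<in>L. of_nat p ^ a0 * B x y \<in> Zloc p"
    using local_integral by (metis B_scale_left)
  then have a: "\<forall>y\<in>L. of_nat p ^ a * B x y \<in> Zloc p" unfolding a_def by (rule LeastI)
  show ?thesis
  proof (cases "a = 0")
    case True
    then have "v \<in> L" using a v by (intro local_dual) auto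
    then show ?thesis using p by (intro bexI[of _ 0]) auto
  next
    case False
    then obtain b where b: "a = Suc b" using not0_implies_Suc by blast
    have "\<not> (\<forall>y\<in>L. of_nat p ^ b * B x y \<in> Zloc p)"
      using not_less_Least[of b "\<lambda>a. \<forall>y\<in>L. of_nat p ^ a * B x y \<in> Zloc p"] b unfolding a_def by auto
    \<comment> \<open>\<open>y0\<close> realizes the largest denominator of \<open>B x\<close> on
      \<open>L\<close>, so all values of \<open>B x\<close> on \<open>L\<close> are multiples of
      \<open>c = B x y0\<close> by elements of \<open>Zloc p\<close>.\<close>
    then obtain y0 where y0: "y0 \<in> L" "of_nat p ^ b * B x y0 \<notin> Zloc p" by blast
    obtain z where z: "z \<in> Zloc p" "of_nat p ^ b * B x y0 * (of_nat p * z) = 1"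
      using Zloc_valuation[OF p y0(2)] by blast
    define c where "c = B x y0"
    have c: "c \<noteq> 0" using z by (auto simp: c_def)
    have ci: "1 / c = of_nat p ^ a * z" using z(2) c unfolding b c_def[symmetric] by (simp add: field_simps)
    have "1 / c \<in> Zloc p" unfolding ci using p z Zloc_nat[OF p, of "p ^ a"] by (intro Zloc_mult) auto
    then have "(1 / c) *s y0 \<in> L" using y0 local_scale by blast
    moreover have "B x ((1 / c) *s y0) \<in> Zloc p" using c p by (simp add: B_simps c_def)
    ultimately have "B v ((1 / c) *s y0) \<in> Zloc p" by (rule v(2))
    then have r: "B v y0 / c \<in> Zloc p" by (simp add: B_simps)
    have "B (v - (B v y0 / c) *s x) y \<in> Zloc p" if y: "y \<in> L" for y
    proof -
      define t where "t = B x y / c"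
      have "t = (of_nat p ^ a * B x y) * z" unfolding t_def using ci by (simp add: divide_inverse mult_ac)
      then have t: "t \<in> Zloc p" using a y z p by (auto intro: Zloc_mult)
      have "y - t *s y0 \<in> L" using t y y0 local_diff local_scale by blast
      moreover have "B x (y - t *s y0) = 0" using c by (simp add: B_simps t_def c_def)
      ultimately have "B v (y - t *s y0) \<in> Zloc p" using v(2) p by simp
      moreover have "B (v - (B v y0 / c) *s x) y = B v (y - t *s y0)"
        by (simp add: B_simps t_def)
      ultimately show ?thesis by simp
    qed
    then have "v - (B v y0 / c) *s x \<in> L" using v x U
      by (intro local_dual) (auto intro: subspace_diff subspace_scale)
    then show ?thesis using r by blast
  qed
qed

text \<open>\<open>x\<close> need not lie in \<open>L\<close>. Behind the scenes \<open>L\<close> is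
  exchanged for its neighbour, the sum of \<open>Zloc p *s x\<close> and of the \<open>y\<close> in
  \<open>L\<close> with \<open>B x y\<close> integral. This is again self-dual and contains
  \<open>x\<close>; since \<open>B x x\<close> is a unit, \<open>x\<close> splits off, and
  \<open>L'\<close> is what remains.\<close>

lemma local_unimodular_perp:
  assumes x: "x \<in> U" "B x x \<in> Zloc p" "1 / B x x \<in> Zloc p" "B x x \<noteq> 0"
  shows "\<exists>L'. local_unimodular p (perp U x) L'"
proof -
  define L' where "L' = {v\<in>perp U x. \<forall>y\<in>L. B x y \<in> Zloc p \<longrightarrow> B v y \<in> Zloc p}"
  have intro: "v \<in> L'" if "v \<in> perp U x" "r \<in> Zloc p" "v - r *s x \<in> L" for v r
  proof -
    have "B v y \<in> Zloc p" if y: "y \<in> L" "B x y \<in> Zloc p" for y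
    proof -
      have "B v y = B (v - r *s x) y + r * B x y" by (simp add: B_simps)
      then show ?thesis using Zloc_add[OF p local_integral[OF \<open>v - r *s x \<in> L\<close> y(1)] Zloc_mult[OF p \<open>r \<in> Zloc p\<close> y(2)]]
        by simp
    qed
    then show ?thesis using that by (auto simp: L'_def)
  qed
  have int: "B v w \<in> Zloc p" if "v \<in> L'" "w \<in> L'" for v w
  proof -
    have v: "v \<in> U" "B v x = 0" "\<And>y. y \<in> L \<Longrightarrow> B x y \<in> Zloc p \<Longrightarrow> B v y \<in> Zloc p"
      using that by (auto simp: L'_def perp_def)
    obtain r where r: "r \<in> Zloc p" "v - r *s x \<in> L" using local_cyclic[OF x(1) v(1,3)] by blast
    have "B x (v - r *s x) = - (r * B x x)" using v by (simp add: B_simps B_sym[of x v])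
    then have "B x (v - r *s x) \<in> Zloc p" using r x p by (auto intro: Zloc_uminus Zloc_mult)
    then have "B w (v - r *s x) \<in> Zloc p" using that r by (auto simp: L'_def)
    moreover have "B w x = 0" using that by (auto simp: L'_def perp_def)
    ultimately show ?thesis by (simp add: B_simps B_sym[of v w])
  qed
  have dual: "v \<in> L'" if v: "v \<in> perp U x" "\<forall>l\<in>L'. B v l \<in> Zloc p" for v
  proof -
    have "B v y \<in> Zloc p" if y: "y \<in> L" "B x y \<in> Zloc p" for y
    proof -
      define r where "r = B x y / B x x"
      have r: "r \<in> Zloc p" using Zloc_mult[OF p y(2) x(3)] by (simp add: r_def)
      have "y - r *s x \<in> L'"
      proof (rule intro[of _ "- r"])
        show "y - r *s x \<in> perp U x" using y x local_sub U
          by (auto simp: perp_def B_simps r_def B_sym[of y x] intro!: subspace_diff subspace_scale)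
      qed (use r y p in \<open>auto intro: Zloc_uminus\<close>)
      then have "B v (y - r *s x) \<in> Zloc p" using v by blast
      then show ?thesis using v by (simp add: B_simps perp_def)
    qed
    then show ?thesis using v by (auto simp: L'_def)
  qed
  have "\<exists>a. of_nat p ^ a *s v \<in> L'" if v: "v \<in> perp U x" for v
  proof -
    obtain a where a: "of_nat p ^ a *s v \<in> L" using local_full v by (auto simp: perp_def)
    have "of_nat p ^ a *s v \<in> L'"
    proof (rule intro)
      show "of_nat p ^ a *s v \<in> perp U x" using v subspace_scale[OF subspace_perp[OF U]] by blast
      show "0 \<in> Zloc p" using p by simp
      show "of_nat p ^ a *s v - 0 *s x \<in> L" using a by simp
    qed
    then show ?thesis by blast
  qed
  then have "local_unimodular p (perp U x) L'"
    unfolding local_unimodular_def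
  proof (intro conjI ballI iffI)
    show "L' \<subseteq> perp U x" by (auto simp: L'_def)
  qed (use int dual in \<open>blast+\<close>)
  then show ?thesis by blast
qed

lemma local_unimodular_line_ext:
  assumes h: "\<forall>u\<in>U. B h u = 0" "B h h \<in> {1, -1}"
  shows "\<exists>L'. local_unimodular p (line_ext U h) L'"
proof -
  have hs: "B u h = 0" if "u \<in> U" for u using h(1) that B_sym by metis
  define L' where "L' = {l + r *s h | l r. l \<in> L \<and> r \<in> Zloc p}"
  have Bf: "B (u + c *s h) (w + d *s h) = B u w + c * d * B h h" if "u \<in> U" "w \<in> U" for u w c d
    using that h hs by (simp add: B_simps)
  have hh: "c * B h h \<in> Zloc p \<longleftrightarrow> c \<in> Zloc p" for c using h(2) Zloc_uminus[OF p, of c] Zloc_uminus[OF p, of "- c"] by auto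
  have int: "B v w \<in> Zloc p" if "v \<in> L'" "w \<in> L'" for v w
  proof -
    obtain l r m s where lr: "v = l + r *s h" "w = m + s *s h" "l \<in> L" "m \<in> L" "r \<in> Zloc p" "s \<in> Zloc p"
      using \<open>v \<in> L'\<close> \<open>w \<in> L'\<close> unfolding L'_def by auto
    have "B v w = B l m + r * s * B h h" unfolding lr(1,2) using Bf[of l m r s] lr local_sub by blast
    moreover have "r * s * B h h \<in> Zloc p" unfolding hh using lr p by (intro Zloc_mult)
    ultimately show ?thesis using lr local_integral p by (auto intro: Zloc_add)
  qed
  have dual: "v \<in> L'" if v: "v \<in> line_ext U h" "\<forall>l\<in>L'. B v l \<in> Zloc p" for v
  proof -
    obtain u c where u: "v = u + c *s h" "u \<in> U" using v by (auto simp: line_ext_def)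
    have "B u l \<in> Zloc p" if "l \<in> L" for l
    proof -
      have "l + 0 *s h \<in> L'" using that Zloc_0[OF p] unfolding L'_def by blast
      then have "B v (l + 0 *s h) \<in> Zloc p" using v by blast
      then show ?thesis using Bf[of u l c 0] that local_sub u by auto
    qed
    then have uL: "u \<in> L" using u local_dual by blast
    have "0 \<in> L" using subspace_0[OF U] p by (intro local_dual) auto
    then have "0 + 1 *s h \<in> L'" using Zloc_1[OF p] unfolding L'_def by blast
    then have "B v (0 + 1 *s h) \<in> Zloc p" using v by blast
    then have "c \<in> Zloc p" using Bf[of u 0 c 1] subspace_0[OF U] u hh by auto
    then show ?thesis using uL u unfolding L'_def by blast
  qed
  have full: "\<exists>a. of_nat p ^ a *s v \<in> L'" if v: "v \<in> line_ext U h" for v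
  proof -
    obtain u c where u: "v = u + c *s h" "u \<in> U" using v by (auto simp: line_ext_def)
    obtain a where a: "of_nat p ^ a *s u \<in> L" using local_full u by blast
    obtain b where b: "of_nat p ^ b * c \<in> Zloc p" using Zloc_power_clear[OF p] by blast
    have pw: "of_nat p ^ k \<in> Zloc p" for k using p Zloc_nat[of p "p ^ k"] by simp
    have "of_nat p ^ (a + b) *s v = of_nat p ^ b *s (of_nat p ^ a *s u) + (of_nat p ^ a * (of_nat p ^ b * c)) *s h"
      by (simp add: u power_add algebra_simps)
    moreover have "of_nat p ^ b *s (of_nat p ^ a *s u) \<in> L" using a pw local_scale by blast
    moreover have "of_nat p ^ a * (of_nat p ^ b * c) \<in> Zloc p" by (rule Zloc_mult[OF p pw b])
    ultimately show ?thesis unfolding L'_def by blast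
  qed
  have "local_unimodular p (line_ext U h) L'"
    unfolding local_unimodular_def
  proof (intro conjI ballI iffI)
    show "L' \<subseteq> line_ext U h" using local_sub by (auto simp: L'_def line_ext_def)
  qed (use int dual full in \<open>blast+\<close>)
  then show ?thesis by blast
qed

end

text \<open>Let \<open>p ^ e\<close> be the common denominator of the coefficients at
  \<open>p\<close>. All norms of the frame carry a factor \<open>p\<close>, so for
  \<open>e > 0\<close> integrality of \<open>B v v\<close> makes \<open>p\<close> divide the sum of
  \<open>w * c^2\<close> over the cleared coefficients. Anisotropy modulo \<open>p\<close> then
  makes \<open>p\<close> divide each of them, against the minimality of \<open>e\<close>.\<close>

lemma prime_integral_coefficients:
  assumes p: "prime p" and fs: "distinct fs" "map (\<lambda>f. B f f) fs = map (\<lambda>w. of_int (int p * w)) ws"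
    and F: "frame U (set fs)" and U: "subspace U" and an: "anisotropic_mod p ws"
    and v: "v \<in> U" "B v v \<in> Zloc p" and f: "f \<in> set fs"
  shows "B v f / B f f \<in> Zloc p"
proof -
  define c where "c f = B v f / B f f" for f
  have P: "rat_of_nat p \<noteq> 0" using p by auto
  define e where "e = (LEAST e. \<forall>f\<in>set fs. of_nat p ^ e * c f \<in> Zloc p)"
  have e: "\<forall>f\<in>set fs. of_nat p ^ e * c f \<in> Zloc p"
    unfolding e_def using Zloc_power_clear_all[OF p finite_set[of fs], of c] by (rule LeastI_ex)
  have "e = 0"
  proof (rule ccontr)
    assume "e \<noteq> 0"
    then obtain k where k: "e = Suc k" using not0_implies_Suc by blast
    have "\<not> (\<forall>f\<in>set fs. of_nat p ^ k * c f \<in> Zloc p)"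
      using not_less_Least[of k "\<lambda>e. \<forall>f\<in>set fs. of_nat p ^ e * c f \<in> Zloc p"] k unfolding e_def by auto
    then obtain g where g: "g \<in> set fs" "of_nat p ^ k * c g \<notin> Zloc p" by blast
    have "\<forall>f\<in>set fs. \<exists>a b. \<not> int p dvd b \<and> of_nat p ^ e * c f = of_int a / of_int b"
      using e by (auto simp: Zloc_def)
    then obtain a b where ab: "\<And>f. f \<in> set fs \<Longrightarrow> \<not> int p dvd b f"
       "\<And>f. f \<in> set fs \<Longrightarrow> of_nat p ^ e * c f = of_int (a f) / of_int (b f)" by metis
    define D where "D = prod b (set fs)"
    have D: "\<not> int p dvd D" using ab(1) p unfolding D_def by (auto simp: prime_dvd_prod_iff)
    then have D0: "D \<noteq> 0" by auto
    define m where "m f = a f * prod b (set fs - {f})" for f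
    have m: "of_int D * of_nat p ^ e * c f = of_int (m f)" if "f \<in> set fs" for f
    proof -
      have "D = b f * prod b (set fs - {f})" using that by (simp add: D_def prod.remove)
      moreover have "b f \<noteq> 0" using ab(1)[OF that] by auto
      ultimately show ?thesis using ab(2)[OF that] by (simp add: m_def mult.assoc)
    qed
    have "B v v = (\<Sum>f\<in>set fs. B v f * B v f / B f f)" by (rule frame_norm[OF F U v(1) v(1)])
    also have "\<dots> = (\<Sum>f\<in>set fs. B f f * (c f)\<^sup>2)"
      unfolding c_def by (intro sum.cong) (auto simp: power2_eq_square)
    also have "\<dots> = (\<Sum>f\<leftarrow>fs. B f f * (c f)\<^sup>2)" using fs(1) by (simp add: sum_list_distinct_conv_sum_set)
    also have "\<dots> = (\<Sum>(n,f)\<leftarrow>zip (map (\<lambda>f. B f f) fs) fs. n * (c f)\<^sup>2)"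
      by (simp add: zip_map1 zip_same_conv_map comp_def)
    also have "\<dots> = (\<Sum>(w,f)\<leftarrow>zip ws fs. of_int (int p * w) * (c f)\<^sup>2)"
      unfolding fs(2) by (simp add: zip_map1 comp_def case_prod_unfold)
    finally have "(of_int D * of_nat p ^ e)\<^sup>2 * B v v = (\<Sum>(w,f)\<leftarrow>zip ws fs. of_int (int p * w) * (of_int D * of_nat p ^ e * c f)\<^sup>2)"
      by (simp add: sum_list_const_mult[symmetric] case_prod_unfold power_mult_distrib mult_ac del: sum_list_const_mult)
    also have "\<dots> = (\<Sum>(w,f)\<leftarrow>zip ws fs. of_int (int p * w * (m f)\<^sup>2))"
      by (intro arg_cong[of _ _ sum_list] map_cong) (auto simp: m dest!: set_zip_rightD)
    also have "\<dots> = of_int (int p * (\<Sum>(w,c)\<leftarrow>zip ws (map m fs). w * c\<^sup>2))"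
      by (simp add: zip_map2 comp_def case_prod_unfold sum_list_const_mult[symmetric] mult.assoc of_int_sum_list' del: sum_list_const_mult)
    finally have eq: "(of_int D * of_nat p ^ e)\<^sup>2 * B v v = of_int (int p * (\<Sum>(w,c)\<leftarrow>zip ws (map m fs). w * c\<^sup>2))" .
    have "of_int (\<Sum>(w,c)\<leftarrow>zip ws (map m fs). w * c\<^sup>2) / of_nat p = of_int D * of_int D * of_nat (p ^ k) * of_nat (p ^ k) * B v v"
      using eq P by (simp add: k power2_eq_square field_simps)
    also have "\<dots> \<in> Zloc p" using p v by (intro Zloc_mult Zloc_int Zloc_nat)
    finally have "int p dvd (\<Sum>(w,c)\<leftarrow>zip ws (map m fs). w * c\<^sup>2)" using Zloc_int_dvd p by blast
    moreover have "length ws = length fs" using fs(2) map_eq_imp_length_eq by metis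
    ultimately have "int p dvd m g" using an g unfolding anisotropic_mod_def
      by (metis (no_types, lifting) image_eqI length_map list.set_map)
    then obtain m' where m': "m g = int p * m'" by auto
    have "of_nat p ^ k * c g = of_int m' * (1 / of_int D)"
      using m[OF g(1)] P D0 by (simp add: m' k field_simps)
    also have "\<dots> \<in> Zloc p" using p D by (intro Zloc_mult Zloc_int Zloc_inverse_unit)
    finally show False using g by blast
  qed
  then show ?thesis using e f by (simp add: c_def)
qed

text \<open>Norms in \<open>C\<close> are units at \<open>p\<close>, so their vectors are split off
  one by one. When only multiples of \<open>p\<close> are left, every vector of \<open>L\<close> has
  integral coefficients. Then \<open>(1 / p) *s f\<close> has integral products with
  \<open>L\<close> for a frame member \<open>f\<close>, so it lies in \<open>L\<close> by
  self-duality, although its own coefficient is \<open>1 / p\<close>.\<close>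

lemma no_local_unimodular_anisotropic:
  assumes p: "prime p" and ws: "ws \<noteq> []" "set ws \<subseteq> {0<..<int p}" "anisotropic_mod p ws"
  shows "has_frame U (prime_multiples p ws + C) \<Longrightarrow> smooth_mset p C \<Longrightarrow> subspace U \<Longrightarrow> local_unimodular p U L \<Longrightarrow> False"
proof (induction C arbitrary: U L)
  case empty
  note U = empty.prems(3) and L = empty.prems(4)
  obtain F where F: "frame U F" "norms F = prime_multiples p ws" using empty by (auto simp: has_frame_def)
  have "image_mset (\<lambda>v. B v v) (mset_set F) = mset (map (\<lambda>w. of_int (int p * w)) ws)"
    using F(2) by (simp add: norms_def prime_multiples_def)
  from mset_map_eq_list[OF this] obtain fs where
    fs: "mset fs = mset_set F" "map (\<lambda>f. B f f) fs = map (\<lambda>w. of_int (int p * w)) ws" by blast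
  have fin: "finite F" using F by (auto simp: frame_def orth_set_def)
  have sf: "set fs = F" using fs(1) fin by (metis finite_set_mset_mset_set set_mset_mset)
  have df: "distinct fs" using fs(1) sf by (metis card_distinct size_mset size_mset_set)
  note coeff = prime_integral_coefficients[OF p df fs(2) _ U ws(3), unfolded sf, OF F(1)]
  have "length fs = length ws" using fs(2) map_eq_imp_length_eq by metis
  then obtain f where f: "f \<in> F" using ws(1) sf by (cases fs) auto
  then obtain w where w: "B f f = of_int (int p * w)" "w \<in> set ws"
    using fs(2) sf by (metis (no_types, lifting) image_iff list.set_map)
  have P: "rat_of_nat p \<noteq> 0" and fU: "f \<in> U" using p f F by (auto simp: frame_def)
  have fn: "B f f \<noteq> 0" using F f by (auto simp: frame_def orth_set_def)
  have "(1 / of_nat p) *s f \<in> L"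
  proof (rule local_dual[OF p L U])
    show "(1 / of_nat p) *s f \<in> U" using fU U subspace_scale by blast
    fix l assume l: "l \<in> L"
    have "B l f / B f f \<in> Zloc p" using coeff[OF _ local_integral[OF p L U l l] f] local_sub[OF p L U] l by blast
    then have "of_int w * (B l f / B f f) \<in> Zloc p" using p by (intro Zloc_mult) auto
    moreover have "B ((1 / of_nat p) *s f) l = of_int w * (B l f / B f f)"
      using P fn unfolding w by (simp add: B_simps B_sym[of f l])
    ultimately show "B ((1 / of_nat p) *s f) l \<in> Zloc p" by simp
  qed
  moreover from this have "B ((1 / of_nat p) *s f) ((1 / of_nat p) *s f) \<in> Zloc p" using local_integral[OF p L U] by blast
  ultimately have "B ((1 / of_nat p) *s f) f / B f f \<in> Zloc p" using coeff f local_sub[OF p L U] by blast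
  then show False using inverse_prime_notin_Zloc[OF p] fn by (simp add: B_simps)
next
  case (add c C)
  obtain w where w: "c = of_int w" "smooth p w" using add.prems by auto
  have "has_frame U (add_mset c (prime_multiples p ws + C))" using add.prems by simp
  then obtain F f where F: "frame U F" "f \<in> F" "B f f = c" "norms (F - {f}) = prime_multiples p ws + C"
    using has_frame_add_msetE by blast
  have fU: "f \<in> U" using F by (auto simp: frame_def)
  have "\<not> int p dvd w" using smooth_not_dvd w p by auto
  moreover from this have "w \<noteq> 0" by auto
  ultimately obtain L' where "local_unimodular p (perp U f) L'"
    using local_unimodular_perp[OF p add.prems(4,3) fU] F(3) w(1) p Zloc_inverse_unit[OF p] by auto
  moreover have "has_frame (perp U f) (prime_multiples p ws + C)"
    using frame_perp(1)[OF F(1,2)] F(4) has_frame_def by blast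
  ultimately show False using add.IH[of "perp U f" L'] add.prems subspace_perp by auto
qed

end

section \<open>Indefinite unimodular lattices\<close>

lemma Zloc_integral:
  assumes p: "prime p" and "x \<in> Zloc p" "of_nat p ^ e * x \<in> \<int>"
  shows "x \<in> \<int>"
proof -
  obtain a c where ac: "\<not> int p dvd c" "x = of_int a / of_int c" using assms by (auto simp: Zloc_def)
  then have c0: "c \<noteq> 0" by auto
  obtain m where "of_nat p ^ e * x = of_int m" using assms(3) by (auto elim: Ints_cases)
  then have "rat_of_int (int p ^ e * a) = of_int (m * c)" using ac c0 by (simp add: field_simps)
  then have "int p ^ e * a = m * c" by (simp only: of_int_eq_iff)
  then have "c dvd int p ^ e * a" by simp
  moreover have "coprime c (int p ^ e)"
    using ac p by (metis coprime_commute coprime_power_left_iff prime_imp_coprime prime_nat_int_transfer)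
  ultimately have "c dvd a" using coprime_dvd_mult_right_iff by blast
  then show ?thesis using ac c0 by auto
qed

lemma reach_integral:
  "\<forall>x\<in>#A. x \<noteq> 0 \<Longrightarrow> \<exists>A' n. reach A A' \<and> smooth_mset n A'"
proof (induction A)
  case (add x A)
  then obtain A' n where A': "reach A A'" "smooth_mset n A'" by auto
  obtain a b where q: "quotient_of x = (a, b)" by force
  have ab: "x = of_int a / of_int b" "b > 0" using q quotient_of_div quotient_of_denom_pos by auto
  have a0: "a \<noteq> 0" using ab add.prems by auto
  define m where "m = n + nat \<bar>a * b\<bar> + 1"
  have mono: "smooth m w" if "smooth n w" for w using that unfolding smooth_def m_def by (metis less_le_trans of_nat_le_iff le_add1 add.assoc)
  have lA: "smooth_mset m A'" using A'(2) mono unfolding smooth_mset_def by blast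
  have lab: "smooth m (a * b)" using a0 ab(2) by (intro smooth_less) (auto simp: m_def)
  have "reach (add_mset x A) (add_mset x A')" using A' by (intro reach_add_mset)
  also have "reach \<dots> (add_mset (of_int (a * b)) A')"
    using ab by (intro reach_scale[of "of_int b"]) (auto simp: power2_eq_square)
  finally show ?case using lA lab by (intro exI[of _ "add_mset (of_int (a * b)) A'"] exI[of _ m]) (auto intro: smooth_mset_memberI simp del: of_int_mult)
qed (auto intro: exI[of _ "{#}"])

definition reduced :: "rat multiset \<Rightarrow> bool" where
  "reduced A \<longleftrightarrow> set_mset A \<subseteq> {1, -1} \<or> (\<exists>p ws C. prime p \<and> ws \<noteq> [] \<and> set ws \<subseteq> {0<..<int p} \<and>
     anisotropic_mod p ws \<and> smooth_mset p C \<and> A = prime_multiples p ws + C)"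

lemma reach_reduced': "smooth_mset n A \<Longrightarrow> \<exists>B. reach A B \<and> reduced B"
  using reach_reduced unfolding reduced_def .

section \<open>Self-dual lattices over the integers in a rational space\<close>

context rat_quad_space
begin

definition unimodular_in :: "'v set \<Rightarrow> 'v set \<Rightarrow> bool" where
  "unimodular_in U L \<longleftrightarrow> subspace U \<and> L \<subseteq> U \<and> (\<forall>v\<in>U. v \<in> L \<longleftrightarrow> (\<forall>l\<in>L. B v l \<in> \<int>)) \<and>
     (\<forall>v\<in>U. \<exists>n::nat. n > 0 \<and> of_nat n *s v \<in> L)"

lemma unimodular_inD:
  assumes "unimodular_in U L"
  shows "subspace U" "L \<subseteq> U" "\<And>x y. x \<in> L \<Longrightarrow> y \<in> L \<Longrightarrow> B x y \<in> \<int>"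
    "\<And>v. v \<in> U \<Longrightarrow> (\<And>l. l \<in> L \<Longrightarrow> B v l \<in> \<int>) \<Longrightarrow> v \<in> L"
    "\<And>v. v \<in> U \<Longrightarrow> \<exists>n::nat. n > 0 \<and> of_nat n *s v \<in> L"
  using assms unfolding unimodular_in_def by blast+

lemma unimodular_in_int: "unimodular_in U L \<Longrightarrow> x \<in> L \<Longrightarrow> y \<in> L \<Longrightarrow> \<exists>k. B x y = of_int k"
  using unimodular_inD(3) Ints_cases by metis

lemma unimodular_in_add: "unimodular_in U L \<Longrightarrow> x \<in> L \<Longrightarrow> y \<in> L \<Longrightarrow> x + y \<in> L"
  by (rule unimodular_inD(4)) (use unimodular_inD[of U L] in \<open>auto simp: B_simps intro: subspace_add\<close>)

lemma unimodular_in_scale: "unimodular_in U L \<Longrightarrow> x \<in> L \<Longrightarrow> of_int k *s x \<in> L"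
  by (rule unimodular_inD(4)) (use unimodular_inD[of U L] in \<open>auto simp: B_simps intro: subspace_scale\<close>)

lemma unimodular_in_diff: "unimodular_in U L \<Longrightarrow> x \<in> L \<Longrightarrow> y \<in> L \<Longrightarrow> x - y \<in> L"
  using unimodular_in_add[of U L x "- y"] unimodular_in_scale[of U L y "-1"] by simp

text \<open>Self-duality survives localization: if \<open>n *s v\<close> lies in \<open>L\<close>,
  the part of \<open>n\<close> prime to \<open>p\<close> may be used to multiply \<open>v\<close>,
  and the remaining power of \<open>p\<close> causes no denominators because the products are
  already integral at \<open>p\<close>.\<close>

lemma unimodular_local:
  assumes L: "unimodular_in U L" and p: "prime p"
  shows "local_unimodular p U {v\<in>U. \<exists>b. \<not> int p dvd b \<and> of_int b *s v \<in> L}"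
proof -
  note D = unimodular_inD[OF L]
  define M where "M = {v\<in>U. \<exists>b. \<not> int p dvd b \<and> of_int b *s v \<in> L}"
  have LM: "L \<subseteq> M" using D(2) p unfolding M_def by (auto intro!: exI[of _ 1] simp: prime_nat_iff)
  have int: "B v w \<in> Zloc p" if vw: "v \<in> M" "w \<in> M" for v w
  proof -
    obtain b c where bc: "\<not> int p dvd b" "of_int b *s v \<in> L" "\<not> int p dvd c" "of_int c *s w \<in> L"
      using vw unfolding M_def by blast
    have "b \<noteq> 0" "c \<noteq> 0" using bc by auto
    then have "B v w = B (of_int b *s v) (of_int c *s w) * (1 / of_int b * (1 / of_int c))"
      by (simp add: B_simps)
    moreover have "B (of_int b *s v) (of_int c *s w) \<in> Zloc p" using D(3) bc Zloc_Ints[OF p] by blast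
    ultimately show ?thesis using bc p Zloc_mult Zloc_inverse_unit by metis
  qed
  have dual: "v \<in> M" if v: "v \<in> U" "\<forall>l\<in>M. B v l \<in> Zloc p" for v
  proof -
    obtain n where n: "n > 0" "of_nat n *s v \<in> L" using D(5) v by blast
    obtain e b where eb: "n = p ^ e * b" "\<not> p dvd b" using nat_prime_decompose[OF p n(1)] .
    have "of_int (int b) *s v \<in> L"
    proof (rule D(4))
      show "of_int (int b) *s v \<in> U" using v D(1) subspace_scale by blast
      fix l assume l: "l \<in> L"
      have "B (of_int (int b) *s v) l \<in> Zloc p" using v LM l p by (auto simp: B_simps intro!: Zloc_mult)
      moreover have "of_nat p ^ e * B (of_int (int b) *s v) l = B (of_nat n *s v) l"
        by (simp add: B_simps eb)
      then have "of_nat p ^ e * B (of_int (int b) *s v) l \<in> \<int>" using D(3)[OF n(2) l] by simp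
      ultimately show "B (of_int (int b) *s v) l \<in> \<int>" using Zloc_integral[OF p] by blast
    qed
    then show ?thesis using v eb unfolding M_def by (intro CollectI conjI exI[of _ "int b"]) auto
  qed
  have full: "\<exists>a. of_nat p ^ a *s v \<in> M" if v: "v \<in> U" for v
  proof -
    obtain n where n: "n > 0" "of_nat n *s v \<in> L" using D(5) v by blast
    obtain e b where eb: "n = p ^ e * b" "\<not> p dvd b" using nat_prime_decompose[OF p n(1)] .
    have "of_int (int b) *s (of_nat p ^ e *s v) \<in> L" using n(2) unfolding eb by (simp add: mult_ac)
    moreover have "of_nat p ^ e *s v \<in> U" using v D(1) subspace_scale by blast
    moreover have "\<not> int p dvd int b" using eb by simp
    ultimately have "of_nat p ^ e *s v \<in> M" unfolding M_def by blast
    then show ?thesis by blast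
  qed
  have "local_unimodular p U M"
    unfolding local_unimodular_def
  proof (intro conjI ballI iffI)
    show "M \<subseteq> U" by (auto simp: M_def)
  qed (use int dual full in \<open>blast+\<close>)
  then show ?thesis by (simp add: M_def)
qed

text \<open>Room for adjoining hyperbolic planes to \<open>U\<close>.\<close>

definition room :: "'v set \<Rightarrow> (nat \<Rightarrow> 'v) \<Rightarrow> nat \<Rightarrow> bool" where
  "room U h m \<longleftrightarrow> (\<forall>i<m. (\<forall>u\<in>U. B (h i) u = 0) \<and> B (h i) (h i) = (-1) ^ i \<and>
      (\<forall>j<m. i \<noteq> j \<longrightarrow> B (h i) (h j) = 0))"

lemma room_perp: "room U h m \<Longrightarrow> n < m \<Longrightarrow> \<forall>u\<in>ext U h n. B (h n) u = 0"
  using ext_perp[of m U h n n] unfolding room_def by blast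

lemma room_norm: "room U h m \<Longrightarrow> n < m \<Longrightarrow> B (h n) (h n) = (-1) ^ n"
  by (auto simp: room_def)

lemma neg_one_power_cases: "(-1::rat) ^ n \<in> {1, -1}"
  by (cases "even n") auto

text \<open>Every step of \<open>stab\<close> is carried out on an actual frame. Its index tells how
  many of the lines \<open>h\<close> are consumed, two for each plane, which is why the extension
  grows from \<open>2 * k\<close> to \<open>2 * (k + n)\<close>.\<close>

lemma stab_has_frame:
  assumes "stab n A C" "subspace U" "room U h m"
  shows "has_frame (ext U h (2 * k)) A \<Longrightarrow> 2 * (k + n) \<le> m \<Longrightarrow> has_frame (ext U h (2 * (k + n))) C"
  using assms(1)
proof (induction arbitrary: k rule: stab.induct)
  case (scale c x A)
  then show ?case using has_frame_scale subspace_ext[OF assms(2)] by simp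
next
  case (pair x y A)
  then show ?case using has_frame_pair subspace_ext[OF assms(2)] by simp
next
  case (hyp A)
  have e: "2 * (k + 1) = Suc (Suc (2 * k))" by simp
  have lt: "2 * k < m" "Suc (2 * k) < m" using hyp by auto
  note sub = subspace_ext[OF assms(2)]
  have "has_frame (ext U h (Suc (2 * k))) (add_mset 1 A)"
    using has_frame_line_ext[OF hyp(1) sub room_perp[OF assms(3) lt(1)]] room_norm[OF assms(3) lt(1)] by simp
  then have "has_frame (ext U h (Suc (Suc (2 * k)))) (add_mset (-1) (add_mset 1 A))"
    using has_frame_line_ext[OF _ sub room_perp[OF assms(3) lt(2)]] room_norm[OF assms(3) lt(2)] by simp
  then show ?case unfolding e by (simp add: add_mset_commute)
next
  case (trans m' A B n C)
  then have "has_frame (ext U h (2 * (k + m'))) B" by simp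
  then show ?case using trans.IH(2)[of "k + m'"] trans.prems by (simp add: add.assoc)
qed simp

lemma local_unimodular_ext:
  assumes p: "prime p" and "local_unimodular p U L" "subspace U" "room U h m"
  shows "n \<le> m \<Longrightarrow> \<exists>L'. local_unimodular p (ext U h n) L'"
proof (induction n)
  case 0
  then show ?case using assms by auto
next
  case (Suc n)
  then obtain L' where L': "local_unimodular p (ext U h n) L'" by auto
  have n: "n < m" using Suc by simp
  have "B (h n) (h n) \<in> {1, -1}" using room_norm[OF assms(4) n] neg_one_power_cases[of n] by (metis)
  from local_unimodular_line_ext[OF p L' subspace_ext[OF assms(3)] room_perp[OF assms(4) n] this]
  show ?case by simp
qed

lemma signs_ext:
  assumes "subspace U" "room U h m"
  shows "n \<le> m \<Longrightarrow> has_frame (ext U h n) A \<Longrightarrow> set_mset A \<subseteq> {1, -1} \<Longrightarrow> \<exists>A'. has_frame U A' \<and> set_mset A' \<subseteq> {1, -1}"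
proof (induction n arbitrary: A)
  case 0
  then show ?case by auto
next
  case (Suc n)
  have n: "n < m" using Suc by simp
  have "B (h n) (h n) \<in> {1, -1}" using room_norm[OF assms(2) n] neg_one_power_cases[of n] by (metis)
  with signs_cancel_line[of "ext U h n" "h n" A] Suc.prems subspace_ext[OF assms(1)] room_perp[OF assms(2) n]
  obtain A' where "has_frame (ext U h n) A'" "set_mset A' \<subseteq> {1, -1}" by auto
  then show ?case using Suc by auto
qed

text \<open>The added lines preserve unimodularity at every prime, so the second alternative of
  \<open>reduced\<close> is contradictory in the extended space. In the first one the lines are
  cancelled again.\<close>

lemma signs_with_room:
  assumes L: "unimodular_in U L" and "has_frame U A" "stab n A A'" "room U h (2 * n)"
    and A': "reduced A'"
  shows "\<exists>A''. has_frame U A'' \<and> set_mset A'' \<subseteq> {1, -1}"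
proof -
  note sub = unimodular_inD(1)[OF L]
  have fr: "has_frame (ext U h (2 * n)) A'"
    using stab_has_frame[OF assms(3) sub assms(4), of 0] assms(2) by simp
  from A' show ?thesis unfolding reduced_def
  proof
    assume "set_mset A' \<subseteq> {1, -1}"
    then show ?thesis using signs_ext[OF sub assms(4) order_refl fr] by blast
  next
    assume "\<exists>p ws C. prime p \<and> ws \<noteq> [] \<and> set ws \<subseteq> {0<..<int p} \<and> anisotropic_mod p ws \<and> smooth_mset p C \<and> A' = prime_multiples p ws + C"
    then obtain p ws C where p: "prime p" "ws \<noteq> []" "set ws \<subseteq> {0<..<int p}" "anisotropic_mod p ws" "smooth_mset p C" "A' = prime_multiples p ws + C"
      by blast
    obtain M where "local_unimodular p (ext U h (2 * n)) M"
      using local_unimodular_ext[OF p(1) unimodular_local[OF L p(1)] sub assms(4) order_refl] by blast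
    then show ?thesis
      using no_local_unimodular_anisotropic[OF p(1-4) _ p(5) subspace_ext[OF sub]] fr p(6) by blast
  qed
qed

end

text \<open>The type \<open>'v\<close> may have no vectors outside \<open>U\<close>, so the room for
  planes is created by pairing with rational sequences. The alternating signs make consecutive
  coordinates below \<open>N\<close> a plane of norms \<open>1, -1\<close>; the form vanishes on the
  coordinates from \<open>N\<close> on.\<close>

lemma (in rat_quad_space) rat_quad_space_prod:
  fixes N :: nat
  shows "rat_quad_space (\<lambda>c (v, x). (c *s v, \<lambda>i. c * x i))
    (\<lambda>(v, x) (w, y). B v w + (\<Sum>i<N. (-1) ^ i * x i * (y i :: rat)))"
proof (unfold_locales, goal_cases)
  case (5 x y z)
  then show ?case by (auto simp: B_simps distrib_left distrib_right sum.distrib split: prod.splits)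
next
  case (6 c x z)
  then show ?case by (auto simp: B_simps distrib_left sum_distrib_left mult_ac split: prod.splits)
next
  case (7 x y)
  show ?case using B_sym[of "fst x" "fst y"] by (simp add: case_prod_unfold mult_ac)
qed (auto simp: scale_right_distrib scale_left_distrib distrib_left distrib_right fun_eq_iff)

context rat_quad_space
begin

text \<open>This is the consequence of Milnor's computation for unimodular lattices: rationally they
  are sums of lines of norms \<open>1\<close> and \<open>-1\<close>.\<close>

theorem unimodular_signs:
  assumes L: "unimodular_in U L" and F: "frame U F"
  shows "\<exists>F. frame U F \<and> (\<forall>f\<in>F. B f f \<in> {1, -1})"
proof -
  have fin: "finite F" using F by (auto simp: frame_def orth_set_def)
  have "\<forall>x\<in>#norms F. x \<noteq> 0" using F fin by (auto simp: norms_def frame_def orth_set_def)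
  then obtain A1 m where A1: "reach (norms F) A1" "smooth_mset m A1" using reach_integral by blast
  obtain A2 where A2: "reach A1 A2" "reduced A2"
    using reach_reduced'[OF A1(2)] by blast
  obtain n where n: "stab n (norms F) A2" using reach_trans[OF A1(1) A2(1)] by (auto simp: reach_def)
  \<comment> \<open>The number of planes is known only after the reduction, so the ambient space is
    chosen here and the whole situation is transported along \<open>e\<close>.\<close>
  define s' where "s' = (\<lambda>c (v, x). (c *s v, \<lambda>i. c * x i :: rat) :: 'v \<times> (nat \<Rightarrow> rat))"
  define B' where "B' = (\<lambda>(v, x) (w, y). B v w + (\<Sum>i<2 * n. (-1) ^ i * x i * (y i :: rat)))"
  interpret R: rat_quad_space s' B' unfolding s'_def B'_def by (rule rat_quad_space_prod)
  define e where "e v = (v, 0 :: nat \<Rightarrow> rat)" for v :: 'v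
  have e: "B' (e v) (e w) = B v w" "e (v + w) = e v + e w" "s' c (e v) = e (c *s v)" "e v = e w \<longleftrightarrow> v = w"
    "e v = 0 \<longleftrightarrow> v = 0" for v w c
    by (auto simp: e_def B'_def s'_def zero_prod_def fun_eq_iff)
  have e0: "e 0 = 0" using e(5) by blast
  have inj: "inj_on e X" for X using e(4) by (auto simp: inj_on_def)
  note D = unimodular_inD[OF L]
  have "R.subspace (e ` U)"
    using subspace_0[OF D(1)] subspace_add[OF D(1)] subspace_scale[OF D(1)] e0
    unfolding R.subspace_def by (auto simp: e image_iff simp flip: e(2))
  then have L': "R.unimodular_in (e ` U) (e ` L)"
    using D unfolding R.unimodular_in_def by (auto simp: e image_iff)
  have fr: "R.frame (e ` U) (e ` G) \<longleftrightarrow> frame U G" for G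
    unfolding R.frame_def R.orth_set_def frame_def orth_set_def
    by (simp add: e image_subset_iff_subset_vimage finite_image_iff[OF inj]) (auto simp: e image_iff subset_iff)
  have nm: "R.norms (e ` G) = norms G" for G
    unfolding R.norms_def norms_def using inj
    by (subst image_mset_mset_set[symmetric]) (auto simp: image_mset.compositionality comp_def e)
  have hf: "R.has_frame (e ` U) A \<longleftrightarrow> has_frame U A" for A
  proof
    assume "R.has_frame (e ` U) A"
    then obtain G where G: "R.frame (e ` U) G" "R.norms G = A" by (auto simp: R.has_frame_def)
    then have "G \<subseteq> e ` U" by (auto simp: R.frame_def)
    then obtain G' where "G = e ` G'" by (auto simp: subset_image_iff)
    then show "has_frame U A" using G fr nm unfolding has_frame_def by auto
  qed (auto simp: R.has_frame_def has_frame_def simp flip: fr nm)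
  define h where "h i = (0 :: 'v, \<lambda>j. if j = i then 1 else 0 :: rat)" for i :: nat
  have "R.room (e ` U) h (2 * n)"
    unfolding R.room_def by (auto simp: h_def e_def B'_def if_distrib if_distribR sum.delta cong: if_cong)
  with R.signs_with_room[OF L' _ n _ A2(2)] have "\<exists>A''. R.has_frame (e ` U) A'' \<and> set_mset A'' \<subseteq> {1, -1}"
    unfolding hf using F has_frame_def by blast
  then obtain A'' where A'': "has_frame U A''" "set_mset A'' \<subseteq> {1, -1}" unfolding hf by blast
  then obtain G where G: "frame U G" "norms G = A''" by (auto simp: has_frame_def)
  then have "finite G" by (auto simp: frame_def orth_set_def)
  then have "B f f \<in># norms G" if "f \<in> G" for f using that by (auto simp: norms_def)
  then show ?thesis using G A'' by blast
qed

text \<open>Takes the place of the Hasse-Minkowski theorem. Both signs occur among the norms of a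
  sign frame, since otherwise the space would be definite, and two members of opposite norm add up
  to an isotropic vector.\<close>

lemma unimodular_isotropic:
  assumes "unimodular_in U L" "frame U F" and s: "s \<in> U" "B s s > 0" and t: "t \<in> U" "B t t < 0"
  shows "\<exists>v\<in>U. v \<noteq> 0 \<and> B v v = 0"
proof -
  note sub = unimodular_inD(1)[OF assms(1)]
  obtain F where F: "frame U F" "\<forall>f\<in>F. B f f \<in> {1, -1}" using unimodular_signs assms by blast
  have "\<exists>f\<in>F. B f f = 1"
  proof (rule ccontr)
    assume n: "\<not> (\<exists>f\<in>F. B f f = 1)"
    then have "\<forall>f\<in>F. B f f = -1" using F(2) by blast
    then have "B s s = - (\<Sum>f\<in>F. (B s f)\<^sup>2)" unfolding frame_norm[OF F(1) sub s(1) s(1)]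
      by (subst sum_negf[symmetric]) (intro sum.cong; simp add: power2_eq_square)
    moreover have "(\<Sum>f\<in>F. (B s f)\<^sup>2) \<ge> 0" by (intro sum_nonneg) auto
    ultimately show False using s by simp
  qed
  moreover have "\<exists>f\<in>F. B f f = -1"
  proof (rule ccontr)
    assume n: "\<not> (\<exists>f\<in>F. B f f = -1)"
    then have "\<forall>f\<in>F. B f f = 1" using F(2) by blast
    then have "B t t = (\<Sum>f\<in>F. (B t f)\<^sup>2)" unfolding frame_norm[OF F(1) sub t(1) t(1)]
      by (intro sum.cong; simp add: power2_eq_square)
    moreover have "(\<Sum>f\<in>F. (B t f)\<^sup>2) \<ge> 0" by (intro sum_nonneg) auto
    ultimately show False using t by simp
  qed
  ultimately obtain f g where fg: "f \<in> F" "B f f = 1" "g \<in> F" "B g g = -1" by blast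
  then have "f \<noteq> g" by auto
  then have o: "B f g = 0" "B g f = 0" "f \<in> U" "g \<in> U" using F fg by (auto simp: frame_def orth_set_def)
  have "B (f + g) f = 1" "B (f + g) (f + g) = 0" using fg o by (auto simp: B_simps)
  moreover from this have "f + g \<noteq> 0" by auto
  ultimately show ?thesis using o sub subspace_add by blast
qed

text \<open>The least positive value \<open>d\<close> of \<open>B x\<close> on \<open>L\<close>
  divides all its values by division with remainder. Hence \<open>x / d\<close> has integral
  products with \<open>L\<close>, lies in \<open>L\<close> by self-duality, and takes the value
  \<open>1\<close>.\<close>

lemma unimodular_primitive:
  assumes L: "unimodular_in U L" and nd: "nondegenerate U" and v: "v \<in> U" "v \<noteq> 0"
  shows "\<exists>c. c \<noteq> 0 \<and> c *s v \<in> L \<and> (\<exists>y\<in>L. B (c *s v) y = 1)"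
proof -
  note D = unimodular_inD[OF L]
  obtain n :: nat where n: "n > 0" "of_nat n *s v \<in> L" using D(5) v by blast
  define x where "x = of_nat n *s v"
  have x: "x \<in> L" "x \<noteq> 0" "x \<in> U" using n v D(2) by (auto simp: x_def)
  obtain u where u: "u \<in> U" "B x u \<noteq> 0" using nd x by (auto simp: nondegenerate_def)
  obtain k :: nat where k: "k > 0" "of_nat k *s u \<in> L" using D(5) u by blast
  define I where "I = {d::nat. d > 0 \<and> (\<exists>l\<in>L. B x l = of_nat d)}"
  have "B x (of_nat k *s u) \<noteq> 0" "B x (of_nat k *s u) \<in> \<int>" using u k D(3)[OF x(1) k(2)] by (auto simp: B_simps)
  then obtain z where z: "B x (of_nat k *s u) = of_int z" "z \<noteq> 0" by (auto elim: Ints_cases)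
  have "B x (of_int (sgn z) *s (of_nat k *s u)) = of_nat (nat \<bar>z\<bar>)"
    using z by (simp add: B_simps sgn_if)
  then have "nat \<bar>z\<bar> \<in> I" using z unimodular_in_scale[OF L k(2)] unfolding I_def by force
  define d where "d = (LEAST d. d \<in> I)"
  have d: "d \<in> I" unfolding d_def using \<open>nat \<bar>z\<bar> \<in> I\<close> by (rule LeastI)
  then obtain y where y: "y \<in> L" "B x y = of_nat d" "d > 0" by (auto simp: I_def)
  have dvd: "(1 / of_nat d) * B x l \<in> \<int>" if l: "l \<in> L" for l
  proof -
    obtain m where m: "B x l = of_int m" using D(3)[OF x(1) l] by (auto elim: Ints_cases)
    define r where "r = m mod int d"
    have "l - of_int (m div int d) *s y \<in> L" using unimodular_in_diff[OF L l unimodular_in_scale[OF L y(1)]] .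
    moreover have "m = m div int d * int d + r" by (simp add: r_def)
    then have "rat_of_int m = of_int (m div int d) * of_nat d + of_int r"
      by (metis of_int_add of_int_mult of_int_of_nat_eq)
    then have "B x (l - of_int (m div int d) *s y) = of_int r"
      by (simp add: B_simps m y)
    moreover have r: "0 \<le> r" "r < int d" using y by (auto simp: r_def)
    ultimately have "r > 0 \<Longrightarrow> nat r \<in> I" unfolding I_def by force
    moreover have "nat r \<notin> I" using not_less_Least[of "nat r" "\<lambda>d. d \<in> I"] r unfolding d_def[symmetric] by auto
    ultimately have "\<not> r > 0" by blast
    then have "m = m div int d * int d" using r by (auto simp: r_def)
    then have "rat_of_int m = of_int (m div int d) * of_nat d" by (metis of_int_mult of_int_of_nat_eq)
    then show ?thesis using y m by simp
  qed
  have "(1 / of_nat d) *s x \<in> L" using x dvd D(1) by (intro D(4)) (auto simp: B_simps intro: subspace_scale)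
  moreover have "B ((1 / of_nat d) *s x) y = 1" using y by (simp add: B_simps)
  moreover have "(1 / of_nat d) *s x = (of_nat n / of_nat d) *s v" by (simp add: x_def)
  ultimately show ?thesis using n y by (intro exI[of _ "of_nat n / of_nat d"]) auto
qed

lemma unimodular_split:
  assumes L: "unimodular_in U L" and f: "f \<in> L" "B f f \<in> {1, -1}"
  shows "unimodular_in (perp U f) (L \<inter> perp U f)"
proof -
  note D = unimodular_inD[OF L]
  have pr: "x - (B x f / B f f) *s f \<in> L \<inter> perp U f" if xL: "x \<in> L" for x
  proof -
    obtain k where k: "B x f = of_int k" using unimodular_in_int[OF L xL f(1)] by blast
    have "B x f / B f f = of_int (if B f f = 1 then k else - k)" using f k by auto
    then have "x - (B x f / B f f) *s f \<in> L" using unimodular_in_diff[OF L that] unimodular_in_scale[OF L f(1)] by metis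
    then show ?thesis using D(2) f by (auto simp: perp_def B_simps)
  qed
  show ?thesis
    unfolding unimodular_in_def
  proof (intro conjI ballI iffI)
    show "subspace (perp U f)" using D(1) by (rule subspace_perp)
    fix v assume v: "v \<in> perp U f"
    show "B v l \<in> \<int>" if "v \<in> L \<inter> perp U f" "l \<in> L \<inter> perp U f" for l using that D(3) by auto
    show "v \<in> L \<inter> perp U f" if "\<forall>l\<in>L \<inter> perp U f. B v l \<in> \<int>"
    proof -
      have "B v l \<in> \<int>" if l: "l \<in> L" for l
      proof -
        have "B v (l - (B l f / B f f) *s f) = B v l" using v by (simp add: B_simps perp_def)
        then show ?thesis using pr[OF l] \<open>\<forall>l\<in>L \<inter> perp U f. B v l \<in> \<int>\<close> by metis
      qed
      then show ?thesis using v D(4) by (auto simp: perp_def)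
    qed
    obtain n :: nat where n: "n > 0" "of_nat n *s v \<in> L" using D(5) v by (auto simp: perp_def)
    moreover have "of_nat n *s v \<in> perp U f" using subspace_scale[OF subspace_perp[OF D(1)] v] .
    ultimately show "\<exists>n::nat. n > 0 \<and> of_nat n *s v \<in> L \<inter> perp U f" by blast
  qed auto
qed

lemma nondegenerate_perp:
  assumes "nondegenerate U" "subspace U" "f \<in> U" "B f f \<noteq> 0"
  shows "nondegenerate (perp U f)"
  unfolding nondegenerate_def
proof (intro ballI impI)
  fix v assume v: "v \<in> perp U f" "\<forall>u\<in>perp U f. B v u = 0"
  have "B v u = 0" if u: "u \<in> U" for u
  proof -
    have "u - (B u f / B f f) *s f \<in> perp U f"
      using u assms by (auto simp: perp_def B_simps intro: subspace_diff subspace_scale)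
    then have "B v (u - (B u f / B f f) *s f) = 0" using v by blast
    then show ?thesis using v by (simp add: B_simps perp_def)
  qed
  then show "v = 0" using v assms by (auto simp: nondegenerate_def perp_def)
qed

lemma bounded_dim_perp:
  assumes "bounded_dim U (Suc n)" "f \<in> U" "B f f \<noteq> 0"
  shows "bounded_dim (perp U f) n"
  unfolding bounded_dim_def
proof (intro allI impI)
  fix F assume F: "orth_set F" "F \<subseteq> perp U f"
  then have "f \<notin> F" "finite F" using assms by (auto simp: perp_def orth_set_def)
  moreover have "B f x = 0" if "x \<in> F" for x using that F B_sym[of f x] by (auto simp: perp_def)
  then have "orth_set (insert f F)" "insert f F \<subseteq> U" using F assms by (auto simp: orth_set_def perp_def)
  then have "card (insert f F) \<le> Suc n" using assms(1) by (auto simp: bounded_dim_def)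
  ultimately show "card F \<le> n" by simp
qed

lemma frame_insert:
  assumes "frame (perp U f) F" "f \<in> U" "B f f \<noteq> 0"
  shows "frame U (insert f F)"
proof -
  have "B f x = 0" if "x \<in> F" for x using that assms B_sym[of f x] by (auto simp: frame_def perp_def)
  then show ?thesis using assms by (auto simp: frame_def orth_set_def perp_def)
qed

text \<open>A primitive isotropic \<open>x\<close> and an odd \<open>y\<close> with
  \<open>B x y = 1\<close> span a plane with an orthogonal basis \<open>f, g\<close> of norms
  \<open>1\<close> and \<open>-1\<close>. One of these is split off; the other stays in the
  complement and keeps it odd, and the choice is made so that the complement stays
  indefinite.\<close>

theorem odd_indefinite_unimodular:
  assumes "unimodular_in U L" "nondegenerate U" "bounded_dim U n"
    "t \<in> L" "B t t = of_int k" "odd k" "a \<in> U" "B a a > 0" "b \<in> U" "B b b < 0"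
  shows "\<exists>F. frame U F \<and> F \<subseteq> L \<and> (\<forall>f\<in>F. B f f \<in> {1, -1})"
  using assms
proof (induction n arbitrary: U L t k a b)
  case 0
  have "orth_set {a}" using 0 by (auto simp: orth_set_def)
  then have "card {a} \<le> 0" using 0 unfolding bounded_dim_def by blast
  then show ?case by simp
next
  case (Suc n)
  note L = Suc.prems(1) and D = unimodular_inD[OF Suc.prems(1)]
  obtain F0 where "frame U F0" using frame_exists[OF Suc.prems(3,2) D(1)] by blast
  from unimodular_isotropic[OF L this Suc.prems(7-10)] obtain x0 where x0: "x0 \<in> U" "x0 \<noteq> 0" "B x0 x0 = 0" by blast
  from unimodular_primitive[OF L Suc.prems(2) x0(1,2)] obtain c y0 where
    cy: "c *s x0 \<in> L" "y0 \<in> L" "B (c *s x0) y0 = 1" by blast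
  define x where "x = c *s x0"
  have x: "x \<in> L" "B x x = 0" using cy x0 by (auto simp: x_def B_simps)
  have xy0: "B x y0 = 1" using cy by (simp add: x_def)
  obtain y m where y: "y \<in> L" "B x y = 1" "B y y = of_int m" "odd m"
  proof -
    obtain m0 where m0: "B y0 y0 = of_int m0" using unimodular_in_int[OF L] cy by metis
    show ?thesis
    proof (cases "odd m0")
      case True
      then show ?thesis using that cy m0 xy0 by blast
    next
      case False
      obtain j where j: "B x t = of_int j" using unimodular_in_int[OF L x(1) Suc.prems(4)] by blast
      obtain i where i: "B t y0 = of_int i" using unimodular_in_int[OF L Suc.prems(4) cy(2)] by blast
      \<comment> \<open>If \<open>y0\<close> has even norm, \<open>t\<close> supplies the odd norm,
        and the multiple of \<open>y0\<close> corrects the product with \<open>x\<close> to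
        \<open>1\<close> while changing the norm by an even number.\<close>
      define y where "y = t + of_int (1 - j) *s y0"
      have "y \<in> L" unfolding y_def using Suc.prems cy by (intro unimodular_in_add[OF L] unimodular_in_scale[OF L])
      moreover have "B x y = 1" by (simp add: y_def B_simps j xy0)
      moreover have "B y y = of_int (k + 2 * (1 - j) * i + (1 - j) * (1 - j) * m0)"
        by (simp add: y_def B_simps Suc.prems(5) m0 i B_sym[of y0 t] algebra_simps)
      moreover have "odd (k + 2 * (1 - j) * i + (1 - j) * (1 - j) * m0)" using False Suc.prems by simp
      ultimately show ?thesis using that by blast
    qed
  qed
  \<comment> \<open>Subtracting \<open>x\<close> a suitable number of times brings the odd norm of
    \<open>y\<close> down to \<open>1\<close>; one more subtraction gives norm
    \<open>-1\<close>.\<close>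
  obtain q where q: "m = 2 * q + 1" using y(4) by (auto elim: oddE)
  define f where "f = y - of_int q *s x"
  define g where "g = f - x"
  have f: "f \<in> L" unfolding f_def using x y by (intro unimodular_in_diff[OF L] unimodular_in_scale[OF L])
  have g: "g \<in> L" unfolding g_def using x f by (intro unimodular_in_diff[OF L])
  have yx: "B y x = 1" using y(2) B_sym by metis
  have fx: "B f x = 1" "B x f = 1" using x yx y by (auto simp: f_def B_simps)
  have ff: "B f f = 1" using x y yx by (simp add: f_def B_simps q)
  have gg: "B g g = -1" and fg: "B f g = 0" "B g f = 0" using fx ff x by (auto simp: g_def B_simps)
  have fU: "f \<in> U" "g \<in> U" using f g D(2) by auto
  \<comment> \<open>A vector \<open>z\<close> orthogonal to the plane decides: if its norm is
    positive, \<open>f\<close> is split off and \<open>g\<close> remains as the negative vector; if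
    negative, the other way round. If all such vectors are isotropic, nondegeneracy shows that the
    plane is everything.\<close>
  show ?case
  proof (cases "\<exists>z\<in>perp (perp U f) g. B z z \<noteq> 0")
    case True
    then obtain z where z: "z \<in> U" "B z f = 0" "B z g = 0" "B z z \<noteq> 0" by (auto simp: perp_def)
    have "\<exists>h h'. h \<in> L \<and> h' \<in> perp U h \<and> h' \<in> L \<and> B h h \<in> {1, -1} \<and> B h' h' \<in> {1, -1} \<and>
       (\<exists>a\<in>perp U h. B a a > 0) \<and> (\<exists>b\<in>perp U h. B b b < 0)"
    proof (cases "B z z > 0")
      case True
      then show ?thesis using z f g fU ff gg fg
        by (intro exI[of _ f] exI[of _ g]) (auto simp: perp_def intro!: bexI[of _ z] bexI[of _ g])
    next
      case False
      then show ?thesis using z f g fU ff gg fg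
        by (intro exI[of _ g] exI[of _ f]) (auto simp: perp_def intro!: bexI[of _ z] bexI[of _ f])
    qed
    then obtain h h' a' b' where h: "h \<in> L" "h' \<in> perp U h" "h' \<in> L" "B h h \<in> {1, -1}" "B h' h' \<in> {1, -1}"
      and ab: "a' \<in> perp U h" "B a' a' > 0" "b' \<in> perp U h" "B b' b' < 0" by blast
    have hn: "B h h \<noteq> 0" "h \<in> U" using h D(2) by auto
    obtain k' where k': "B h' h' = of_int k'" "odd k'"
    proof -
      have "B h' h' = of_int (if B h' h' = 1 then 1 else -1)" using h by auto
      then show ?thesis using that[of "if B h' h' = 1 then 1 else -1"] by auto
    qed
    obtain F where F: "frame (perp U h) F" "F \<subseteq> L \<inter> perp U h" "\<forall>f\<in>F. B f f \<in> {1, -1}"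
      using Suc.IH[OF unimodular_split[OF L h(1,4)] nondegenerate_perp[OF Suc.prems(2) D(1) hn(2,1)]
          bounded_dim_perp[OF Suc.prems(3) hn(2,1)] _ k' ab] h by blast
    show ?thesis using frame_insert[OF F(1) hn(2,1)] F h by (intro exI[of _ "insert h F"]) auto
  next
    case False
    have sub: "subspace (perp (perp U f) g)" using D(1) subspace_perp by blast
    have gpf: "g \<in> perp U f" using fU fg by (simp add: perp_def)
    have nd: "nondegenerate (perp (perp U f) g)"
      using nondegenerate_perp[OF nondegenerate_perp[OF Suc.prems(2) D(1) fU(1)] subspace_perp[OF D(1)] gpf] ff gg by simp
    have "v = 0" if v: "v \<in> perp (perp U f) g" for v
    proof -
      have "B v u = 0" if u: "u \<in> perp (perp U f) g" for u
      proof -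
        have "B (v + u) (v + u) = 0" "B v v = 0" "B u u = 0" using u v sub False subspace_add by blast+
        then show ?thesis by (simp add: B_simps B_sym[of u v])
      qed
      then show ?thesis using nd v by (auto simp: nondegenerate_def)
    qed
    then have "frame (perp (perp U f) g) {}" by (auto simp: frame_def orth_set_def)
    then have "frame U {f, g}" using frame_insert[OF frame_insert] fU gpf ff gg by simp
    then show ?thesis using f g ff gg by (intro exI[of _ "{f, g}"]) auto
  qed
qed

end

lemma half_integer_cases:
  assumes "2 * r \<in> \<int>" "(r::rat) \<notin> \<int>" shows "\<exists>k. r = of_int k + 1 / 2"
proof -
  obtain m where m: "2 * r = of_int m" using assms(1) by (auto elim: Ints_cases)
  have "odd m"
  proof
    assume "even m"
    then obtain k where "m = 2 * k" by auto
    then have "r = of_int k" using m by simp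
    then show False using assms(2) by simp
  qed
  then obtain k where "m = 2 * k + 1" by (auto elim: oddE)
  then show ?thesis using m by (intro exI[of _ k]) simp
qed

lemma half_notin_Ints: "(1 / 2 :: rat) \<notin> \<int>"
proof
  assume "(1 / 2 :: rat) \<in> \<int>"
  then obtain k where k: "(1 / 2 :: rat) = of_int k" by (auto elim: Ints_cases)
  then have "(of_int (2 * k) :: rat) = of_int 1" by simp
  then have "2 * k = 1" by (simp only: of_int_eq_iff)
  then show False by presburger
qed

section \<open>Even lattices and their odd neighbours\<close>

context rat_quad_space
begin

definition even_part :: "'v set \<Rightarrow> 'v set" where
  "even_part L = {l\<in>L. \<exists>k. B l l = of_int (2 * k)}"

text \<open>A frame of norms \<open>1\<close> and \<open>-1\<close> inside \<open>L\<close> already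
  spans a self-dual lattice, so integral coefficients suffice for membership. An isometry matching
  two such frames therefore matches the lattices.\<close>

lemma unimodular_frame_eq:
  assumes "unimodular_in U L" "frame U F" "F \<subseteq> L" "\<forall>f\<in>F. B f f \<in> {1, -1}"
  shows "L = {v\<in>U. \<forall>f\<in>F. B v f \<in> \<int>}"
proof -
  note D = unimodular_inD[OF assms(1)]
  have "v \<in> L" if v: "v \<in> U" "\<forall>f\<in>F. B v f \<in> \<int>" for v
  proof (rule D(4)[OF v(1)])
    fix l assume l: "l \<in> L"
    have "B v f * B l f / B f f \<in> \<int>" if f: "f \<in> F" for f
    proof -
      have "B v f * B l f \<in> \<int>" using v f assms(3) D(3)[OF l] by auto
      then show ?thesis using assms(4) f by fastforce
    qed
    then show "B v l \<in> \<int>" unfolding frame_norm[OF assms(2) D(1) v(1) subsetD[OF D(2) l]] by (rule Ints_sum)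
  qed
  then show ?thesis using D(2,3) assms(3) by auto
qed

text \<open>The parity of the norm is additive, because the mixed term is counted twice; so the even
  part is a subgroup with at most two classes.\<close>

lemma even_part_diff:
  assumes L: "unimodular_in U L" and "x \<in> L" "y \<in> L" and "x \<in> even_part L \<longleftrightarrow> y \<in> even_part L"
  shows "x - y \<in> even_part L"
proof -
  obtain k l m where k: "B x x = of_int k" "B y y = of_int l" "B x y = of_int m"
    using unimodular_in_int[OF L] assms by metis
  have ev: "z \<in> even_part L \<longleftrightarrow> even j" if "z \<in> L" "B z z = of_int j" for z j
    using that by (auto simp: even_part_def simp del: of_int_mult elim!: evenE)
  have "B (x - y) (x - y) = of_int (k + l - 2 * m)" by (simp add: B_simps k B_sym[of y x])
  moreover have "even (k + l - 2 * m)" using assms ev[OF _ k(1)] ev[OF _ k(2)] by auto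
  ultimately show ?thesis using ev unimodular_in_diff[OF L] assms by blast
qed

lemma even_part_scale2:
  assumes L: "unimodular_in U L" and "x \<in> L" shows "2 *s x \<in> even_part L"
proof -
  obtain k where k: "B x x = of_int k" using unimodular_in_int[OF L] assms by metis
  have "B (2 *s x) (2 *s x) = of_int (2 * (2 * k))" by (simp add: B_simps k)
  moreover have "2 *s x \<in> L" using unimodular_in_scale[OF L assms(2), of 2] by simp
  ultimately show ?thesis unfolding even_part_def by blast
qed

text \<open>A vector outside \<open>L\<close> that is integral on the even part takes a
  half-integral, non-integral value on every odd vector of \<open>L\<close>. Two such vectors thus
  differ by an element of \<open>L\<close>, and modulo the even part the only nonzero class in
  \<open>L\<close> is that of \<open>b\<close>.\<close>

lemma even_part_coset:
  assumes L: "unimodular_in U L" and b: "b \<in> L" "B b b = -1"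
    and x: "x \<in> U" "x \<notin> L" "\<forall>e\<in>even_part L. B x e \<in> \<int>"
    and w: "w \<in> U" "w \<notin> L" "\<forall>e\<in>even_part L. B w e \<in> \<int>"
  shows "w - x \<in> even_part L \<or> w - (x - b) \<in> even_part L"
proof -
  note D = unimodular_inD[OF L]
  have half: "\<exists>k. B z l = of_int k + 1 / 2"
    if z: "z \<in> U" "z \<notin> L" "\<forall>e\<in>even_part L. B z e \<in> \<int>" and l: "l \<in> L" "l \<notin> even_part L" for z l
  proof (rule half_integer_cases)
    have "B z (2 *s l) \<in> \<int>" using z even_part_scale2[OF L l(1)] by blast
    then show "2 * B z l \<in> \<int>" by (simp add: B_simps)
    obtain l0 where l0: "l0 \<in> L" "B z l0 \<notin> \<int>" using D(4) z by blast
    then have "l0 - l \<in> even_part L" using even_part_diff[OF L l0(1) l(1)] z l by blast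
    then have "B z l0 - B z l \<in> \<int>" using z by (metis B_diff_right)
    then show "B z l \<notin> \<int>" using l0 by (metis Ints_add diff_add_cancel)
  qed
  have wx: "w - x \<in> L"
  proof (rule D(4))
    show "w - x \<in> U" using w x D(1) subspace_diff by blast
    fix l assume l: "l \<in> L"
    show "B (w - x) l \<in> \<int>"
    proof (cases "l \<in> even_part L")
      case True
      then show ?thesis using w x by (auto simp: B_simps)
    next
      case False
      obtain j k where "B w l = of_int j + 1 / 2" "B x l = of_int k + 1 / 2"
        using half[OF w l False] half[OF x l False] by blast
      then have "B (w - x) l = of_int (j - k)" by (simp add: B_simps)
      then show ?thesis by (metis Ints_of_int)
    qed
  qed
  have "b \<notin> even_part L"
  proof
    assume "b \<in> even_part L"
    then obtain k where "rat_of_int (2 * k) = of_int (-1)" using b by (auto simp: even_part_def)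
    then have "2 * k = -1" by (simp only: of_int_eq_iff)
    then show False by presburger
  qed
  moreover have nb: "- b \<in> L" "- b \<in> even_part L \<longleftrightarrow> b \<in> even_part L"
    using unimodular_in_scale[OF L b(1), of "-1"] b by (auto simp: even_part_def B_simps)
  ultimately have "w - x \<in> even_part L \<or> (w - x) - (- b) \<in> even_part L"
    using even_part_diff[OF L wx nb(1)] by blast
  then show ?thesis by (simp add: algebra_simps)
qed

lemma refl_even_part:
  assumes L: "unimodular_in U L" and b: "b \<in> L" "B b b = -1" and e: "e \<in> even_part L"
  shows "refl b e \<in> even_part L"
proof -
  obtain k where k: "B e b = of_int k" using unimodular_in_int[OF L] b e by (auto simp: even_part_def)
  have "2 * B e b / B b b = of_int (- 2 * k)" using k b by simp
  then have "refl b e = e - of_int (- 2 * k) *s b" by (simp only: refl_def)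
  moreover have "e \<in> L" using e by (simp add: even_part_def)
  ultimately have "refl b e \<in> L" using unimodular_in_diff[OF L _ unimodular_in_scale[OF L b(1)]] by metis
  then show ?thesis using e refl_B[of b e e] b by (auto simp: even_part_def)
qed

text \<open>An even indefinite unimodular lattice contains a hyperbolic plane spanned by isotropic \<open>x, y\<close>
  with \<open>B x y = 1\<close>. Exchanging it for the odd plane with orthogonal basis
  \<open>x + y / 2, x - y / 2\<close> gives an odd unimodular lattice with the same even part.\<close>

lemma even_indefinite_unimodular:
  assumes L: "unimodular_in U L" and ev: "\<And>l. l \<in> L \<Longrightarrow> \<exists>k. B l l = of_int (2 * k)"
    and nd: "nondegenerate U" and bd: "bounded_dim U n"
    and ind: "s \<in> U" "B s s > 0" "t \<in> U" "B t t < 0"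
  shows "\<exists>N F x b. unimodular_in U N \<and> frame U F \<and> F \<subseteq> N \<and> (\<forall>f\<in>F. B f f \<in> {1, -1}) \<and>
    x \<in> U \<and> x \<notin> N \<and> (\<forall>e\<in>even_part N. B x e \<in> \<int>) \<and>
    L = even_part N \<union> {e + x |e. e \<in> even_part N} \<and> b \<in> N \<and> B b b = -1 \<and> refl b x = x - b"
proof -
  note D = unimodular_inD[OF L]
  obtain F0 where F0: "frame U F0" using frame_exists[OF bd nd D(1)] by blast
  obtain x0 where x0: "x0 \<in> U" "x0 \<noteq> 0" "B x0 x0 = 0" using unimodular_isotropic[OF L F0 ind] by blast
  from unimodular_primitive[OF L nd x0(1,2)] obtain c y0 where
    cy: "c *s x0 \<in> L" "y0 \<in> L" "B (c *s x0) y0 = 1" by blast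
  define x where "x = c *s x0"
  obtain k where k: "B y0 y0 = of_int (2 * k)" using ev cy by blast
  define y where "y = y0 - of_int k *s x"
  have x: "x \<in> L" "B x x = 0" using cy x0 by (auto simp: x_def B_simps)
  have xy0: "B x y0 = 1" "B y0 x = 1" using cy B_sym by (auto simp: x_def)
  have y: "y \<in> L" unfolding y_def using cy x by (intro unimodular_in_diff[OF L] unimodular_in_scale[OF L])
  have yy: "B y y = 0" and xy: "B x y = 1" "B y x = 1" using x xy0 k by (auto simp: y_def B_simps)
  define a b where "a = x + (1 / 2) *s y" and "b = x - (1 / 2) *s y"
  have aU: "a \<in> U" "x \<in> U" "y \<in> U" using x y D(1,2) unfolding a_def by (auto intro!: subspace_add subspace_scale)
  have ab: "B a a = 1" "B b b = -1" "B x a = 1 / 2" "B a x = 1 / 2" "B y a = 1" "B x b = - (1 / 2)"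
    using x xy yy by (auto simp: a_def b_def B_simps)
  \<comment> \<open>\<open>E\<close> is the common sublattice of \<open>L\<close> and its neighbour
    \<open>N\<close>: index two in \<open>L\<close>, with \<open>x\<close> representing the other
    class because \<open>B x a = 1 / 2\<close>.\<close>
  define E where "E = {l\<in>L. B l a \<in> \<int>}"
  define N where "N = {l + of_int j *s a |l j. l \<in> E}"
  have la: "\<exists>j. B l a = of_int j / 2" if l: "l \<in> L" for l
  proof -
    obtain i j where "B l x = of_int i" "B l y = of_int j" using unimodular_in_int[OF L l x(1)] unimodular_in_int[OF L l y] by blast
    then have "B l a = of_int (2 * i + j) / 2" by (simp add: a_def B_simps field_simps)
    then show ?thesis by blast
  qed
  have E2: "2 *s l \<in> E" if l: "l \<in> L" for l
  proof -
    obtain j where "B l a = of_int j / 2" using la[OF l] by blast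
    then have "B (2 *s l) a = of_int j" by (simp add: B_simps)
    then show ?thesis using unimodular_in_scale[OF L l, of 2] by (simp add: E_def)
  qed
  have Ex: "l \<in> E \<or> l - x \<in> E" if l: "l \<in> L" for l
  proof (cases "B l a \<in> \<int>")
    case False
    obtain j where "B l a = of_int j / 2" using la[OF l] by blast
    then have "2 * B l a = of_int j" by simp
    then have "2 * B l a \<in> \<int>" by (metis Ints_of_int)
    then obtain k where "B l a = of_int k + 1 / 2" using half_integer_cases[OF _ False] by blast
    then have "B (l - x) a = of_int k" unfolding B_diff_left ab(3) by simp
    then have "B (l - x) a \<in> \<int>" by (metis Ints_of_int)
    then show ?thesis using unimodular_in_diff[OF L l x(1)] by (auto simp: E_def)
  qed (use l in \<open>auto simp: E_def\<close>)
  have Eadd: "l + m \<in> E" "l - m \<in> E" if "l \<in> E" "m \<in> E" for l m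
    using that unimodular_in_add[OF L] unimodular_in_diff[OF L] by (auto simp: E_def B_simps)
  have Esc: "of_int j *s l \<in> E" if "l \<in> E" for l j
    using that unimodular_in_scale[OF L] by (auto simp: E_def B_simps)
  have EN: "E \<subseteq> N" unfolding N_def by (force intro: exI[of _ 0])
  have E0: "0 \<in> E" using Eadd(2)[OF E2[OF x(1)] E2[OF x(1)]] by simp
  have aN: "a \<in> N" unfolding N_def using E0 by (force intro: exI[of _ 1])
  have EU: "E \<subseteq> U" using D(2) by (auto simp: E_def)
  have NU: "N \<subseteq> U" using EU aU D(1) unfolding N_def by (auto intro!: subspace_add subspace_scale)
  have N: "unimodular_in U N"
    unfolding unimodular_in_def
  proof (intro conjI ballI iffI)
    fix v assume v: "v \<in> U"
    show "B v l \<in> \<int>" if vl: "v \<in> N" "l \<in> N" for l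
    proof -
      obtain p i q j where "v = p + of_int i *s a" "l = q + of_int j *s a" "p \<in> E" "q \<in> E" using vl unfolding N_def by blast
      then have "B p q \<in> \<int>" "B p a \<in> \<int>" "B a q \<in> \<int>" and e: "B v l = B p q + of_int j * B p a + of_int i * (B a q + of_int j)"
        using D(3) B_sym[of a q] ab(1) by (simp_all add: E_def B_simps algebra_simps)
      then show ?thesis unfolding e by (intro Ints_add Ints_mult) simp_all
    qed
    \<comment> \<open>Since \<open>B a x = 1 / 2\<close>, either \<open>v\<close> or
      \<open>v - a\<close> has an integral product with \<open>x\<close>. Being integral on
      \<open>E\<close> as well, that vector is integral on all of \<open>L\<close> and lies in
      \<open>L\<close> by self-duality.\<close>
    show "v \<in> N" if dual: "\<forall>l\<in>N. B v l \<in> \<int>"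
    proof (cases "B v x \<in> \<int>")
      case True
      have "v \<in> L"
      proof (rule D(4)[OF v])
        fix l assume "l \<in> L"
        then have "B v l \<in> \<int> \<or> B v (l - x) \<in> \<int>" using Ex dual EN by blast
        moreover have "B v l = B v (l - x) + B v x" by (simp add: B_diff_right)
        ultimately show "B v l \<in> \<int>" using Ints_add[OF _ True] by metis
      qed
      then show ?thesis using dual aN EN by (auto simp: E_def)
    next
      case False
      have "B v (2 *s x) \<in> \<int>" using dual EN E2[OF x(1)] by blast
      then have "2 * B v x \<in> \<int>" by (simp add: B_simps)
      then obtain k where "B v x = of_int k + 1 / 2" using half_integer_cases[OF _ False] by blast
      then have "B (v - a) x = of_int k" unfolding B_diff_left ab(4) by simp
      then have vx: "B (v - a) x \<in> \<int>" by (metis Ints_of_int)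
      have va: "v - a \<in> L"
      proof (rule D(4))
        show "v - a \<in> U" using v aU D(1) subspace_diff by blast
        fix l assume "l \<in> L"
        moreover have "B (v - a) m \<in> \<int>" if m: "m \<in> E" for m
        proof -
          have "B v m \<in> \<int>" "B a m \<in> \<int>" using m dual EN B_sym[of a m] by (auto simp: E_def)
          then show ?thesis unfolding B_diff_left by (rule Ints_diff)
        qed
        ultimately have "B (v - a) l \<in> \<int> \<or> B (v - a) (l - x) \<in> \<int>" using Ex by blast
        moreover have "B (v - a) l = B (v - a) (l - x) + B (v - a) x" by (simp add: B_diff_right)
        ultimately show "B (v - a) l \<in> \<int>" using Ints_add[OF _ vx] by metis
      qed
      have "B v a \<in> \<int>" using dual aN by blast
      then have "v - a \<in> E" using va ab by (auto simp: E_def B_simps)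
      then show ?thesis unfolding N_def by (force intro: exI[of _ 1])
    qed
    obtain m :: nat where m: "m > 0" "of_nat m *s v \<in> L" using D(5) v by blast
    have "of_nat (2 * m) *s v \<in> N" using E2[OF m(2)] EN by (auto simp: )
    then show "\<exists>m::nat. m > 0 \<and> of_nat m *s v \<in> N" using m(1) by (intro exI[of _ "2 * m"]) auto
  qed (use D(1) NU in auto)
  have a2: "2 *s a \<in> E"
  proof -
    have "2 *s a = 2 *s x + y" by (simp add: a_def algebra_simps)
    moreover have "y \<in> E" using y ab by (simp add: E_def)
    ultimately show ?thesis using E2[OF x(1)] Eadd by metis
  qed
  have EE: "even_part N = E"
  proof
    show "E \<subseteq> even_part N" using EN ev by (auto simp: even_part_def E_def)
    show "even_part N \<subseteq> E"
    proof
      fix v assume "v \<in> even_part N"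
      then obtain l j i where v: "v = l + of_int j *s a" "l \<in> E" "B v v = of_int (2 * i)"
        unfolding even_part_def N_def by blast
      obtain p where p: "B l l = of_int (2 * p)" using v ev by (auto simp: E_def)
      obtain q where q: "B l a = of_int q" "B a l = of_int q" using v B_sym[of l a] by (auto simp: E_def elim: Ints_cases)
      \<comment> \<open>Modulo two the norm is the square of the coefficient \<open>j\<close> of
        \<open>a\<close>, so \<open>j\<close> is even, and \<open>2 *s a\<close> already lies in
        \<open>E\<close>.\<close>
      have "B v v = of_int (2 * p + 2 * j * q + j * j)"
        unfolding v(1) by (simp add: B_simps p q ab algebra_simps)
      then have "2 * i = 2 * p + 2 * j * q + j * j" using v(3) by (simp only: of_int_eq_iff)
      then have "j * j = 2 * (i - p - j * q)" by (simp add: algebra_simps)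
      then have "even (j * j)" by simp
      then have "even j" by simp
      then obtain r where "j = 2 * r" by auto
      then have "v = l + of_int r *s (2 *s a)" using v(1) by (simp add: mult.commute)
      then show "v \<in> E" using v Eadd Esc a2 by blast
    qed
  qed
  have xN: "x \<notin> N"
  proof
    assume "x \<in> N"
    then have "B x a \<in> \<int>" using aN unimodular_inD(3)[OF N] by blast
    then show False using half_notin_Ints ab by simp
  qed
  have bN: "b \<in> N"
  proof -
    have "b = - y + of_int 1 *s a" by (simp add: a_def b_def algebra_simps flip: scale_left_distrib)
    moreover have "- y \<in> E" using y ab unimodular_in_scale[OF L y, of "-1"] by (simp add: E_def B_simps)
    ultimately show ?thesis unfolding N_def by blast
  qed
  have LE: "L = E \<union> {e + x |e. e \<in> E}"
  proof
    show "L \<subseteq> E \<union> {e + x |e. e \<in> E}"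
    proof
      fix l assume "l \<in> L"
      then have "l \<in> E \<or> l - x \<in> E" by (rule Ex)
      moreover have "l = (l - x) + x" by simp
      ultimately show "l \<in> E \<union> {e + x |e. e \<in> E}" by blast
    qed
    show "E \<union> {e + x |e. e \<in> E} \<subseteq> L" using x unimodular_in_add[OF L] by (auto simp: E_def)
  qed
  have "a \<in> N" "B a a = of_int 1" "odd (1::int)" using aN ab by auto
  from odd_indefinite_unimodular[OF N nd bd this ind] obtain F where
    F: "frame U F" "F \<subseteq> N" "\<forall>f\<in>F. B f f \<in> {1, -1}" by blast
  \<comment> \<open>Here \<open>B x b = - (1 / 2)\<close> and \<open>B b b = -1\<close>, so the
    reflection shifts \<open>x\<close> by exactly \<open>b\<close> and exchanges the two classes of
    \<open>even_part_coset\<close>.\<close>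
  have "refl b x = x - b" using ab by (simp add: refl_def)
  moreover have "\<forall>e\<in>even_part N. B x e \<in> \<int>" using D(3)[OF x(1)] by (auto simp: EE E_def)
  ultimately show ?thesis using N F xN bN LE ab aU EE by (intro exI[of _ N] exI[of _ F] exI[of _ x] exI[of _ b]) auto
qed

end

locale rat_quad_pair = V: rat_quad_space s1 B1 + W: rat_quad_space s2 B2
  for s1 :: "rat \<Rightarrow> 'v::ab_group_add \<Rightarrow> 'v" and B1 and s2 :: "rat \<Rightarrow> 'w::ab_group_add \<Rightarrow> 'w" and B2
begin

text \<open>Members of equal norm are matched by listing both frames. \<open>T\<close> and
  \<open>T'\<close> transfer the expansion coefficients and are thus inverse to each other on the
  two subspaces.\<close>

lemma frame_isometry:
  assumes F1: "V.frame U1 F1" "V.subspace U1" and F2: "W.frame U2 F2" "W.subspace U2" and n: "V.norms F1 = W.norms F2"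
  shows "\<exists>T T'. (\<forall>v\<in>U1. T v \<in> U2 \<and> T' (T v) = v) \<and> (\<forall>w\<in>U2. T' w \<in> U1 \<and> T (T' w) = w) \<and>
     (\<forall>v v'. T (v + v') = T v + T v') \<and> (\<forall>v\<in>U1. \<forall>v'\<in>U1. B2 (T v) (T v') = B1 v v') \<and>
     T ` F1 = F2 \<and> T' ` F2 = F1"
proof -
  have fin: "finite F1" "finite F2" using F1 F2 by (auto simp: V.frame_def W.frame_def V.orth_set_def W.orth_set_def)
  obtain fs where fs: "set fs = F1" "distinct fs" using finite_distinct_list[OF fin(1)] by blast
  have "mset fs = mset_set F1" using fs mset_set_set by metis
  then have "image_mset (\<lambda>v. B2 v v) (mset_set F2) = mset (map (\<lambda>v. B1 v v) fs)"
    using n by (simp add: V.norms_def W.norms_def)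
  from mset_map_eq_list[OF this] obtain gs where
    gs: "mset gs = mset_set F2" "map (\<lambda>v. B2 v v) gs = map (\<lambda>v. B1 v v) fs" by blast
  have sg: "set gs = F2" using gs(1) fin by (metis finite_set_mset_mset_set set_mset_mset)
  have dg: "distinct gs" using gs(1) sg by (metis card_distinct size_mset size_mset_set)
  define m where "m = length fs"
  have lg: "length gs = m" using gs(2) map_eq_imp_length_eq m_def by metis
  define f g where "f = (!) fs" and "g = (!) gs"
  have bf: "bij_betw f {..<m} F1" and bg: "bij_betw g {..<m} F2"
    unfolding f_def g_def using fs sg dg lg m_def bij_betw_nth by blast+
  have nm: "B2 (g i) (g i) = B1 (f i) (f i)" if "i < m" for i
    using arg_cong[OF gs(2), of "\<lambda>xs. xs ! i"] that lg by (simp add: f_def g_def m_def)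
  have fU: "f i \<in> U1" "g i \<in> U2" "B1 (f i) (f i) \<noteq> 0" if "i < m" for i
    using that bf bg F1 F2 unfolding V.frame_def W.frame_def V.orth_set_def bij_betw_def by auto
  have of1: "B1 (f i) (f j) = (if i = j then B1 (f j) (f j) else 0)" if "i < m" "j < m" for i j
  proof -
    have "f i \<in> F1" "f j \<in> F1" "f i = f j \<longleftrightarrow> i = j" using that bf by (auto simp: bij_betw_def inj_on_def)
    then show ?thesis using F1(1) unfolding V.frame_def V.orth_set_def by auto
  qed
  have og: "B2 (g i) (g j) = (if i = j then B1 (f j) (f j) else 0)" if "i < m" "j < m" for i j
  proof -
    have "g i \<in> F2" "g j \<in> F2" "g i = g j \<longleftrightarrow> i = j" using that bg by (auto simp: bij_betw_def inj_on_def)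
    then show ?thesis using F2(1) nm[OF that(2)] unfolding W.frame_def W.orth_set_def by auto
  qed
  define T where "T v = (\<Sum>i<m. s2 (B1 v (f i) / B1 (f i) (f i)) (g i))" for v
  define T' where "T' w = (\<Sum>i<m. s1 (B2 w (g i) / B1 (f i) (f i)) (f i))" for w
  have TU: "T v \<in> U2" and T'U: "T' w \<in> U1" for v w
    unfolding T_def T'_def using fU F1 F2
    by (auto intro!: W.subspace_sum W.subspace_scale V.subspace_sum V.subspace_scale)
  have TB: "B2 (T v) (g j) = B1 v (f j)" if "j < m" for v j
  proof -
    have "B2 (T v) (g j) = (\<Sum>i<m. if i = j then B1 v (f j) else 0)"
      unfolding T_def W.B_sum_left W.B_scale_left using fU(3)[OF that]
      by (intro sum.cong[OF HOL.refl]) (simp only: og[OF _ that] lessThan_iff, simp)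
    then show ?thesis using that by simp
  qed
  have T'B: "B1 (T' w) (f j) = B2 w (g j)" if "j < m" for w j
  proof -
    have "B1 (T' w) (f j) = (\<Sum>i<m. if i = j then B2 w (g j) else 0)"
      unfolding T'_def V.B_sum_left V.B_scale_left using fU(3)[OF that]
      by (intro sum.cong[OF HOL.refl]) (simp only: of1[OF _ that] lessThan_iff, simp)
    then show ?thesis using that by simp
  qed
  have eq1: "v = v'" if "v \<in> U1" "v' \<in> U1" "\<And>j. j < m \<Longrightarrow> B1 v (f j) = B1 v' (f j)" for v v'
  proof -
    have "\<forall>x\<in>F1. B1 (v - v') x = 0" using that bf by (auto simp: V.B_simps bij_betw_def)
    then have "v - v' = 0" using that F1 V.subspace_diff unfolding V.frame_def by blast
    then show ?thesis by simp
  qed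
  have eq2: "v = v'" if "v \<in> U2" "v' \<in> U2" "\<And>j. j < m \<Longrightarrow> B2 v (g j) = B2 v' (g j)" for v v'
  proof -
    have "\<forall>x\<in>F2. B2 (v - v') x = 0" using that bg by (auto simp: W.B_simps bij_betw_def)
    then have "v - v' = 0" using that F2 W.subspace_diff unfolding W.frame_def by blast
    then show ?thesis by simp
  qed
  have 1: "T' (T v) = v" if "v \<in> U1" for v using that T'U TB T'B by (intro eq1) auto
  have 2: "T (T' w) = w" if "w \<in> U2" for w using that TU TB T'B by (intro eq2) auto
  have 3: "B2 (T v) (T v') = B1 v v'" if "v \<in> U1" "v' \<in> U1" for v v'
  proof -
    have "B2 (T v) (T v') = (\<Sum>x\<in>F2. B2 (T v) x * B2 (T v') x / B2 x x)"
      by (rule W.frame_norm[OF F2 TU TU])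
    also have "\<dots> = (\<Sum>i<m. B2 (T v) (g i) * B2 (T v') (g i) / B2 (g i) (g i))"
      by (rule sum.reindex_bij_betw[OF bg, symmetric])
    also have "\<dots> = (\<Sum>i<m. B1 v (f i) * B1 v' (f i) / B1 (f i) (f i))"
      using TB nm by (intro sum.cong) auto
    also have "\<dots> = (\<Sum>x\<in>F1. B1 v x * B1 v' x / B1 x x)"
      by (rule sum.reindex_bij_betw[OF bf])
    also have "\<dots> = B1 v v'" by (rule V.frame_norm[OF F1 that, symmetric])
    finally show ?thesis .
  qed
  have 4: "T (v + v') = T v + T v'" for v v'
    unfolding T_def by (simp add: V.B_simps add_divide_distrib W.scale_left_distrib sum.distrib)
  have Tf: "T (f i) = g i" "T' (g i) = f i" if "i < m" for i
  proof -
    have "B2 (T (f i)) (g j) = B2 (g i) (g j)" "B1 (T' (g i)) (f j) = B1 (f i) (f j)" if j: "j < m" for j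
      unfolding TB[OF j] T'B[OF j] of1[OF \<open>i < m\<close> j] og[OF \<open>i < m\<close> j] by (rule HOL.refl)+
    then show "T (f i) = g i" "T' (g i) = f i" using that TU T'U fU by (blast intro: eq1 eq2)+
  qed
  have "T ` F1 = F2" "T' ` F2 = F1" using Tf bf bg by (auto simp: bij_betw_def image_image)
  then show ?thesis using 1 2 3 4 TU T'U by (intro exI[of _ T] exI[of _ T']) simp
qed

text \<open>The isometry matching the sign frames of the odd neighbours carries \<open>N1\<close> to
  \<open>N2\<close>, hence even part to even part. The image of \<open>x1\<close> lies in one of the
  two classes of \<open>even_part_coset\<close>; in the wrong case the reflection in
  \<open>b2\<close> repairs it.\<close>

theorem even_unimodular_isometric:
  assumes L1: "V.unimodular_in U1 L1" "\<And>l. l \<in> L1 \<Longrightarrow> \<exists>k. B1 l l = of_int (2 * k)"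
      "V.nondegenerate U1" "V.bounded_dim U1 n1" "s \<in> U1" "B1 s s > 0" "t \<in> U1" "B1 t t < 0"
    and L2: "W.unimodular_in U2 L2" "\<And>l. l \<in> L2 \<Longrightarrow> \<exists>k. B2 l l = of_int (2 * k)"
      "W.nondegenerate U2" "W.bounded_dim U2 n2" "s' \<in> U2" "B2 s' s' > 0" "t' \<in> U2" "B2 t' t' < 0"
    and sg: "\<And>F1 F2. V.frame U1 F1 \<Longrightarrow> W.frame U2 F2 \<Longrightarrow> \<forall>f\<in>F1. B1 f f \<in> {1, -1} \<Longrightarrow>
        \<forall>f\<in>F2. B2 f f \<in> {1, -1} \<Longrightarrow> V.norms F1 = W.norms F2"
  shows "\<exists>f. bij_betw f L1 L2 \<and> (\<forall>x\<in>L1. \<forall>y\<in>L1. f (x + y) = f x + f y) \<and>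
     (\<forall>x\<in>L1. \<forall>y\<in>L1. B2 (f x) (f y) = B1 x y)"
proof -
  obtain N1 F1 x1 b1 where 1: "V.unimodular_in U1 N1" "V.frame U1 F1" "F1 \<subseteq> N1" "\<forall>f\<in>F1. B1 f f \<in> {1, -1}"
    "x1 \<in> U1" "x1 \<notin> N1" "\<forall>e\<in>V.even_part N1. B1 x1 e \<in> \<int>"
    "L1 = V.even_part N1 \<union> {e + x1 |e. e \<in> V.even_part N1}"
    using V.even_indefinite_unimodular[OF L1] by auto
  obtain N2 F2 x2 b2 where 2: "W.unimodular_in U2 N2" "W.frame U2 F2" "F2 \<subseteq> N2" "\<forall>f\<in>F2. B2 f f \<in> {1, -1}"
    "x2 \<in> U2" "x2 \<notin> N2" "\<forall>e\<in>W.even_part N2. B2 x2 e \<in> \<int>"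
    "L2 = W.even_part N2 \<union> {e + x2 |e. e \<in> W.even_part N2}"
    "b2 \<in> N2" "B2 b2 b2 = -1" "W.refl b2 x2 = x2 - b2"
    using W.even_indefinite_unimodular[OF L2] by auto
  note sub = V.unimodular_inD(1)[OF 1(1)] W.unimodular_inD(1)[OF 2(1)]
  from frame_isometry[OF 1(2) sub(1) 2(2) sub(2) sg[OF 1(2) 2(2) 1(4) 2(4)]]
  obtain T T' where TT: "\<forall>v\<in>U1. T v \<in> U2 \<and> T' (T v) = v" "\<forall>w\<in>U2. T' w \<in> U1 \<and> T (T' w) = w"
     "\<forall>v v'. T (v + v') = T v + T v'" "\<forall>v\<in>U1. \<forall>v'\<in>U1. B2 (T v) (T v') = B1 v v'"
     "T ` F1 = F2" "T' ` F2 = F1" by (elim exE conjE) (rule that)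
  then have T: "\<And>v. v \<in> U1 \<Longrightarrow> T v \<in> U2" "\<And>v. v \<in> U1 \<Longrightarrow> T' (T v) = v"
    "\<And>w. w \<in> U2 \<Longrightarrow> T' w \<in> U1" "\<And>w. w \<in> U2 \<Longrightarrow> T (T' w) = w"
    "\<And>v v'. T (v + v') = T v + T v'" "\<And>v v'. v \<in> U1 \<Longrightarrow> v' \<in> U1 \<Longrightarrow> B2 (T v) (T v') = B1 v v'"
    "T ` F1 = F2" "T' ` F2 = F1"
    by simp_all
  have F1U: "F1 \<subseteq> U1" and F2U: "F2 \<subseteq> U2" using 1(2) 2(2) by (auto simp: V.frame_def W.frame_def)
  have T'B: "B1 (T' w) (T' w') = B2 w w'" if "w \<in> U2" "w' \<in> U2" for w w'
    using T(6)[OF T(3)[OF that(1)] T(3)[OF that(2)]] T(4) that by simp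
  note N1 = V.unimodular_frame_eq[OF 1(1-4)] and N2 = W.unimodular_frame_eq[OF 2(1-4)]
  have TN: "T v \<in> N2" if "v \<in> N1" for v
  proof -
    have v: "v \<in> U1" "\<And>f. f \<in> F1 \<Longrightarrow> B1 v f \<in> \<int>" using that unfolding N1 by auto
    have "B2 (T v) f \<in> \<int>" if "f \<in> F2" for f
    proof -
      from that T(7) obtain g where "g \<in> F1" "f = T g" by blast
      then show ?thesis using T(6)[OF v(1), of g] v(2)[of g] F1U by auto
    qed
    then show ?thesis unfolding N2 using T(1) v(1) by blast
  qed
  have T'N: "T' w \<in> N1" if "w \<in> N2" for w
  proof -
    have w: "w \<in> U2" "\<And>f. f \<in> F2 \<Longrightarrow> B2 w f \<in> \<int>" using that unfolding N2 by auto
    have "B1 (T' w) f \<in> \<int>" if "f \<in> F1" for f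
    proof -
      from that T(8) obtain g where "g \<in> F2" "f = T' g" by blast
      then show ?thesis using T'B[OF w(1), of g] w(2)[of g] F2U by auto
    qed
    then show ?thesis unfolding N1 using T(3) w(1) by blast
  qed
  have NU: "N1 \<subseteq> U1" "N2 \<subseteq> U2" using V.unimodular_inD(2)[OF 1(1)] W.unimodular_inD(2)[OF 2(1)] by auto
  define E1 E2 where "E1 = V.even_part N1" and "E2 = W.even_part N2"
  have EU: "E1 \<subseteq> U1" "E2 \<subseteq> U2" using NU by (auto simp: E1_def E2_def V.even_part_def W.even_part_def)
  have TE: "T v \<in> E2" if "v \<in> E1" for v
    using that TN T(6) NU unfolding E1_def E2_def V.even_part_def W.even_part_def by auto
  have T'E: "T' w \<in> E1" if "w \<in> E2" for w
    using that T'N T'B NU unfolding E1_def E2_def V.even_part_def W.even_part_def by auto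
  have TEE: "T ` E1 = E2"
    using TE T'E T(4) EU by (auto simp: image_iff) (metis subsetD)
  have Tinj: "inj_on T U1" using T(2) by (metis inj_onI)
  have E2add: "e + e' \<in> E2" "e - e' \<in> E2" if "e \<in> E2" "e' \<in> E2" for e e'
  proof -
    have m: "a - b \<in> E2" if "a \<in> E2" "b \<in> E2" for a b
      using W.even_part_diff[OF 2(1)] that unfolding E2_def by (simp add: W.even_part_def)
    from m[OF m[OF that(2) that(2)] that(2)] have "- e' \<in> E2" by simp
    from m[OF that(1) this] m[OF that] show "e + e' \<in> E2" "e - e' \<in> E2" by simp_all
  qed
  have L1U: "L1 \<subseteq> U1" using V.unimodular_inD(2)[OF L1(1)] .
  have concl: "?thesis" if G: "inj_on G U1" "G ` E1 = E2" "G x1 - x2 \<in> E2" "\<And>v v'. G (v + v') = G v + G v'"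
    "\<And>v v'. v \<in> U1 \<Longrightarrow> v' \<in> U1 \<Longrightarrow> B2 (G v) (G v') = B1 v v'" for G
  proof -
    have "G ` L1 = L2"
    proof
      show "G ` L1 \<subseteq> L2"
      proof
        fix w assume "w \<in> G ` L1"
        then consider e where "w = G e" "e \<in> E1" | e where "w = G e + G x1" "e \<in> E1"
          using 1(8) G(4) unfolding E1_def by auto
        then show "w \<in> L2"
        proof cases
          case 1
          then show ?thesis using G(2) \<open>L2 = _\<close> unfolding E2_def by blast
        next
          case (2 e)
          then have "G e + (G x1 - x2) \<in> E2" using G E2add by blast
          moreover have "w = (G e + (G x1 - x2)) + x2" using 2 by simp
          ultimately show ?thesis using \<open>L2 = _\<close> unfolding E2_def by blast
        qed
      qed
      show "L2 \<subseteq> G ` L1"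
      proof
        fix w assume "w \<in> L2"
        then consider "w \<in> E2" | e where "w = e + x2" "e \<in> E2" using 2(8) unfolding E2_def by blast
        then show "w \<in> G ` L1"
        proof cases
          case 1
          then show ?thesis using G(2) \<open>L1 = _\<close> unfolding E1_def by blast
        next
          case (2 e)
          then have "e - (G x1 - x2) \<in> E2" using G E2add by blast
          then obtain d where d: "d \<in> E1" "G d = e - (G x1 - x2)" using G(2) by (metis imageE)
          then have "w = G (d + x1)" using 2 G(4) by simp
          then show ?thesis using d \<open>L1 = _\<close> unfolding E1_def by blast
        qed
      qed
    qed
    then have "bij_betw G L1 L2" using G(1) L1U inj_on_subset by (auto simp: bij_betw_def)
    then show ?thesis using G L1U by (intro exI[of _ G]) blast
  qed
  have w: "T x1 \<in> U2" using T(1) 1(5) .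
  have wN: "T x1 \<notin> N2" using T'N[of "T x1"] T(2)[OF 1(5)] 1(6) by auto
  have wE: "\<forall>e\<in>E2. B2 (T x1) e \<in> \<int>"
  proof
    fix e assume "e \<in> E2"
    then obtain d where "d \<in> E1" "e = T d" using TEE by blast
    then show "B2 (T x1) e \<in> \<int>" using 1(5,7) T(6) EU(1) unfolding E1_def by (metis subsetD)
  qed
  from W.even_part_coset[OF 2(1,9,10,5,6,7) w wN wE[unfolded E2_def]]
  show ?thesis
  proof
    assume "T x1 - x2 \<in> W.even_part N2"
    then show ?thesis using concl[of T] Tinj TEE T(5,6) E2_def by blast
  next
    \<comment> \<open>The reflection in \<open>b2\<close> preserves \<open>E2\<close> and takes
      \<open>x2 - b2\<close> back to \<open>x2\<close>.\<close>
    assume as: "T x1 - (x2 - b2) \<in> W.even_part N2"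
    have bn: "B2 b2 b2 \<noteq> 0" using 2(10) by simp
    define G where "G v = W.refl b2 (T v)" for v
    have ra: "W.refl b2 (u + v) = W.refl b2 u + W.refl b2 v" for u v
      unfolding W.refl_def using W.scale_left_distrib[of "2 * B2 u b2 / B2 b2 b2" "2 * B2 v b2 / B2 b2 b2" b2]
      by (simp add: W.B_simps add_divide_distrib distrib_left)
    have rE: "W.refl b2 e \<in> E2" if "e \<in> E2" for e using W.refl_even_part[OF 2(1,9,10)] that E2_def by simp
    have "W.refl b2 ` E2 = E2"
      using rE W.refl_refl[OF bn] by (auto simp: image_iff) (metis)
    then have GE: "G ` E1 = E2" unfolding G_def using TEE by (metis image_image)
    have "W.refl b2 (T x1 - (x2 - b2)) + W.refl b2 (x2 - b2) = G x1"
      unfolding G_def ra[symmetric] by simp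
    moreover have "W.refl b2 (x2 - b2) = x2" using W.refl_refl[OF bn, of x2] 2(11) by simp
    ultimately have "G x1 - x2 = W.refl b2 (T x1 - (x2 - b2))" by (simp add: algebra_simps)
    then have Gx: "G x1 - x2 \<in> E2" using rE as E2_def by simp
    have "inj_on G U1"
    proof (rule inj_onI)
      fix u v assume uv: "u \<in> U1" "v \<in> U1" "G u = G v"
      then have "W.refl b2 (G u) = W.refl b2 (G v)" by simp
      then have "T u = T v" unfolding G_def W.refl_refl[OF bn] .
      then show "u = v" using Tinj uv by (auto dest: inj_onD)
    qed
    then show ?thesis using concl[of G] GE Gx T(5,6) ra W.refl_B[OF bn] by (simp add: G_def)
  qed
qed

end

section \<open>Coordinates on free abelian groups\<close>

lemma hom_integer:
  fixes A (structure)
  assumes "group A" "h \<in> hom A integer_group"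
  shows "\<And>x y. x \<in> carrier A \<Longrightarrow> y \<in> carrier A \<Longrightarrow> h (x \<otimes>\<^bsub>A\<^esub> y) = h x + h y"
    "h \<one>\<^bsub>A\<^esub> = 0"
    "\<And>x. x \<in> carrier A \<Longrightarrow> h (inv\<^bsub>A\<^esub> x) = - h x"
    "\<And>x (k::int). x \<in> carrier A \<Longrightarrow> h (x [^]\<^bsub>A\<^esub> k) = k * h x"
    "\<And>x (k::nat). x \<in> carrier A \<Longrightarrow> h (x [^]\<^bsub>A\<^esub> k) = int k * h x"
proof -
  interpret group_hom A integer_group h using assms by (simp add: group_hom_def group_hom_axioms_def)
  show "\<And>x y. x \<in> carrier A \<Longrightarrow> y \<in> carrier A \<Longrightarrow> h (x \<otimes>\<^bsub>A\<^esub> y) = h x + h y"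
    "h \<one>\<^bsub>A\<^esub> = 0" "\<And>x. x \<in> carrier A \<Longrightarrow> h (inv\<^bsub>A\<^esub> x) = - h x" using hom_one by simp_all
  show "\<And>x (k::int). x \<in> carrier A \<Longrightarrow> h (x [^]\<^bsub>A\<^esub> k) = k * h x" using hom_int_pow by simp
  show "\<And>x (k::nat). x \<in> carrier A \<Longrightarrow> h (x [^]\<^bsub>A\<^esub> k) = int k * h x" using hom_nat_pow by simp
qed

lemma hom_integerI:
  "(\<And>x y. x \<in> carrier A \<Longrightarrow> y \<in> carrier A \<Longrightarrow> h (x \<otimes>\<^bsub>A\<^esub> y) = h x + h y) \<Longrightarrow> h \<in> hom A integer_group"
  by (auto simp: hom_def)

definition kernel_group :: "('a, 'm) monoid_scheme \<Rightarrow> ('a \<Rightarrow> int) \<Rightarrow> ('a, 'm) monoid_scheme" where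
  "kernel_group A h = A\<lparr>carrier := {x\<in>carrier A. h x = 0}\<rparr>"

lemma kernel_group:
  fixes A (structure)
  assumes "comm_group A" "h \<in> hom A integer_group"
  shows "subgroup {x\<in>carrier A. h x = 0} A" "comm_group (kernel_group A h)"
proof -
  interpret comm_group A by fact
  show s: "subgroup {x\<in>carrier A. h x = 0} A"
    using hom_integer[OF is_group assms(2)] by (intro subgroupI) auto
  show "comm_group (kernel_group A h)"
    unfolding kernel_group_def
  proof (rule group.group_comm_groupI)
    show "group (A\<lparr>carrier := {x \<in> carrier A. h x = 0}\<rparr>)" using subgroup.subgroup_is_group[OF s is_group] .
  qed (auto simp: m_comm)
qed

lemma hom_kernel_group: "g \<in> hom A integer_group \<Longrightarrow> g \<in> hom (kernel_group A h) integer_group"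
  by (auto simp: hom_def kernel_group_def)

text \<open>Division by a generator of the image: a nonzero functional splits off a cyclic summand.\<close>

lemma hom_integer_split:
  fixes A (structure)
  assumes "comm_group A" "h \<in> hom A integer_group" "y \<in> carrier A" "h y \<noteq> 0"
  shows "\<exists>a\<in>carrier A. \<exists>d>0. h a = d \<and> (\<forall>x\<in>carrier A. d dvd h x)"
proof -
  interpret comm_group A by fact
  note H = hom_integer[OF is_group assms(2)]
  define P where "P k \<longleftrightarrow> k > 0 \<and> (\<exists>x\<in>carrier A. h x = int k)" for k
  have "P (nat \<bar>h y\<bar>)"
    unfolding P_def using assms H(3)[of y] by (cases "h y > 0") (force intro: bexI[of _ y] bexI[of _ "inv y"])+
  then have "P (LEAST k. P k)" by (rule LeastI)
  then obtain a where a: "a \<in> carrier A" "h a = int (LEAST k. P k)" "(LEAST k. P k) > 0" by (auto simp: P_def)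
  have "h a dvd h x" if x: "x \<in> carrier A" for x
  proof (rule ccontr)
    assume "\<not> h a dvd h x"
    then have r: "h x mod h a > 0" "h x mod h a < h a" using a
      by (auto simp: dvd_eq_mod_eq_0 order.not_eq_order_implies_strict)
    have "h (x \<otimes> a [^] (- (h x div h a))) = h x mod h a"
      using x a H by (simp add: minus_div_mult_eq_mod)
    then have "P (nat (h x mod h a))" using r x a unfolding P_def
      by (auto intro!: bexI[of _ "x \<otimes> a [^] (- (h x div h a))"])
    then have "(LEAST k. P k) \<le> nat (h x mod h a)" by (rule Least_le)
    then show False using r a by linarith
  qed
  moreover have "h a > 0" using a by simp
  ultimately show ?thesis using a(1) by blast
qed

text \<open>A basis together with its dual basis. Freeness is used in this form, and the free
  abelian groups of the definition of a lattice appear only in the two conversions.\<close>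

definition coordinates :: "('a, 'm) monoid_scheme \<Rightarrow> nat \<Rightarrow> (nat \<Rightarrow> 'a) \<Rightarrow> (nat \<Rightarrow> 'a \<Rightarrow> int) \<Rightarrow> bool" where
  "coordinates A n e c \<longleftrightarrow> (\<forall>i<n. e i \<in> carrier A) \<and> (\<forall>i<n. c i \<in> hom A integer_group) \<and>
     (\<forall>i<n. \<forall>j<n. c i (e j) = of_bool (i = j)) \<and>
     (\<forall>x\<in>carrier A. \<forall>y\<in>carrier A. (\<forall>i<n. c i x = c i y) \<longrightarrow> x = y)"

lemma coordinatesD:
  assumes "coordinates A n e c"
  shows "\<And>i. i < n \<Longrightarrow> e i \<in> carrier A" "\<And>i. i < n \<Longrightarrow> c i \<in> hom A integer_group"
    "\<And>i j. i < n \<Longrightarrow> j < n \<Longrightarrow> c i (e j) = of_bool (i = j)"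
    "\<And>x y. x \<in> carrier A \<Longrightarrow> y \<in> carrier A \<Longrightarrow> (\<And>i. i < n \<Longrightarrow> c i x = c i y) \<Longrightarrow> x = y"
  using assms by (auto simp: coordinates_def)

text \<open>The linear combination is described by its values under all functionals, which is all
  that is used of it and replaces finite products in the group.\<close>

lemma coordinates_combination:
  fixes A (structure)
  assumes "group A" "coordinates A n e c"
  shows "\<exists>y\<in>carrier A. (\<forall>i<n. c i y = u i) \<and> (\<forall>h\<in>hom A integer_group. h y = (\<Sum>i<n. u i * h (e i)))"
proof -
  interpret group A by fact
  note C = coordinatesD[OF assms(2)]
  have "\<exists>y\<in>carrier A. \<forall>h\<in>hom A integer_group. h y = (\<Sum>i<k. u i * h (e i))" if "k \<le> n" for k
    using that
  proof (induction k)
    case 0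
    then show ?case using hom_integer(2)[OF is_group] by (intro bexI[of _ \<one>]) auto
  next
    case (Suc k)
    then obtain y where y: "y \<in> carrier A" "\<forall>h\<in>hom A integer_group. h y = (\<Sum>i<k. u i * h (e i))" by auto
    have "e k \<in> carrier A" using Suc C by auto
    then show ?case using y hom_integer[OF is_group] by (intro bexI[of _ "y \<otimes> e k [^] u k"]) auto
  qed
  then obtain y where y: "y \<in> carrier A" "\<forall>h\<in>hom A integer_group. h y = (\<Sum>i<n. u i * h (e i))" by blast
  have "c i y = u i" if "i < n" for i
  proof -
    have "c i y = (\<Sum>j<n. if j = i then u i else 0)"
      using y C(2)[OF that] C(3)[OF that] by (auto intro!: sum.cong)
    then show ?thesis using that by simp
  qed
  then show ?thesis using y by blast
qed

lemma coordinates_expansion: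
  assumes "group A" "coordinates A n e c" "x \<in> carrier A" "h \<in> hom A integer_group"
  shows "h x = (\<Sum>i<n. c i x * h (e i))"
proof -
  obtain y where y: "y \<in> carrier A" "\<forall>i<n. c i y = c i x" "h y = (\<Sum>i<n. c i x * h (e i))"
    using coordinates_combination[OF assms(1,2), of "\<lambda>i. c i x"] assms(4) by blast
  then have "y = x" using coordinatesD(4)[OF assms(2)] assms by auto
  then show ?thesis using y by simp
qed

lemma free_frag_expansion:
  assumes "Poly_Mapping.keys a \<subseteq> {..<n::nat}"
  shows "a = (\<Sum>i<n. frag_cmul (poly_mapping.lookup a i) (frag_of i))"
proof (rule poly_mapping_eqI)
  fix k
  have "poly_mapping.lookup (\<Sum>i<m. frag_cmul (poly_mapping.lookup a i) (frag_of i)) k =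
     (if k < m then poly_mapping.lookup a k else 0)" for m :: nat
    by (induction m) (auto simp: lookup_add less_Suc_eq)
  then show "poly_mapping.lookup a k = poly_mapping.lookup (\<Sum>i<n. frag_cmul (poly_mapping.lookup a i) (frag_of i)) k"
    using assms by (auto simp: in_keys_iff subset_iff)
qed

lemma lookup_free_combination:
  "poly_mapping.lookup (\<Sum>i<m::nat. frag_cmul (u i) (frag_of i)) k = (if k < m then u k else 0)"
  by (induction m) (auto simp: lookup_add less_Suc_eq)

lemma iso_free_imp_coordinates:
  assumes \<phi>: "\<phi> \<in> iso (free_Abelian_group {..<n}) A" and A: "comm_group A" and e: "\<forall>i<n. e i = \<phi> (frag_of i)"
  shows "\<exists>c. coordinates A n e c"
proof -
  interpret comm_group A by fact
  let ?F = "free_Abelian_group {..<n}"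
  define c where "c i x = poly_mapping.lookup (inv_into (carrier ?F) \<phi> x) i" for i x
  have bij: "bij_betw \<phi> (carrier ?F) (carrier A)" and hom: "\<phi> \<in> hom ?F A" using \<phi> by (auto simp: iso_def)
  have inv: "inv_into (carrier ?F) \<phi> \<in> hom A ?F"
    using group.iso_set_sym[OF group_free_Abelian_group \<phi>] by (auto simp: iso_def)
  have ek: "frag_of i \<in> carrier ?F" if "i < n" for i using that by simp
  have 1: "e i \<in> carrier A" if "i < n" for i using that e ek hom by (metis hom_carrier image_eqI subsetD)
  have 2: "c i \<in> hom A integer_group" for i
    using inv unfolding c_def by (intro hom_integerI) (auto simp: hom_def lookup_add)
  have 3: "c i (e j) = of_bool (i = j)" if "i < n" "j < n" for i j
  proof -
    have "inv_into (carrier ?F) \<phi> (e j) = frag_of j"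
      using that e ek bij by (metis bij_betw_inv_into_left)
    then show ?thesis by (auto simp: c_def)
  qed
  have 4: "x = y" if xy: "x \<in> carrier A" "y \<in> carrier A" "\<forall>i<n. c i x = c i y" for x y
  proof -
    let ?a = "inv_into (carrier ?F) \<phi> x" and ?b = "inv_into (carrier ?F) \<phi> y"
    have k: "Poly_Mapping.keys ?a \<subseteq> {..<n}" "Poly_Mapping.keys ?b \<subseteq> {..<n}"
      using inv xy by (auto simp: hom_def Pi_iff)
    have "?a = (\<Sum>i<n. frag_cmul (c i x) (frag_of i))" using free_frag_expansion[OF k(1)] by (simp add: c_def)
    also have "\<dots> = (\<Sum>i<n. frag_cmul (c i y) (frag_of i))" using xy by simp
    also have "\<dots> = ?b" using free_frag_expansion[OF k(2)] by (simp add: c_def)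
    finally show ?thesis using xy bij by (metis bij_betw_inv_into_right)
  qed
  show ?thesis unfolding coordinates_def using 1 2 3 4 by blast
qed

lemma coordinates_imp_iso_free:
  fixes A (structure)
  assumes A: "comm_group A" and c: "coordinates A n e c"
  shows "\<exists>\<phi>\<in>iso (free_Abelian_group {..<n}) A. \<forall>i<n. e i = \<phi> (frag_of i)"
proof -
  interpret comm_group A by fact
  note C = coordinatesD[OF c]
  let ?F = "free_Abelian_group {..<n}"
  define \<psi> where "\<psi> x = (\<Sum>i<n. frag_cmul (c i x) (frag_of i))" for x
  have lk: "poly_mapping.lookup (\<psi> x) i = (if i < n then c i x else 0)" for x i
    by (simp add: \<psi>_def lookup_free_combination)
  have pc: "\<psi> x \<in> carrier ?F" for x by (auto simp: in_keys_iff lk split: if_splits)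
  have hom: "\<psi> \<in> hom A ?F"
  proof (rule homI)
    fix x y assume "x \<in> carrier A" "y \<in> carrier A"
    then show "\<psi> (x \<otimes> y) = \<psi> x \<otimes>\<^bsub>?F\<^esub> \<psi> y"
      using hom_integer(1)[OF is_group C(2)] by (auto intro!: poly_mapping_eqI simp: lk lookup_add)
  qed (rule pc)
  have "inj_on \<psi> (carrier A)"
    using C(4) by (intro inj_onI) (metis lk)
  moreover have "a \<in> \<psi> ` carrier A" if "a \<in> carrier ?F" for a
  proof -
    obtain y where y: "y \<in> carrier A" "\<forall>i<n. c i y = poly_mapping.lookup a i"
      using coordinates_combination[OF is_group c] by blast
    have "\<psi> y = a" using that y by (auto intro!: poly_mapping_eqI simp: lk in_keys_iff subset_iff)
    then show ?thesis using y by blast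
  qed
  ultimately have iso: "\<psi> \<in> iso A ?F" using hom pc by (auto simp: iso_def bij_betw_def)
  then have inv: "inv_into (carrier A) \<psi> \<in> iso ?F A" by (rule iso_set_sym)
  have "\<psi> (e i) = frag_of i" if "i < n" for i
    using that C(3) by (auto intro!: poly_mapping_eqI simp: lk lookup_single when_def)
  then have "e i = inv_into (carrier A) \<psi> (frag_of i)" if "i < n" for i
    using that C(1) \<open>inj_on \<psi> (carrier A)\<close> by (metis inv_into_f_f)
  then show ?thesis using inv by blast
qed

text \<open>Finitely many integral functionals that separate elements embed the group in a free one.
  By induction the kernel of the last functional is free, and a nonzero functional splits off one
  more cyclic summand. This gives freeness of orthogonal complements and of glued lattices.\<close>

lemma coordinates_exist:
  fixes A and n :: nat
  assumes "comm_group A" "\<forall>i<n. c i \<in> hom A integer_group"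
    "\<forall>x\<in>carrier A. (\<forall>i<n. c i x = 0) \<longrightarrow> x = \<one>\<^bsub>A\<^esub>"
  shows "\<exists>r e c'. coordinates A r e c'"
  using assms
proof (induction n arbitrary: A)
  case 0
  then have "coordinates A 0 undefined undefined" by (metis (no_types, lifting) coordinates_def less_nat_zero_code)
  then show ?case by blast
next
  case (Suc n)
  interpret comm_group A by fact
  define h where "h = c n"
  have h: "h \<in> hom A integer_group" using Suc.prems by (simp add: h_def)
  note H = hom_integer[OF is_group h]
  let ?K = "kernel_group A h"
  have "\<exists>r e c'. coordinates ?K r e c'"
  proof (rule Suc.IH)
    show "comm_group ?K" using kernel_group(2)[OF Suc.prems(1) h] .
    show "\<forall>i<n. c i \<in> hom ?K integer_group" using Suc.prems by (auto intro!: hom_kernel_group)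
    show "\<forall>x\<in>carrier ?K. (\<forall>i<n. c i x = 0) \<longrightarrow> x = \<one>\<^bsub>?K\<^esub>"
      using Suc.prems(3) by (auto simp: kernel_group_def h_def less_Suc_eq)
  qed
  then obtain r e c' where K: "coordinates ?K r e c'" by blast
  note C = coordinatesD[OF K]
  show ?case
  proof (cases "\<exists>y\<in>carrier A. h y \<noteq> 0")
    case False
    then have "?K = A" by (simp add: kernel_group_def cong: conj_cong)
    then show ?thesis using K by auto
  next
    case True
    then obtain a d where a: "a \<in> carrier A" "d > 0" "h a = d" "\<forall>x\<in>carrier A. d dvd h x"
      using hom_integer_split[OF Suc.prems(1) h] by blast
    define q where "q x = h x div d" for x
    have hq: "h x = d * q x" if "x \<in> carrier A" for x using that a by (simp add: q_def)
    have qm: "q (x \<otimes>\<^bsub>A\<^esub> y) = q x + q y" if "x \<in> carrier A" "y \<in> carrier A" for x y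
      using hq[of x] hq[of y] hq[of "x \<otimes>\<^bsub>A\<^esub> y"] H(1)[OF that] that a(2) by (simp flip: distrib_left)
    have qa: "q a = 1" using a by (simp add: q_def)
    have q0: "q x = 0" if "h x = 0" for x using that by (simp add: q_def)
    \<comment> \<open>The projection onto the kernel of \<open>h\<close> along \<open>a\<close>;
      \<open>q\<close> is the new coordinate.\<close>
    define p where "p x = x \<otimes>\<^bsub>A\<^esub> a [^]\<^bsub>A\<^esub> (- q x)" for x
    have pK: "p x \<in> carrier ?K" if x: "x \<in> carrier A" for x
    proof -
      have "h (p x) = h x + (- q x) * d" using x a(1,3) H(1,4) by (simp add: p_def)
      then show ?thesis using hq[OF x] x a(1) by (simp add: kernel_group_def p_def)
    qed
    have pm: "p (x \<otimes>\<^bsub>A\<^esub> y) = p x \<otimes>\<^bsub>A\<^esub> p y" if "x \<in> carrier A" "y \<in> carrier A" for x y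
    proof -
      have "a [^]\<^bsub>A\<^esub> (- q (x \<otimes>\<^bsub>A\<^esub> y)) = a [^]\<^bsub>A\<^esub> (- q x) \<otimes>\<^bsub>A\<^esub> a [^]\<^bsub>A\<^esub> (- q y)"
        using a(1) qm[OF that] int_pow_mult[of a "- q x" "- q y"] by simp
      then show ?thesis using that a(1) by (simp add: p_def m_ac)
    qed
    have eK: "e i \<in> carrier A" "h (e i) = 0" if "i < r" for i using C(1)[OF that] by (auto simp: kernel_group_def)
    have pe: "p (e i) = e i" if "i < r" for i using eK[OF that] a(1) q0 by (simp add: p_def)
    have pa: "p a = \<one>\<^bsub>A\<^esub>" using a(1) qa by (simp add: p_def int_pow_neg)
    have gK: "group ?K" using kernel_group(2)[OF Suc.prems(1) h] comm_group_def by blast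
    define e' where "e' i = (if i < r then e i else a)" for i
    define c'' where "c'' i = (if i < r then (\<lambda>x. c' i (p x)) else q)" for i
    have "coordinates A (Suc r) e' c''"
      unfolding coordinates_def
    proof (intro conjI allI ballI impI)
      fix i assume i: "i < Suc r"
      show "e' i \<in> carrier A" using eK a by (simp add: e'_def)
      show "c'' i \<in> hom A integer_group"
      proof (cases "i < r")
        case True
        have "c' i (p (x \<otimes>\<^bsub>A\<^esub> y)) = c' i (p x) + c' i (p y)" if "x \<in> carrier A" "y \<in> carrier A" for x y
          using hom_integer(1)[OF gK C(2)[OF True] pK[OF that(1)] pK[OF that(2)]] pm[OF that]
          by (simp add: kernel_group_def)
        then show ?thesis using True by (auto simp: c''_def intro!: hom_integerI)
      next
        case False
        then show ?thesis using qm by (auto simp: c''_def intro!: hom_integerI)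
      qed
      fix j assume j: "j < Suc r"
      show "c'' i (e' j) = of_bool (i = j)"
        using i j C(3) eK pe pa qa q0 hom_integer(2)[OF gK C(2)] by (auto simp: c''_def e'_def less_Suc_eq kernel_group_def)
    next
      fix x y assume xy: "x \<in> carrier A" "y \<in> carrier A" "\<forall>i<Suc r. c'' i x = c'' i y"
      then have "p x = p y" using pK by (intro C(4)) (auto simp: c''_def less_Suc_eq)
      moreover have "q x = q y" using xy(3) by (auto simp: c''_def)
      ultimately show "x = y" using xy a(1) by (simp add: p_def)
    qed
    then show ?thesis by blast
  qed
qed

text \<open>More vectors than coordinates. One step of Gaussian elimination with pivot
  \<open>w k n\<close> clears the last coordinate and removes the vector \<open>k\<close>.\<close>

lemma nontrivial_relation:
  fixes w :: "'i \<Rightarrow> nat \<Rightarrow> 'k::field"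
  assumes "finite I" "n < card I"
  shows "\<exists>c. (\<exists>i\<in>I. c i \<noteq> 0) \<and> (\<forall>j<n. (\<Sum>i\<in>I. c i * w i j) = 0)"
  using assms
proof (induction n arbitrary: I w)
  case 0
  then have "I \<noteq> {}" by auto
  then show ?case by (intro exI[of _ "\<lambda>_. 1"]) auto
next
  case (Suc n)
  show ?case
  proof (cases "\<forall>i\<in>I. w i n = 0")
    case True
    obtain c where c: "\<exists>i\<in>I. c i \<noteq> 0" "\<forall>j<n. (\<Sum>i\<in>I. c i * w i j) = 0" using Suc.IH[OF Suc.prems(1), of w] Suc.prems(2) by auto
    then show ?thesis using True by (intro exI[of _ c]) (auto simp: less_Suc_eq)
  next
    case False
    then obtain k where k: "k \<in> I" "w k n \<noteq> 0" by blast
    define w' where "w' i j = w i j - w i n / w k n * w k j" for i j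
    have "n < card (I - {k})" using Suc.prems k by simp
    then obtain c where c: "\<exists>i\<in>I - {k}. c i \<noteq> 0" "\<forall>j<n. (\<Sum>i\<in>I - {k}. c i * w' i j) = 0"
      using Suc.IH[of "I - {k}" w'] Suc.prems by auto
    define s where "s = (\<Sum>i\<in>I - {k}. c i * w i n / w k n)"
    define c' where "c' i = (if i = k then - s else c i)" for i
    have "(\<Sum>i\<in>I. c' i * w i j) = (\<Sum>i\<in>I - {k}. c i * w' i j)" for j
    proof -
      have "(\<Sum>i\<in>I. c' i * w i j) = - s * w k j + (\<Sum>i\<in>I - {k}. c' i * w i j)"
        using Suc.prems k by (simp add: sum.remove c'_def)
      also have "(\<Sum>i\<in>I - {k}. c' i * w i j) = (\<Sum>i\<in>I - {k}. c i * w i j)" by (intro sum.cong) (auto simp: c'_def)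
      also have "- s * w k j = (\<Sum>i\<in>I - {k}. - (c i * w i n / w k n) * w k j)"
        unfolding s_def by (simp add: sum_distrib_right sum_negf)
      also have "\<dots> + (\<Sum>i\<in>I - {k}. c i * w i j) = (\<Sum>i\<in>I - {k}. c i * w' i j)"
        unfolding sum.distrib[symmetric] by (intro sum.cong) (auto simp: w'_def algebra_simps)
      finally show ?thesis .
    qed
    moreover have "w' i n = 0" for i using k by (simp add: w'_def)
    ultimately have "\<forall>j<Suc n. (\<Sum>i\<in>I. c' i * w i j) = 0" using c(2) by (auto simp: less_Suc_eq)
    then show ?thesis using c(1) by (intro exI[of _ c']) (auto simp: c'_def)
  qed
qed

definition gram :: "nat \<Rightarrow> (nat \<Rightarrow> nat \<Rightarrow> int) \<Rightarrow> (nat \<Rightarrow> 'k) \<Rightarrow> (nat \<Rightarrow> 'k::linordered_field) \<Rightarrow> 'k" where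
  "gram n G u v = (\<Sum>i<n. \<Sum>j<n. u i * v j * of_int (G i j))"

text \<open>The model of an \<open>n\<close>-dimensional space: sequences that vanish from
  \<open>n\<close> on. The type does not depend on \<open>n\<close>.\<close>

definition supp_below :: "nat \<Rightarrow> (nat \<Rightarrow> 'k::zero) set" where
  "supp_below n = {u. \<forall>i\<ge>n. u i = 0}"

lemma quad_space_gram:
  assumes "\<forall>i<n. \<forall>j<n. G i j = G j i"
  shows "quad_space (\<lambda>(a::'k::linordered_field) u i. a * u i) (gram n G)"
proof (unfold_locales, goal_cases)
  case (7 x y)
  have "gram n G x y = (\<Sum>j<n. \<Sum>i<n. x i * y j * of_int (G i j))" unfolding gram_def by (rule sum.swap)
  also have "\<dots> = gram n G y x" unfolding gram_def using assms by (intro sum.cong) (auto simp: mult_ac)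
  finally show ?case .
qed (auto simp: gram_def fun_eq_iff algebra_simps sum.distrib sum_distrib_left)

lemma rat_quad_space_gram:
  assumes "\<forall>i<n. \<forall>j<n. G i j = G j i"
  shows "rat_quad_space (\<lambda>a u i. a * u i) (gram n G)"
  using quad_space_gram[OF assms] by (simp add: rat_quad_space_def)

section \<open>Signature of a lattice\<close>

lemma sum_fun_apply: "(\<Sum>a\<in>A. f a) x = (\<Sum>a\<in>A. f a x)"
  by (induction A rule: infinite_finite_induct) auto

locale integral_lattice = comm_group L for L :: "'a zlat" (structure) +
  assumes lattice: "zlattice L"
begin

lemma form_hom: "x \<in> carrier L \<Longrightarrow> form L x \<in> hom L integer_group"
  using lattice by (simp add: zlattice_def)

lemma form_sym: "x \<in> carrier L \<Longrightarrow> y \<in> carrier L \<Longrightarrow> form L x y = form L y x"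
  using lattice by (simp add: zlattice_def)

lemma form_hom_left:
  assumes "y \<in> carrier L" shows "(\<lambda>x. form L x y) \<in> hom L integer_group"
proof -
  have "form L y \<in> hom L integer_group" using assms form_hom by blast
  then show ?thesis using form_sym[OF _ assms] by (auto simp: hom_def)
qed

lemmas form_right = hom_integer[OF is_group form_hom]
lemmas form_left = hom_integer[OF is_group form_hom_left]

lemma form_nondegenerate: "x \<in> carrier L \<Longrightarrow> (\<And>y. y \<in> carrier L \<Longrightarrow> form L x y = 0) \<Longrightarrow> x = \<one>"
  using lattice by (auto simp: zlattice_def)

lemma inj_on_form:
  assumes "\<And>x y. x \<in> carrier L \<Longrightarrow> y \<in> carrier L \<Longrightarrow> B (f x) (f y) = form L x y"
  shows "inj_on f (carrier L)"
proof (rule inj_onI)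
  fix x z assume xz: "x \<in> carrier L" "z \<in> carrier L" "f x = f z"
  have "x \<otimes>\<^bsub>L\<^esub> inv\<^bsub>L\<^esub> z = \<one>\<^bsub>L\<^esub>"
  proof (rule form_nondegenerate)
    fix y assume y: "y \<in> carrier L"
    then have "form L x y = form L z y" using xz assms by metis
    then show "form L (x \<otimes>\<^bsub>L\<^esub> inv\<^bsub>L\<^esub> z) y = 0" using xz y by (simp add: form_left)
  qed (use xz in simp)
  then show "x = z" using xz by (metis inv_closed inv_equality inv_inv)
qed

lemma coordinates_ex: "\<exists>n e c. coordinates L n e c"
proof -
  obtain n :: nat where "free_Abelian_group {..<n} \<cong> L" using lattice by (auto simp: zlattice_def)
  then obtain \<phi> where \<phi>: "\<phi> \<in> iso (free_Abelian_group {..<n}) L" by (auto simp: is_iso_def)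
  show ?thesis using iso_free_imp_coordinates[OF \<phi> comm_group_axioms, of "\<lambda>i. \<phi> (frag_of i)"] by blast
qed

end

lemma integral_latticeI: "zlattice L \<Longrightarrow> integral_lattice L"
  by (simp add: integral_lattice_def integral_lattice_axioms_def zlattice_def)

lemma even_lattice_integral: "even_lattice L \<Longrightarrow> integral_lattice L"
  by (simp add: even_lattice_def integral_latticeI)

text \<open>An orthogonal basis of the rational space whose members lie in the lattice itself. It
  carries the signature in terms of integers.\<close>

definition lattice_frame :: "'a zlat \<Rightarrow> 'a set \<Rightarrow> bool" where
  "lattice_frame L F \<longleftrightarrow> finite F \<and> F \<subseteq> carrier L \<and> (\<forall>f\<in>F. form L f f \<noteq> 0) \<and>
     (\<forall>f\<in>F. \<forall>g\<in>F. f \<noteq> g \<longrightarrow> form L f g = 0) \<and>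
     (\<forall>x\<in>carrier L. (\<forall>f\<in>F. form L x f = 0) \<longrightarrow> x = \<one>\<^bsub>L\<^esub>)"

definition frame_signature :: "'a zlat \<Rightarrow> 'a set \<Rightarrow> nat \<times> nat" where
  "frame_signature L F = (card {f\<in>F. form L f f > 0}, card {f\<in>F. form L f f < 0})"

lemma frame_signature_card:
  assumes "lattice_frame L F" "frame_signature L F = (p, q)"
  shows "card F = p + q"
proof -
  have un: "{f\<in>F. form L f f > 0} \<union> {f\<in>F. form L f f < 0} = F" using assms(1) by (auto simp: lattice_frame_def neq_iff)
  have "finite F" using assms(1) by (simp add: lattice_frame_def)
  then have "finite {f\<in>F. form L f f > 0}" "finite {f\<in>F. form L f f < 0}" by simp_all
  moreover have "{f\<in>F. form L f f > 0} \<inter> {f\<in>F. form L f f < 0} = {}"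
    using less_asym by blast
  ultimately have "card ({f\<in>F. form L f f > 0} \<union> {f\<in>F. form L f f < 0}) =
      card {f\<in>F. form L f f > 0} + card {f\<in>F. form L f f < 0}"
    by (simp only: card_Un_disjoint)
  then show ?thesis using assms(2) un by (simp add: frame_signature_def)
qed

section \<open>A lattice in rational and real coordinates\<close>

locale coord_lattice = integral_lattice L for L :: "'a zlat" (structure) +
  fixes n :: nat and e :: "nat \<Rightarrow> 'a" and c :: "nat \<Rightarrow> 'a \<Rightarrow> int"
  assumes coords: "coordinates L n e c"
begin

definition G :: "nat \<Rightarrow> nat \<Rightarrow> int" where "G i j = form L (e i) (e j)"

definition vec :: "'a \<Rightarrow> nat \<Rightarrow> 'k::linordered_field" where
  "vec x = (\<lambda>i. if i < n then of_int (c i x) else 0)"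

abbreviation bil :: "(nat \<Rightarrow> 'k) \<Rightarrow> (nat \<Rightarrow> 'k::linordered_field) \<Rightarrow> 'k" where
  "bil \<equiv> gram n G"

lemmas C = coordinatesD[OF coords]

lemma G_sym: "\<forall>i<n. \<forall>j<n. G i j = G j i"
  using C(1) form_sym by (auto simp: G_def)

sublocale Q: rat_quad_space "\<lambda>(a::rat) u i. a * u i" "gram n G"
  by (rule rat_quad_space_gram[OF G_sym])

sublocale R: quad_space "\<lambda>(a::real) u i. a * u i" "gram n G"
  by (rule quad_space_gram[OF G_sym])

lemma bil_vec:
  assumes "x \<in> carrier L" "y \<in> carrier L"
  shows "bil (vec x) (vec y) = (of_int (form L x y) :: 'k::linordered_field)"
proof -
  have "form L x y = (\<Sum>i<n. c i x * form L (e i) y)"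
    using coordinates_expansion[OF is_group coords assms(1) form_hom_left[OF assms(2)]] .
  also have "\<dots> = (\<Sum>i<n. \<Sum>j<n. c i x * c j y * G i j)"
  proof (rule sum.cong[OF HOL.refl])
    fix i assume "i \<in> {..<n}"
    then have "form L (e i) y = (\<Sum>j<n. c j y * G i j)"
      using coordinates_expansion[OF is_group coords assms(2) form_hom[OF C(1)]] by (simp add: G_def)
    then show "c i x * form L (e i) y = (\<Sum>j<n. c i x * c j y * G i j)" by (simp add: sum_distrib_left mult.assoc)
  qed
  finally have f: "form L x y = (\<Sum>i<n. \<Sum>j<n. c i x * c j y * G i j)" .
  show ?thesis unfolding f gram_def vec_def by simp
qed

lemma vec_supp: "vec x \<in> supp_below n"
  by (simp add: vec_def supp_below_def)

lemma vec_mult: "x \<in> carrier L \<Longrightarrow> y \<in> carrier L \<Longrightarrow> vec (x \<otimes> y) = vec x + vec y"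
  using hom_integer(1)[OF is_group C(2)] by (auto simp: vec_def fun_eq_iff)

lemma vec_inj: "inj_on (vec :: 'a \<Rightarrow> nat \<Rightarrow> 'k::linordered_field) (carrier L)"
proof (rule inj_onI)
  fix x y assume xy: "x \<in> carrier L" "y \<in> carrier L" "(vec x :: nat \<Rightarrow> 'k) = vec y"
  have "c i x = c i y" if "i < n" for i
    using fun_cong[OF xy(3), of i] that by (simp add: vec_def)
  then show "x = y" using C(4) xy by blast
qed

lemma vec_surj:
  assumes "v \<in> supp_below n" "\<And>i. i < n \<Longrightarrow> v i = of_int (u i)"
  shows "\<exists>x\<in>carrier L. vec x = v"
proof -
  obtain x where "x \<in> carrier L" "\<forall>i<n. c i x = u i" using coordinates_combination[OF is_group coords] by blast
  then show ?thesis using assms by (intro bexI[of _ x]) (auto simp: vec_def supp_below_def fun_eq_iff)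
qed

lemma sum_vec_basis: "j < n \<Longrightarrow> (\<Sum>i<n. a i * vec (e i) j) = (a j :: 'k::linordered_field)"
proof -
  assume j: "j < n"
  have "(\<Sum>i<n. a i * vec (e i) j) = (\<Sum>i<n. if i = j then a j else 0)"
    using j C(3) by (intro sum.cong) (auto simp: vec_def)
  then show ?thesis using j by simp
qed

lemma sum_vec_basis_fun:
  assumes "v \<in> supp_below n"
  shows "v = (\<Sum>i<n. (\<lambda>j. v i * vec (e i) j :: 'k::linordered_field))"
proof
  fix j
  have "j \<ge> n \<Longrightarrow> (\<Sum>i<n. v i * vec (e i) j) = 0" by (auto simp: vec_def intro!: sum.neutral)
  then show "v j = (\<Sum>i<n. (\<lambda>j. v i * vec (e i) j)) j"
    using assms sum_vec_basis[of j v] by (cases "j < n") (auto simp: sum_fun_apply supp_below_def)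
qed

lemma vec_one: "vec \<one> = 0"
  using hom_integer(2)[OF is_group C(2)] by (auto simp: vec_def fun_eq_iff)

lemma vec_eq_0: "x \<in> carrier L \<Longrightarrow> vec x = (0 :: nat \<Rightarrow> 'k::linordered_field) \<Longrightarrow> x = \<one>"
  using vec_inj[where 'k = 'k] vec_one by (metis inj_onD one_closed)

lemma common_denominator:
  assumes "finite I"
  shows "\<exists>N::int. N > 0 \<and> (\<forall>i\<in>I. \<exists>k. of_int N * (u i :: rat) = of_int k)"
  using assms
proof (induction I)
  case (insert i I)
  then obtain N where N: "N > 0" "\<forall>j\<in>I. \<exists>k. of_int N * u j = of_int k" by blast
  obtain a b where q: "quotient_of (u i) = (a, b)" by force
  have ab: "u i = of_int a / of_int b" "b > 0" using q quotient_of_div quotient_of_denom_pos by auto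
  have "\<exists>k. of_int (N * b) * u j = of_int k" if j: "j \<in> insert i I" for j
  proof (cases "j = i")
    case True
    then show ?thesis using ab by (intro exI[of _ "N * a"]) simp
  next
    case False
    then obtain k where "of_int N * u j = of_int k" using N(2) j by blast
    then show ?thesis by (intro exI[of _ "k * b"]) (simp add: mult_ac)
  qed
  then show ?case using N ab by (intro exI[of _ "N * b"]) auto
qed (auto intro: exI[of _ 1])

lemma clear_denominators:
  assumes "v \<in> supp_below n"
  shows "\<exists>N>0. \<exists>x\<in>carrier L. vec x = (\<lambda>i. of_int N * (v i :: rat))"
proof -
  obtain N where N: "N > 0" "\<forall>i\<in>{..<n}. \<exists>k. of_int N * v i = of_int k"
    using common_denominator[of "{..<n}" v] by auto
  then obtain u where "\<And>i. i < n \<Longrightarrow> of_int N * v i = of_int (u i)" by (metis lessThan_iff)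
  then have "\<exists>x\<in>carrier L. vec x = (\<lambda>i. of_int N * v i)"
    using assms by (intro vec_surj) (auto simp: supp_below_def)
  then show ?thesis using N by blast
qed

lemma Q_subspace: "Q.subspace (supp_below n)"
  by (auto simp: Q.subspace_def supp_below_def)

lemma R_subspace: "R.subspace (supp_below n)"
  by (auto simp: R.subspace_def supp_below_def)

lemma Q_nondegenerate: "Q.nondegenerate (supp_below n)"
  unfolding Q.nondegenerate_def
proof (intro ballI impI)
  fix v :: "nat \<Rightarrow> rat" assume v: "v \<in> supp_below n" "\<forall>u\<in>supp_below n. bil v u = 0"
  obtain N x where N: "N > 0" "x \<in> carrier L" "vec x = (\<lambda>i. of_int N * v i)" using clear_denominators[OF v(1)] by blast
  have "rat_of_int (form L x y) = 0" if "y \<in> carrier L" for y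
  proof -
    have "rat_of_int (form L x y) = bil (vec x) (vec y)" using bil_vec[OF N(2) that, where 'k = rat] by simp
    also have "\<dots> = of_int N * bil v (vec y)" unfolding N(3) by (rule Q.B_scale_left)
    also have "bil v (vec y) = 0" using v(2) vec_supp by blast
    finally show ?thesis by simp
  qed
  then have "x = \<one>" using form_nondegenerate N(2) by simp
  then have "(\<lambda>i. of_int N * v i) = 0" using N(3) vec_one by metis
  then show "v = 0" using N(1) by (auto simp: fun_eq_iff)
qed

lemma Q_bounded_dim: "Q.bounded_dim (supp_below n) n"
  unfolding Q.bounded_dim_def
proof (intro allI impI)
  fix F :: "(nat \<Rightarrow> rat) set" assume F: "Q.orth_set F" "F \<subseteq> supp_below n"
  have fin: "finite F" using F by (simp add: Q.orth_set_def)
  show "card F \<le> n"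
  proof (rule ccontr)
    assume "\<not> card F \<le> n"
    then obtain a where a: "\<exists>f\<in>F. a f \<noteq> 0" "\<forall>j<n. (\<Sum>f\<in>F. a f * f j) = 0"
      using nontrivial_relation[OF fin, of n "\<lambda>f. f"] by auto
    obtain g where g: "g \<in> F" "a g \<noteq> 0" using a by blast
    have "(\<Sum>f\<in>F. (\<lambda>i. a f * f i)) = 0"
    proof
      fix j
      have "(\<Sum>f\<in>F. a f * f j) = 0" using a F by (cases "j < n") (auto simp: supp_below_def subset_iff intro!: sum.neutral)
      then show "(\<Sum>f\<in>F. (\<lambda>i. a f * f i)) j = 0 j" using fin by (simp add: sum_fun_apply)
    qed
    then have "0 = bil (\<Sum>f\<in>F. (\<lambda>i. a f * f i)) g" by simp
    also have "\<dots> = (\<Sum>f\<in>F. a f * bil f g)" unfolding Q.B_sum_left Q.B_scale_left by simp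
    also have "\<dots> = (\<Sum>f\<in>F. if f = g then a g * bil g g else 0)"
      using F g by (intro sum.cong) (auto simp: Q.orth_set_def)
    also have "\<dots> = a g * bil g g" using fin g by simp
    finally show False using g F by (auto simp: Q.orth_set_def)
  qed
qed

lemma Q_frame_ex: "\<exists>F. Q.frame (supp_below n) F"
  using Q.frame_exists[OF Q_bounded_dim Q_nondegenerate Q_subspace] .

lemma lattice_frame_Q:
  assumes F: "lattice_frame L F" shows "Q.frame (supp_below n) (vec ` F)"
  unfolding Q.frame_def
proof (intro conjI ballI impI)
  have FL: "F \<subseteq> carrier L" using F by (simp add: lattice_frame_def)
  show "Q.orth_set (vec ` F)"
    using F FL bil_vec[where 'k = rat] unfolding lattice_frame_def Q.orth_set_def by (auto simp: subset_iff)
  show "vec ` F \<subseteq> supp_below n" using vec_supp by blast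
  fix v :: "nat \<Rightarrow> rat" assume v: "v \<in> supp_below n" "\<forall>f\<in>vec ` F. bil v f = 0"
  obtain N x where N: "N > 0" "x \<in> carrier L" "vec x = (\<lambda>i. of_int N * v i)" using clear_denominators[OF v(1)] by blast
  have "rat_of_int (form L x f) = 0" if "f \<in> F" for f
  proof -
    have "rat_of_int (form L x f) = bil (vec x) (vec f)" using bil_vec[OF N(2), of f, where 'k = rat] that FL by auto
    also have "\<dots> = of_int N * bil v (vec f)" unfolding N(3) by (rule Q.B_scale_left)
    also have "\<dots> = 0" using v(2) that by simp
    finally show ?thesis .
  qed
  then have "x = \<one>" using F N(2) by (auto simp: lattice_frame_def)
  then have "(\<lambda>i. of_int N * v i) = 0" using N(3) vec_one by metis
  then show "v = 0" using N(1) by (auto simp: fun_eq_iff)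
qed

lemma Q_frame_lattice:
  assumes F: "Q.frame (supp_below n) F"
  shows "\<exists>F'. lattice_frame L F' \<and> frame_signature L F' = (card {f\<in>F. bil f f > 0}, card {f\<in>F. bil f f < 0})"
proof -
  have fin: "finite F" and FU: "F \<subseteq> supp_below n" using F by (auto simp: Q.frame_def Q.orth_set_def)
  have "\<forall>f\<in>F. \<exists>N x. N > 0 \<and> x \<in> carrier L \<and> vec x = (\<lambda>i. of_int N * f i)"
    using clear_denominators FU by blast
  then obtain N x where N: "\<And>f. f \<in> F \<Longrightarrow> (N f :: int) > 0" "\<And>f. f \<in> F \<Longrightarrow> x f \<in> carrier L"
    "\<And>f. f \<in> F \<Longrightarrow> vec (x f) = (\<lambda>i. of_int (N f) * f i)" by metis
  have form: "rat_of_int (form L (x f) (x g)) = of_int (N f) * of_int (N g) * bil f g" if "f \<in> F" "g \<in> F" for f g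
  proof -
    have "rat_of_int (form L (x f) (x g)) = bil (vec (x f)) (vec (x g))" using bil_vec N(2) that by metis
    also have "\<dots> = of_int (N f) * bil f (\<lambda>i. of_int (N g) * g i)"
      unfolding N(3)[OF that(1)] N(3)[OF that(2)] by (rule Q.B_scale_left)
    also have "\<dots> = of_int (N f) * (of_int (N g) * bil f g)" unfolding Q.B_scale_right by (rule HOL.refl)
    finally show ?thesis by simp
  qed
  have sgn: "form L (x f) (x f) > 0 \<longleftrightarrow> bil f f > 0" "form L (x f) (x f) < 0 \<longleftrightarrow> bil f f < 0" if "f \<in> F" for f
  proof -
    have "0 < form L (x f) (x f) \<longleftrightarrow> 0 < rat_of_int (form L (x f) (x f))" "form L (x f) (x f) < 0 \<longleftrightarrow> rat_of_int (form L (x f) (x f)) < 0"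
      by simp_all
    moreover have "rat_of_int (N f) * of_int (N f) > 0" using N(1)[OF that] by simp
    moreover have "0 < a * b \<longleftrightarrow> 0 < b" "a * b < 0 \<longleftrightarrow> b < 0" if "a > 0" for a b :: rat
      using that by (simp_all add: zero_less_mult_iff mult_less_0_iff)
    ultimately show "form L (x f) (x f) > 0 \<longleftrightarrow> bil f f > 0" "form L (x f) (x f) < 0 \<longleftrightarrow> bil f f < 0"
      unfolding form[OF that that] by metis+
  qed
  have orth: "form L (x f) (x g) = 0" if "f \<in> F" "g \<in> F" "f \<noteq> g" for f g
    using form[OF that(1,2)] F that by (auto simp: Q.frame_def Q.orth_set_def)
  have nz: "form L (x f) (x f) \<noteq> 0" if "f \<in> F" for f
    using form[OF that that] N(1)[OF that] F that by (auto simp: Q.frame_def Q.orth_set_def)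
  have inj: "inj_on x F" using orth nz by (metis inj_onI)
  have "lattice_frame L (x ` F)"
    unfolding lattice_frame_def
  proof (intro conjI ballI impI)
    fix y assume y: "y \<in> carrier L" "\<forall>f\<in>x ` F. form L y f = 0"
    have "bil (vec y) f = 0" if "f \<in> F" for f
    proof -
      have "of_int (N f) * bil (vec y) f = bil (vec y) (vec (x f))"
        unfolding N(3)[OF that] Q.B_scale_right by (rule HOL.refl)
      also have "\<dots> = 0" using bil_vec[OF y(1) N(2)[OF that], where 'k = rat] y(2) that by simp
      finally show ?thesis using N(1)[OF that] by simp
    qed
    moreover have "(vec y :: nat \<Rightarrow> rat) \<in> supp_below n" by (rule vec_supp)
    ultimately have "(vec y :: nat \<Rightarrow> rat) = 0" using F unfolding Q.frame_def by blast
    then show "y = \<one>" using vec_eq_0 y by blast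
  next
    fix y z assume "y \<in> x ` F" "z \<in> x ` F" "y \<noteq> z"
    then show "form L y z = 0" using orth by blast
  qed (use fin N nz in auto)
  moreover have "{f\<in>x ` F. form L f f > 0} = x ` {f\<in>F. bil f f > 0}" "{f\<in>x ` F. form L f f < 0} = x ` {f\<in>F. bil f f < 0}"
    using sgn by auto
  moreover have "inj_on x {f\<in>F. bil f f > 0}" "inj_on x {f\<in>F. bil f f < 0}" using inj by (auto simp: inj_on_def)
  ultimately show ?thesis
    by (intro exI[of _ "x ` F"]) (simp add: frame_signature_def card_image)
qed

text \<open>With fewer than \<open>n\<close> members, some nontrivial rational combination of the
  basis would be orthogonal to all of them, against completeness.\<close>

lemma lattice_frame_card:
  assumes F: "lattice_frame L F" shows "card F = n"
proof (rule antisym)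
  have fin: "finite F" "F \<subseteq> carrier L" using F by (auto simp: lattice_frame_def)
  have inj: "inj_on (vec :: _ \<Rightarrow> _ \<Rightarrow> rat) F" using vec_inj fin inj_on_subset by blast
  have Q: "Q.frame (supp_below n) (vec ` F)" using lattice_frame_Q[OF F] .
  then have "card (vec ` F :: (nat \<Rightarrow> rat) set) \<le> n"
    using Q_bounded_dim unfolding Q.frame_def Q.bounded_dim_def by blast
  then show "card F \<le> n" using card_image[OF inj] by simp
  show "n \<le> card F"
  proof (rule ccontr)
    assume "\<not> n \<le> card F"
    obtain g where g: "bij_betw g {..<card F} F" using ex_bij_betw_nat_finite[OF fin(1)] by (auto simp: atLeast0LessThan)
    obtain a :: "nat \<Rightarrow> rat" where a: "\<exists>i\<in>{..<n}. a i \<noteq> 0"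
        "\<forall>j<card F. (\<Sum>i<n. a i * bil (vec (e i)) (vec (g j))) = 0"
      using nontrivial_relation[of "{..<n}" "card F" "\<lambda>i j. bil (vec (e i)) (vec (g j))"] \<open>\<not> n \<le> card F\<close> by auto
    define v where "v = (\<lambda>i. if i < n then a i else 0)"
    have "v \<in> supp_below n" by (simp add: v_def supp_below_def)
    from sum_vec_basis_fun[OF this] have v: "v = (\<Sum>i<n. (\<lambda>j. a i * vec (e i) j))" by (simp add: v_def)
    have gz: "bil v (vec (g j)) = 0" if "j < card F" for j
      unfolding v Q.B_sum_left Q.B_scale_left using a(2) that by simp
    have "bil v (vec f) = 0" if "f \<in> F" for f
    proof -
      have "f \<in> g ` {..<card F}" using g that by (simp add: bij_betw_def)
      then show ?thesis using gz by blast
    qed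
    then have "\<forall>f\<in>vec ` F. bil v f = 0" by blast
    moreover have "v \<in> supp_below n" by (simp add: v_def supp_below_def)
    ultimately have "v = 0" using Q by (auto simp: Q.frame_def)
    then show False using a(1) by (auto simp: v_def fun_eq_iff split: if_splits)
  qed
qed

text \<open>Completeness over the reals does not follow by clearing denominators. Instead the
  rational expansions of the basis vectors in \<open>F\<close> are carried over by
  \<open>of_rat\<close>; they express each coordinate of a real vector through its products with
  \<open>F\<close>.\<close>

lemma lattice_frame_R:
  assumes F: "lattice_frame L F" shows "R.frame (supp_below n) (vec ` F)"
  unfolding R.frame_def
proof (intro conjI ballI impI)
  have FL: "F \<subseteq> carrier L" and fin: "finite F" using F by (auto simp: lattice_frame_def)
  show "R.orth_set (vec ` F)"
    using F FL bil_vec[where 'k = real] unfolding lattice_frame_def R.orth_set_def by (auto simp: subset_iff)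
  show "vec ` F \<subseteq> supp_below n" using vec_supp by blast
  have inj: "inj_on (vec :: _ \<Rightarrow> _ \<Rightarrow> rat) F" using vec_inj FL inj_on_subset by blast
  have exp: "of_bool (i = j) = (\<Sum>f\<in>F. of_int (form L (e i) f) / of_int (form L f f) * (vec f j :: real))" if "i < n" "j < n" for i j
  proof -
    have "vec (e i) = (\<Sum>f\<in>vec ` F. (\<lambda>k. (bil (vec (e i)) f / bil f f) * (f k :: rat)))"
      using Q.frame_expansion[OF lattice_frame_Q[OF F] Q_subspace vec_supp] .
    also have "\<dots> = (\<Sum>f\<in>F. (\<lambda>k. (bil (vec (e i)) (vec f) / bil (vec f) (vec f)) * vec f k))"
      using sum.reindex[OF inj] by (simp add: comp_def)
    finally have ve: "vec (e i) = (\<Sum>f\<in>F. (\<lambda>k. (bil (vec (e i)) (vec f) / bil (vec f) (vec f)) * (vec f k :: rat)))" .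
    have "vec (e i) j = (\<Sum>f\<in>F. (bil (vec (e i)) (vec f) / bil (vec f) (vec f)) * (vec f j :: rat))"
      by (subst ve) (rule sum_fun_apply)
    also have "\<dots> = (\<Sum>f\<in>F. of_int (form L (e i) f) / of_int (form L f f) * vec f j)"
      using FL C(1)[OF that(1)] by (intro sum.cong) (auto simp: bil_vec subset_iff)
    finally have "(of_bool (i = j) :: rat) = (\<Sum>f\<in>F. of_int (form L (e i) f) / of_int (form L f f) * of_int (c j f))"
      using C(3)[OF that(2,1)] that by (simp add: vec_def eq_commute[of i j])
    then have "(of_rat (of_bool (i = j)) :: real) = of_rat (\<Sum>f\<in>F. of_int (form L (e i) f) / of_int (form L f f) * of_int (c j f))"
      by simp
    moreover have "(of_rat (of_bool (i = j)) :: real) = of_bool (i = j)" by simp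
    ultimately show ?thesis using that(2) by (simp only: of_rat_sum of_rat_mult of_rat_divide of_rat_of_int_eq vec_def if_True)
  qed
  fix v :: "nat \<Rightarrow> real" assume v: "v \<in> supp_below n" "\<forall>f\<in>vec ` F. bil v f = 0"
  note vs = sum_vec_basis_fun[OF v(1)]
  have z: "(\<Sum>i<n. v i * of_int (form L (e i) f)) = 0" if "f \<in> F" for f
  proof -
    have "0 = bil v (vec f)" using v that by simp
    also have "\<dots> = (\<Sum>i<n. v i * bil (vec (e i)) (vec f))" by (subst vs) (simp only: R.B_sum_left R.B_scale_left)
    also have "\<dots> = (\<Sum>i<n. v i * of_int (form L (e i) f))"
      using that FL C(1) by (intro sum.cong) (auto simp: bil_vec subset_iff)
    finally show ?thesis by simp
  qed
  have "v j = 0" if j: "j < n" for j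
  proof -
    have "v j = (\<Sum>i<n. v i * of_bool (i = j))" using j by (simp add: of_bool_def if_distrib sum.delta cong: if_cong)
    also have "\<dots> = (\<Sum>i<n. \<Sum>f\<in>F. v i * (of_int (form L (e i) f) / of_int (form L f f) * vec f j))"
      using exp[OF _ j] by (intro sum.cong) (auto simp: sum_distrib_left)
    also have "\<dots> = (\<Sum>f\<in>F. \<Sum>i<n. v i * (of_int (form L (e i) f) / of_int (form L f f) * vec f j))" by (rule sum.swap)
    also have "\<dots> = (\<Sum>f\<in>F. (\<Sum>i<n. v i * of_int (form L (e i) f)) * (vec f j / of_int (form L f f)))"
      unfolding sum_distrib_right by (intro sum.cong[OF HOL.refl]) (simp add: mult.assoc)
    also have "\<dots> = 0" using z by simp
    finally show ?thesis .
  qed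
  then show "v = 0" using v(1) by (auto simp: fun_eq_iff supp_below_def) (metis not_le)
qed

text \<open>Sylvester's argument: more than \<open>p\<close> orthogonal positive vectors would have a combination
  orthogonal to the \<open>p\<close> positive members of the frame.\<close>

lemma sylvester:
  fixes a :: "nat \<Rightarrow> nat \<Rightarrow> real"
  assumes F: "lattice_frame L F" and s: "s \<in> {1, -1}"
    and a: "\<And>k. k \<in> I \<Longrightarrow> a k \<in> supp_below n" "\<And>k l. k \<in> I \<Longrightarrow> l \<in> I \<Longrightarrow> bil (a k) (a l) = (if k = l then s else 0)"
    and I: "finite I"
  shows "card I \<le> card {f\<in>F. s * of_int (form L f f) > 0}"
proof (rule ccontr)
  let ?P = "{f\<in>F. s * of_int (form L f f) > 0}"
  assume ct: "\<not> card I \<le> card ?P"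
  have FL: "F \<subseteq> carrier L" and fin: "finite F" using F by (auto simp: lattice_frame_def)
  obtain g where g: "bij_betw g {..<card ?P} ?P" using ex_bij_betw_nat_finite[of ?P] fin by (auto simp: atLeast0LessThan)
  obtain b where b: "\<exists>k\<in>I. b k \<noteq> 0" "\<forall>j<card ?P. (\<Sum>k\<in>I. b k * bil (a k) (vec (g j))) = 0"
    using nontrivial_relation[OF I, of "card ?P" "\<lambda>k j. bil (a k) (vec (g j))"] ct by auto
  define v where "v = (\<Sum>k\<in>I. (\<lambda>i. b k * a k i))"
  have vU: "v \<in> supp_below n" unfolding v_def by (intro R.subspace_sum[OF R_subspace] R.subspace_scale[OF R_subspace] a(1))
  have "bil v (vec f) = 0" if "f \<in> ?P" for f
  proof -
    have "f \<in> g ` {..<card ?P}" using that g by (simp add: bij_betw_def)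
    then obtain j where "j < card ?P" "f = g j" by blast
    then show ?thesis unfolding v_def R.B_sum_left R.B_scale_left using b(2) by simp
  qed
  then have nonpos: "s * (bil v f * bil v f / bil f f) \<le> 0" if "f \<in> vec ` F" for f
  proof -
    from that obtain x where x: "f = vec x" "x \<in> F" by blast
    show ?thesis
    proof (cases "x \<in> ?P")
      case True
      then show ?thesis using \<open>\<And>f. f \<in> ?P \<Longrightarrow> bil v (vec f) = 0\<close> x by simp
    next
      case False
      then have "s * bil f f \<le> 0" using x FL by (auto simp: bil_vec not_less subset_iff)
      moreover have "bil v f * bil v f \<ge> 0" by simp
      moreover have "s * (bil v f * bil v f / bil f f) = (bil v f * bil v f) / (s * bil f f)" using s by auto
      ultimately show ?thesis by (simp add: divide_nonneg_nonpos)
    qed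
  qed
  have "s * bil v v = (\<Sum>f\<in>vec ` F. s * (bil v f * bil v f / bil f f))"
    unfolding R.frame_norm[OF lattice_frame_R[OF F] R_subspace vU vU] by (simp add: sum_distrib_left)
  also have "\<dots> \<le> 0" using nonpos by (rule sum_nonpos)
  finally have "s * bil v v \<le> 0" .
  moreover have "bil v v = (\<Sum>k\<in>I. \<Sum>l\<in>I. b k * (b l * bil (a l) (a k)))"
    unfolding v_def R.B_sum_left R.B_sum_right R.B_scale_left R.B_scale_right by (simp add: sum_distrib_left)
  moreover have "\<dots> = (\<Sum>k\<in>I. \<Sum>l\<in>I. if l = k then s * (b k)\<^sup>2 else 0)"
    using a(2) by (intro sum.cong) (auto simp: power2_eq_square)
  moreover have "\<dots> = s * (\<Sum>k\<in>I. (b k)\<^sup>2)" using I by (simp add: sum_distrib_left)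
  moreover have "s * s = 1" using s by auto
  ultimately have "(\<Sum>k\<in>I. (b k)\<^sup>2) \<le> 0" by (simp flip: mult.assoc)
  moreover have "(\<Sum>k\<in>I. (b k)\<^sup>2) > 0" using b(1) I by (metis (no_types, lifting) sum_pos2 zero_le_power2 zero_less_power2)
  ultimately show False by simp
qed

lemma has_signature_frame:
  assumes F: "lattice_frame L F" shows "has_signature L (fst (frame_signature L F)) (snd (frame_signature L F))"
proof -
  let ?P = "{f\<in>F. form L f f > 0}" and ?N = "{f\<in>F. form L f f < 0}"
  define p q where "p = card ?P" and "q = card ?N"
  have sg: "frame_signature L F = (p, q)" by (simp add: frame_signature_def p_def q_def)
  have FL: "F \<subseteq> carrier L" and fin: "finite F" using F by (auto simp: lattice_frame_def)
  have n: "n = p + q" using frame_signature_card[OF F sg] lattice_frame_card[OF F] by simp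
  obtain g where g: "bij_betw g {..<p} ?P" using ex_bij_betw_nat_finite[of ?P] fin by (auto simp: atLeast0LessThan p_def)
  obtain h where h: "bij_betw h {..<q} ?N" using ex_bij_betw_nat_finite[of ?N] fin by (auto simp: atLeast0LessThan q_def)
  \<comment> \<open>The frame is listed with its positive members in front; dividing each by the
    root of its absolute norm then gives the diagonal Gram matrix of the signature.\<close>
  define x where "x k = (if k < p then g k else h (k - p))" for k
  have xF: "x k \<in> F" "(form L (x k) (x k) > 0) = (k < p)" if "k < p + q" for k
  proof -
    have "k < p \<Longrightarrow> g k \<in> ?P" "\<not> k < p \<Longrightarrow> h (k - p) \<in> ?N" using g h that by (auto simp: bij_betw_def)
    then show "x k \<in> F" "(form L (x k) (x k) > 0) = (k < p)" by (auto simp: x_def)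
  qed
  have xinj: "k = l" if "k < p + q" "l < p + q" "x k = x l" for k l
  proof -
    have "(k < p) = (l < p)" using xF(2) that by metis
    then show ?thesis
      using g h that unfolding x_def bij_betw_def inj_on_def by (cases "k < p") (auto, force)
  qed
  define a where "a k i = of_int (c i (x k)) / sqrt \<bar>real_of_int (form L (x k) (x k))\<bar>" for k i
  have e: "lattice_basis L (p + q) e"
    unfolding lattice_basis_def using coordinates_imp_iso_free[OF comm_group_axioms coords] n by simp
  have st: "\<forall>k<p + q. \<forall>l<p + q. (\<Sum>i<p + q. \<Sum>j<p + q. a k i * a l j * real_of_int (form L (e i) (e j))) =
           (if k \<noteq> l then 0 else if k < p then 1 else - 1)"
  proof (intro allI impI)
    fix k l assume kl: "k < p + q" "l < p + q"
    define r where "r k = sqrt \<bar>real_of_int (form L (x k) (x k))\<bar>" for k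
    have xk: "x k \<in> carrier L" "x l \<in> carrier L" using xF kl FL by auto
    have "(\<Sum>i<p + q. \<Sum>j<p + q. a k i * a l j * real_of_int (form L (e i) (e j))) =
       (\<Sum>i<n. \<Sum>j<n. vec (x k) i * vec (x l) j * of_int (G i j)) / (r k * r l)"
      unfolding n[symmetric] sum_divide_distrib by (intro sum.cong) (auto simp: a_def vec_def G_def r_def)
    also have "\<dots> = of_int (form L (x k) (x l)) / (r k * r l)"
      using bil_vec[OF xk, where 'k = real] by (simp add: gram_def)
    also have "\<dots> = (if k \<noteq> l then 0 else if k < p then 1 else - 1)"
    proof (cases "k = l")
      case True
      have "form L (x k) (x k) \<noteq> 0" using xF(1)[OF kl(1)] F by (auto simp: lattice_frame_def)
      moreover have "r k * r k = \<bar>real_of_int (form L (x k) (x k))\<bar>" by (simp add: r_def)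
      ultimately show ?thesis using True xF(2)[OF kl(1)] by (auto simp: abs_if)
    next
      case False
      then have "x k \<noteq> x l" using xinj kl by blast
      then show ?thesis using False xF kl F by (auto simp: lattice_frame_def)
    qed
    finally show "(\<Sum>i<p + q. \<Sum>j<p + q. a k i * a l j * real_of_int (form L (e i) (e j))) =
           (if k \<noteq> l then 0 else if k < p then 1 else - 1)" .
  qed
  show ?thesis unfolding has_signature_def sg fst_conv snd_conv using conjI[OF e st] by (intro exI)
qed

lemma vec_real_supp: "(\<lambda>i. if i < n then a i else 0) \<in> supp_below n"
  by (simp add: supp_below_def)

text \<open>Sylvester's argument bounds \<open>p\<close> and \<open>q\<close> from above by the
  numbers of positive and negative members. Both pairs have the sum \<open>n\<close>, so equality
  holds.\<close>

lemma signature_frame_eq: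
  assumes F: "lattice_frame L F"
    and a: "\<forall>k<p + q. \<forall>l<p + q. (\<Sum>i<p + q. \<Sum>j<p + q. a k i * a l j * real_of_int (form L (e i) (e j))) =
           (if k \<noteq> l then 0 else if k < p then 1 else - 1)" and n: "n = p + q"
  shows "frame_signature L F = (p, q)"
proof -
  define a' where "a' k = (\<lambda>i. if i < n then a k i else 0)" for k
  have b: "bil (a' k) (a' l) = (if k \<noteq> l then 0 else if k < p then 1 else - 1)" if "k < p + q" "l < p + q" for k l
  proof -
    have "bil (a' k) (a' l) = (\<Sum>i<p + q. \<Sum>j<p + q. a k i * a l j * real_of_int (form L (e i) (e j)))"
      unfolding gram_def a'_def G_def by (intro sum.cong) (auto simp: n)
    also have "\<dots> = (if k \<noteq> l then 0 else if k < p then 1 else - 1)" by (rule a[rule_format, OF that])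
    finally show ?thesis .
  qed
  have s: "a' k \<in> supp_below n" for k unfolding a'_def by (rule vec_real_supp)
  let ?P = "{f\<in>F. form L f f > 0}" and ?N = "{f\<in>F. form L f f < 0}"
  have "card {..<p} \<le> card {f\<in>F. 1 * real_of_int (form L f f) > 0}"
    by (rule sylvester[OF F, of 1 _ a']) (auto simp: b s)
  moreover have "card {p..<p + q} \<le> card {f\<in>F. -1 * real_of_int (form L f f) > 0}"
    by (rule sylvester[OF F, of "-1" _ a']) (auto simp: b s)
  ultimately have "p \<le> card ?P" "q \<le> card ?N" by (simp_all add: conj_commute cong: conj_cong)
  moreover have "card ?P + card ?N = p + q"
    using frame_signature_card[OF F, of "card ?P" "card ?N"] lattice_frame_card[OF F] n by (simp add: frame_signature_def)
  ultimately show ?thesis by (simp add: frame_signature_def)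
qed

end

lemma lattice_frame_exists:
  assumes "zlattice L" shows "\<exists>F. lattice_frame L F"
proof -
  interpret integral_lattice L using assms by (rule integral_latticeI)
  obtain n e c where "coordinates L n e c" using coordinates_ex by blast
  then interpret coord_lattice L n e c by unfold_locales
  obtain F where "Q.frame (supp_below n) F" using Q_frame_ex by blast
  then show ?thesis using Q_frame_lattice by blast
qed

lemma has_signature_iff_frame:
  assumes L: "zlattice L" and F: "lattice_frame L F"
  shows "has_signature L p q \<longleftrightarrow> frame_signature L F = (p, q)"
proof
  interpret integral_lattice L using L by (rule integral_latticeI)
  assume sg: "frame_signature L F = (p, q)"
  obtain n e c where "coordinates L n e c" using coordinates_ex by blast
  then interpret coord_lattice L n e c by unfold_locales
  show "has_signature L p q" using has_signature_frame[OF F] sg by simp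
next
  interpret integral_lattice L using L by (rule integral_latticeI)
  assume "has_signature L p q"
  then obtain e a where ea: "lattice_basis L (p + q) e" "\<forall>k<p + q. \<forall>l<p + q.
       (\<Sum>i<p + q. \<Sum>j<p + q. a k i * a l j * real_of_int (form L (e i) (e j))) =
           (if k \<noteq> l then 0 else if k < p then 1 else - 1)"
    unfolding has_signature_def by blast
  obtain c where "coordinates L (p + q) e c"
    using ea(1) iso_free_imp_coordinates[OF _ comm_group_axioms] unfolding lattice_basis_def by blast
  then interpret coord_lattice L "p + q" e c by unfold_locales
  show "frame_signature L F = (p, q)" using signature_frame_eq[OF F ea(2)] by simp
qed

section \<open>Discriminant forms\<close>

lemma dual_group_carrier: "carrier (dual_group L) = hom L integer_group \<inter> extensional (carrier L)"
  by (simp add: dual_group_def)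

text \<open>A rational vector with integral products defines an integral functional, which
  unimodularity represents by some lattice vector; nondegeneracy identifies the two.\<close>

lemma (in coord_lattice) vec_unimodular:
  assumes "unimodular L"
  shows "Q.unimodular_in (supp_below n) (vec ` carrier L)"
  unfolding Q.unimodular_in_def
proof (intro conjI ballI iffI)
  show "vec ` carrier L \<subseteq> supp_below n" using vec_supp by blast
  fix v :: "nat \<Rightarrow> rat" assume v: "v \<in> supp_below n"
  show "bil v l \<in> \<int>" if vl: "v \<in> vec ` carrier L" "l \<in> vec ` carrier L" for l
  proof -
    obtain x y where "v = vec x" "l = vec y" "x \<in> carrier L" "y \<in> carrier L" using vl by blast
    then show ?thesis by (simp add: bil_vec)
  qed
  show "v \<in> vec ` carrier L" if int: "\<forall>l\<in>vec ` carrier L. bil v l \<in> \<int>"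
  proof -
    define g where "g = (\<lambda>y\<in>carrier L. \<lfloor>bil v (vec y)\<rfloor>)"
    have g: "of_int (g y) = bil v (vec y)" if "y \<in> carrier L" for y
      using int that by (auto simp: g_def)
    have "g (x \<otimes> y) = g x + g y" if "x \<in> carrier L" "y \<in> carrier L" for x y
    proof -
      have "rat_of_int (g (x \<otimes> y)) = of_int (g x + g y)"
        using that by (simp add: g vec_mult Q.B_add_right)
      then show ?thesis by (simp only: of_int_eq_iff)
    qed
    then have "g \<in> carrier (dual_group L)" by (auto simp: dual_group_carrier g_def intro: hom_integerI)
    then have "g \<in> to_dual L ` carrier L" using assms by (simp add: unimodular_def bij_betw_def)
    then obtain x where x: "x \<in> carrier L" "to_dual L x = g" by blast
    have z: "bil (v - vec x) (vec y) = 0" if "y \<in> carrier L" for y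
    proof -
      have "to_dual L x y = form L x y" using that by (simp add: to_dual_def)
      then have "form L x y = g y" using x by simp
      then show ?thesis using g[OF that] bil_vec[OF x(1) that, where 'k = rat] by (simp add: Q.B_diff_left)
    qed
    have "bil (v - vec x) u = 0" if u: "u \<in> supp_below n" for u
    proof -
      obtain N y where N: "N > 0" "y \<in> carrier L" "vec y = (\<lambda>i. of_int N * u i)" using clear_denominators[OF u] by blast
      have "of_int N * bil (v - vec x) u = bil (v - vec x) (vec y)" unfolding N(3) Q.B_scale_right by simp
      then show ?thesis using z[OF N(2)] N(1) by simp
    qed
    moreover have "v - vec x \<in> supp_below n" using v vec_supp Q.subspace_diff[OF Q_subspace] by blast
    ultimately have "v - vec x = 0" using Q_nondegenerate unfolding Q.nondegenerate_def by blast
    then show ?thesis using x(1) by auto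
  qed
  obtain N x where N: "N > 0" "x \<in> carrier L" "vec x = (\<lambda>i. of_int N * v i)" using clear_denominators[OF v] by blast
  then show "\<exists>m::nat. m > 0 \<and> (\<lambda>i. of_nat m * v i) \<in> vec ` carrier L"
    by (intro exI[of _ "nat N"]) (auto intro!: image_eqI[of _ vec x])
qed (rule Q_subspace)

lemma (in quad_space) norms_signs:
  assumes "finite F" "\<forall>f\<in>F. B f f \<in> {1, -1}"
  shows "norms F = replicate_mset (card {f\<in>F. B f f > 0}) 1 + replicate_mset (card {f\<in>F. B f f < 0}) (-1)"
  using assms
proof (induction F)
  case (insert x F)
  have n: "norms (insert x F) = add_mset (B x x) (norms F)" using insert by (simp add: norms_def)
  have s: "{f \<in> insert x F. B f f > 0} = (if B x x > 0 then insert x {f\<in>F. B f f > 0} else {f\<in>F. B f f > 0})"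
    "{f \<in> insert x F. B f f < 0} = (if B x x < 0 then insert x {f\<in>F. B f f < 0} else {f\<in>F. B f f < 0})" by auto
  have IH: "norms F = replicate_mset (card {f\<in>F. B f f > 0}) 1 + replicate_mset (card {f\<in>F. B f f < 0}) (-1)"
    using insert by simp
  have "B x x = 1 \<or> B x x = -1" using insert.prems by simp
  then show ?case unfolding n s IH using insert.hyps by (elim disjE) simp_all
qed (simp add: norms_def)

lemma frame_signature_unique:
  assumes "zlattice L" "lattice_frame L F" "lattice_frame L F'"
  shows "frame_signature L F = frame_signature L F'"
proof -
  obtain p q where "frame_signature L F = (p, q)" by fastforce
  then show ?thesis using has_signature_iff_frame[OF assms(1,2), of p q] has_signature_iff_frame[OF assms(1,3), of p q] by simp
qed

text \<open>The norms of a sign frame are determined by how many of them are positive and how many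
  negative, that is, by the signature. So the result on rational spaces applies in coordinates and
  is pulled back along \<open>vec\<close>.\<close>

theorem even_unimodular_indefinite_isometric:
  assumes L: "even_lattice L" "unimodular L" "indefinite L" and M: "even_lattice M" "unimodular M" "indefinite M"
    and F: "lattice_frame L F" "lattice_frame M F'" "frame_signature L F = frame_signature M F'"
  shows "isometric L M"
proof -
  have zL: "zlattice L" "zlattice M" using L M by (auto simp: even_lattice_def)
  interpret L: integral_lattice L using even_lattice_integral[OF L(1)] .
  interpret M: integral_lattice M using even_lattice_integral[OF M(1)] .
  obtain n e c where "coordinates L n e c" using L.coordinates_ex by blast
  then interpret L: coord_lattice L n e c by unfold_locales
  obtain n' e' c' where "coordinates M n' e' c'" using M.coordinates_ex by blast
  then interpret M: coord_lattice M n' e' c' by unfold_locales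
  interpret P: rat_quad_pair "\<lambda>a u i. a * u i" "gram n L.G" "\<lambda>a u i. a * u i" "gram n' M.G" by unfold_locales
  have evL: "\<exists>k. L.bil l l = rat_of_int (2 * k)" if "l \<in> L.vec ` carrier L" for l
    using that L(1) by (auto simp: L.bil_vec even_lattice_def elim!: evenE)
  have evM: "\<exists>k. M.bil l l = rat_of_int (2 * k)" if "l \<in> M.vec ` carrier M" for l
    using that M(1) by (auto simp: M.bil_vec even_lattice_def elim!: evenE)
  obtain s t where st: "s \<in> carrier L" "form L s s > 0" "t \<in> carrier L" "form L t t < 0" using L(3) by (auto simp: indefinite_def)
  obtain s' t' where st': "s' \<in> carrier M" "form M s' s' > 0" "t' \<in> carrier M" "form M t' t' < 0" using M(3) by (auto simp: indefinite_def)
  have "\<exists>f. bij_betw f (L.vec ` carrier L :: (nat \<Rightarrow> rat) set) (M.vec ` carrier M) \<and>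
     (\<forall>x\<in>L.vec ` carrier L. \<forall>y\<in>L.vec ` carrier L. f (x + y) = f x + f y) \<and>
     (\<forall>x\<in>L.vec ` carrier L. \<forall>y\<in>L.vec ` carrier L. M.bil (f x) (f y) = L.bil x y)"
  proof (rule P.even_unimodular_isometric[OF L.vec_unimodular[OF L(2)] evL L.Q_nondegenerate L.Q_bounded_dim _ _ _ _
        M.vec_unimodular[OF M(2)] evM M.Q_nondegenerate M.Q_bounded_dim])
    show "L.vec s \<in> supp_below n" "L.vec t \<in> supp_below n" "M.vec s' \<in> supp_below n'" "M.vec t' \<in> supp_below n'"
      by (rule L.vec_supp M.vec_supp)+
    show "L.bil (L.vec s) (L.vec s) > (0::rat)" "L.bil (L.vec t) (L.vec t) < (0::rat)"
      "M.bil (M.vec s') (M.vec s') > (0::rat)" "M.bil (M.vec t') (M.vec t') < (0::rat)"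
      using st st' by (simp_all add: L.bil_vec M.bil_vec)
    fix F1 F2 assume A: "L.Q.frame (supp_below n) F1" "M.Q.frame (supp_below n') F2"
      "\<forall>f\<in>F1. L.bil f f \<in> {1, - 1}" "\<forall>f\<in>F2. M.bil f f \<in> {1, - 1}"
    obtain E1 where E1: "lattice_frame L E1" "frame_signature L E1 = (card {f \<in> F1. 0 < L.bil f f}, card {f \<in> F1. L.bil f f < 0})"
      using L.Q_frame_lattice[OF A(1)] by blast
    obtain E2 where E2: "lattice_frame M E2" "frame_signature M E2 = (card {f \<in> F2. 0 < M.bil f f}, card {f \<in> F2. M.bil f f < 0})"
      using M.Q_frame_lattice[OF A(2)] by blast
    have "frame_signature L E1 = frame_signature M E2"
      using frame_signature_unique[OF zL(1) E1(1) F(1)] frame_signature_unique[OF zL(2) E2(1) F(2)] F(3) by simp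
    then have eq: "card {f \<in> F1. 0 < L.bil f f} = card {f \<in> F2. 0 < M.bil f f}" "card {f \<in> F1. L.bil f f < 0} = card {f \<in> F2. M.bil f f < 0}"
      using E1 E2 by auto
    have fin: "finite F1" "finite F2" using A(1,2) by (auto simp: L.Q.frame_def L.Q.orth_set_def M.Q.frame_def M.Q.orth_set_def)
    show "L.Q.norms F1 = M.Q.norms F2"
      unfolding L.Q.norms_signs[OF fin(1) A(3)] M.Q.norms_signs[OF fin(2) A(4)] eq ..
  qed
  then obtain f where f0: "bij_betw f (L.vec ` carrier L :: (nat \<Rightarrow> rat) set) (M.vec ` carrier M)"
     "\<forall>x\<in>L.vec ` carrier L. \<forall>y\<in>L.vec ` carrier L. f (x + y) = f x + f y"
     "\<forall>x\<in>L.vec ` carrier L. \<forall>y\<in>L.vec ` carrier L. M.bil (f x) (f y) = L.bil x y"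
    by (elim exE conjE) (rule that)
  then have f: "bij_betw f (L.vec ` carrier L :: (nat \<Rightarrow> rat) set) (M.vec ` carrier M)"
    "\<And>x y. x \<in> carrier L \<Longrightarrow> y \<in> carrier L \<Longrightarrow> f (L.vec x + L.vec y) = f (L.vec x) + f (L.vec y)"
    "\<And>x y. x \<in> carrier L \<Longrightarrow> y \<in> carrier L \<Longrightarrow> M.bil (f (L.vec x)) (f (L.vec y)) = L.bil (L.vec x) (L.vec y)"
    by simp_all
  define h where "h = inv_into (carrier M) (M.vec :: _ \<Rightarrow> _ \<Rightarrow> rat)"
  have bL: "bij_betw (L.vec :: _ \<Rightarrow> _ \<Rightarrow> rat) (carrier L) (L.vec ` carrier L)" using L.vec_inj by (rule inj_on_imp_bij_betw)
  have bM: "bij_betw h (M.vec ` carrier M) (carrier M)"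
    unfolding h_def using M.vec_inj by (intro bij_betw_inv_into inj_on_imp_bij_betw)
  define g where "g = restrict (\<lambda>x. h (f (L.vec x))) (carrier L)"
  have "bij_betw (\<lambda>x. h (f (L.vec x))) (carrier L) (carrier M)"
    using bij_betw_trans[OF bij_betw_trans[OF bL f(1)] bM] by (simp add: comp_def)
  then have bg: "bij_betw g (carrier L) (carrier M)" unfolding g_def by (subst bij_betw_restrict_eq)
  have fM: "f (L.vec x) \<in> M.vec ` carrier M" if "x \<in> carrier L" for x using f(1) that by (auto simp: bij_betw_def)
  have vg: "M.vec (g x) = f (L.vec x)" if "x \<in> carrier L" for x
    using that fM by (simp add: g_def h_def f_inv_into_f)
  have gc: "g x \<in> carrier M" if "x \<in> carrier L" for x using bg that by (auto simp: bij_betw_def)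
  have hom: "g (x \<otimes>\<^bsub>L\<^esub> y) = g x \<otimes>\<^bsub>M\<^esub> g y" if xy: "x \<in> carrier L" "y \<in> carrier L" for x y
  proof -
    have "(M.vec (g (x \<otimes>\<^bsub>L\<^esub> y)) :: nat \<Rightarrow> rat) = M.vec (g x \<otimes>\<^bsub>M\<^esub> g y)"
      using xy gc by (simp add: vg L.vec_mult M.vec_mult f(2))
    then show ?thesis using M.vec_inj[where 'k = rat] xy gc by (meson L.m_closed M.m_closed inj_onD)
  qed
  have "form M (g x) (g y) = form L x y" if xy: "x \<in> carrier L" "y \<in> carrier L" for x y
  proof -
    have "rat_of_int (form M (g x) (g y)) = of_int (form L x y)"
      using f(3)[OF xy] xy gc by (simp flip: L.bil_vec M.bil_vec add: vg)
    then show ?thesis by simp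
  qed
  then have "g \<in> isometries L M"
    using bg hom gc by (auto simp: isometries_def iso_def hom_def g_def)
  then show ?thesis by (auto simp: isometric_def)
qed

lemma combination_exists:
  assumes "group A" "finite F" "F \<subseteq> carrier A"
  shows "\<exists>x\<in>carrier A. \<forall>h\<in>hom A integer_group. h x = (\<Sum>f\<in>F. u f * h f)"
  using assms(2,3)
proof (induction F)
  case empty
  then show ?case using hom_integer(2)[OF assms(1)] group.is_monoid[OF assms(1)] monoid.one_closed by fastforce
next
  case (insert f F)
  interpret group A by fact
  obtain x where x: "x \<in> carrier A" "\<forall>h\<in>hom A integer_group. h x = (\<Sum>f\<in>F. u f * h f)" using insert by auto
  have "h (f [^]\<^bsub>A\<^esub> u f \<otimes>\<^bsub>A\<^esub> x) = (\<Sum>f\<in>insert f F. u f * h f)" if "h \<in> hom A integer_group" for h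
    using hom_integer[OF is_group that] x insert that by simp
  then show ?case using x insert by (intro bexI[of _ "f [^]\<^bsub>A\<^esub> u f \<otimes>\<^bsub>A\<^esub> x"]) auto
qed

text \<open>The bilinear form of the rational space on functionals: if \<open>g\<close> is the
  vector \<open>x / n\<close>, its product with \<open>f\<close> is \<open>f x / n\<close>. It
  polarizes \<open>dual_norm\<close>.\<close>

definition dual_form :: "'a zlat \<Rightarrow> ('a \<Rightarrow> int) \<Rightarrow> ('a \<Rightarrow> int) \<Rightarrow> rat" where
  "dual_form L f g = (THE r. \<exists>x\<in>carrier L. \<exists>n::int. n > 0 \<and>
     (\<forall>y\<in>carrier L. n * g y = form L x y) \<and> r = of_int (f x) / of_int n)"

text \<open>The coset of \<open>f\<close> modulo the image of the lattice, written out pointwise;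
  \<open>dual_class_eq\<close> links it to the quotient group.\<close>

definition dual_class :: "'a zlat \<Rightarrow> ('a \<Rightarrow> int) \<Rightarrow> ('a \<Rightarrow> int) set" where
  "dual_class L f = {g\<in>carrier (dual_group L). \<exists>x\<in>carrier L. \<forall>y\<in>carrier L. g y = f y + form L x y}"

context integral_lattice
begin

text \<open>With a complete orthogonal set \<open>F\<close> of lattice vectors, \<open>N = (\<Prod>f\<in>F. (f, f)\<^sup>2)\<close> works for all functionals.\<close>

lemma dual_multiple: "\<exists>N>0. \<forall>h\<in>hom L integer_group. \<exists>x\<in>carrier L. \<forall>y\<in>carrier L. N * h y = form L x y"
proof -
  obtain F where F: "lattice_frame L F" using lattice_frame_exists[OF lattice] by blast
  have fin: "finite F" and FL: "F \<subseteq> carrier L" and nz: "\<And>f. f \<in> F \<Longrightarrow> form L f f \<noteq> 0"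
    using F by (auto simp: lattice_frame_def)
  define N where "N = (\<Prod>f\<in>F. (form L f f)\<^sup>2)"
  have N: "N > 0" unfolding N_def using nz by (intro prod_pos) simp
  have dvd: "form L f f dvd N" if "f \<in> F" for f
    unfolding N_def using dvd_prodI[OF fin that, of "\<lambda>f. (form L f f)\<^sup>2"] by (simp add: power2_eq_square dvd_mult_left)
  have "\<exists>x\<in>carrier L. \<forall>y\<in>carrier L. N * h y = form L x y" if h: "h \<in> hom L integer_group" for h
  proof -
    obtain x where x: "x \<in> carrier L" "\<forall>g\<in>hom L integer_group. g x = (\<Sum>f\<in>F. h f * (N div form L f f) * g f)"
      using combination_exists[OF is_group fin FL, of "\<lambda>f. h f * (N div form L f f)"] by blast
    have "N * h y = form L x y" if y: "y \<in> carrier L" for y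
    proof -
      obtain z where z: "z \<in> carrier L" "\<forall>g\<in>hom L integer_group. g z = (\<Sum>f\<in>F. form L y f * (N div form L f f) * g f)"
        using combination_exists[OF is_group fin FL, of "\<lambda>f. form L y f * (N div form L f f)"] by blast
      \<comment> \<open>\<open>N\<close> times \<open>y\<close> equals the combination
        \<open>z\<close> of \<open>F\<close>, since the difference is orthogonal to all of
        \<open>F\<close>; on \<open>z\<close> the functional \<open>h\<close> can be
        evaluated.\<close>
      define w where "w = y [^] N \<otimes> inv z"
      have "form L w k = 0" if k: "k \<in> F" for k
      proof -
        have kL: "k \<in> carrier L" using k FL by blast
        have "form L z k = (\<Sum>f\<in>F. form L y f * (N div form L f f) * form L f k)"
          by (rule bspec[OF z(2) form_hom_left[OF kL]])
        also have "\<dots> = (\<Sum>f\<in>F. if f = k then form L y k * N else 0)"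
          using F k dvd by (intro sum.cong) (auto simp: lattice_frame_def)
        also have "\<dots> = form L y k * N" using fin k by simp
        finally show ?thesis using kL y z(1) by (simp add: w_def form_left)
      qed
      then have "w = \<one>" using F y z by (auto simp: lattice_frame_def w_def)
      then have "h w = 0" using hom_integer(2)[OF is_group h] by simp
      then have "N * h y = h z" using y z hom_integer[OF is_group h] by (simp add: w_def)
      also have "\<dots> = (\<Sum>f\<in>F. form L y f * (N div form L f f) * h f)" using z(2) h by blast
      also have "\<dots> = (\<Sum>f\<in>F. h f * (N div form L f f) * form L f y)"
        using FL y form_sym by (intro sum.cong) (auto simp: subset_iff)
      also have "\<dots> = form L x y" using x(2) form_hom_left[OF y] by simp
      finally show ?thesis .
    qed
    then show ?thesis using x(1) by blast
  qed
  then show ?thesis using N by blast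
qed

lemma dual_rep:
  assumes "h \<in> hom L integer_group"
  obtains n x where "n > 0" "x \<in> carrier L" "\<And>y. y \<in> carrier L \<Longrightarrow> n * h y = form L x y"
  using dual_multiple assms by blast

lemma dual_form_eq:
  assumes f: "f \<in> hom L integer_group" and x: "x \<in> carrier L" "n > 0" "\<And>y. y \<in> carrier L \<Longrightarrow> n * g y = form L x y"
  shows "dual_form L f g = of_int (f x) / of_int n"
  unfolding dual_form_def
proof (rule the_equality)
  show "\<exists>xa\<in>carrier L. \<exists>m>0. (\<forall>y\<in>carrier L. m * g y = form L xa y) \<and> rat_of_int (f x) / rat_of_int n = rat_of_int (f xa) / rat_of_int m"
    using x by blast
  fix r assume "\<exists>x\<in>carrier L. \<exists>n>0. (\<forall>y\<in>carrier L. n * g y = form L x y) \<and> r = rat_of_int (f x) / rat_of_int n"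
  then obtain z m where z: "z \<in> carrier L" "m > 0" "\<forall>y\<in>carrier L. m * g y = form L z y" "r = rat_of_int (f z) / rat_of_int m"
    by blast
  have "form L (x [^] m \<otimes> inv (z [^] n)) y = 0" if "y \<in> carrier L" for y
  proof -
    have "form L (x [^] m \<otimes> inv (z [^] n)) y = m * (n * g y) - n * (m * g y)"
      using that x z by (simp add: form_left)
    then show ?thesis by simp
  qed
  then have "x [^] m \<otimes> inv (z [^] n) = \<one>" using x z by (intro form_nondegenerate) auto
  then have "f (x [^] m \<otimes> inv (z [^] n)) = 0" using hom_integer(2)[OF is_group f] by simp
  then have "m * f x = n * f z" using x z hom_integer[OF is_group f] by simp
  then have "rat_of_int m * of_int (f x) = of_int n * of_int (f z)" by (metis of_int_mult)
  then have "of_int (f z) / of_int m = rat_of_int (f x) / of_int n" using x(2) z(2) by (simp add: frac_eq_eq mult.commute)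
  then show "r = rat_of_int (f x) / rat_of_int n" using z(4) by simp
qed

lemma dual_norm_eq:
  assumes f: "f \<in> hom L integer_group" shows "dual_norm L f = dual_form L f f"
proof -
  have eq: "(\<exists>x\<in>carrier L. \<exists>n::int. n > 0 \<and> (\<forall>y\<in>carrier L. n * f y = form L x y) \<and> r = of_int (form L x x) / (of_int n)\<^sup>2) \<longleftrightarrow>
     (\<exists>x\<in>carrier L. \<exists>n::int. n > 0 \<and> (\<forall>y\<in>carrier L. n * f y = form L x y) \<and> r = of_int (f x) / of_int n)" for r :: rat
  proof (intro bex_cong ex_cong1 HOL.refl conj_cong)
    fix x n assume x: "x \<in> carrier L" "n > 0" "\<forall>y\<in>carrier L. n * f y = form L x y"
    then have "form L x x = n * f x" by simp
    then show "(r = of_int (form L x x) / (of_int n)\<^sup>2) = (r = of_int (f x) / of_int n)"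
      using x(2) by (simp add: power2_eq_square)
  qed
  show ?thesis unfolding dual_norm_def dual_form_def eq ..
qed

lemma dual_form_sym:
  assumes "f \<in> hom L integer_group" "g \<in> hom L integer_group"
  shows "dual_form L f g = dual_form L g f"
proof -
  obtain n x where x: "n > 0" "x \<in> carrier L" "\<And>y. y \<in> carrier L \<Longrightarrow> n * f y = form L x y" by (rule dual_rep[OF assms(1)]) (rule that)
  obtain m z where z: "m > 0" "z \<in> carrier L" "\<And>y. y \<in> carrier L \<Longrightarrow> m * g y = form L z y" by (rule dual_rep[OF assms(2)]) (rule that)
  have "n * f z = m * g x" using x z form_sym by simp
  then have "rat_of_int n * of_int (f z) = of_int m * of_int (g x)" by (metis of_int_mult)
  then have "of_int (f z) / rat_of_int m = of_int (g x) / of_int n" using x(1) z(1) by (simp add: frac_eq_eq mult.commute)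
  then show ?thesis using dual_form_eq[OF assms(1) z(2,1,3)] dual_form_eq[OF assms(2) x(2,1,3)] by simp
qed

lemma dual_form_add_left:
  assumes "f \<in> hom L integer_group" "f' \<in> hom L integer_group" "g \<in> hom L integer_group"
    "k \<in> hom L integer_group" "\<And>y. y \<in> carrier L \<Longrightarrow> k y = f y + f' y"
  shows "dual_form L k g = dual_form L f g + dual_form L f' g"
proof -
  obtain m z where z: "m > 0" "z \<in> carrier L" "\<And>y. y \<in> carrier L \<Longrightarrow> m * g y = form L z y" by (rule dual_rep[OF assms(3)]) (rule that)
  show ?thesis
    using assms z by (simp add: dual_form_eq[OF _ z(2,1,3)] add_divide_distrib)
qed

lemma dual_form_to_dual:
  assumes "f \<in> hom L integer_group" "x \<in> carrier L" "\<And>y. y \<in> carrier L \<Longrightarrow> g y = form L x y"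
  shows "dual_form L f g = of_int (f x)"
  using dual_form_eq[OF assms(1,2), of 1 g] assms(3) by simp

lemma divisible_vector:
  assumes "x \<in> carrier L" "n > 0" "\<And>h. h \<in> hom L integer_group \<Longrightarrow> n dvd h x"
  shows "\<exists>y\<in>carrier L. y [^] (n::int) = x"
proof -
  obtain r e c where c: "coordinates L r e c" using coordinates_ex by blast
  note C = coordinatesD[OF c]
  obtain y where y: "y \<in> carrier L" "\<forall>i<r. c i y = c i x div n"
    using coordinates_combination[OF is_group c, of "\<lambda>i. c i x div n"] by blast
  have "y [^] n = x"
    using y assms C(2) hom_integer(4)[OF is_group C(2)] by (intro C(4)) auto
  then show ?thesis using y by blast
qed

section \<open>The dual lattice and the discriminant group\<close>

lemma dual_comm_group: "comm_group (dual_group L)"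
proof (rule comm_groupI)
  fix f g assume fg: "f \<in> carrier (dual_group L)" "g \<in> carrier (dual_group L)"
  show "f \<otimes>\<^bsub>dual_group L\<^esub> g \<in> carrier (dual_group L)"
    using fg by (auto simp: dual_group_def hom_def)
  show "f \<otimes>\<^bsub>dual_group L\<^esub> g = g \<otimes>\<^bsub>dual_group L\<^esub> f" by (auto simp: dual_group_def)
next
  fix f assume f: "f \<in> carrier (dual_group L)"
  show "\<one>\<^bsub>dual_group L\<^esub> \<otimes>\<^bsub>dual_group L\<^esub> f = f"
    using f by (auto simp: dual_group_def fun_eq_iff extensional_def)
  show "\<exists>g\<in>carrier (dual_group L). g \<otimes>\<^bsub>dual_group L\<^esub> f = \<one>\<^bsub>dual_group L\<^esub>"
    using f by (intro bexI[of _ "\<lambda>x\<in>carrier L. - f x"]) (auto simp: dual_group_def hom_def)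
qed (auto simp: dual_group_def hom_def)

lemma dual_mult: "y \<in> carrier L \<Longrightarrow> (f \<otimes>\<^bsub>dual_group L\<^esub> g) y = f y + g y"
  by (simp add: dual_group_def)

lemma dual_eqI:
  "f \<in> carrier (dual_group L) \<Longrightarrow> g \<in> carrier (dual_group L) \<Longrightarrow> (\<And>y. y \<in> carrier L \<Longrightarrow> f y = g y) \<Longrightarrow> f = g"
  by (auto simp: dual_group_carrier intro: extensionalityI)

lemma dual_hom: "f \<in> carrier (dual_group L) \<Longrightarrow> f \<in> hom L integer_group"
  by (simp add: dual_group_carrier)

lemma restrict_dual: "f \<in> hom L integer_group \<Longrightarrow> restrict f (carrier L) \<in> carrier (dual_group L)"
  by (auto simp: dual_group_carrier hom_def)

lemma to_dual_carrier: "x \<in> carrier L \<Longrightarrow> to_dual L x \<in> carrier (dual_group L)"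
  unfolding to_dual_def by (intro restrict_dual form_hom)

lemma to_dual_apply: "y \<in> carrier L \<Longrightarrow> to_dual L x y = form L x y"
  by (simp add: to_dual_def)

lemma to_dual_subgroup: "subgroup (to_dual L ` carrier L) (dual_group L)"
proof -
  interpret D: comm_group "dual_group L" by (rule dual_comm_group)
  have "group_hom L (dual_group L) (to_dual L)"
  proof (unfold_locales, rule homI)
    fix x y assume "x \<in> carrier L" "y \<in> carrier L"
    then show "to_dual L (x \<otimes> y) = to_dual L x \<otimes>\<^bsub>dual_group L\<^esub> to_dual L y"
      by (intro dual_eqI) (auto simp: to_dual_carrier to_dual_apply dual_mult form_left)
  qed (rule to_dual_carrier)
  then show ?thesis by (rule group_hom.img_is_subgroup)
qed

lemma dual_class_eq:
  assumes "f \<in> carrier (dual_group L)"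
  shows "(to_dual L ` carrier L) #>\<^bsub>dual_group L\<^esub> f = dual_class L f"
proof -
  interpret D: comm_group "dual_group L" by (rule dual_comm_group)
  have "g \<in> dual_class L f \<longleftrightarrow> (\<exists>x\<in>carrier L. g = to_dual L x \<otimes>\<^bsub>dual_group L\<^esub> f)" for g
  proof
    assume "g \<in> dual_class L f"
    then obtain x where x: "g \<in> carrier (dual_group L)" "x \<in> carrier L" "\<forall>y\<in>carrier L. g y = f y + form L x y"
      by (auto simp: dual_class_def)
    then have "g = to_dual L x \<otimes>\<^bsub>dual_group L\<^esub> f"
      using assms by (intro dual_eqI) (auto simp: to_dual_carrier to_dual_apply dual_mult)
    then show "\<exists>x\<in>carrier L. g = to_dual L x \<otimes>\<^bsub>dual_group L\<^esub> f" using x by blast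
  next
    assume "\<exists>x\<in>carrier L. g = to_dual L x \<otimes>\<^bsub>dual_group L\<^esub> f"
    then show "g \<in> dual_class L f" using assms
      by (auto simp: dual_class_def to_dual_carrier to_dual_apply dual_mult)
  qed
  then show ?thesis by (auto simp: r_coset_def)
qed

lemma disc_carrier: "carrier (disc_group L) = dual_class L ` carrier (dual_group L)"
  unfolding disc_group_def FactGroup_def RCOSETS_def using dual_class_eq by (auto simp: image_iff)

lemma dual_class_self: "f \<in> carrier (dual_group L) \<Longrightarrow> f \<in> dual_class L f"
  unfolding dual_class_def using form_left(2) by (intro CollectI conjI bexI[of _ \<one>]) auto

lemma dual_class_eq_iff:
  assumes "f \<in> carrier (dual_group L)" "g \<in> carrier (dual_group L)"
  shows "dual_class L f = dual_class L g \<longleftrightarrow> g \<in> dual_class L f"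
proof -
  interpret D: comm_group "dual_group L" by (rule dual_comm_group)
  note H = to_dual_subgroup
  show ?thesis
    using D.repr_independence[OF _ assms(1) H, of g] dual_class_eq[OF assms(1)] dual_class_eq[OF assms(2)] dual_class_self[OF assms(2)]
    by metis
qed

lemma disc_group_group: "comm_group (disc_group L)"
  unfolding disc_group_def using comm_group.abelian_FactGroup[OF dual_comm_group to_dual_subgroup] .

lemma disc_mult:
  assumes "f \<in> carrier (dual_group L)" "g \<in> carrier (dual_group L)"
  shows "dual_class L f \<otimes>\<^bsub>disc_group L\<^esub> dual_class L g = dual_class L (f \<otimes>\<^bsub>dual_group L\<^esub> g)"
proof -
  interpret D: comm_group "dual_group L" by (rule dual_comm_group)
  interpret N: normal "to_dual L ` carrier L" "dual_group L"
    using D.subgroup_imp_normal[OF to_dual_subgroup] .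
  show ?thesis
    using N.rcos_sum[OF assms] dual_class_eq assms by (simp add: disc_group_def FactGroup_def)
qed

text \<open>A fixed \<open>N\<close> annihilates the discriminant group, so a class depends only on
  the values of a functional on a basis modulo \<open>N\<close>.\<close>

lemma disc_finite: "finite (carrier (disc_group L))"
proof -
  obtain r e c where c: "coordinates L r e c" using coordinates_ex by blast
  note C = coordinatesD[OF c]
  obtain N where N: "N > 0" "\<forall>h\<in>hom L integer_group. \<exists>x\<in>carrier L. \<forall>y\<in>carrier L. N * h y = form L x y"
    using dual_multiple by blast
  define key where "key f = map (\<lambda>i. f (e i) mod N) [0..<r]" for f :: "'a \<Rightarrow> int"
  have same: "dual_class L f = dual_class L g" if fg: "f \<in> carrier (dual_group L)" "g \<in> carrier (dual_group L)" "key f = key g" for f g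
  proof -
    have km: "(g (e i) - f (e i)) mod N = 0" if "i < r" for i
    proof -
      have "g (e i) mod N = f (e i) mod N" using fg(3) that by (simp add: key_def)
      then show ?thesis by (simp add: mod_eq_dvd_iff dvd_eq_mod_eq_0)
    qed
    define u where "u y = (\<Sum>i<r. c i y * ((g (e i) - f (e i)) div N))" for y
    have u: "u \<in> hom L integer_group"
      using hom_integer(1)[OF is_group C(2)] by (intro hom_integerI) (simp add: u_def sum.distrib distrib_right)
    obtain x where x: "x \<in> carrier L" "\<forall>y\<in>carrier L. N * u y = form L x y" using N u by blast
    have "g y = f y + form L x y" if y: "y \<in> carrier L" for y
    proof -
      have "N * u y = (\<Sum>i<r. c i y * (g (e i) - f (e i)))"
        unfolding u_def sum_distrib_left using km by (intro sum.cong) (auto simp: mod_eq_0_iff_dvd)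
      also have "\<dots> = g y - f y"
        using coordinates_expansion[OF is_group c y dual_hom[OF fg(1)]] coordinates_expansion[OF is_group c y dual_hom[OF fg(2)]]
        by (simp add: right_diff_distrib sum_subtractf)
      finally show ?thesis using x y by simp
    qed
    then have "g \<in> dual_class L f" using fg x unfolding dual_class_def by blast
    then show ?thesis using dual_class_eq_iff fg by blast
  qed
  have fin: "finite (key ` carrier (dual_group L))"
  proof (rule finite_subset)
    show "key ` carrier (dual_group L) \<subseteq> {xs. set xs \<subseteq> {0..<N} \<and> length xs = r}"
      using N(1) by (auto simp: key_def)
    show "finite {xs. set xs \<subseteq> {0..<N} \<and> length xs = r}" by (rule finite_lists_length_eq) simp
  qed
  have "dual_class L ` carrier (dual_group L) \<subseteq> (\<lambda>k. dual_class L (SOME f. f \<in> carrier (dual_group L) \<and> key f = k)) ` (key ` carrier (dual_group L))"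
  proof
    fix d assume "d \<in> dual_class L ` carrier (dual_group L)"
    then obtain f where f: "f \<in> carrier (dual_group L)" "d = dual_class L f" by blast
    have "(SOME g. g \<in> carrier (dual_group L) \<and> key g = key f) \<in> carrier (dual_group L) \<and> key (SOME g. g \<in> carrier (dual_group L) \<and> key g = key f) = key f"
      using someI[of "\<lambda>g. g \<in> carrier (dual_group L) \<and> key g = key f" f] f by simp
    then have "d = dual_class L (SOME g. g \<in> carrier (dual_group L) \<and> key g = key f)" using same f by metis
    then show "d \<in> (\<lambda>k. dual_class L (SOME f. f \<in> carrier (dual_group L) \<and> key f = k)) ` (key ` carrier (dual_group L))" using f by blast
  qed
  then show ?thesis unfolding disc_carrier using fin finite_subset by blast
qed

end

lemma mod_2Z_iff: "x \<in> mod_2Z r \<longleftrightarrow> (\<exists>k::int. x - r = 2 * of_int k)"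
  by (auto simp: mod_2Z_def algebra_simps)

lemma mod_2Z_eq_iff: "mod_2Z r = mod_2Z s \<longleftrightarrow> (\<exists>k::int. r - s = 2 * of_int k)"
proof
  assume "mod_2Z r = mod_2Z s"
  moreover have "r \<in> mod_2Z r" unfolding mod_2Z_iff by (intro exI[of _ 0]) simp
  ultimately show "\<exists>k::int. r - s = 2 * of_int k" by (simp add: mod_2Z_iff)
next
  assume "\<exists>k::int. r - s = 2 * of_int k"
  then obtain k where k: "r - s = 2 * of_int k" by blast
  have "x - r = 2 * of_int i \<Longrightarrow> x - s = 2 * of_int (i + k)" "x - s = 2 * of_int i \<Longrightarrow> x - r = 2 * of_int (i - k)" for x i
    using k by simp_all
  then show "mod_2Z r = mod_2Z s" unfolding set_eq_iff mod_2Z_iff by blast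
qed

lemma uminus_mod_2Z: "uminus ` mod_2Z r = mod_2Z (- r)"
proof -
  have "- x - r = 2 * of_int i \<longleftrightarrow> x - - r = 2 * of_int (- i)" for x i by auto
  then have m: "- x \<in> mod_2Z r \<longleftrightarrow> x \<in> mod_2Z (- r)" for x unfolding mod_2Z_iff by (metis minus_minus)
  show ?thesis
  proof (intro equalityI subsetI)
    fix x assume "x \<in> uminus ` mod_2Z r"
    then show "x \<in> mod_2Z (- r)" using m[of x] by auto
  next
    fix x assume "x \<in> mod_2Z (- r)"
    then have "- x \<in> mod_2Z r" using m by simp
    then show "x \<in> uminus ` mod_2Z r" by (rule rev_image_eqI) simp
  qed
qed

locale even_integral_lattice = integral_lattice L for L :: "'a zlat" (structure) +
  assumes even_form: "x \<in> carrier L \<Longrightarrow> even (form L x x)"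
begin

text \<open>Changing \<open>f\<close> by a lattice vector \<open>x\<close> changes its norm by
  \<open>2 * f x + form L x x\<close>, an even integer in an even lattice.\<close>

lemma disc_quad_class:
  assumes f: "f \<in> carrier (dual_group L)"
  shows "disc_quad L (dual_class L f) = mod_2Z (dual_norm L f)"
proof -
  have "mod_2Z (dual_norm L g) = mod_2Z (dual_norm L f)" if gf: "g \<in> dual_class L f" for g
  proof -
    obtain x where g: "g \<in> carrier (dual_group L)" and x: "x \<in> carrier L" "\<forall>y\<in>carrier L. g y = f y + form L x y"
      using gf by (auto simp: dual_class_def)
    note h = dual_hom[OF f] dual_hom[OF g] dual_hom[OF to_dual_carrier[OF x(1)]]
    have sp: "dual_form L g k = dual_form L f k + dual_form L (to_dual L x) k" if "k \<in> hom L integer_group" for k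
      using dual_form_add_left[OF h(1,3) that h(2)] x by (simp add: to_dual_apply)
    have "dual_form L g (to_dual L x) = of_int (g x)" "dual_form L f (to_dual L x) = of_int (f x)"
      using dual_form_to_dual[OF _ x(1) to_dual_apply] h by auto
    then have "dual_norm L g - dual_norm L f = of_int (g x) + of_int (f x)"
      using sp[OF h(2)] sp[OF h(1)] dual_form_sym[OF h(2,1)] dual_form_sym[OF h(3,2)] dual_form_sym[OF h(3,1)] h
      by (simp add: dual_norm_eq)
    also have "\<dots> = of_int (2 * f x + form L x x)" using x by simp
    finally have "dual_norm L g - dual_norm L f = of_int (2 * f x + form L x x)" .
    moreover obtain k where "form L x x = 2 * k" using even_form[OF x(1)] by blast
    ultimately have "dual_norm L g - dual_norm L f = 2 * of_int (f x + k)" by simp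
    then show ?thesis unfolding mod_2Z_eq_iff by blast
  qed
  then have "disc_quad L (dual_class L f) = (\<Union>g\<in>dual_class L f. mod_2Z (dual_norm L f))"
    unfolding disc_quad_def by (intro SUP_cong HOL.refl)
  then show ?thesis using dual_class_self[OF f] by (simp only: UN_constant) auto
qed

end

lemma even_integral_latticeI: "even_lattice L \<Longrightarrow> even_integral_lattice L"
  by (simp add: even_integral_lattice_def even_integral_lattice_axioms_def even_lattice_integral) (simp add: even_lattice_def)

text \<open>The kernel of an integral functional is a direct summand, so the projection onto it
  extends everything defined there.\<close>

lemma extend_from_kernel:
  fixes A (structure)
  assumes A: "comm_group A" and h: "h \<in> hom A integer_group" and f: "f \<in> hom (kernel_group A h) integer_group"
  shows "\<exists>f'\<in>hom A integer_group. \<forall>x\<in>carrier A. h x = 0 \<longrightarrow> f' x = f x"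
proof -
  interpret comm_group A by fact
  note H = hom_integer[OF is_group h]
  have fm: "f (x \<otimes> y) = f x + f y" if "x \<in> carrier A" "y \<in> carrier A" "h x = 0" "h y = 0" for x y
    using f that by (auto simp: hom_def kernel_group_def)
  show ?thesis
  proof (cases "\<exists>y\<in>carrier A. h y \<noteq> 0")
    case False
    then show ?thesis using fm by (intro bexI[of _ f] hom_integerI) auto
  next
    case True
    then obtain a d where a: "a \<in> carrier A" "d > 0" "h a = d" "\<forall>x\<in>carrier A. d dvd h x"
      using hom_integer_split[OF A h] by blast
    define q where "q x = h x div d" for x
    have hq: "h x = d * q x" if "x \<in> carrier A" for x using that a by (simp add: q_def)
    have qm: "q (x \<otimes> y) = q x + q y" if "x \<in> carrier A" "y \<in> carrier A" for x y
      using hq[of x] hq[of y] hq[of "x \<otimes> y"] H(1)[OF that] that a(2) by (simp flip: distrib_left)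
    define p where "p x = x \<otimes> a [^] (- q x)" for x
    have pc: "p x \<in> carrier A" "h (p x) = 0" if x: "x \<in> carrier A" for x
    proof -
      have "h (p x) = h x + (- q x) * d" using x a(1,3) H(1,4) by (simp add: p_def)
      then show "h (p x) = 0" "p x \<in> carrier A" using hq[OF x] x a(1) by (simp_all add: p_def)
    qed
    have pm: "p (x \<otimes> y) = p x \<otimes> p y" if "x \<in> carrier A" "y \<in> carrier A" for x y
    proof -
      have "a [^] (- q (x \<otimes> y)) = a [^] (- q x) \<otimes> a [^] (- q y)"
        using a(1) qm[OF that] int_pow_mult[of a "- q x" "- q y"] by simp
      then show ?thesis using that a(1) by (simp add: p_def m_ac)
    qed
    have "(\<lambda>x. f (p x)) \<in> hom A integer_group"
      using pm fm pc by (intro hom_integerI) simp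
    moreover have "p x = x" if "x \<in> carrier A" "h x = 0" for x using that a(1) by (simp add: p_def q_def)
    ultimately show ?thesis by (intro bexI[of _ "\<lambda>x. f (p x)"]) auto
  qed
qed

text \<open>Extension of functionals from a primitive sublattice, presented as the common kernel of
  finitely many functionals; additivity of \<open>f\<close> is available only on that
  kernel.\<close>

lemma extend_from_joint_kernel:
  assumes "comm_group A" "\<forall>i<n::nat. h i \<in> hom A integer_group"
    "\<And>x y. x \<in> carrier A \<Longrightarrow> y \<in> carrier A \<Longrightarrow> \<forall>i<n. h i x = 0 \<Longrightarrow> \<forall>i<n. h i y = 0 \<Longrightarrow> f (x \<otimes>\<^bsub>A\<^esub> y) = f x + f y"
  shows "\<exists>f'\<in>hom A integer_group. \<forall>x\<in>carrier A. (\<forall>i<n. h i x = 0) \<longrightarrow> f' x = f x"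
  using assms
proof (induction n arbitrary: A)
  case 0
  then show ?case by (intro bexI[of _ f] hom_integerI) auto
next
  case (Suc n)
  have hn: "h n \<in> hom A integer_group" using Suc.prems by blast
  let ?K = "kernel_group A (h n)"
  have "\<exists>f'\<in>hom ?K integer_group. \<forall>x\<in>carrier ?K. (\<forall>i<n. h i x = 0) \<longrightarrow> f' x = f x"
  proof (rule Suc.IH)
    show "comm_group ?K" by (rule kernel_group(2)[OF Suc.prems(1) hn])
    show "\<forall>i<n. h i \<in> hom ?K integer_group" using Suc.prems(2) by (auto intro!: hom_kernel_group)
  qed (use Suc.prems(3) in \<open>auto simp: kernel_group_def less_Suc_eq\<close>)
  then obtain f1 where f1: "f1 \<in> hom ?K integer_group" "\<forall>x\<in>carrier ?K. (\<forall>i<n. h i x = 0) \<longrightarrow> f1 x = f x" by blast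
  obtain f' where "f' \<in> hom A integer_group" "\<forall>x\<in>carrier A. h n x = 0 \<longrightarrow> f' x = f1 x"
    using extend_from_kernel[OF Suc.prems(1) hn f1(1)] by blast
  then show ?case using f1(2) by (intro bexI[of _ f']) (auto simp: kernel_group_def less_Suc_eq)
qed

section \<open>Gluing maps of primitive embeddings\<close>

definition restr :: "'a zlat \<Rightarrow> 'b zlat \<Rightarrow> ('b \<Rightarrow> 'a) \<Rightarrow> 'a \<Rightarrow> 'b \<Rightarrow> int" where
  "restr L T i x = (\<lambda>t\<in>carrier T. form L x (i t))"

text \<open>Defined on whole classes, so that no representative has to be chosen;
  \<open>glue_map_class\<close> shows that the image is a single class.\<close>

definition glue_map :: "'a zlat \<Rightarrow> 'b zlat \<Rightarrow> 'c zlat \<Rightarrow> ('b \<Rightarrow> 'a) \<Rightarrow> ('c \<Rightarrow> 'a) \<Rightarrow> ('b \<Rightarrow> int) set \<Rightarrow> ('c \<Rightarrow> int) set" where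
  "glue_map L T S i j = (\<lambda>c\<in>carrier (disc_group T). restr L S j ` {x\<in>carrier L. restr L T i x \<in> c})"

locale glue_pair = L: even_integral_lattice L + T: even_integral_lattice T + S: even_integral_lattice S
  for L :: "'a zlat" and T :: "'b zlat" and S :: "'c zlat" +
  fixes i :: "'b \<Rightarrow> 'a" and j :: "'c \<Rightarrow> 'a"
  assumes unimod: "unimodular L"
    and i_hom: "i \<in> hom T L" and j_hom: "j \<in> hom S L"
    and i_form: "x \<in> carrier T \<Longrightarrow> y \<in> carrier T \<Longrightarrow> form L (i x) (i y) = form T x y"
    and j_form: "u \<in> carrier S \<Longrightarrow> v \<in> carrier S \<Longrightarrow> form L (j u) (j v) = form S u v"
    and i_prim: "z \<in> carrier L \<Longrightarrow> (n::nat) > 0 \<Longrightarrow> z [^]\<^bsub>L\<^esub> n \<in> i ` carrier T \<Longrightarrow> z \<in> i ` carrier T"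
    and j_image: "j ` carrier S = {y\<in>carrier L. \<forall>x\<in>i ` carrier T. form L x y = 0}"
begin

sublocale I: group_hom T L i using i_hom by unfold_locales
sublocale J: group_hom S L j using j_hom by unfold_locales

abbreviation "rT \<equiv> restr L T i"
abbreviation "rS \<equiv> restr L S j"

lemma orth: "t \<in> carrier T \<Longrightarrow> s \<in> carrier S \<Longrightarrow> form L (i t) (j s) = 0"
  "t \<in> carrier T \<Longrightarrow> s \<in> carrier S \<Longrightarrow> form L (j s) (i t) = 0"
proof -
  assume ts: "t \<in> carrier T" "s \<in> carrier S"
  then have "j s \<in> {y\<in>carrier L. \<forall>x\<in>i ` carrier T. form L x y = 0}" using j_image by blast
  then show "form L (i t) (j s) = 0" using ts by blast
  then show "form L (j s) (i t) = 0" using L.form_sym ts by simp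
qed

lemma in_j_image: "y \<in> carrier L \<Longrightarrow> (\<And>t. t \<in> carrier T \<Longrightarrow> form L y (i t) = 0) \<Longrightarrow> y \<in> j ` carrier S"
  unfolding j_image using L.form_sym by auto

lemma rT_hom: "x \<in> carrier L \<Longrightarrow> (\<lambda>t. form L x (i t)) \<in> hom T integer_group"
  by (intro hom_integerI) (simp add: L.form_right)

lemma rS_hom: "x \<in> carrier L \<Longrightarrow> (\<lambda>s. form L x (j s)) \<in> hom S integer_group"
  by (intro hom_integerI) (simp add: L.form_right)

lemma rT_dual: "x \<in> carrier L \<Longrightarrow> rT x \<in> carrier (dual_group T)"
  unfolding restr_def using T.restrict_dual[OF rT_hom] .

lemma rS_dual: "x \<in> carrier L \<Longrightarrow> rS x \<in> carrier (dual_group S)"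
  unfolding restr_def using S.restrict_dual[OF rS_hom] .

lemma rT_apply: "t \<in> carrier T \<Longrightarrow> rT x t = form L x (i t)" by (simp add: restr_def)
lemma rS_apply: "s \<in> carrier S \<Longrightarrow> rS x s = form L x (j s)" by (simp add: restr_def)

text \<open>\<open>T\<close> and \<open>S\<close> together have full rank: a multiple of the
  projection of \<open>x\<close> to \<open>T\<close> is a vector of \<open>T\<close>, and the
  difference is orthogonal to \<open>T\<close>.\<close>

lemma sum_multiple:
  assumes x: "x \<in> carrier L"
  shows "\<exists>N>0. \<exists>t\<in>carrier T. \<exists>s\<in>carrier S. x [^]\<^bsub>L\<^esub> (N::int) = i t \<otimes>\<^bsub>L\<^esub> j s"
proof -
  obtain N t where N: "N > 0" "t \<in> carrier T" "\<And>y. y \<in> carrier T \<Longrightarrow> N * form L x (i y) = form T t y"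
    by (rule T.dual_rep[OF rT_hom[OF x]]) (rule that)
  define y where "y = x [^]\<^bsub>L\<^esub> N \<otimes>\<^bsub>L\<^esub> inv\<^bsub>L\<^esub> (i t)"
  have yL: "y \<in> carrier L" using x N by (simp add: y_def)
  have "form L y (i u) = 0" if "u \<in> carrier T" for u
    using x N that by (simp add: y_def L.form_left i_form)
  then obtain s where s: "s \<in> carrier S" "y = j s" using in_j_image[OF yL] by blast
  have "x [^]\<^bsub>L\<^esub> N = y \<otimes>\<^bsub>L\<^esub> i t" using x N by (simp add: y_def L.m_assoc)
  then have "x [^]\<^bsub>L\<^esub> N = i t \<otimes>\<^bsub>L\<^esub> j s" using yL N s L.m_comm by simp
  then show ?thesis using N s by blast
qed

lemma faithful:
  assumes x: "x \<in> carrier L" "\<And>t. t \<in> carrier T \<Longrightarrow> form L x (i t) = 0" "\<And>s. s \<in> carrier S \<Longrightarrow> form L x (j s) = 0"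
  shows "x = \<one>\<^bsub>L\<^esub>"
proof (rule L.form_nondegenerate[OF x(1)])
  fix y assume y: "y \<in> carrier L"
  obtain N t s where N: "N > 0" "t \<in> carrier T" "s \<in> carrier S" "y [^]\<^bsub>L\<^esub> (N::int) = i t \<otimes>\<^bsub>L\<^esub> j s"
    using sum_multiple[OF y] by blast
  have "N * form L x y = form L x (y [^]\<^bsub>L\<^esub> N)" using x y by (simp add: L.form_right)
  also have "\<dots> = 0" unfolding N(4) using x N by (simp add: L.form_right)
  finally show "form L x y = 0" using N by simp
qed

lemma res_inj:
  assumes "x \<in> carrier L" "y \<in> carrier L" "rT x = rT y" "rS x = rS y"
  shows "x = y"
proof -
  have "form L x (i t) = form L y (i t)" if "t \<in> carrier T" for t
    using fun_cong[OF assms(3), of t] that by (simp add: restr_def)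
  moreover have "form L x (j s) = form L y (j s)" if "s \<in> carrier S" for s
    using fun_cong[OF assms(4), of s] that by (simp add: restr_def)
  ultimately have "x \<otimes>\<^bsub>L\<^esub> inv\<^bsub>L\<^esub> y = \<one>\<^bsub>L\<^esub>"
    using assms(1,2) by (intro faithful) (simp_all add: L.form_left)
  then show ?thesis using assms(1,2) by (metis L.inv_closed L.inv_equality L.inv_inv)
qed

text \<open>A primitive sublattice is its own double orthogonal complement: a multiple of
  \<open>x\<close> has no component in \<open>S\<close>, so it lies in \<open>T\<close>, and
  primitivity removes the factor.\<close>

lemma in_i_image:
  assumes x: "x \<in> carrier L" "\<And>s. s \<in> carrier S \<Longrightarrow> form L x (j s) = 0"
  shows "x \<in> i ` carrier T"
proof -
  obtain N t s where N: "N > 0" "t \<in> carrier T" "s \<in> carrier S" "x [^]\<^bsub>L\<^esub> (N::int) = i t \<otimes>\<^bsub>L\<^esub> j s"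
    using sum_multiple[OF x(1)] by blast
  have "j s = \<one>\<^bsub>L\<^esub>"
  proof (rule faithful)
    fix u assume u: "u \<in> carrier S"
    have "form L (x [^]\<^bsub>L\<^esub> N) (j u) = 0" using x u by (simp add: L.form_left)
    then show "form L (j s) (j u) = 0" unfolding N(4) using N u orth by (simp add: L.form_left)
  qed (use N orth in auto)
  then have "x [^]\<^bsub>L\<^esub> nat N = i t" using N by (simp add: int_pow_int[symmetric])
  then show ?thesis using i_prim[OF x(1), of "nat N"] N by simp
qed

text \<open>\<open>T\<close> is the common kernel of the products with a basis of \<open>S\<close>,
  so a functional on \<open>T\<close> extends to \<open>L\<close>, where unimodularity represents it
  by a vector.\<close>

lemma rT_surj:
  assumes f: "f \<in> carrier (dual_group T)" shows "\<exists>x\<in>carrier L. rT x = f"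
proof -
  obtain r e c where c: "coordinates S r e c" using S.coordinates_ex by blast
  note C = coordinatesD[OF c]
  define h where "h k x = form L x (j (e k))" for k x
  have h: "\<forall>k<r. h k \<in> hom L integer_group" unfolding h_def using C(1) L.form_hom_left by simp
  have K: "x \<in> i ` carrier T" if x: "x \<in> carrier L" "\<forall>k<r. h k x = 0" for x
  proof (rule in_i_image[OF x(1)])
    fix s assume s: "s \<in> carrier S"
    show "form L x (j s) = 0"
      using coordinates_expansion[OF S.is_group c s rS_hom[OF x(1)]] x(2) by (simp add: h_def)
  qed
  have inj: "inj_on i (carrier T)" using T.inj_on_form[where f=i and B="form L"] i_form .
  define g where "g x = f (inv_into (carrier T) i x)" for x
  have gi: "g (i t) = f t" if "t \<in> carrier T" for t
    using that inj by (simp add: g_def)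
  have "\<exists>f'\<in>hom L integer_group. \<forall>x\<in>carrier L. (\<forall>k<r. h k x = 0) \<longrightarrow> f' x = g x"
  proof (rule extend_from_joint_kernel[OF L.comm_group_axioms h])
    fix x y assume xy: "x \<in> carrier L" "y \<in> carrier L" "\<forall>k<r. h k x = 0" "\<forall>k<r. h k y = 0"
    from K[OF xy(1,3)] K[OF xy(2,4)] obtain t u where "t \<in> carrier T" "u \<in> carrier T" "x = i t" "y = i u" by blast
    then show "g (x \<otimes>\<^bsub>L\<^esub> y) = g x + g y"
      using gi gi[of "t \<otimes>\<^bsub>T\<^esub> u"] hom_integer(1)[OF T.is_group T.dual_hom[OF f]] by simp
  qed
  then obtain f' where f': "f' \<in> hom L integer_group" "\<forall>x\<in>carrier L. (\<forall>k<r. h k x = 0) \<longrightarrow> f' x = g x" by blast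
  have "restrict f' (carrier L) \<in> to_dual L ` carrier L"
    using unimod L.restrict_dual[OF f'(1)] by (simp add: unimodular_def bij_betw_def)
  then obtain x where x: "x \<in> carrier L" "to_dual L x = restrict f' (carrier L)" by auto
  have "rT x t = f t" if t: "t \<in> carrier T" for t
  proof -
    have "form L x (i t) = f' (i t)" using fun_cong[OF x(2), of "i t"] t by (simp add: to_dual_def)
    also have "\<dots> = f t" using f'(2) t C(1) orth gi by (simp add: h_def)
    finally show ?thesis using t by (simp add: restr_def)
  qed
  then show ?thesis using x(1) T.dual_eqI[OF rT_dual f] by blast
qed

text \<open>The complement is primitive too, so \<open>T\<close> and \<open>S\<close> play symmetric
  roles and facts about one restriction carry over to the other.\<close>

lemma swap: "glue_pair L S T j i"
proof unfold_locales
  show "z \<in> j ` carrier S" if z: "z \<in> carrier L" "n > 0" "z [^]\<^bsub>L\<^esub> n \<in> j ` carrier S" for z and n :: nat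
  proof (rule in_j_image[OF z(1)])
    fix t assume t: "t \<in> carrier T"
    have "form L (z [^]\<^bsub>L\<^esub> n) (i t) = 0" using z(3) t orth by auto
    then show "form L z (i t) = 0" using z t by (simp add: L.form_left)
  qed
  show "i ` carrier T = {y\<in>carrier L. \<forall>x\<in>j ` carrier S. form L x y = 0}"
  proof (intro equalityI subsetI)
    fix y assume "y \<in> {y\<in>carrier L. \<forall>x\<in>j ` carrier S. form L x y = 0}"
    then show "y \<in> i ` carrier T" using L.form_sym by (intro in_i_image) auto
  qed (auto simp: orth)
qed (simp_all add: unimod i_hom j_hom i_form j_form)

lemma rS_surj: "f \<in> carrier (dual_group S) \<Longrightarrow> \<exists>x\<in>carrier L. rS x = f"
  by (rule glue_pair.rT_surj[OF swap])

lemma form_decomposition: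
  assumes x: "x \<in> carrier L" and y: "y \<in> carrier L"
  shows "of_int (form L x y) = dual_form T (rT x) (rT y) + dual_form S (rS x) (rS y)"
proof -
  obtain N t s where N: "N > 0" "t \<in> carrier T" "s \<in> carrier S" "y [^]\<^bsub>L\<^esub> (N::int) = i t \<otimes>\<^bsub>L\<^esub> j s"
    using sum_multiple[OF y] by blast
  have m: "N * form L y z = form L (i t) z + form L (j s) z" if "z \<in> carrier L" for z
  proof -
    have "N * form L y z = form L (y [^]\<^bsub>L\<^esub> N) z" using y that by (simp add: L.form_left)
    then show ?thesis unfolding N(4) using N that by (simp add: L.form_left)
  qed
  have "dual_form T (rT x) (rT y) = of_int (rT x t) / of_int N"
    using N m orth i_form by (intro T.dual_form_eq T.dual_hom rT_dual x) (simp_all add: rT_apply)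
  moreover have "dual_form S (rS x) (rS y) = of_int (rS x s) / of_int N"
    using N m orth j_form by (intro S.dual_form_eq S.dual_hom rS_dual x) (simp_all add: rS_apply)
  moreover have "N * form L x y = form L x (i t) + form L x (j s)"
    using m[OF x] x y N L.form_sym by simp
  then have "rat_of_int N * of_int (form L x y) = of_int (form L x (i t)) + of_int (form L x (j s))"
    by (metis of_int_add of_int_mult)
  ultimately have "rat_of_int N * of_int (form L x y) = of_int N * (dual_form T (rT x) (rT y) + dual_form S (rS x) (rS y))"
    using N by (simp add: rT_apply rS_apply distrib_left)
  then show ?thesis using N(1) by simp
qed

text \<open>If the restrictions to \<open>T\<close> differ by a vector \<open>t\<close> of
  \<open>T\<close>, then \<open>x - y - t\<close> is orthogonal to \<open>T\<close> and hence a
  vector of \<open>S\<close>, by which the restrictions to \<open>S\<close> differ. This makes the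
  pairs of classes the graph of a bijection.\<close>

lemma rT_class_iff:
  assumes x: "x \<in> carrier L" and y: "y \<in> carrier L"
  shows "rT x \<in> dual_class T (rT y) \<longleftrightarrow> rS x \<in> dual_class S (rS y)"
proof
  assume "rT x \<in> dual_class T (rT y)"
  then obtain t where t: "t \<in> carrier T" "\<forall>u\<in>carrier T. rT x u = rT y u + form T t u" by (auto simp: dual_class_def)
  define z where "z = x \<otimes>\<^bsub>L\<^esub> inv\<^bsub>L\<^esub> (y \<otimes>\<^bsub>L\<^esub> i t)"
  have z: "z \<in> carrier L" using x y t by (simp add: z_def)
  have "form L z (i u) = 0" if "u \<in> carrier T" for u
    using t that x y by (simp add: z_def L.form_left i_form rT_apply)
  then obtain s where s: "s \<in> carrier S" "z = j s" using in_j_image[OF z] by blast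
  have "rS x u = rS y u + form S s u" if u: "u \<in> carrier S" for u
  proof -
    have "form L z (j u) = form S s u" using s u j_form by simp
    then show ?thesis using u t x y orth by (simp add: z_def L.form_left rS_apply)
  qed
  then show "rS x \<in> dual_class S (rS y)" using s x rS_dual unfolding dual_class_def by blast
next
  assume "rS x \<in> dual_class S (rS y)"
  then obtain t where t: "t \<in> carrier S" "\<forall>u\<in>carrier S. rS x u = rS y u + form S t u" by (auto simp: dual_class_def)
  define z where "z = x \<otimes>\<^bsub>L\<^esub> inv\<^bsub>L\<^esub> (y \<otimes>\<^bsub>L\<^esub> j t)"
  have z: "z \<in> carrier L" using x y t by (simp add: z_def)
  have "form L z (j u) = 0" if "u \<in> carrier S" for u
    using t that x y by (simp add: z_def L.form_left j_form rS_apply)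
  then obtain s where s: "s \<in> carrier T" "z = i s" using in_i_image[OF z] by blast
  have "rT x u = rT y u + form T s u" if u: "u \<in> carrier T" for u
  proof -
    have "form L z (i u) = form T s u" using s u i_form by simp
    then show ?thesis using u t x y orth by (simp add: z_def L.form_left rT_apply)
  qed
  then show "rT x \<in> dual_class T (rT y)" using s x rT_dual unfolding dual_class_def by blast
qed

lemma glue_map_class:
  assumes x: "x \<in> carrier L"
  shows "glue_map L T S i j (dual_class T (rT x)) = dual_class S (rS x)"
proof -
  have c: "dual_class T (rT x) \<in> carrier (disc_group T)" using T.disc_carrier rT_dual[OF x] by blast
  have "restr L S j ` {y\<in>carrier L. rT y \<in> dual_class T (rT x)} = dual_class S (rS x)"
  proof (intro equalityI subsetI)
    fix f assume "f \<in> restr L S j ` {y\<in>carrier L. rT y \<in> dual_class T (rT x)}"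
    then show "f \<in> dual_class S (rS x)" using rT_class_iff x by auto
  next
    fix f assume f: "f \<in> dual_class S (rS x)"
    then obtain y where "y \<in> carrier L" "rS y = f" using rS_surj by (auto simp: dual_class_def)
    then show "f \<in> restr L S j ` {y\<in>carrier L. rT y \<in> dual_class T (rT x)}" using f rT_class_iff x by blast
  qed
  then show ?thesis using c by (simp add: glue_map_def)
qed

lemma disc_T_cases:
  assumes "c \<in> carrier (disc_group T)" obtains x where "x \<in> carrier L" "c = dual_class T (rT x)"
  using assms rT_surj unfolding T.disc_carrier by blast

lemma disc_S_cases:
  assumes "c \<in> carrier (disc_group S)" obtains x where "x \<in> carrier L" "c = dual_class S (rS x)"
  using assms rS_surj unfolding S.disc_carrier by blast

lemma rT_mult: "x \<in> carrier L \<Longrightarrow> y \<in> carrier L \<Longrightarrow> rT (x \<otimes>\<^bsub>L\<^esub> y) = rT x \<otimes>\<^bsub>dual_group T\<^esub> rT y"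
  by (auto simp: restr_def dual_group_def L.form_left fun_eq_iff)

lemma rS_mult: "x \<in> carrier L \<Longrightarrow> y \<in> carrier L \<Longrightarrow> rS (x \<otimes>\<^bsub>L\<^esub> y) = rS x \<otimes>\<^bsub>dual_group S\<^esub> rS y"
  by (auto simp: restr_def dual_group_def L.form_left fun_eq_iff)

text \<open>The norms of the two restrictions of \<open>x\<close> add up to
  \<open>form L x x\<close>, which is even; this is the sign change between the two discriminant
  forms.\<close>

lemma glue_map_isometry:
  "glue_map L T S i j \<in> quad_isometries (disc_group T) (neg_disc_quad T) (disc_group S) (disc_quad S)"
proof -
  let ?g = "glue_map L T S i j"
  have cl: "?g c \<in> carrier (disc_group S)" if "c \<in> carrier (disc_group T)" for c
    using that by (elim disc_T_cases) (auto simp: glue_map_class S.disc_carrier rS_dual)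
  have hom: "?g (c \<otimes>\<^bsub>disc_group T\<^esub> d) = ?g c \<otimes>\<^bsub>disc_group S\<^esub> ?g d"
    if "c \<in> carrier (disc_group T)" "d \<in> carrier (disc_group T)" for c d
    using that
  proof (elim disc_T_cases)
    fix x y assume xy: "x \<in> carrier L" "c = dual_class T (rT x)" "y \<in> carrier L" "d = dual_class T (rT y)"
    then have "c \<otimes>\<^bsub>disc_group T\<^esub> d = dual_class T (rT (x \<otimes>\<^bsub>L\<^esub> y))"
      by (simp add: T.disc_mult rT_dual rT_mult)
    then show ?thesis using xy by (simp add: glue_map_class S.disc_mult rS_dual rS_mult)
  qed
  have inj: "c = d" if "c \<in> carrier (disc_group T)" "d \<in> carrier (disc_group T)" "?g c = ?g d" for c d
    using that(1,2)
  proof (elim disc_T_cases)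
    fix x y assume xy: "x \<in> carrier L" "c = dual_class T (rT x)" "y \<in> carrier L" "d = dual_class T (rT y)"
    then have "dual_class S (rS x) = dual_class S (rS y)" using that(3) by (simp add: glue_map_class)
    then show "c = d" using xy rT_class_iff[of y x] S.dual_class_eq_iff T.dual_class_eq_iff rS_dual rT_dual by simp
  qed
  have surj: "d \<in> ?g ` carrier (disc_group T)" if "d \<in> carrier (disc_group S)" for d
    using that
  proof (elim disc_S_cases)
    fix x assume x: "x \<in> carrier L" "d = dual_class S (rS x)"
    then have "?g (dual_class T (rT x)) = d" "dual_class T (rT x) \<in> carrier (disc_group T)"
      by (auto simp: glue_map_class T.disc_carrier rT_dual)
    then show ?thesis by blast
  qed
  have quad: "disc_quad S (?g c) = neg_disc_quad T c" if "c \<in> carrier (disc_group T)" for c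
    using that
  proof (elim disc_T_cases)
    fix x assume x: "x \<in> carrier L" "c = dual_class T (rT x)"
    obtain k where k: "form L x x = 2 * k" using L.even_form[OF x(1)] by blast
    have "dual_norm S (rS x) - (- dual_norm T (rT x)) = of_int (form L x x)"
      using form_decomposition[OF x(1) x(1)]
      by (simp add: S.dual_norm_eq T.dual_norm_eq S.dual_hom T.dual_hom rS_dual rT_dual x(1))
    also have "\<dots> = 2 * of_int k" by (simp add: k)
    finally have "mod_2Z (dual_norm S (rS x)) = mod_2Z (- dual_norm T (rT x))" unfolding mod_2Z_eq_iff by blast
    then show ?thesis using x
      by (simp add: glue_map_class neg_disc_quad_def T.disc_quad_class S.disc_quad_class rT_dual rS_dual uminus_mod_2Z)
  qed
  have "bij_betw ?g (carrier (disc_group T)) (carrier (disc_group S))"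
    unfolding bij_betw_def
  proof (intro conjI equalityI subsetI)
    show "inj_on ?g (carrier (disc_group T))" using inj by (intro inj_onI)
    show "d \<in> carrier (disc_group S)" if "d \<in> ?g ` carrier (disc_group T)" for d using that cl by auto
  qed (rule surj)
  moreover have "?g \<in> extensional (carrier (disc_group T))" by (simp add: glue_map_def)
  ultimately show ?thesis using hom cl quad by (auto simp: quad_isometries_def iso_def hom_def)
qed

text \<open>The union of the two frames is complete because \<open>T\<close> and \<open>S\<close>
  together have full rank, and the counts of positive and negative members add.\<close>

lemma lattice_frame_glue:
  assumes F: "lattice_frame T F" and F': "lattice_frame S F'"
    and sg: "frame_signature T F = (p, q)" "frame_signature S F' = (p', q')"
  shows "lattice_frame L (i ` F \<union> j ` F') \<and> frame_signature L (i ` F \<union> j ` F') = (p + p', q + q')"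
proof -
  have FT: "F \<subseteq> carrier T" "finite F" and FS: "F' \<subseteq> carrier S" "finite F'" using F F' by (auto simp: lattice_frame_def)
  have fi: "form L (i x) (i y) = form T x y" if "x \<in> F" "y \<in> F" for x y using that FT i_form by blast
  have fj: "form L (j x) (j y) = form S x y" if "x \<in> F'" "y \<in> F'" for x y using that FS j_form by blast
  have fo: "form L (i x) (j y) = 0" "form L (j y) (i x) = 0" if "x \<in> F" "y \<in> F'" for x y using that FT FS orth by blast+
  have nz: "form T x x \<noteq> 0" if "x \<in> F" for x using that F by (simp add: lattice_frame_def)
  have nz': "form S x x \<noteq> 0" if "x \<in> F'" for x using that F' by (simp add: lattice_frame_def)
  have ox: "form T x y = 0" if "x \<in> F" "y \<in> F" "x \<noteq> y" for x y using that F by (simp add: lattice_frame_def)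
  have ox': "form S x y = 0" if "x \<in> F'" "y \<in> F'" "x \<noteq> y" for x y using that F' by (simp add: lattice_frame_def)
  have inj: "inj_on i F"
  proof (rule inj_onI, rule ccontr)
    fix x y assume xy: "x \<in> F" "y \<in> F" "i x = i y" "x \<noteq> y"
    then show False using fi[of x x] fi[of x y] ox[of x y] nz[of x] by simp
  qed
  have inj': "inj_on j F'"
  proof (rule inj_onI, rule ccontr)
    fix x y assume xy: "x \<in> F'" "y \<in> F'" "j x = j y" "x \<noteq> y"
    then show False using fj[of x x] fj[of x y] ox'[of x y] nz'[of x] by simp
  qed
  have disj: "i ` F \<inter> j ` F' = {}"
  proof (rule ccontr)
    assume "i ` F \<inter> j ` F' \<noteq> {}"
    then obtain x y where xy: "x \<in> F" "y \<in> F'" "i x = j y" by auto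
    then show False using fi[of x x] fo[of x y] nz[of x] by simp
  qed
  have "lattice_frame L (i ` F \<union> j ` F')"
    unfolding lattice_frame_def
  proof (intro conjI ballI impI)
    show "finite (i ` F \<union> j ` F')" using FT FS by simp
    show "i ` F \<union> j ` F' \<subseteq> carrier L" using FT FS by auto
    fix f assume f: "f \<in> i ` F \<union> j ` F'"
    then show "form L f f \<noteq> 0" using fi fj nz nz' by auto
    fix g assume g: "g \<in> i ` F \<union> j ` F'" "f \<noteq> g"
    show "form L f g = 0"
      using f g(1)
    proof (elim UnE imageE)
      fix x y assume "f = i x" "x \<in> F" "g = i y" "y \<in> F"
      then show ?thesis using fi ox g(2) by auto
    next
      fix x y assume "f = j x" "x \<in> F'" "g = j y" "y \<in> F'"
      then show ?thesis using fj ox' g(2) by auto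
    qed (simp_all add: fo)
  next
    fix x assume x: "x \<in> carrier L" "\<forall>f\<in>i ` F \<union> j ` F'. form L x f = 0"
    obtain N t s where N: "N > 0" "t \<in> carrier T" "s \<in> carrier S" "x [^]\<^bsub>L\<^esub> (N::int) = i t \<otimes>\<^bsub>L\<^esub> j s"
      using sum_multiple[OF x(1)] by blast
    have m: "N * form L x z = form L (i t) z + form L (j s) z" if "z \<in> carrier L" for z
    proof -
      have "N * form L x z = form L (x [^]\<^bsub>L\<^esub> N) z" using x that by (simp add: L.form_left)
      then show ?thesis unfolding N(4) using N that by (simp add: L.form_left)
    qed
    have "form T t f = 0" if "f \<in> F" for f
      using m[of "i f"] x(2) that FT orth N i_form by (auto simp: subset_iff)
    then have t: "t = \<one>\<^bsub>T\<^esub>" using F N by (simp add: lattice_frame_def)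
    have "form S s f = 0" if "f \<in> F'" for f
      using m[of "j f"] x(2) that FS orth N j_form by (auto simp: subset_iff)
    then have s: "s = \<one>\<^bsub>S\<^esub>" using F' N by (simp add: lattice_frame_def)
    show "x = \<one>\<^bsub>L\<^esub>"
    proof (rule L.form_nondegenerate[OF x(1)])
      fix z assume z: "z \<in> carrier L"
      then show "form L x z = 0" using m[OF z] N(1) by (simp add: t s L.form_left)
    qed
  qed
  moreover have "{f \<in> i ` F \<union> j ` F'. 0 < form L f f} = i ` {f\<in>F. 0 < form T f f} \<union> j ` {f\<in>F'. 0 < form S f f}"
    "{f \<in> i ` F \<union> j ` F'. form L f f < 0} = i ` {f\<in>F. form T f f < 0} \<union> j ` {f\<in>F'. form S f f < 0}"
    using fi fj by auto
  moreover have "card (i ` A \<union> j ` A') = card A + card A'" if A: "A \<subseteq> F" "A' \<subseteq> F'" for A A'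
  proof -
    have "card (i ` A \<union> j ` A') = card (i ` A) + card (j ` A')"
      using A disj FT FS by (intro card_Un_disjoint) (auto intro: finite_subset)
    then show ?thesis using A inj inj' by (simp add: card_image inj_on_subset)
  qed
  ultimately show ?thesis using sg by (auto simp: frame_signature_def)
qed

end

section \<open>Isometries and their effect on frames and gluing maps\<close>

lemma isometriesD:
  assumes "f \<in> isometries L M"
  shows "f \<in> hom L M" "bij_betw f (carrier L) (carrier M)" "f \<in> extensional (carrier L)"
    "\<And>x. x \<in> carrier L \<Longrightarrow> f x \<in> carrier M"
    "\<And>x y. x \<in> carrier L \<Longrightarrow> y \<in> carrier L \<Longrightarrow> f (x \<otimes>\<^bsub>L\<^esub> y) = f x \<otimes>\<^bsub>M\<^esub> f y"
    "\<And>x y. x \<in> carrier L \<Longrightarrow> y \<in> carrier L \<Longrightarrow> form M (f x) (f y) = form L x y"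
  using assms by (auto simp: isometries_def iso_def hom_def)

lemma isometriesI:
  assumes "bij_betw f (carrier L) (carrier M)" "f \<in> extensional (carrier L)"
    "\<And>x y. x \<in> carrier L \<Longrightarrow> y \<in> carrier L \<Longrightarrow> f (x \<otimes>\<^bsub>L\<^esub> y) = f x \<otimes>\<^bsub>M\<^esub> f y"
    "\<And>x y. x \<in> carrier L \<Longrightarrow> y \<in> carrier L \<Longrightarrow> form M (f x) (f y) = form L x y"
  shows "f \<in> isometries L M"
  using assms by (auto simp: isometries_def iso_def hom_def bij_betw_def)

lemma isometries_inverse:
  assumes f: "f \<in> isometries L M" and L: "group L"
  shows "restrict (inv_into (carrier L) f) (carrier M) \<in> isometries M L"
proof (rule isometriesI)
  interpret group L by fact
  note F = isometriesD[OF f]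
  have b: "bij_betw (inv_into (carrier L) f) (carrier M) (carrier L)" using bij_betw_inv_into[OF F(2)] .
  then show "bij_betw (restrict (inv_into (carrier L) f) (carrier M)) (carrier M) (carrier L)" by (subst bij_betw_restrict_eq)
  have c: "inv_into (carrier L) f x \<in> carrier L" "f (inv_into (carrier L) f x) = x" if "x \<in> carrier M" for x
    using that F(2) by (auto simp: bij_betw_def inv_into_into f_inv_into_f)
  have e: "inv_into (carrier L) f (f x) = x" if "x \<in> carrier L" for x using that F(2) by (simp add: bij_betw_inv_into_left)
  fix x y assume xy: "x \<in> carrier M" "y \<in> carrier M"
  have m: "x \<otimes>\<^bsub>M\<^esub> y = f (inv_into (carrier L) f x \<otimes>\<^bsub>L\<^esub> inv_into (carrier L) f y)" using F(5) c xy by simp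
  then have "x \<otimes>\<^bsub>M\<^esub> y \<in> carrier M" using F(4) c xy by simp
  then show "restrict (inv_into (carrier L) f) (carrier M) (x \<otimes>\<^bsub>M\<^esub> y) =
      restrict (inv_into (carrier L) f) (carrier M) x \<otimes>\<^bsub>L\<^esub> restrict (inv_into (carrier L) f) (carrier M) y"
    using xy c by (simp add: m e)
  show "form L (restrict (inv_into (carrier L) f) (carrier M) x) (restrict (inv_into (carrier L) f) (carrier M) y) = form M x y"
    using F(6)[OF c(1) c(1), OF xy] c(2) xy by simp
qed simp

lemma isometries_compose:
  assumes f: "f \<in> isometries L M" and g: "g \<in> isometries M N" and L: "group L"
  shows "compose (carrier L) g f \<in> isometries L N"
proof (rule isometriesI)
  interpret group L by fact
  note F = isometriesD[OF f] and G = isometriesD[OF g]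
  show "bij_betw (compose (carrier L) g f) (carrier L) (carrier N)" using bij_betw_compose[OF F(2) G(2)] .
  show "compose (carrier L) g f \<in> extensional (carrier L)" by simp
  fix x y assume xy: "x \<in> carrier L" "y \<in> carrier L"
  then show "compose (carrier L) g f (x \<otimes>\<^bsub>L\<^esub> y) = compose (carrier L) g f x \<otimes>\<^bsub>N\<^esub> compose (carrier L) g f y"
    by (simp add: compose_def F(4,5) G(5))
  show "form N (compose (carrier L) g f x) (compose (carrier L) g f y) = form L x y"
    using xy by (simp add: compose_def F(4,6) G(6))
qed

lemma isometric_sym: "isometric L M \<Longrightarrow> group L \<Longrightarrow> isometric M L"
  using isometries_inverse unfolding isometric_def by blast

lemma isometric_trans: "isometric L M \<Longrightarrow> isometric M N \<Longrightarrow> group L \<Longrightarrow> isometric L N"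
  using isometries_compose unfolding isometric_def by blast

lemma isometric_refl:
  assumes "group L" shows "isometric L L"
proof -
  interpret group L by fact
  have "restrict id (carrier L) \<in> isometries L L"
    by (rule isometriesI) (auto simp: bij_betw_def inj_on_def hom_def)
  then show ?thesis by (auto simp: isometric_def)
qed

lemma isometry_lattice_frame:
  assumes f: "f \<in> isometries L M" and L: "zlattice L" and M: "zlattice M" and F: "lattice_frame L F"
  shows "lattice_frame M (f ` F) \<and> frame_signature M (f ` F) = frame_signature L F"
proof -
  note D = isometriesD[OF f]
  interpret L: integral_lattice L using L by (rule integral_latticeI)
  interpret M: integral_lattice M using M by (rule integral_latticeI)
  interpret h: group_hom L M f using D(1) by unfold_locales
  have FL: "F \<subseteq> carrier L" "finite F" using F by (auto simp: lattice_frame_def)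
  have fm: "form M (f x) (f y) = form L x y" if "x \<in> F" "y \<in> F" for x y using that FL D(6) by blast
  have inj: "inj_on f F" using D(2) FL inj_on_subset by (auto simp: bij_betw_def)
  have "lattice_frame M (f ` F)"
    unfolding lattice_frame_def
  proof (intro conjI ballI impI)
    show "finite (f ` F)" "f ` F \<subseteq> carrier M" using FL D(4) by auto
    fix y assume y: "y \<in> f ` F"
    then show "form M y y \<noteq> 0" using fm F by (auto simp: lattice_frame_def)
    fix z assume "z \<in> f ` F" "y \<noteq> z"
    then obtain u v where "u \<in> F" "v \<in> F" "y = f u" "z = f v" "u \<noteq> v" using y by blast
    then show "form M y z = 0" using fm F unfolding lattice_frame_def by simp
  next
    fix y assume y: "y \<in> carrier M" "\<forall>g\<in>f ` F. form M y g = 0"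
    then obtain x where x: "x \<in> carrier L" "y = f x" using D(2) by (auto simp: bij_betw_def)
    then have "x = \<one>\<^bsub>L\<^esub>" using y(2) F FL D(6) by (auto simp: lattice_frame_def subset_iff)
    then show "y = \<one>\<^bsub>M\<^esub>" using x by simp
  qed
  moreover have "{g\<in>f ` F. 0 < form M g g} = f ` {g\<in>F. 0 < form L g g}" "{g\<in>f ` F. form M g g < 0} = f ` {g\<in>F. form L g g < 0}"
    using fm by auto
  moreover have "card (f ` A) = card A" if "A \<subseteq> F" for A using that inj by (simp add: card_image inj_on_subset)
  ultimately show ?thesis by (simp add: frame_signature_def)
qed

lemma glue_pair_transport:
  assumes P: "glue_pair L T S i j" and M: "even_integral_lattice M" "unimodular M" and f: "f \<in> isometries L M"
  shows "glue_pair M T S (compose (carrier T) f i) (compose (carrier S) f j)"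
    "glue_map M T S (compose (carrier T) f i) (compose (carrier S) f j) = glue_map L T S i j"
proof -
  interpret glue_pair L T S i j by fact
  interpret M: even_integral_lattice M by fact
  note D = isometriesD[OF f]
  interpret h: group_hom L M f using D(1) by unfold_locales
  let ?i = "compose (carrier T) f i" and ?j = "compose (carrier S) f j"
  have e: "?i t = f (i t)" "?j s = f (j s)" if "t \<in> carrier T" "s \<in> carrier S" for t s using that by (simp_all add: compose_def)
  have sur: "\<exists>x\<in>carrier L. y = f x" if "y \<in> carrier M" for y using that D(2) by (auto simp: bij_betw_def)
  have inj: "x = y" if "x \<in> carrier L" "y \<in> carrier L" "f x = f y" for x y
    using that D(2) by (auto simp: bij_betw_def dest: inj_onD)
  have im: "?i ` carrier T = f ` i ` carrier T" "?j ` carrier S = f ` j ` carrier S" by (auto simp: compose_def)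
  show "glue_pair M T S ?i ?j"
  proof unfold_locales
    show "?i \<in> hom T M" "?j \<in> hom S M" using D by (auto simp: hom_def compose_def)
    show "form M (?i x) (?i y) = form T x y" if "x \<in> carrier T" "y \<in> carrier T" for x y
      using that by (simp add: compose_def D(6) i_form)
    show "form M (?j x) (?j y) = form S x y" if "x \<in> carrier S" "y \<in> carrier S" for x y
      using that by (simp add: compose_def D(6) j_form)
    show "z \<in> ?i ` carrier T" if z: "z \<in> carrier M" "(n::nat) > 0" "z [^]\<^bsub>M\<^esub> n \<in> ?i ` carrier T" for z n
    proof -
      obtain x where x: "x \<in> carrier L" "z = f x" using sur[OF z(1)] by blast
      obtain t where t: "t \<in> carrier T" "z [^]\<^bsub>M\<^esub> n = f (i t)" using z(3) im by auto
      then have "f (x [^]\<^bsub>L\<^esub> n) = f (i t)" using x by (simp add: h.hom_nat_pow)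
      then have "x [^]\<^bsub>L\<^esub> n = i t" using inj x t by simp
      then have "x \<in> i ` carrier T" using i_prim[OF x(1) z(2)] t by blast
      then show ?thesis using im x by blast
    qed
    show "?j ` carrier S = {y\<in>carrier M. \<forall>x\<in>?i ` carrier T. form M x y = 0}"
    proof (intro equalityI subsetI)
      fix y assume "y \<in> ?j ` carrier S"
      then show "y \<in> {y\<in>carrier M. \<forall>x\<in>?i ` carrier T. form M x y = 0}"
        using orth D(4,6) by (auto simp: compose_def)
    next
      fix y assume y: "y \<in> {y\<in>carrier M. \<forall>x\<in>?i ` carrier T. form M x y = 0}"
      then obtain x where x: "x \<in> carrier L" "y = f x" using sur by blast
      have "form L x (i t) = 0" if "t \<in> carrier T" for t
        using y that x D(6)[of "i t" x] L.form_sym by (auto simp: im)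
      from in_j_image[OF x(1) this] have "x \<in> j ` carrier S" .
      then show "y \<in> ?j ` carrier S" unfolding im x(2) by (rule imageI)
    qed
    show "unimodular M" by fact
  qed
  have rr: "restr M T ?i (f x) = restr L T i x" "restr M S ?j (f x) = restr L S j x" if "x \<in> carrier L" for x
    using that D(6) by (auto simp: restr_def compose_def fun_eq_iff)
  show "glue_map M T S ?i ?j = glue_map L T S i j"
    unfolding glue_map_def
  proof (intro restrict_ext)
    fix c
    have "{y\<in>carrier M. restr M T ?i y \<in> c} = f ` {x\<in>carrier L. restr L T i x \<in> c}"
      using rr sur D(4) by (auto simp: image_iff) metis
    then show "restr M S ?j ` {y\<in>carrier M. restr M T ?i y \<in> c} = restr L S j ` {x\<in>carrier L. restr L T i x \<in> c}"
      using rr by (auto simp: image_image)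
  qed
qed

text \<open>A vector of \<open>L\<close> is determined by its pair of restrictions, and the pairs
  that occur are described by the gluing map. Equal gluing maps thus allow the same pairs for both
  embeddings, and matching vectors with equal restrictions is an isometry, because the form is the
  sum of the forms of the restrictions.\<close>

theorem glue_map_determines:
  assumes P: "glue_pair L T S i j" and P': "glue_pair L T S i' j'" and eq: "glue_map L T S i j = glue_map L T S i' j'"
  shows "\<exists>f\<in>isometries L L. (\<forall>t\<in>carrier T. f (i t) = i' t) \<and> (\<forall>s\<in>carrier S. f (j s) = j' s)"
proof -
  interpret A: glue_pair L T S i j by fact
  interpret B: glue_pair L T S i' j' by fact
  have ex: "\<exists>y\<in>carrier L. restr L T k' y = restr L T k x \<and> restr L S l' y = restr L S l x"
    if "glue_pair L T S k l" "glue_pair L T S k' l'" "glue_map L T S k l = glue_map L T S k' l'" "x \<in> carrier L" for k l k' l' x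
  proof -
    interpret C: glue_pair L T S k l by fact
    interpret D: glue_pair L T S k' l' by fact
    note x = that(4)
    have cl: "dual_class T (C.rT x) \<in> carrier (disc_group T)" using C.rT_dual[OF x] A.T.disc_carrier by blast
    have "C.rS x \<in> glue_map L T S k l (dual_class T (C.rT x))"
      using C.glue_map_class[OF x] A.S.dual_class_self[OF C.rS_dual[OF x]] by simp
    then have "C.rS x \<in> glue_map L T S k' l' (dual_class T (C.rT x))" using that(3) by simp
    then obtain y where y: "y \<in> carrier L" "D.rT y \<in> dual_class T (C.rT x)" "C.rS x = D.rS y"
      using cl by (auto simp: glue_map_def)
    then obtain t where t: "t \<in> carrier T" "\<forall>u\<in>carrier T. D.rT y u = C.rT x u + form T t u" by (auto simp: dual_class_def)
    define z where "z = y \<otimes>\<^bsub>L\<^esub> inv\<^bsub>L\<^esub> k' t"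
    have z: "z \<in> carrier L" using y t by (simp add: z_def)
    have "D.rT z = C.rT x"
    proof (rule A.T.dual_eqI[OF D.rT_dual[OF z] C.rT_dual[OF x]])
      fix u assume u: "u \<in> carrier T"
      have "D.rT z u = D.rT y u - form T t u"
        using u y t by (simp add: z_def D.rT_apply A.L.form_left D.i_form)
      then show "D.rT z u = C.rT x u" using t u by simp
    qed
    moreover have "D.rS z = D.rS y"
    proof (rule A.S.dual_eqI[OF D.rS_dual[OF z] D.rS_dual[OF y(1)]])
      fix u assume "u \<in> carrier S"
      then show "D.rS z u = D.rS y u" using y t D.orth by (simp add: z_def D.rS_apply A.L.form_left)
    qed
    ultimately show ?thesis using z y by auto
  qed
  define f where "f = (\<lambda>x\<in>carrier L. SOME y. y \<in> carrier L \<and> B.rT y = A.rT x \<and> B.rS y = A.rS x)"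
  have f: "f x \<in> carrier L \<and> B.rT (f x) = A.rT x \<and> B.rS (f x) = A.rS x" if "x \<in> carrier L" for x
  proof -
    have "\<exists>y. y \<in> carrier L \<and> B.rT y = A.rT x \<and> B.rS y = A.rS x" using ex[OF P P' eq that] by blast
    from someI_ex[OF this] show ?thesis using that by (simp add: f_def)
  qed
  have uniq: "f x = y" if "x \<in> carrier L" "y \<in> carrier L" "B.rT y = A.rT x" "B.rS y = A.rS x" for x y
    using B.res_inj f[OF that(1)] that by simp
  have "bij_betw f (carrier L) (carrier L)"
    unfolding bij_betw_def
  proof (intro conjI inj_onI equalityI subsetI)
    fix x y assume xy: "x \<in> carrier L" "y \<in> carrier L" "f x = f y"
    then show "x = y" using f[OF xy(1)] f[OF xy(2)] by (intro A.res_inj) simp_all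
  next
    fix y assume "y \<in> f ` carrier L" then show "y \<in> carrier L" using f by blast
  next
    fix y assume y: "y \<in> carrier L"
    obtain x where "x \<in> carrier L" "A.rT x = B.rT y" "A.rS x = B.rS y" using ex[OF P' P eq[symmetric] y] by blast
    then show "y \<in> f ` carrier L" using uniq[of x y] y by force
  qed
  moreover have "f (x \<otimes>\<^bsub>L\<^esub> y) = f x \<otimes>\<^bsub>L\<^esub> f y" if "x \<in> carrier L" "y \<in> carrier L" for x y
    using f[OF that(1)] f[OF that(2)] that by (intro uniq) (simp_all add: A.rT_mult A.rS_mult B.rT_mult B.rS_mult)
  moreover have "form L (f x) (f y) = form L x y" if xy: "x \<in> carrier L" "y \<in> carrier L" for x y
  proof -
    have "rat_of_int (form L (f x) (f y)) = of_int (form L x y)"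
      using A.form_decomposition[OF xy] B.form_decomposition[of "f x" "f y"] f[OF xy(1)] f[OF xy(2)] by simp
    then show ?thesis by simp
  qed
  ultimately have "f \<in> isometries L L" by (intro isometriesI) (simp_all add: f_def)
  moreover have "f (i t) = i' t" if t: "t \<in> carrier T" for t
  proof (rule uniq)
    show "B.rT (i' t) = A.rT (i t)" using t A.i_form B.i_form by (auto simp: restr_def fun_eq_iff)
    show "B.rS (i' t) = A.rS (i t)" using t A.orth B.orth by (auto simp: restr_def fun_eq_iff)
  qed (use t in auto)
  moreover have "f (j s) = j' s" if s: "s \<in> carrier S" for s
  proof (rule uniq)
    show "B.rT (j' s) = A.rT (j s)" using s A.orth B.orth by (auto simp: restr_def fun_eq_iff)
    show "B.rS (j' s) = A.rS (j s)" using s A.j_form B.j_form by (auto simp: restr_def fun_eq_iff)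
  qed (use s in auto)
  ultimately show ?thesis by blast
qed

text \<open>Stated for the composite of \<open>f\<close> with \<open>h\<close>, so that the inverse
  in \<open>disc_map\<close> cancels.\<close>

lemma disc_map_class:
  assumes L: "integral_lattice L" and h: "h \<in> isometries L L" and f: "f \<in> carrier (dual_group L)"
  shows "disc_map L h (dual_class L (\<lambda>y\<in>carrier L. f (h y))) = dual_class L f"
proof -
  interpret integral_lattice L by fact
  note H = isometriesD[OF h]
  have hi: "inv_into (carrier L) h y \<in> carrier L" "h (inv_into (carrier L) h y) = y" if "y \<in> carrier L" for y
    using that H(2) by (auto simp: bij_betw_def inv_into_into f_inv_into_f)
  have hl: "inv_into (carrier L) h (h y) = y" if "y \<in> carrier L" for y using that H(2) by (simp add: bij_betw_inv_into_left)
  note R = isometriesD[OF isometries_inverse[OF h is_group]]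
  have dh: "(\<lambda>y\<in>carrier L. g (k y)) \<in> carrier (dual_group L)" if "k \<in> isometries L L" "g \<in> carrier (dual_group L)" for g k
    using isometriesD[OF that(1)] hom_integer(1)[OF is_group dual_hom[OF that(2)]]
    by (intro restrict_dual hom_integerI) simp
  have pf: "(\<lambda>y\<in>carrier L. f (h y)) \<in> carrier (dual_group L)" by (rule dh[OF h f])
  have c: "dual_class L (\<lambda>y\<in>carrier L. f (h y)) \<in> carrier (disc_group L)" using pf disc_carrier by blast
  have "(\<lambda>g. \<lambda>y\<in>carrier L. g (inv_into (carrier L) h y)) ` dual_class L (\<lambda>y\<in>carrier L. f (h y)) = dual_class L f"
  proof (intro equalityI subsetI)
    fix k assume "k \<in> (\<lambda>g. \<lambda>y\<in>carrier L. g (inv_into (carrier L) h y)) ` dual_class L (\<lambda>y\<in>carrier L. f (h y))"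
    then obtain g where g: "g \<in> dual_class L (\<lambda>y\<in>carrier L. f (h y))" "k = (\<lambda>y\<in>carrier L. g (inv_into (carrier L) h y))" by blast
    then obtain x where x: "g \<in> carrier (dual_group L)" "x \<in> carrier L" "\<forall>y\<in>carrier L. g y = f (h y) + form L x y"
      by (auto simp: dual_class_def)
    have "k = (\<lambda>y\<in>carrier L. g (restrict (inv_into (carrier L) h) (carrier L) y))" using g(2) by (auto simp: fun_eq_iff)
    then have "k \<in> carrier (dual_group L)" using dh[OF isometries_inverse[OF h is_group] x(1)] by simp
    moreover have "k y = f y + form L (h x) y" if y: "y \<in> carrier L" for y
    proof -
      have "form L x (inv_into (carrier L) h y) = form L (h x) y"
        using H(6)[OF x(2) hi(1)[OF y]] hi(2)[OF y] by simp
      then show ?thesis using x(3) y hi by (simp add: g(2))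
    qed
    ultimately show "k \<in> dual_class L f" using x(2) H(4) unfolding dual_class_def by blast
  next
    fix k assume "k \<in> dual_class L f"
    then obtain x where x: "k \<in> carrier (dual_group L)" "x \<in> carrier L" "\<forall>y\<in>carrier L. k y = f y + form L x y"
      by (auto simp: dual_class_def)
    define g where "g = (\<lambda>y\<in>carrier L. k (h y))"
    have "g \<in> carrier (dual_group L)" unfolding g_def by (rule dh[OF h x(1)])
    moreover have "g y = (\<lambda>y\<in>carrier L. f (h y)) y + form L (inv_into (carrier L) h x) y" if y: "y \<in> carrier L" for y
    proof -
      have "form L x (h y) = form L (inv_into (carrier L) h x) y"
        using H(6)[OF hi(1)[OF x(2)] y] hi(2)[OF x(2)] by simp
      then show ?thesis using x(3) y H(4) by (simp add: g_def)
    qed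
    ultimately have "g \<in> dual_class L (\<lambda>y\<in>carrier L. f (h y))" using hi(1)[OF x(2)] unfolding dual_class_def by blast
    moreover have "k = (\<lambda>y\<in>carrier L. g (inv_into (carrier L) h y))"
      using x(1) hi by (intro dual_eqI[OF x(1)])
        (auto simp: g_def dual_group_carrier hom_def H(4) intro!: restrict_dual[unfolded dual_group_carrier, THEN IntD1])
    ultimately show "k \<in> (\<lambda>g. \<lambda>y\<in>carrier L. g (inv_into (carrier L) h y)) ` dual_class L (\<lambda>y\<in>carrier L. f (h y))" by blast
  qed
  then show ?thesis using c by (simp add: disc_map_def)
qed

section \<open>Lattices glued from two orthogonal parts\<close>

text \<open>
  The lattice \<open>T \<oplus> S \<subseteq> M \<subseteq> T\<^sup>* \<oplus> S\<^sup>*\<close> whose image in \<open>A\<^sub>T \<oplus> A\<^sub>S\<close> is the graph of \<open>\<gamma>\<close>. The floor is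
  taken of an integer.
\<close>

definition glue_lattice :: "'b zlat \<Rightarrow> 'c zlat \<Rightarrow> (('b \<Rightarrow> int) set \<Rightarrow> ('c \<Rightarrow> int) set) \<Rightarrow> (('b \<Rightarrow> int) \<times> ('c \<Rightarrow> int)) zlat" where
  "glue_lattice T S \<gamma> = \<lparr>carrier = {(f, g). f \<in> carrier (dual_group T) \<and> g \<in> carrier (dual_group S) \<and>
       \<gamma> (dual_class T f) = dual_class S g},
     monoid.mult = (\<lambda>x y. (fst x \<otimes>\<^bsub>dual_group T\<^esub> fst y, snd x \<otimes>\<^bsub>dual_group S\<^esub> snd y)),
     one = (\<one>\<^bsub>dual_group T\<^esub>, \<one>\<^bsub>dual_group S\<^esub>),
     form = (\<lambda>x y. \<lfloor>dual_form T (fst x) (fst y) + dual_form S (snd x) (snd y)\<rfloor>)\<rparr>"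

lemma (in integral_lattice) disc_one: "\<one>\<^bsub>disc_group L\<^esub> = dual_class L \<one>\<^bsub>dual_group L\<^esub>"
proof -
  interpret D: comm_group "dual_group L" by (rule dual_comm_group)
  have "to_dual L ` carrier L \<subseteq> carrier (dual_group L)" using to_dual_carrier by blast
  then show ?thesis using dual_class_eq[OF D.one_closed] D.coset_mult_one by (simp add: disc_group_def FactGroup_def)
qed

lemma (in integral_lattice) dual_one_apply: "y \<in> carrier L \<Longrightarrow> \<one>\<^bsub>dual_group L\<^esub> y = 0"
  by (simp add: dual_group_def)

lemma (in integral_lattice) dual_class_one_iff:
  assumes "f \<in> carrier (dual_group L)"
  shows "dual_class L f = dual_class L \<one>\<^bsub>dual_group L\<^esub> \<longleftrightarrow> f \<in> to_dual L ` carrier L"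
proof -
  interpret D: comm_group "dual_group L" by (rule dual_comm_group)
  have "dual_class L f = dual_class L \<one>\<^bsub>dual_group L\<^esub> \<longleftrightarrow> f \<in> dual_class L \<one>\<^bsub>dual_group L\<^esub>"
    using dual_class_eq_iff[OF D.one_closed assms] by auto
  also have "\<dots> \<longleftrightarrow> (\<exists>x\<in>carrier L. \<forall>y\<in>carrier L. f y = form L x y)"
    using assms dual_one_apply by (auto simp: dual_class_def)
  also have "\<dots> \<longleftrightarrow> f \<in> to_dual L ` carrier L"
  proof
    assume "\<exists>x\<in>carrier L. \<forall>y\<in>carrier L. f y = form L x y"
    then obtain x where x: "x \<in> carrier L" "\<forall>y\<in>carrier L. f y = form L x y" by blast
    then have "f = to_dual L x" by (intro dual_eqI[OF assms to_dual_carrier]) (simp_all add: to_dual_apply)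
    then show "f \<in> to_dual L ` carrier L" using x by blast
  next
    assume "f \<in> to_dual L ` carrier L"
    then show "\<exists>x\<in>carrier L. \<forall>y\<in>carrier L. f y = form L x y" using to_dual_apply by blast
  qed
  finally show ?thesis .
qed

text \<open>The lattice is its own double dual: writing \<open>f\<close> as \<open>x / n\<close>,
  integrality says that \<open>n\<close> divides the value of every functional at \<open>x\<close>,
  so \<open>x\<close> is divisible by \<open>n\<close> in the lattice.\<close>

lemma (in integral_lattice) dual_form_integral_imp:
  assumes f: "f \<in> carrier (dual_group L)" and int: "\<And>g. g \<in> carrier (dual_group L) \<Longrightarrow> dual_form L g f \<in> \<int>"
  shows "f \<in> to_dual L ` carrier L"
proof -
  obtain n x where x: "n > 0" "x \<in> carrier L" "\<And>y. y \<in> carrier L \<Longrightarrow> n * f y = form L x y"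
    by (rule dual_rep[OF dual_hom[OF f]]) (rule that)
  have "n dvd h x" if h: "h \<in> hom L integer_group" for h
  proof -
    have r: "restrict h (carrier L) \<in> carrier (dual_group L)" using h by (rule restrict_dual)
    have "dual_form L (restrict h (carrier L)) f = of_int (h x) / of_int n"
      using dual_form_eq[OF dual_hom[OF r] x(2,1,3)] x(2) by simp
    then obtain k where "rat_of_int (h x) / of_int n = of_int k" using int[OF r] by (auto elim: Ints_cases)
    then have "rat_of_int (h x) = of_int (k * n)" using x(1) by (simp add: field_simps)
    then have "h x = k * n" by (simp only: of_int_eq_iff)
    then show ?thesis by simp
  qed
  then obtain y where y: "y \<in> carrier L" "y [^] n = x" using divisible_vector[OF x(2,1)] by blast
  have "f z = form L y z" if z: "z \<in> carrier L" for z
  proof -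
    have "form L (y [^] n) z = n * form L y z" using y(1) z by (simp add: form_left)
    then have "n * f z = n * form L y z" unfolding y(2) using x(3)[OF z] by simp
    then show ?thesis using x(1) by simp
  qed
  then have "f = to_dual L y" using y f by (intro dual_eqI to_dual_carrier) (auto simp: to_dual_apply)
  then show ?thesis using y by blast
qed

locale glue_data = T: even_integral_lattice T + S: even_integral_lattice S for T :: "'b zlat" and S :: "'c zlat" +
  fixes \<gamma>
  assumes gamma: "\<gamma> \<in> quad_isometries (disc_group T) (neg_disc_quad T) (disc_group S) (disc_quad S)"
begin

abbreviation "M \<equiv> glue_lattice T S \<gamma>"

sublocale DT: comm_group "dual_group T" by (rule T.dual_comm_group)
sublocale DS: comm_group "dual_group S" by (rule S.dual_comm_group)
sublocale AT: comm_group "disc_group T" by (rule T.disc_group_group)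
sublocale AS: comm_group "disc_group S" by (rule S.disc_group_group)
sublocale \<gamma>: group_hom "disc_group T" "disc_group S" \<gamma>
  using gamma by unfold_locales (auto simp: quad_isometries_def iso_def)

lemma gamma_bij: "bij_betw \<gamma> (carrier (disc_group T)) (carrier (disc_group S))"
  using gamma by (simp add: quad_isometries_def iso_def)

lemma gamma_quad: "c \<in> carrier (disc_group T) \<Longrightarrow> disc_quad S (\<gamma> c) = neg_disc_quad T c"
  using gamma by (simp add: quad_isometries_def)

lemma M_iff: "x \<in> carrier M \<longleftrightarrow> fst x \<in> carrier (dual_group T) \<and> snd x \<in> carrier (dual_group S) \<and>
   \<gamma> (dual_class T (fst x)) = dual_class S (snd x)"
  by (auto simp: glue_lattice_def)

lemma M_mult: "x \<otimes>\<^bsub>M\<^esub> y = (fst x \<otimes>\<^bsub>dual_group T\<^esub> fst y, snd x \<otimes>\<^bsub>dual_group S\<^esub> snd y)"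
  by (simp add: glue_lattice_def)

lemma M_one: "\<one>\<^bsub>M\<^esub> = (\<one>\<^bsub>dual_group T\<^esub>, \<one>\<^bsub>dual_group S\<^esub>)"
  by (simp add: glue_lattice_def)

lemma classT: "f \<in> carrier (dual_group T) \<Longrightarrow> dual_class T f \<in> carrier (disc_group T)"
  using T.disc_carrier by blast

lemma classS: "f \<in> carrier (dual_group S) \<Longrightarrow> dual_class S f \<in> carrier (disc_group S)"
  using S.disc_carrier by blast

lemma gamma_one: "\<gamma> (dual_class T \<one>\<^bsub>dual_group T\<^esub>) = dual_class S \<one>\<^bsub>dual_group S\<^esub>"
  using \<gamma>.hom_one by (simp add: T.disc_one S.disc_one)

lemma gamma_class_ex:
  assumes "f \<in> carrier (dual_group T)" shows "\<exists>g. (f, g) \<in> carrier M"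
proof -
  have "\<gamma> (dual_class T f) \<in> carrier (disc_group S)" using classT[OF assms] by simp
  then show ?thesis using assms by (auto simp: M_iff S.disc_carrier)
qed

lemma gamma_class_ex':
  assumes "g \<in> carrier (dual_group S)" shows "\<exists>f. (f, g) \<in> carrier M"
proof -
  have "dual_class S g \<in> \<gamma> ` carrier (disc_group T)" using classS[OF assms] gamma_bij by (simp add: bij_betw_def)
  then show ?thesis using assms by (auto simp: M_iff T.disc_carrier)
qed

lemma M_closed: "x \<in> carrier M \<Longrightarrow> y \<in> carrier M \<Longrightarrow> x \<otimes>\<^bsub>M\<^esub> y \<in> carrier M"
  unfolding M_iff M_mult
  by (simp add: classT \<gamma>.hom_mult flip: T.disc_mult S.disc_mult)

lemma M_comm_group: "comm_group M"
proof (rule comm_groupI)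
  show "x \<otimes>\<^bsub>M\<^esub> y \<in> carrier M" if "x \<in> carrier M" "y \<in> carrier M" for x y using M_closed that .
  show "\<one>\<^bsub>M\<^esub> \<in> carrier M" by (simp add: M_iff M_one gamma_one)
  show "x \<otimes>\<^bsub>M\<^esub> y \<otimes>\<^bsub>M\<^esub> z = x \<otimes>\<^bsub>M\<^esub> (y \<otimes>\<^bsub>M\<^esub> z)" if "x \<in> carrier M" "y \<in> carrier M" "z \<in> carrier M" for x y z
    using that by (simp add: M_iff M_mult DT.m_assoc DS.m_assoc)
  show "x \<otimes>\<^bsub>M\<^esub> y = y \<otimes>\<^bsub>M\<^esub> x" if "x \<in> carrier M" "y \<in> carrier M" for x y
    using that by (simp add: M_iff M_mult DT.m_comm DS.m_comm)
  show "\<one>\<^bsub>M\<^esub> \<otimes>\<^bsub>M\<^esub> x = x" if "x \<in> carrier M" for x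
    using that by (simp add: M_iff M_mult M_one)
  show "\<exists>y\<in>carrier M. y \<otimes>\<^bsub>M\<^esub> x = \<one>\<^bsub>M\<^esub>" if x: "x \<in> carrier M" for x
  proof -
    let ?y = "(inv\<^bsub>dual_group T\<^esub> fst x, inv\<^bsub>dual_group S\<^esub> snd x)"
    have c: "fst x \<in> carrier (dual_group T)" "snd x \<in> carrier (dual_group S)" using x by (auto simp: M_iff)
    have "dual_class T (inv\<^bsub>dual_group T\<^esub> fst x) = inv\<^bsub>disc_group T\<^esub> (dual_class T (fst x))"
      using c by (intro AT.inv_equality[symmetric]) (simp_all add: T.disc_mult T.disc_one classT)
    moreover have "dual_class S (inv\<^bsub>dual_group S\<^esub> snd x) = inv\<^bsub>disc_group S\<^esub> (dual_class S (snd x))"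
      using c by (intro AS.inv_equality[symmetric]) (simp_all add: S.disc_mult S.disc_one classS)
    ultimately have "?y \<in> carrier M" using x c by (simp add: M_iff classT)
    moreover have "?y \<otimes>\<^bsub>M\<^esub> x = \<one>\<^bsub>M\<^esub>" using c by (simp add: M_mult M_one)
    ultimately show ?thesis by blast
  qed
qed

definition bsum :: "('b \<Rightarrow> int) \<times> ('c \<Rightarrow> int) \<Rightarrow> ('b \<Rightarrow> int) \<times> ('c \<Rightarrow> int) \<Rightarrow> rat" where
  "bsum x y = dual_form T (fst x) (fst y) + dual_form S (snd x) (snd y)"

lemma M_hom: "x \<in> carrier M \<Longrightarrow> fst x \<in> hom T integer_group" "x \<in> carrier M \<Longrightarrow> snd x \<in> hom S integer_group"
  by (simp_all add: M_iff T.dual_hom S.dual_hom)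

lemma bsum_sym: "x \<in> carrier M \<Longrightarrow> y \<in> carrier M \<Longrightarrow> bsum x y = bsum y x"
  using T.dual_form_sym S.dual_form_sym M_hom by (simp add: bsum_def)

lemma bsum_add:
  assumes "x \<in> carrier M" "y \<in> carrier M" "z \<in> carrier M"
  shows "bsum (x \<otimes>\<^bsub>M\<^esub> y) z = bsum x z + bsum y z"
proof -
  note h = M_hom[OF assms(1)] M_hom[OF assms(2)] M_hom[OF assms(3)] M_hom[OF M_closed[OF assms(1,2)]]
  have "dual_form T (fst (x \<otimes>\<^bsub>M\<^esub> y)) (fst z) = dual_form T (fst x) (fst z) + dual_form T (fst y) (fst z)"
    using h by (intro T.dual_form_add_left) (simp_all add: M_mult T.dual_mult)
  moreover have "dual_form S (snd (x \<otimes>\<^bsub>M\<^esub> y)) (snd z) = dual_form S (snd x) (snd z) + dual_form S (snd y) (snd z)"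
    using h by (intro S.dual_form_add_left) (simp_all add: M_mult S.dual_mult)
  ultimately show ?thesis by (simp add: bsum_def)
qed

lemma bsum_even:
  assumes x: "x \<in> carrier M" shows "\<exists>k. bsum x x = 2 * of_int k"
proof -
  have c: "fst x \<in> carrier (dual_group T)" "snd x \<in> carrier (dual_group S)" and g: "\<gamma> (dual_class T (fst x)) = dual_class S (snd x)"
    using x by (auto simp: M_iff)
  have "mod_2Z (dual_norm S (snd x)) = mod_2Z (- dual_norm T (fst x))"
    using gamma_quad[OF classT[OF c(1)]] c
    by (simp add: g neg_disc_quad_def T.disc_quad_class S.disc_quad_class uminus_mod_2Z)
  then show ?thesis unfolding mod_2Z_eq_iff bsum_def using M_hom[OF x]
    by (simp add: T.dual_norm_eq S.dual_norm_eq add.commute)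
qed

text \<open>By polarization, twice the product is a combination of norms, and these are even
  integers; so the product itself is an integer and the floor changes nothing.\<close>

lemma bsum_int:
  assumes x: "x \<in> carrier M" and y: "y \<in> carrier M" shows "of_int (form M x y) = bsum x y"
proof -
  note xy = M_closed[OF x y]
  obtain k l m where k: "bsum x x = 2 * of_int k" "bsum y y = 2 * of_int l" "bsum (x \<otimes>\<^bsub>M\<^esub> y) (x \<otimes>\<^bsub>M\<^esub> y) = 2 * of_int m"
    using bsum_even x y xy by metis
  have "bsum (x \<otimes>\<^bsub>M\<^esub> y) (x \<otimes>\<^bsub>M\<^esub> y) = bsum x x + bsum y y + 2 * bsum x y"
    using bsum_add[OF x y xy] bsum_add[OF x y x] bsum_add[OF x y y] bsum_sym[OF x xy] bsum_sym[OF y xy] bsum_sym[OF x y] by simp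
  then have "bsum x y = of_int (m - k - l)" using k by simp
  moreover have "form M x y = \<lfloor>bsum x y\<rfloor>" by (simp add: glue_lattice_def bsum_def)
  ultimately show ?thesis by simp
qed

definition iT :: "'b \<Rightarrow> ('b \<Rightarrow> int) \<times> ('c \<Rightarrow> int)" where "iT t = (to_dual T t, \<one>\<^bsub>dual_group S\<^esub>)"
definition jS :: "'c \<Rightarrow> ('b \<Rightarrow> int) \<times> ('c \<Rightarrow> int)" where "jS s = (\<one>\<^bsub>dual_group T\<^esub>, to_dual S s)"

lemma iT_in: "t \<in> carrier T \<Longrightarrow> iT t \<in> carrier M"
  using T.dual_class_one_iff[OF T.to_dual_carrier] gamma_one
  by (simp add: iT_def M_iff T.to_dual_carrier)

lemma jS_in: "s \<in> carrier S \<Longrightarrow> jS s \<in> carrier M"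
  using S.dual_class_one_iff[OF S.to_dual_carrier] gamma_one
  by (simp add: jS_def M_iff S.to_dual_carrier)

lemma dual_form_one: "f \<in> hom S integer_group \<Longrightarrow> dual_form S f \<one>\<^bsub>dual_group S\<^esub> = 0"
  "g \<in> hom T integer_group \<Longrightarrow> dual_form T g \<one>\<^bsub>dual_group T\<^esub> = 0"
  using S.dual_form_to_dual[of f "\<one>\<^bsub>S\<^esub>"] T.dual_form_to_dual[of g "\<one>\<^bsub>T\<^esub>"]
    S.dual_one_apply T.dual_one_apply S.form_left(2) T.form_left(2) hom_integer(2)[OF S.is_group, of f] hom_integer(2)[OF T.is_group, of g]
  by simp_all

lemma form_iT:
  assumes "x \<in> carrier M" "t \<in> carrier T" shows "form M x (iT t) = fst x t"
proof -
  have "rat_of_int (form M x (iT t)) = of_int (fst x t)"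
    using assms M_hom[OF assms(1)] dual_form_one T.dual_form_to_dual[OF M_hom(1)[OF assms(1)] assms(2) T.to_dual_apply]
    by (simp add: bsum_int iT_in bsum_def) (simp add: iT_def)
  then show ?thesis by simp
qed

lemma form_jS:
  assumes "x \<in> carrier M" "s \<in> carrier S" shows "form M x (jS s) = snd x s"
proof -
  have "rat_of_int (form M x (jS s)) = of_int (snd x s)"
    using assms M_hom[OF assms(1)] dual_form_one S.dual_form_to_dual[OF M_hom(2)[OF assms(1)] assms(2) S.to_dual_apply]
    by (simp add: bsum_int jS_in bsum_def) (simp add: jS_def)
  then show ?thesis by simp
qed

lemma M_eqI:
  assumes "x \<in> carrier M" "y \<in> carrier M" "\<And>t. t \<in> carrier T \<Longrightarrow> fst x t = fst y t" "\<And>s. s \<in> carrier S \<Longrightarrow> snd x s = snd y s"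
  shows "x = y"
  using assms T.dual_eqI S.dual_eqI by (intro prod_eqI) (auto simp: M_iff)

lemma M_one_apply:
  "t \<in> carrier T \<Longrightarrow> fst \<one>\<^bsub>M\<^esub> t = 0" "s \<in> carrier S \<Longrightarrow> snd \<one>\<^bsub>M\<^esub> s = 0"
  by (simp_all add: M_one T.dual_one_apply S.dual_one_apply)

lemma M_even_lattice: "even_lattice M"
proof -
  interpret M: comm_group M by (rule M_comm_group)
  have f_add: "form M (x \<otimes>\<^bsub>M\<^esub> y) z = form M x z + form M y z" if "x \<in> carrier M" "y \<in> carrier M" "z \<in> carrier M" for x y z
  proof -
    have "rat_of_int (form M (x \<otimes>\<^bsub>M\<^esub> y) z) = of_int (form M x z + form M y z)"
      using that by (simp add: bsum_int bsum_add)
    then show ?thesis by (simp only: of_int_eq_iff)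
  qed
  have f_sym: "form M x y = form M y x" if "x \<in> carrier M" "y \<in> carrier M" for x y
  proof -
    have "rat_of_int (form M x y) = of_int (form M y x)" using that by (simp add: bsum_int bsum_sym)
    then show ?thesis by simp
  qed
  obtain n e c where c: "coordinates T n e c" using T.coordinates_ex by blast
  obtain m e' c' where c': "coordinates S m e' c'" using S.coordinates_ex by blast
  note C = coordinatesD[OF c] and C' = coordinatesD[OF c']
  define h where "h k x = (if k < n then fst x (e k) else snd x (e' (k - n)))" for k and x :: "('b \<Rightarrow> int) \<times> ('c \<Rightarrow> int)"
  have "\<exists>r e c. coordinates M r e c"
  proof (rule coordinates_exist[OF M_comm_group])
    show "\<forall>k<n + m. h k \<in> hom M integer_group"
      using C(1) C'(1) by (auto intro!: hom_integerI simp: h_def M_mult T.dual_mult S.dual_mult)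
    show "\<forall>x\<in>carrier M. (\<forall>k<n + m. h k x = 0) \<longrightarrow> x = \<one>\<^bsub>M\<^esub>"
    proof (intro ballI impI)
      fix x assume x: "x \<in> carrier M" "\<forall>k<n + m. h k x = 0"
      have "fst x (e k) = 0" if "k < n" for k using x(2) that by (auto simp: h_def dest!: spec[of _ k])
      then have "fst x t = 0" if "t \<in> carrier T" for t
        using coordinates_expansion[OF T.is_group c that M_hom(1)[OF x(1)]] by simp
      moreover have "snd x (e' k) = 0" if "k < m" for k using x(2) that by (auto simp: h_def dest!: spec[of _ "n + k"])
      then have "snd x s = 0" if "s \<in> carrier S" for s
        using coordinates_expansion[OF S.is_group c' that M_hom(2)[OF x(1)]] by simp
      ultimately show "x = \<one>\<^bsub>M\<^esub>" using x(1)
        by (intro M_eqI) (simp_all add: M_one_apply)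
    qed
  qed
  then obtain r e1 c1 where "coordinates M r e1 c1" by blast
  then have "free_Abelian_group {..<r} \<cong> M"
    using coordinates_imp_iso_free[OF M_comm_group] unfolding is_iso_def by blast
  moreover have "x = \<one>\<^bsub>M\<^esub>" if x: "x \<in> carrier M" "\<forall>y\<in>carrier M. form M x y = 0" for x
  proof (rule M_eqI)
    show "fst x t = fst \<one>\<^bsub>M\<^esub> t" if "t \<in> carrier T" for t
      using form_iT[OF x(1) that] x(2) iT_in[OF that] M_one_apply(1)[OF that] by simp
    show "snd x s = snd \<one>\<^bsub>M\<^esub> s" if "s \<in> carrier S" for s
      using form_jS[OF x(1) that] x(2) jS_in[OF that] M_one_apply(2)[OF that] by simp
  qed (use x in simp_all)
  moreover have "form M x \<in> hom M integer_group" if "x \<in> carrier M" for x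
    using that f_add f_sym by (intro hom_integerI) simp
  moreover have "even (form M x x)" if xM: "x \<in> carrier M" for x
  proof -
    obtain k where "bsum x x = 2 * of_int k" using bsum_even[OF xM] by blast
    then have "rat_of_int (form M x x) = of_int (2 * k)" using bsum_int xM by simp
    then have "form M x x = 2 * k" by (simp only: of_int_eq_iff)
    then show ?thesis by simp
  qed
  ultimately show ?thesis
    unfolding even_lattice_def zlattice_def using M_comm_group f_sym by blast
qed

sublocale M: even_integral_lattice M
  using even_integral_latticeI[OF M_even_lattice] .

lemma M_int_pow:
  assumes "x \<in> carrier M"
  shows "t \<in> carrier T \<Longrightarrow> fst (x [^]\<^bsub>M\<^esub> (N::int)) t = N * fst x t"
    "s \<in> carrier S \<Longrightarrow> snd (x [^]\<^bsub>M\<^esub> (N::int)) s = N * snd x s"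
proof -
  have xc: "x [^]\<^bsub>M\<^esub> N \<in> carrier M" using assms by simp
  show "t \<in> carrier T \<Longrightarrow> fst (x [^]\<^bsub>M\<^esub> N) t = N * fst x t"
    using M.form_left(4)[OF iT_in assms, of t N] by (simp only: form_iT[OF xc] form_iT[OF assms])
  show "s \<in> carrier S \<Longrightarrow> snd (x [^]\<^bsub>M\<^esub> N) s = N * snd x s"
    using M.form_left(4)[OF jS_in assms, of s N] by (simp only: form_jS[OF xc] form_jS[OF assms])
qed

lemma M_multiple:
  assumes x: "x \<in> carrier M"
  shows "\<exists>N>0. \<exists>t\<in>carrier T. \<exists>s\<in>carrier S. x [^]\<^bsub>M\<^esub> (N::int) = iT t \<otimes>\<^bsub>M\<^esub> jS s"
proof -
  obtain n t where t: "n > 0" "t \<in> carrier T" "\<And>y. y \<in> carrier T \<Longrightarrow> n * fst x y = form T t y"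
    by (rule T.dual_rep[OF M_hom(1)[OF x]]) (rule that)
  obtain m s where s: "m > 0" "s \<in> carrier S" "\<And>y. y \<in> carrier S \<Longrightarrow> m * snd x y = form S s y"
    by (rule S.dual_rep[OF M_hom(2)[OF x]]) (rule that)
  let ?t = "t [^]\<^bsub>T\<^esub> m" and ?s = "s [^]\<^bsub>S\<^esub> n"
  have ts: "?t \<in> carrier T" "?s \<in> carrier S" using t s by auto
  have "x [^]\<^bsub>M\<^esub> (n * m) = iT ?t \<otimes>\<^bsub>M\<^esub> jS ?s"
  proof (rule M_eqI)
    show "iT ?t \<otimes>\<^bsub>M\<^esub> jS ?s \<in> carrier M" using ts iT_in jS_in by simp
    show xc: "x [^]\<^bsub>M\<^esub> (n * m) \<in> carrier M" using x by simp
    fix u assume u: "u \<in> carrier T"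
    have "fst (x [^]\<^bsub>M\<^esub> (n * m)) u = n * m * fst x u" using M_int_pow(1)[OF x u] .
    also have "\<dots> = fst (iT ?t \<otimes>\<^bsub>M\<^esub> jS ?s) u"
      using t(2) t(3)[OF u] u by (simp add: M_mult iT_def jS_def T.dual_mult T.to_dual_apply T.dual_one_apply T.form_left mult_ac)
    finally show "fst (x [^]\<^bsub>M\<^esub> (n * m)) u = fst (iT ?t \<otimes>\<^bsub>M\<^esub> jS ?s) u" .
  next
    fix u assume u: "u \<in> carrier S"
    have "snd (x [^]\<^bsub>M\<^esub> (n * m)) u = n * m * snd x u" using M_int_pow(2)[OF x u] .
    also have "\<dots> = snd (iT ?t \<otimes>\<^bsub>M\<^esub> jS ?s) u"
      using s(2) s(3)[OF u] u by (simp add: M_mult iT_def jS_def S.dual_mult S.to_dual_apply S.dual_one_apply S.form_left mult_ac)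
    finally show "snd (x [^]\<^bsub>M\<^esub> (n * m)) u = snd (iT ?t \<otimes>\<^bsub>M\<^esub> jS ?s) u" .
  qed
  then show ?thesis using t s ts by (intro exI[of _ "n * m"]) auto
qed

lemma iT_hom: "iT \<in> hom T M"
proof (rule homI)
  fix x y assume xy: "x \<in> carrier T" "y \<in> carrier T"
  then show "iT (x \<otimes>\<^bsub>T\<^esub> y) = iT x \<otimes>\<^bsub>M\<^esub> iT y"
    by (intro M_eqI[OF iT_in M_closed[OF iT_in iT_in]]) (simp_all add: M_mult iT_def T.dual_mult S.dual_mult T.to_dual_apply T.form_left S.dual_one_apply)
qed (rule iT_in)

lemma jS_hom: "jS \<in> hom S M"
proof (rule homI)
  fix x y assume xy: "x \<in> carrier S" "y \<in> carrier S"
  then show "jS (x \<otimes>\<^bsub>S\<^esub> y) = jS x \<otimes>\<^bsub>M\<^esub> jS y"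
    by (intro M_eqI[OF jS_in M_closed[OF jS_in jS_in]]) (simp_all add: M_mult jS_def T.dual_mult S.dual_mult S.to_dual_apply S.form_left T.dual_one_apply)
qed (rule jS_in)

text \<open>A functional \<open>h\<close> on \<open>M\<close> agrees with \<open>bsum (f, g)\<close>
  for its restrictions \<open>f\<close> to \<open>T\<close> and \<open>g\<close> to
  \<open>S\<close>. To see that this pair lies in \<open>M\<close>, it is compared with some
  \<open>(f, g0)\<close> in \<open>M\<close>. The difference \<open>d\<close> has integral products
  with all functionals on \<open>S\<close>, since each is the second component of an element of
  \<open>M\<close>; hence \<open>d\<close> comes from \<open>S\<close>.\<close>

lemma M_unimodular: "unimodular M"
  unfolding unimodular_def bij_betw_def
proof (intro conjI inj_onI equalityI subsetI)
  fix x y assume xy: "x \<in> carrier M" "y \<in> carrier M" "to_dual M x = to_dual M y"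
  have "form M x z = form M y z" if "z \<in> carrier M" for z
    using fun_cong[OF xy(3), of z] that by (simp add: to_dual_def)
  then show "x = y" using xy(1,2) iT_in jS_in by (intro M_eqI) (simp_all flip: form_iT form_jS)
next
  fix h assume "h \<in> to_dual M ` carrier M"
  then show "h \<in> carrier (dual_group M)" using M.to_dual_carrier by blast
next
  fix h assume h: "h \<in> carrier (dual_group M)"
  note H = hom_integer[OF M.is_group M.dual_hom[OF h]]
  interpret iT: group_hom T M iT using iT_hom by unfold_locales
  interpret jS: group_hom S M jS using jS_hom by unfold_locales
  define f where "f = (\<lambda>t\<in>carrier T. h (iT t))"
  define g where "g = (\<lambda>s\<in>carrier S. h (jS s))"
  have f: "f \<in> carrier (dual_group T)" unfolding f_def by (intro T.restrict_dual hom_integerI) (simp add: H)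
  have g: "g \<in> carrier (dual_group S)" unfolding g_def by (intro S.restrict_dual hom_integerI) (simp add: H)
  have hb: "of_int (h z) = bsum (f, g) z" if z: "z \<in> carrier M" for z
  proof -
    obtain N t s where N: "N > 0" "t \<in> carrier T" "s \<in> carrier S" "z [^]\<^bsub>M\<^esub> (N::int) = iT t \<otimes>\<^bsub>M\<^esub> jS s"
      using M_multiple[OF z] by blast
    have zc: "z [^]\<^bsub>M\<^esub> N \<in> carrier M" using z by simp
    have "N * fst z u = form T t u" if u: "u \<in> carrier T" for u
    proof -
      have "N * fst z u = fst (iT t \<otimes>\<^bsub>M\<^esub> jS s) u" using M_int_pow(1)[OF z u, of N] unfolding N(4) by simp
      then show ?thesis using u by (simp add: M_mult iT_def jS_def T.dual_mult T.to_dual_apply T.dual_one_apply)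
    qed
    then have "dual_form T f (fst z) = of_int (f t) / of_int N"
      using N by (intro T.dual_form_eq T.dual_hom f)
    moreover have "N * snd z u = form S s u" if u: "u \<in> carrier S" for u
    proof -
      have "N * snd z u = snd (iT t \<otimes>\<^bsub>M\<^esub> jS s) u" using M_int_pow(2)[OF z u, of N] unfolding N(4) by simp
      then show ?thesis using u by (simp add: M_mult iT_def jS_def S.dual_mult S.to_dual_apply S.dual_one_apply)
    qed
    then have "dual_form S g (snd z) = of_int (g s) / of_int N"
      using N by (intro S.dual_form_eq S.dual_hom g)
    moreover have "N * h z = f t + g s"
    proof -
      have "N * h z = h (z [^]\<^bsub>M\<^esub> N)" using H z by simp
      then show ?thesis unfolding N(4) using N by (simp add: H f_def g_def)
    qed
    then have "rat_of_int N * of_int (h z) = of_int (f t) + of_int (g s)" by (metis of_int_add of_int_mult)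
    then have "rat_of_int (h z) = (of_int (f t) + of_int (g s)) / of_int N" using N(1) by (simp add: field_simps)
    ultimately show ?thesis by (simp add: bsum_def add_divide_distrib)
  qed
  obtain g0 where g0: "(f, g0) \<in> carrier M" using gamma_class_ex[OF f] by blast
  have g0D: "g0 \<in> carrier (dual_group S)" using g0 by (simp add: M_iff)
  define d where "d = g \<otimes>\<^bsub>dual_group S\<^esub> inv\<^bsub>dual_group S\<^esub> g0"
  have d: "d \<in> carrier (dual_group S)" and gd: "g = d \<otimes>\<^bsub>dual_group S\<^esub> g0" using g g0D by (auto simp: d_def DS.m_assoc)
  have "dual_form S k d \<in> \<int>" if k: "k \<in> carrier (dual_group S)" for k
  proof -
    obtain k0 where k0: "(k0, k) \<in> carrier M" using gamma_class_ex'[OF k] by blast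
    have "dual_form S g k = dual_form S d k + dual_form S g0 k"
      using S.dual_form_add_left[OF S.dual_hom[OF d] S.dual_hom[OF g0D] S.dual_hom[OF k] S.dual_hom[OF g]] gd S.dual_mult by simp
    then have "dual_form S d k = bsum (f, g) (k0, k) - bsum (f, g0) (k0, k)" by (simp add: bsum_def)
    also have "\<dots> = of_int (h (k0, k) - form M (f, g0) (k0, k))" using hb[OF k0] bsum_int[OF g0 k0] by simp
    finally show ?thesis using S.dual_form_sym[OF S.dual_hom[OF d] S.dual_hom[OF k]] by simp
  qed
  then have dd: "d \<in> to_dual S ` carrier S" using S.dual_form_integral_imp[OF d] by blast
  then obtain s where s: "s \<in> carrier S" "d = to_dual S s" by blast
  have "(f, g) = jS s \<otimes>\<^bsub>M\<^esub> (f, g0)" using gd s f by (simp add: M_mult jS_def)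
  then have fg: "(f, g) \<in> carrier M" using jS_in[OF s(1)] g0 by simp
  have "to_dual M (f, g) = h"
  proof (rule M.dual_eqI[OF M.to_dual_carrier[OF fg] h])
    fix z assume z: "z \<in> carrier M"
    have "rat_of_int (form M (f, g) z) = of_int (h z)" using bsum_int[OF fg z] hb[OF z] by simp
    then show "to_dual M (f, g) z = h z" using z by (simp add: to_dual_def)
  qed
  then show "h \<in> to_dual M ` carrier M" using fg by blast
qed

text \<open>An element of \<open>M\<close> with zero second component has a first component in the
  kernel of \<open>\<gamma>\<close>, so injectivity of \<open>\<gamma>\<close> puts it into
  \<open>T\<close>; this is where primitivity comes from.\<close>

lemma M_glue_pair: "glue_pair M T S iT jS"
proof unfold_locales
  show "unimodular M" by (rule M_unimodular)
  show "iT \<in> hom T M" "jS \<in> hom S M" by (rule iT_hom jS_hom)+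
  show "form M (iT x) (iT y) = form T x y" if "x \<in> carrier T" "y \<in> carrier T" for x y
    using form_iT[OF iT_in[OF that(1)] that(2)] that by (simp add: iT_def T.to_dual_apply)
  show "form M (jS x) (jS y) = form S x y" if "x \<in> carrier S" "y \<in> carrier S" for x y
    using form_jS[OF jS_in[OF that(1)] that(2)] that by (simp add: jS_def S.to_dual_apply)
  have im: "z \<in> iT ` carrier T" if z: "z \<in> carrier M" "\<And>s. s \<in> carrier S \<Longrightarrow> snd z s = 0" for z
  proof -
    have s1: "snd z = \<one>\<^bsub>dual_group S\<^esub>"
      using z by (intro S.dual_eqI) (simp_all add: M_iff S.dual_one_apply)
    have c: "fst z \<in> carrier (dual_group T)" using z by (simp add: M_iff)
    have "\<gamma> (dual_class T (fst z)) = \<gamma> (dual_class T \<one>\<^bsub>dual_group T\<^esub>)" using z(1) s1 by (simp add: M_iff gamma_one)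
    then have "dual_class T (fst z) = dual_class T \<one>\<^bsub>dual_group T\<^esub>"
      using gamma_bij classT[OF c] classT[OF DT.one_closed] by (auto simp: bij_betw_def dest: inj_onD)
    then obtain t where "t \<in> carrier T" "fst z = to_dual T t" using T.dual_class_one_iff[OF c] by blast
    then show ?thesis using s1 by (intro image_eqI[of _ _ t]) (simp_all add: iT_def prod_eq_iff)
  qed
  have jm: "z \<in> jS ` carrier S" if z: "z \<in> carrier M" "\<And>s. s \<in> carrier T \<Longrightarrow> fst z s = 0" for z
  proof -
    have s1: "fst z = \<one>\<^bsub>dual_group T\<^esub>"
      using z by (intro T.dual_eqI) (simp_all add: M_iff T.dual_one_apply)
    have c: "snd z \<in> carrier (dual_group S)" using z by (simp add: M_iff)
    have "dual_class S (snd z) = dual_class S \<one>\<^bsub>dual_group S\<^esub>" using z(1) s1 by (simp add: M_iff gamma_one)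
    then obtain t where "t \<in> carrier S" "snd z = to_dual S t" using S.dual_class_one_iff[OF c] by blast
    then show ?thesis using s1 by (intro image_eqI[of _ _ t]) (simp_all add: jS_def prod_eq_iff)
  qed
  show "z \<in> iT ` carrier T" if z: "z \<in> carrier M" "(n::nat) > 0" "z [^]\<^bsub>M\<^esub> n \<in> iT ` carrier T" for z n
  proof (rule im[OF z(1)])
    fix s assume s: "s \<in> carrier S"
    obtain t where t: "t \<in> carrier T" "z [^]\<^bsub>M\<^esub> n = iT t" using z(3) by blast
    have "int n * snd z s = snd (z [^]\<^bsub>M\<^esub> n) s" using M_int_pow(2)[OF z(1) s, of "int n"] by (simp add: int_pow_int)
    also have "\<dots> = 0" using s by (simp add: t(2) iT_def S.dual_one_apply)
    finally show "snd z s = 0" using z(2) by simp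
  qed
  show "jS ` carrier S = {y\<in>carrier M. \<forall>x\<in>iT ` carrier T. form M x y = 0}"
  proof (intro equalityI subsetI)
    fix y assume "y \<in> jS ` carrier S"
    then obtain s where s: "s \<in> carrier S" "y = jS s" by blast
    have "form M (iT t) (jS s) = 0" if "t \<in> carrier T" for t
      using form_jS[OF iT_in[OF that] s(1)] s(1) by (simp add: iT_def S.dual_one_apply)
    then show "y \<in> {y\<in>carrier M. \<forall>x\<in>iT ` carrier T. form M x y = 0}" using s jS_in by auto
  next
    fix y assume y: "y \<in> {y\<in>carrier M. \<forall>x\<in>iT ` carrier T. form M x y = 0}"
    then have "fst y t = 0" if "t \<in> carrier T" for t
      using form_iT[of y t] M.form_sym[of y "iT t"] iT_in[OF that] that by auto
    then show "y \<in> jS ` carrier S" using y by (intro jm) auto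
  qed
qed

lemma M_glue_map: "glue_map M T S iT jS = \<gamma>"
proof -
  interpret P: glue_pair M T S iT jS by (rule M_glue_pair)
  have rT: "restr M T iT x = fst x" if x: "x \<in> carrier M" for x
    using x P.rT_dual[OF x] by (intro T.dual_eqI) (simp_all add: M_iff restr_def form_iT)
  have rS: "restr M S jS x = snd x" if x: "x \<in> carrier M" for x
    using x P.rS_dual[OF x] by (intro S.dual_eqI) (simp_all add: M_iff restr_def form_jS)
  show ?thesis
  proof (rule extensionalityI[of _ "carrier (disc_group T)"])
    show "\<gamma> \<in> extensional (carrier (disc_group T))" using gamma by (simp add: quad_isometries_def)
    fix c assume "c \<in> carrier (disc_group T)"
    then obtain x where x: "x \<in> carrier M" "c = dual_class T (restr M T iT x)" using P.disc_T_cases by blast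
    then have "glue_map M T S iT jS c = dual_class S (snd x)" using P.glue_map_class[OF x(1)] rS by simp
    then show "glue_map M T S iT jS c = \<gamma> c" using x rT by (simp add: M_iff)
  qed (simp add: glue_map_def)
qed

end

section \<open>Equivalence of embeddings\<close>

lemma image_compose_bij_betw: "bij_betw g A B \<Longrightarrow> compose A f g ` A = f ` B"
  by (auto simp: compose_def bij_betw_def image_image cong: image_cong_simp)

lemma torsion_free_FactGroup:
  assumes "comm_group A" "subgroup H A"
  shows "torsion_free (A Mod H) \<longleftrightarrow> (\<forall>z\<in>carrier A. \<forall>n::nat. n > 0 \<longrightarrow> z [^]\<^bsub>A\<^esub> n \<in> H \<longrightarrow> z \<in> H)"
proof -
  interpret comm_group A by fact
  interpret N: normal H A using subgroup_imp_normal[OF assms(2)] .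
  have pow: "(H #>\<^bsub>A\<^esub> z) [^]\<^bsub>A Mod H\<^esub> n = H #>\<^bsub>A\<^esub> (z [^]\<^bsub>A\<^esub> n)" if "z \<in> carrier A" for z and n :: nat
  proof (induction n)
    case 0
    then show ?case using N.subset by (simp add: FactGroup_def)
  next
    case (Suc n)
    then show ?case using that by (simp add: N.rcos_sum)
  qed
  have one: "H #>\<^bsub>A\<^esub> z = H \<longleftrightarrow> z \<in> H" if "z \<in> carrier A" for z
    using that coset_join1[OF _ that assms(2)] coset_join2[OF that assms(2)] by (auto simp: FactGroup_def N.subset)
  have car: "carrier (A Mod H) = (\<lambda>z. H #>\<^bsub>A\<^esub> z) ` carrier A" by (auto simp: FactGroup_def RCOSETS_def)
  show ?thesis unfolding torsion_free_def car by (auto simp: pow one)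
qed

lemma prim_embeddings_iff:
  assumes L: "integral_lattice L" and T: "integral_lattice T"
  shows "i \<in> prim_embeddings T L \<longleftrightarrow> i \<in> hom T L \<and> i \<in> extensional (carrier T) \<and>
    (\<forall>x\<in>carrier T. \<forall>y\<in>carrier T. form L (i x) (i y) = form T x y) \<and>
    (\<forall>z\<in>carrier L. \<forall>n::nat. n > 0 \<longrightarrow> z [^]\<^bsub>L\<^esub> n \<in> i ` carrier T \<longrightarrow> z \<in> i ` carrier T)"
proof -
  interpret L: integral_lattice L by fact
  interpret T: integral_lattice T by fact
  show ?thesis
  proof (cases "i \<in> hom T L \<and> (\<forall>x\<in>carrier T. \<forall>y\<in>carrier T. form L (i x) (i y) = form T x y)")
    case True
    interpret group_hom T L i using True by unfold_locales blast
    have "inj_on i (carrier T)" using T.inj_on_form[where f=i and B="form L"] True by blast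
    then show ?thesis
      using True torsion_free_FactGroup[OF L.comm_group_axioms img_is_subgroup]
      by (auto simp: prim_embeddings_def mon_def)
  qed (auto simp: prim_embeddings_def mon_def)
qed

lemma glue_pair_prim_embeddings:
  assumes "glue_pair L T S i j" "i \<in> extensional (carrier T)"
  shows "i \<in> prim_embeddings T L"
proof -
  interpret glue_pair L T S i j by fact
  show ?thesis unfolding prim_embeddings_iff[OF L.integral_lattice_axioms T.integral_lattice_axioms]
  proof (intro conjI ballI allI impI)
    show "z \<in> i ` carrier T" if "z \<in> carrier L" "n > 0" "z [^]\<^bsub>L\<^esub> n \<in> i ` carrier T" for z and n :: nat
      using i_prim[OF that] .
  qed (fact i_hom assms(2) | rule i_form; assumption)+
qed

text \<open>The complement is free because the coordinates of \<open>L\<close> separate its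
  elements. It is nondegenerate because each vector of \<open>L\<close> has a multiple that is a sum
  of a vector of \<open>T\<close> and one of the complement.\<close>

lemma glue_pair_orth_compl:
  assumes L: "even_lattice L" "unimodular L" and T: "even_lattice T" and i: "i \<in> prim_embeddings T L"
  defines "K \<equiv> orth_compl L (i ` carrier T)"
  shows "even_lattice K" "glue_pair L T K i (\<lambda>x. x)"
proof -
  interpret L: even_integral_lattice L using L by (intro even_integral_latticeI)
  interpret T: even_integral_lattice T using T by (intro even_integral_latticeI)
  have I: "i \<in> hom T L" "i \<in> extensional (carrier T)"
    "\<And>x y. x \<in> carrier T \<Longrightarrow> y \<in> carrier T \<Longrightarrow> form L (i x) (i y) = form T x y"
    "\<And>z n. z \<in> carrier L \<Longrightarrow> (n::nat) > 0 \<Longrightarrow> z [^]\<^bsub>L\<^esub> n \<in> i ` carrier T \<Longrightarrow> z \<in> i ` carrier T"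
    using i by (auto simp: prim_embeddings_iff[OF L.integral_lattice_axioms T.integral_lattice_axioms])
  interpret I: group_hom T L i using I(1) by unfold_locales
  have K: "x \<in> carrier K \<longleftrightarrow> x \<in> carrier L \<and> (\<forall>t\<in>carrier T. form L (i t) x = 0)" for x
    by (auto simp: K_def orth_compl_def)
  have Ks: "form K = form L" "x \<otimes>\<^bsub>K\<^esub> y = x \<otimes>\<^bsub>L\<^esub> y" "\<one>\<^bsub>K\<^esub> = \<one>\<^bsub>L\<^esub>" for x y
    by (simp_all add: K_def orth_compl_def)
  have "subgroup {y \<in> carrier L. \<forall>x\<in>i ` carrier T. form L x y = 0} L"
    by (rule L.subgroupI) (auto simp: L.form_right intro: exI[of _ "\<one>\<^bsub>L\<^esub>"])
  then have grp: "group K" using subgroup.subgroup_is_group[OF _ L.is_group] by (simp add: K_def orth_compl_def)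
  then have cg: "comm_group K"
    by (rule group.group_comm_groupI) (simp add: K Ks L.m_comm)
  obtain n e c where c: "coordinates L n e c" using L.coordinates_ex by blast
  note C = coordinatesD[OF c]
  have "\<exists>r e c. coordinates K r e c"
  proof (rule coordinates_exist[OF cg])
    show "\<forall>k<n. c k \<in> hom K integer_group"
      using hom_integer(1)[OF L.is_group C(2)] by (auto intro!: hom_integerI simp: K Ks)
    show "\<forall>x\<in>carrier K. (\<forall>k<n. c k x = 0) \<longrightarrow> x = \<one>\<^bsub>K\<^esub>"
      using C(4) hom_integer(2)[OF L.is_group C(2)] by (auto simp: K Ks)
  qed
  then obtain r e' c' where "coordinates K r e' c'" by blast
  then have free: "free_Abelian_group {..<r} \<cong> K"
    using coordinates_imp_iso_free[OF cg] unfolding is_iso_def by blast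
  have nd: "x = \<one>\<^bsub>K\<^esub>" if x: "x \<in> carrier K" "\<forall>y\<in>carrier K. form K x y = 0" for x
  proof -
    have xL: "x \<in> carrier L" using x K by blast
    have "form L x z = 0" if z: "z \<in> carrier L" for z
    proof -
      have "(\<lambda>t. form L z (i t)) \<in> hom T integer_group"
        using z by (intro hom_integerI) (simp add: L.form_right)
      then obtain N t where N: "N > 0" "t \<in> carrier T" "\<And>y. y \<in> carrier T \<Longrightarrow> N * form L z (i y) = form T t y"
        by (rule T.dual_rep) (rule that)
      define y where "y = z [^]\<^bsub>L\<^esub> N \<otimes>\<^bsub>L\<^esub> inv\<^bsub>L\<^esub> (i t)"
      have yL: "y \<in> carrier L" using z N by (simp add: y_def)
      have "form L (i u) y = 0" if u: "u \<in> carrier T" for u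
      proof -
        have "form L y (i u) = 0" using z N u by (simp add: y_def L.form_left I)
        then show ?thesis using L.form_sym[OF yL, of "i u"] u by simp
      qed
      then have "y \<in> carrier K" using yL K by blast
      then have "form L x y = 0" using x Ks by simp
      moreover have "form L x (i t) = 0" using x(1) N(2) K L.form_sym[OF xL, of "i t"] by simp
      ultimately show ?thesis using xL z N by (simp add: y_def L.form_right)
    qed
    then show ?thesis using L.form_nondegenerate[OF xL] Ks by simp
  qed
  have "zlattice K" unfolding zlattice_def
  proof (intro conjI ballI impI)
    show "\<exists>n::nat. free_Abelian_group {..<n} \<cong> K" using free by blast
    show "form K x \<in> hom K integer_group" if "x \<in> carrier K" for x
      using that by (intro hom_integerI) (simp add: K Ks L.form_right)
    show "form K x y = form K y x" if "x \<in> carrier K" "y \<in> carrier K" for x y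
      using that L.form_sym by (simp add: K Ks)
  qed (use cg nd in auto)
  then show ev: "even_lattice K" using L.even_form by (simp add: even_lattice_def K Ks)
  interpret K: even_integral_lattice K using ev by (rule even_integral_latticeI)
  show "glue_pair L T K i (\<lambda>x. x)"
  proof unfold_locales
    show "unimodular L" by (rule L(2))
    show "i \<in> hom T L" by (rule I(1))
    show "(\<lambda>x. x) \<in> hom K L" by (auto simp: hom_def K Ks)
    show "(\<lambda>x. x) ` carrier K = {y \<in> carrier L. \<forall>x\<in>i ` carrier T. form L x y = 0}" by (auto simp: K)
    show "form L (i x) (i y) = form T x y" if "x \<in> carrier T" "y \<in> carrier T" for x y using I(3)[OF that] .
    show "form L u v = form K u v" for u v by (simp only: Ks(1))
    show "z \<in> i ` carrier T" if "z \<in> carrier L" "n > 0" "z [^]\<^bsub>L\<^esub> n \<in> i ` carrier T" for z and n :: nat using I(4)[OF that] .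
  qed
qed

lemma glue_pair_precompose:
  assumes P: "glue_pair L T S i j" and g: "g \<in> isometries T T" and S': "even_integral_lattice S'" and h: "h \<in> isometries S' S"
  shows "glue_pair L T S' (compose (carrier T) i g) (compose (carrier S') j h)"
proof -
  interpret glue_pair L T S i j by fact
  interpret S': even_integral_lattice S' by fact
  note G = isometriesD[OF g] and H = isometriesD[OF h]
  have im: "compose (carrier T) i g ` carrier T = i ` carrier T"
    by (rule image_compose_bij_betw[OF G(2)])
  have im': "compose (carrier S') j h ` carrier S' = j ` carrier S"
    by (rule image_compose_bij_betw[OF H(2)])
  show ?thesis
  proof unfold_locales
    show "unimodular L" by (rule unimod)
    show "compose (carrier T) i g \<in> hom T L" using G by (auto simp: hom_def compose_def)
    show "compose (carrier S') j h \<in> hom S' L" using H by (auto simp: hom_def compose_def)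
    show "form L (compose (carrier T) i g x) (compose (carrier T) i g y) = form T x y" if "x \<in> carrier T" "y \<in> carrier T" for x y
      using that G by (simp add: compose_def i_form)
    show "form L (compose (carrier S') j h x) (compose (carrier S') j h y) = form S' x y" if "x \<in> carrier S'" "y \<in> carrier S'" for x y
      using that H by (simp add: compose_def j_form)
    show "z \<in> compose (carrier T) i g ` carrier T" if "z \<in> carrier L" "(n::nat) > 0" "z [^]\<^bsub>L\<^esub> n \<in> compose (carrier T) i g ` carrier T" for z n
      using that i_prim unfolding im by blast
    show "compose (carrier S') j h ` carrier S' = {y\<in>carrier L. \<forall>x\<in>compose (carrier T) i g ` carrier T. form L x y = 0}"
      unfolding im im' by (rule j_image)
  qed
qed

text \<open>Restricting along \<open>g\<close> or \<open>h\<close> composes the functional with it.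
  This is the source of both group actions on the isometries of the discriminant form.\<close>

lemma glue_map_precompose:
  assumes P: "glue_pair L T S i j" and g: "g \<in> isometries T T" and h: "h \<in> isometries S S" and c: "c \<in> carrier (disc_group T)"
  shows "disc_map S h (glue_map L T S (compose (carrier T) i g) (compose (carrier S) j h) c) = glue_map L T S i j (disc_map T g c)"
proof -
  interpret A: glue_pair L T S i j by fact
  interpret B: glue_pair L T S "compose (carrier T) i g" "compose (carrier S) j h"
    using glue_pair_precompose[OF P g A.S.even_integral_lattice_axioms h] .
  note G = isometriesD[OF g] and H = isometriesD[OF h]
  obtain x where x: "x \<in> carrier L" "c = dual_class T (B.rT x)" using B.disc_T_cases[OF c] by blast
  have rT: "B.rT x = (\<lambda>y\<in>carrier T. A.rT x (g y))" using G(4) by (auto simp: restr_def compose_def fun_eq_iff)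
  have rS: "B.rS x = (\<lambda>y\<in>carrier S. A.rS x (h y))" using H(4) by (auto simp: restr_def compose_def fun_eq_iff)
  have "disc_map S h (dual_class S (B.rS x)) = dual_class S (A.rS x)"
    unfolding rS by (rule disc_map_class[OF A.S.integral_lattice_axioms h A.rS_dual[OF x(1)]])
  moreover have "disc_map T g c = dual_class T (A.rT x)"
    unfolding x(2) rT by (rule disc_map_class[OF A.T.integral_lattice_axioms g A.rT_dual[OF x(1)]])
  ultimately show ?thesis using x B.glue_map_class[OF x(1)] A.glue_map_class[OF x(1)] by simp
qed

lemma disc_map_inverse:
  assumes L: "integral_lattice L" and h: "h \<in> isometries L L" and c: "c \<in> carrier (disc_group L)"
  defines "h' \<equiv> restrict (inv_into (carrier L) h) (carrier L)"
  shows "disc_map L h' (disc_map L h c) = c" "disc_map L h (disc_map L h' c) = c"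
    "disc_map L h c \<in> carrier (disc_group L)"
proof -
  interpret integral_lattice L by fact
  have h': "h' \<in> isometries L L" unfolding h'_def using isometries_inverse[OF h is_group] .
  note H = isometriesD[OF h] and H' = isometriesD[OF h']
  have hh: "h (h' y) = y" "h' (h y) = y" if "y \<in> carrier L" for y
    using that H(2,4) by (auto simp: h'_def bij_betw_def f_inv_into_f inv_into_f_f)
  obtain f where f: "f \<in> carrier (dual_group L)" "c = dual_class L f" using c disc_carrier by blast
  have dh: "(\<lambda>y\<in>carrier L. f (k y)) \<in> carrier (dual_group L)" if "k \<in> isometries L L" for k
    using isometriesD[OF that] hom_integer(1)[OF is_group dual_hom[OF f(1)]]
    by (intro restrict_dual hom_integerI) simp
  define k where "k = (\<lambda>y\<in>carrier L. f (h' y))"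
  define k' where "k' = (\<lambda>y\<in>carrier L. f (h y))"
  have k: "k \<in> carrier (dual_group L)" "k' \<in> carrier (dual_group L)" unfolding k_def k'_def using dh h h' by auto
  have "(\<lambda>y\<in>carrier L. k (h y)) = f" "(\<lambda>y\<in>carrier L. k' (h' y)) = f"
    using f(1) hh H(4) H'(4) by (auto simp: k_def k'_def dual_group_carrier extensional_def fun_eq_iff)
  then have 1: "disc_map L h c = dual_class L k" "disc_map L h' c = dual_class L k'"
    using disc_map_class[OF L h k(1)] disc_map_class[OF L h' k(2)] f(2) by simp_all
  show "disc_map L h c \<in> carrier (disc_group L)" unfolding 1 using k disc_carrier by blast
  show "disc_map L h' (disc_map L h c) = c"
    unfolding 1 unfolding k_def f(2) by (rule disc_map_class[OF L h' f(1)])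
  show "disc_map L h (disc_map L h' c) = c"
    unfolding 1 unfolding k'_def f(2) by (rule disc_map_class[OF L h f(1)])
qed

text \<open>\<open>C\<close> is a many-to-many correspondence, total on both sides, under which the
  two relations agree with the order of the pair reversed. \<open>R'\<close> inherits the properties
  of an equivalence relation from \<open>R\<close> along a choice \<open>k\<close> of
  partners.\<close>

lemma quotient_correspondence:
  assumes R: "equiv A R" and A': "A' \<subseteq> A" and R': "R' \<subseteq> B \<times> B"
    and ex: "\<And>a. a \<in> A' \<Longrightarrow> \<exists>b\<in>B. C a b" "\<And>b. b \<in> B \<Longrightarrow> \<exists>a\<in>A'. C a b"
    and iff: "\<And>a b a' b'. a \<in> A' \<Longrightarrow> a' \<in> A' \<Longrightarrow> b \<in> B \<Longrightarrow> b' \<in> B \<Longrightarrow> C a b \<Longrightarrow> C a' b' \<Longrightarrow> (a, a') \<in> R \<longleftrightarrow> (b', b) \<in> R'"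
  shows "\<exists>F. bij_betw F (B // R') ((\<lambda>a. R `` {a}) ` A')"
proof -
  obtain k where k: "\<And>b. b \<in> B \<Longrightarrow> k b \<in> A' \<and> C (k b) b" using ex(2) by metis
  have kr: "(k b, k b') \<in> R \<longleftrightarrow> (b', b) \<in> R'" if "b \<in> B" "b' \<in> B" for b b'
    using iff[of "k b" "k b'" b b'] k that by blast
  have sR: "sym R" "trans R" and rR: "\<And>a. a \<in> A' \<Longrightarrow> (a, a) \<in> R"
    using R A' by (auto simp: equiv_def refl_on_def)
  have symR': "(b', b) \<in> R'" if "(b, b') \<in> R'" for b b'
    using that R' kr sR(1) by (metis SigmaD1 SigmaD2 subsetD symD)
  have reflR': "(b, b) \<in> R'" if "b \<in> B" for b using kr[OF that that] rR k that by blast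
  have cls: "R' `` {b} = {b'\<in>B. (k b, k b') \<in> R}" if "b \<in> B" for b
    using kr[OF _ that] kr[OF that] symR' R' that by blast
  define F where "F D = \<Union> ((\<lambda>b. R `` {k b}) ` D)" for D
  have Rk: "R `` {k b'} = R `` {k b}" if "(k b, k b') \<in> R" for b b'
    using equiv_class_eq[OF R that] by simp
  have F: "F (R' `` {b}) = R `` {k b}" if b: "b \<in> B" for b
  proof -
    have "F (R' `` {b}) = (\<Union>b'\<in>R' `` {b}. R `` {k b})"
      unfolding F_def using Rk cls[OF b] by (intro SUP_cong) auto
    then show ?thesis using reflR'[OF b] by blast
  qed
  have "bij_betw F (B // R') ((\<lambda>a. R `` {a}) ` A')"
    unfolding bij_betw_def
  proof (rule conjI, rule inj_onI)
    fix D D' assume "D \<in> B // R'" "D' \<in> B // R'" and eq: "F D = F D'"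
    then obtain b b' where b: "b \<in> B" "D = R' `` {b}" "b' \<in> B" "D' = R' `` {b'}" by (auto simp: quotient_def)
    then have e: "R `` {k b} = R `` {k b'}" using eq F by simp
    then have "(k b, k b') \<in> R" using rR k[OF b(3)] by blast
    then show "D = D'" unfolding b(2,4) cls[OF b(1)] cls[OF b(3)] using e by blast
  next
    show "F ` (B // R') = (\<lambda>a. R `` {a}) ` A'"
    proof (intro equalityI subsetI)
    fix X assume "X \<in> F ` (B // R')"
    then obtain b where "b \<in> B" "X = F (R' `` {b})" by (auto simp: quotient_def)
    then show "X \<in> (\<lambda>a. R `` {a}) ` A'" using F k by blast
  next
    fix X assume "X \<in> (\<lambda>a. R `` {a}) ` A'"
    then obtain a where a: "a \<in> A'" "X = R `` {a}" by blast
    obtain b where b: "b \<in> B" "C a b" using ex(1)[OF a(1)] by blast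
    have "(a, k b) \<in> R" using iff[of a "k b" b b] k[OF b(1)] a b reflR' by blast
    then have "X = F (R' `` {b})" using equiv_class_eq[OF R] F[OF b(1)] a(2) by blast
    then show "X \<in> F ` (B // R')" using b(1) by (auto simp: quotient_def)
    qed
  qed
  then show ?thesis by blast
qed

section \<open>The equivalence relation on embeddings and the correspondence with isometries of the
  discriminant form\<close>

locale embedding_data =
  fixes L :: "'a zlat" and T :: "'b zlat" and G :: "('b \<Rightarrow> 'b) set"
  assumes L: "even_lattice L" "unimodular L" and indef: "indefinite L" and T: "even_lattice T"
    and G: "subgroup G (orth_group T)"
begin

sublocale L: even_integral_lattice L using even_integral_latticeI[OF L(1)] .
sublocale T: even_integral_lattice T using even_integral_latticeI[OF T] .

lemma isometries_Bij: "isometries T T \<subseteq> Bij (carrier T)"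
  using isometriesD by (auto simp: Bij_def)

lemma orth_group_group: "group (orth_group T)"
proof -
  interpret group "BijGroup (carrier T)" by (rule group_BijGroup)
  have "subgroup (isometries T T) (BijGroup (carrier T))"
  proof (rule subgroupI)
    show "isometries T T \<subseteq> carrier (BijGroup (carrier T))" using isometries_Bij by (simp add: BijGroup_def)
    show "isometries T T \<noteq> {}" using isometric_refl[OF T.is_group] by (simp add: isometric_def)
    fix f assume f: "f \<in> isometries T T"
    then have "inv\<^bsub>BijGroup (carrier T)\<^esub> f = restrict (inv_into (carrier T) f) (carrier T)"
      using isometries_Bij by (intro inv_BijGroup[THEN HOL.trans]) auto
    then show "inv\<^bsub>BijGroup (carrier T)\<^esub> f \<in> isometries T T" using isometries_inverse[OF f T.is_group] by simp
    fix g assume g: "g \<in> isometries T T"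
    then have "f \<otimes>\<^bsub>BijGroup (carrier T)\<^esub> g = compose (carrier T) f g"
      using f isometries_Bij by (auto simp: BijGroup_def)
    then show "f \<otimes>\<^bsub>BijGroup (carrier T)\<^esub> g \<in> isometries T T" using isometries_compose[OF g f T.is_group] by simp
  qed
  then show ?thesis unfolding orth_group_def using subgroup.subgroup_is_group is_group by blast
qed

lemma G_isometries: "g \<in> G \<Longrightarrow> g \<in> isometries T T"
  using subgroup.subset[OF G] by (auto simp: orth_group_def)

lemma orth_group_mult: "g \<in> G \<Longrightarrow> g' \<in> G \<Longrightarrow> g \<otimes>\<^bsub>orth_group T\<^esub> g' = compose (carrier T) g g'"
  using G_isometries isometries_Bij by (auto simp: orth_group_def BijGroup_def)

lemma G_mult: "g \<in> G \<Longrightarrow> g' \<in> G \<Longrightarrow> compose (carrier T) g g' \<in> G"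
  using subgroup.m_closed[OF G] by (metis orth_group_mult)

lemma G_one: "(\<lambda>x\<in>carrier T. x) \<in> G"
  using subgroup.one_closed[OF G] by (simp add: orth_group_def BijGroup_def)

lemma G_inverse:
  assumes g: "g \<in> G" shows "\<exists>g'\<in>G. \<forall>t\<in>carrier T. g (g' t) = t"
proof -
  interpret O: group "orth_group T" by (rule orth_group_group)
  let ?g = "inv\<^bsub>orth_group T\<^esub> g"
  have g': "?g \<in> G" using subgroup.m_inv_closed[OF G g] .
  have "g \<in> carrier (orth_group T)" using g subgroup.subset[OF G] by blast
  then have "g \<otimes>\<^bsub>orth_group T\<^esub> ?g = \<one>\<^bsub>orth_group T\<^esub>" by simp
  then have "compose (carrier T) g ?g = (\<lambda>x\<in>carrier T. x)"
    unfolding orth_group_mult[OF g g'] by (simp add: orth_group_def BijGroup_def)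
  then have "g (?g t) = t" if "t \<in> carrier T" for t
    using that by (metis compose_eq restrict_apply')
  then show ?thesis using g' by blast
qed

lemma G_equiv_iff:
  "(\<iota>, \<iota>') \<in> G_equiv T L G \<longleftrightarrow> \<iota> \<in> prim_embeddings T L \<and> \<iota>' \<in> prim_embeddings T L \<and>
     (\<exists>f\<in>isometries L L. \<exists>g\<in>G. \<forall>t\<in>carrier T. f (\<iota> t) = \<iota>' (g t))"
proof -
  have "compose (carrier T) f \<iota> = compose (carrier T) \<iota>' g \<longleftrightarrow> (\<forall>t\<in>carrier T. f (\<iota> t) = \<iota>' (g t))" for f g
    by (auto simp: compose_def fun_eq_iff)
  then show ?thesis by (auto simp: G_equiv_def)
qed

lemma prim_closed: "\<iota> \<in> prim_embeddings T L \<Longrightarrow> t \<in> carrier T \<Longrightarrow> \<iota> t \<in> carrier L"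
  by (auto simp: prim_embeddings_def mon_def hom_def)

lemma equiv_G_equiv: "equiv (prim_embeddings T L) (G_equiv T L G)"
proof (rule equivI)
  show "G_equiv T L G \<subseteq> prim_embeddings T L \<times> prim_embeddings T L" by (auto simp: G_equiv_def)
  show "refl_on (prim_embeddings T L) (G_equiv T L G)"
  proof (rule refl_onI)
    fix \<iota> assume i: "\<iota> \<in> prim_embeddings T L"
    have id: "(\<lambda>x\<in>carrier L. x) \<in> isometries L L" by (rule isometriesI) (auto simp: bij_betw_def inj_on_def)
    have "\<exists>f\<in>isometries L L. \<exists>g\<in>G. \<forall>t\<in>carrier T. f (\<iota> t) = \<iota> (g t)"
      using G_one prim_closed[OF i] by (intro bexI[OF _ id] bexI[OF _ G_one]) simp
    then show "(\<iota>, \<iota>) \<in> G_equiv T L G" using i by (simp add: G_equiv_iff)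
  qed
  show "sym (G_equiv T L G)"
  proof (rule symI)
    fix \<iota> \<iota>' assume "(\<iota>, \<iota>') \<in> G_equiv T L G"
    then obtain f g where i: "\<iota> \<in> prim_embeddings T L" "\<iota>' \<in> prim_embeddings T L" and f: "f \<in> isometries L L" "g \<in> G"
      "\<forall>t\<in>carrier T. f (\<iota> t) = \<iota>' (g t)" by (auto simp: G_equiv_iff)
    obtain g' where g': "g' \<in> G" "\<forall>t\<in>carrier T. g (g' t) = t" using G_inverse[OF f(2)] by blast
    note F = isometriesD[OF f(1)]
    let ?f = "restrict (inv_into (carrier L) f) (carrier L)"
    have "?f (\<iota>' t) = \<iota> (g' t)" if t: "t \<in> carrier T" for t
    proof -
      have gt: "g' t \<in> carrier T" using isometriesD(4)[OF G_isometries[OF g'(1)] t] .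
      then have "f (\<iota> (g' t)) = \<iota>' t" using f(3) g'(2) t by simp
      then show ?thesis using F(2) prim_closed[OF i(1) gt] prim_closed[OF i(2) t]
        by (metis bij_betw_inv_into_left restrict_apply')
    qed
    then show "(\<iota>', \<iota>) \<in> G_equiv T L G"
      using i g'(1) isometries_inverse[OF f(1) L.is_group] unfolding G_equiv_iff by blast
  qed
  show "trans (G_equiv T L G)"
  proof (rule transI)
    fix \<iota> \<iota>' \<iota>'' assume "(\<iota>, \<iota>') \<in> G_equiv T L G" "(\<iota>', \<iota>'') \<in> G_equiv T L G"
    then obtain f g f' g' where i: "\<iota> \<in> prim_embeddings T L" "\<iota>' \<in> prim_embeddings T L" "\<iota>'' \<in> prim_embeddings T L"
      and f: "f \<in> isometries L L" "g \<in> G" "\<forall>t\<in>carrier T. f (\<iota> t) = \<iota>' (g t)"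
      and f': "f' \<in> isometries L L" "g' \<in> G" "\<forall>t\<in>carrier T. f' (\<iota>' t) = \<iota>'' (g' t)" unfolding G_equiv_iff by blast
    have "compose (carrier L) f' f (\<iota> t) = \<iota>'' (compose (carrier T) g' g t)" if t: "t \<in> carrier T" for t
    proof -
      have "g t \<in> carrier T" using isometriesD(4)[OF G_isometries[OF f(2)] t] .
      then show ?thesis using t f(3) f'(3) prim_closed[OF i(1) t] by (simp add: compose_def)
    qed
    then show "(\<iota>, \<iota>'') \<in> G_equiv T L G"
      using i isometries_compose[OF f(1) f'(1) L.is_group] G_mult[OF f'(2) f(2)] unfolding G_equiv_iff by blast
  qed
qed

lemma quad_isometriesD:
  assumes "f \<in> quad_isometries A q B q'"
  shows "f \<in> hom A B" "bij_betw f (carrier A) (carrier B)" "f \<in> extensional (carrier A)"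
    "\<And>c. c \<in> carrier A \<Longrightarrow> q' (f c) = q c" "\<And>c. c \<in> carrier A \<Longrightarrow> f c \<in> carrier B"
  using assms by (auto simp: quad_isometries_def iso_def bij_betw_def)

lemma quad_isometries_compose:
  assumes "f \<in> quad_isometries A q B q'" "g \<in> quad_isometries B q' C q''" "group A"
  shows "compose (carrier A) g f \<in> quad_isometries A q C q''"
proof -
  note F = quad_isometriesD[OF assms(1)] and G = quad_isometriesD[OF assms(2)]
  interpret group A by fact
  have "bij_betw (compose (carrier A) g f) (carrier A) (carrier C)" using bij_betw_compose[OF F(2) G(2)] .
  moreover have "compose (carrier A) g f \<in> hom A C"
    using F(1,5) G(1,5) by (auto simp: hom_def compose_def)
  ultimately show ?thesis using F(4,5) G(4) by (auto simp: quad_isometries_def iso_def compose_def)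
qed

lemma quad_isometries_inverse:
  assumes "f \<in> quad_isometries A q B q'" "group A" "group B"
  shows "restrict (inv_into (carrier A) f) (carrier B) \<in> quad_isometries B q' A q"
proof -
  note F = quad_isometriesD[OF assms(1)]
  interpret A: group A by fact
  interpret B: group B by fact
  have "inv_into (carrier A) f \<in> iso B A" using F by (intro A.iso_set_sym) (simp add: iso_def)
  then have i: "bij_betw (inv_into (carrier A) f) (carrier B) (carrier A)" "inv_into (carrier A) f \<in> hom B A" by (auto simp: iso_def)
  have "restrict (inv_into (carrier A) f) (carrier B) \<in> hom B A" using i(2) by (auto simp: hom_def)
  moreover have "bij_betw (restrict (inv_into (carrier A) f) (carrier B)) (carrier B) (carrier A)"
    using i(1) by (subst bij_betw_restrict_eq)
  moreover have "q (inv_into (carrier A) f c) = q' c" if "c \<in> carrier B" for c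
    using F(4)[of "inv_into (carrier A) f c"] that F(2) i(1) by (auto simp: bij_betw_def f_inv_into_f)
  ultimately show ?thesis by (auto simp: quad_isometries_def iso_def)
qed

text \<open>
  The isomorphism \<open>j\<close> of \<open>S\<close> with the orthogonal complement is unique only up to \<open>O(S)\<close>; this is the
  left action on \<open>O(A\<^sub>S)\<close>.
\<close>

definition corresponds :: "'c zlat \<Rightarrow> (('b \<Rightarrow> int) set \<Rightarrow> ('c \<Rightarrow> int) set) \<Rightarrow> ('b \<Rightarrow> 'a) \<Rightarrow> (('c \<Rightarrow> int) set \<Rightarrow> ('c \<Rightarrow> int) set) \<Rightarrow> bool" where
  "corresponds S \<phi> \<iota> \<sigma> \<longleftrightarrow> (\<exists>j. glue_pair L T S \<iota> j \<and> (\<forall>c\<in>carrier (disc_group T). glue_map L T S \<iota> j c = \<sigma> (\<phi> c)))"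

text \<open>An equivalence of embeddings carries one complement to the other, which gives the
  isometry of \<open>S\<close> in the double coset relation. Conversely, that relation makes the
  gluing map of \<open>\<iota>, j\<close> equal to the one of \<open>\<iota>', j'\<close> modified
  by \<open>g\<close> and the inverse of \<open>h\<close>, and the gluing map determines the
  embedding up to isometries of \<open>L\<close>. The pair is reversed because \<open>g\<close>
  stands on the side of \<open>\<iota>'\<close>.\<close>

lemma corresponds_iff:
  fixes S :: "'c zlat"
  assumes S: "even_lattice S" and \<phi>: "\<phi> \<in> quad_isometries (disc_group T) (neg_disc_quad T) (disc_group S) (disc_quad S)"
    and i: "\<iota> \<in> prim_embeddings T L" "\<iota>' \<in> prim_embeddings T L"
    and \<sigma>: "\<sigma> \<in> disc_orth S" "\<sigma>' \<in> disc_orth S"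
    and c: "corresponds S \<phi> \<iota> \<sigma>" "corresponds S \<phi> \<iota>' \<sigma>'"
  shows "(\<iota>, \<iota>') \<in> G_equiv T L G \<longleftrightarrow> (\<sigma>', \<sigma>) \<in> double_coset_rel T G S \<phi>"
proof -
  interpret S: even_integral_lattice S using S by (rule even_integral_latticeI)
  note PH = quad_isometriesD[OF \<phi>]
  obtain j where j: "glue_pair L T S \<iota> j" "\<And>c. c \<in> carrier (disc_group T) \<Longrightarrow> glue_map L T S \<iota> j c = \<sigma> (\<phi> c)"
    using c(1) by (auto simp: corresponds_def)
  obtain j' where j': "glue_pair L T S \<iota>' j'" "\<And>c. c \<in> carrier (disc_group T) \<Longrightarrow> glue_map L T S \<iota>' j' c = \<sigma>' (\<phi> c)"
    using c(2) by (auto simp: corresponds_def)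
  interpret A: glue_pair L T S \<iota> j by (rule j(1))
  interpret B: glue_pair L T S \<iota>' j' by (rule j'(1))
  have sc: "\<sigma> d \<in> carrier (disc_group S)" "\<sigma>' d \<in> carrier (disc_group S)" if "d \<in> carrier (disc_group S)" for d
    using \<sigma> that by (auto simp: disc_orth_def dest: quad_isometriesD(5))
  have ext: "\<sigma> \<in> extensional (carrier (disc_group S))" using \<sigma> by (simp add: disc_orth_def quad_isometries_def)
  have ad: "disc_ad T S \<phi> (disc_map T g) (\<phi> c) = \<phi> (disc_map T g c)" if "c \<in> carrier (disc_group T)" for c g
    using that PH(2,5) by (simp add: disc_ad_def bij_betw_inv_into_left)
  have dT: "disc_map T g c \<in> carrier (disc_group T)" if "g \<in> G" "c \<in> carrier (disc_group T)" for g c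
    using disc_map_inverse(3)[OF T.integral_lattice_axioms G_isometries[OF that(1)] that(2)] .
  have rel: "(\<sigma>', \<sigma>) \<in> double_coset_rel T G S \<phi> \<longleftrightarrow> (\<exists>h\<in>isometries S S. \<exists>g\<in>G. \<forall>c\<in>carrier (disc_group T).
       \<sigma> (\<phi> c) = disc_map S h (\<sigma>' (\<phi> (disc_map T g c))))"
  proof -
    have "\<sigma> = compose (carrier (disc_group S)) (disc_map S h) (compose (carrier (disc_group S)) \<sigma>' (disc_ad T S \<phi> (disc_map T g))) \<longleftrightarrow>
      (\<forall>c\<in>carrier (disc_group T). \<sigma> (\<phi> c) = disc_map S h (\<sigma>' (\<phi> (disc_map T g c))))" (is "_ = ?r \<longleftrightarrow> _") for h g
    proof
      assume e: "\<sigma> = ?r"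
      show "\<forall>c\<in>carrier (disc_group T). \<sigma> (\<phi> c) = disc_map S h (\<sigma>' (\<phi> (disc_map T g c)))"
      proof
        fix c assume c: "c \<in> carrier (disc_group T)"
        have "\<sigma> (\<phi> c) = ?r (\<phi> c)" using e by simp
        then show "\<sigma> (\<phi> c) = disc_map S h (\<sigma>' (\<phi> (disc_map T g c)))" using PH(5)[OF c] ad[OF c] by (simp add: compose_def)
      qed
    next
      assume r: "\<forall>c\<in>carrier (disc_group T). \<sigma> (\<phi> c) = disc_map S h (\<sigma>' (\<phi> (disc_map T g c)))"
      show "\<sigma> = ?r"
      proof (rule extensionalityI[OF ext])
        fix d assume d: "d \<in> carrier (disc_group S)"
        then obtain c where "c \<in> carrier (disc_group T)" "d = \<phi> c" using PH(2) by (auto simp: bij_betw_def)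
        then show "\<sigma> d = ?r d" using r d ad by (simp add: compose_def)
      qed simp
    qed
    then show ?thesis using \<sigma> by (simp add: double_coset_rel_def)
  qed
  show ?thesis
  proof
    assume "(\<iota>, \<iota>') \<in> G_equiv T L G"
    then obtain f g where f: "f \<in> isometries L L" "g \<in> G" "\<And>t. t \<in> carrier T \<Longrightarrow> f (\<iota> t) = \<iota>' (g t)"
      by (auto simp: G_equiv_iff)
    note F = isometriesD[OF f(1)] and gI = G_isometries[OF f(2)]
    note Gg = isometriesD[OF gI]
    note P = glue_pair_transport[OF j(1) L.even_integral_lattice_axioms L(2) f(1)]
    interpret P: glue_pair L T S "compose (carrier T) f \<iota>" "compose (carrier S) f j" by (rule P(1))
    have e1: "compose (carrier T) \<iota>' g = compose (carrier T) f \<iota>" using f(3) by (auto simp: compose_def fun_eq_iff)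
    have orth': "y \<in> j' ` carrier S \<longleftrightarrow> y \<in> compose (carrier S) f j ` carrier S" for y
    proof -
      have "compose (carrier T) f \<iota> ` carrier T = \<iota>' ` carrier T"
        unfolding e1[symmetric] by (rule image_compose_bij_betw[OF Gg(2)])
      then show ?thesis using B.j_image P.j_image by simp
    qed
    \<comment> \<open>\<open>f\<close> carries the image of \<open>j\<close> onto the image of
      \<open>j'\<close>; reading this off on \<open>S\<close> defines \<open>h\<close> by
      \<open>j' (h s) = f (j s)\<close>.\<close>
    define h where "h = (\<lambda>s\<in>carrier S. inv_into (carrier S) j' (f (j s)))"
    have injj: "inj_on j' (carrier S)" using S.inj_on_form[where f=j' and B="form L"] B.j_form .
    have fj: "f (j s) \<in> j' ` carrier S" if "s \<in> carrier S" for s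
      using orth'[of "f (j s)"] that by (auto simp: compose_def)
    have h: "h s \<in> carrier S" "j' (h s) = f (j s)" if "s \<in> carrier S" for s
      using fj[OF that] that by (auto simp: h_def inv_into_into f_inv_into_f)
    have hform: "form S (h s) (h u) = form S s u" if "s \<in> carrier S" "u \<in> carrier S" for s u
      using B.j_form[OF h(1) h(1), OF that] h(2) that F(6) A.j_form by simp
    have hI: "h \<in> isometries S S"
    proof (rule isometriesI)
      show "bij_betw h (carrier S) (carrier S)"
        unfolding bij_betw_def
      proof (intro conjI equalityI subsetI)
        show "inj_on h (carrier S)" using S.inj_on_form[where f=h and B="form S"] hform .
      next
        fix u assume u: "u \<in> carrier S"
        then have "j' u \<in> compose (carrier S) f j ` carrier S" using orth' by blast
        then obtain s where s: "s \<in> carrier S" "j' u = f (j s)" by (auto simp: compose_def)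
        then have "h s = u" using inj_onD[OF injj, of "h s" u] h[OF s(1)] s u by simp
        then show "u \<in> h ` carrier S" using s by blast
      qed (use h in blast)
      show "h \<in> extensional (carrier S)" by (simp add: h_def)
      show "h (s \<otimes>\<^bsub>S\<^esub> u) = h s \<otimes>\<^bsub>S\<^esub> h u" if su: "s \<in> carrier S" "u \<in> carrier S" for s u
      proof -
        have "j' (h (s \<otimes>\<^bsub>S\<^esub> u)) = j' (h s \<otimes>\<^bsub>S\<^esub> h u)" using su h F(5) by simp
        then show ?thesis using inj_onD[OF injj, of "h (s \<otimes>\<^bsub>S\<^esub> u)" "h s \<otimes>\<^bsub>S\<^esub> h u"] h su by simp
      qed
    qed (rule hform)
    have e2: "compose (carrier S) j' h = compose (carrier S) f j" using h(2) by (auto simp: compose_def fun_eq_iff)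
    let ?h = "restrict (inv_into (carrier S) h) (carrier S)"
    have "\<sigma> (\<phi> c) = disc_map S ?h (\<sigma>' (\<phi> (disc_map T g c)))" if c: "c \<in> carrier (disc_group T)" for c
    proof -
      have "disc_map S h (\<sigma> (\<phi> c)) = \<sigma>' (\<phi> (disc_map T g c))"
        using glue_map_precompose[OF j'(1) gI hI c] P(2) j(2)[OF c] j'(2)[OF dT[OF f(2) c]] unfolding e1 e2 by simp
      moreover have "disc_map S ?h (disc_map S h (\<sigma> (\<phi> c))) = \<sigma> (\<phi> c)"
        using disc_map_inverse(1)[OF S.integral_lattice_axioms hI sc(1)[OF PH(5)[OF c]]] .
      ultimately show ?thesis by simp
    qed
    then show "(\<sigma>', \<sigma>) \<in> double_coset_rel T G S \<phi>"
      unfolding rel using isometries_inverse[OF hI S.is_group] f(2) by blast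
  next
    assume "(\<sigma>', \<sigma>) \<in> double_coset_rel T G S \<phi>"
    then obtain h g where hg: "h \<in> isometries S S" "g \<in> G"
      "\<And>c. c \<in> carrier (disc_group T) \<Longrightarrow> \<sigma> (\<phi> c) = disc_map S h (\<sigma>' (\<phi> (disc_map T g c)))" unfolding rel by blast
    \<comment> \<open>Precomposing \<open>j'\<close> acts on the gluing map through the inverse, so
      the inverse of \<open>h\<close> is needed here.\<close>
    let ?h = "restrict (inv_into (carrier S) h) (carrier S)"
    have hI: "?h \<in> isometries S S" using isometries_inverse[OF hg(1) S.is_group] .
    note gI = G_isometries[OF hg(2)]
    have Q: "glue_pair L T S (compose (carrier T) \<iota>' g) (compose (carrier S) j' ?h)"
      by (rule glue_pair_precompose[OF j'(1) gI S.even_integral_lattice_axioms hI])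
    interpret Q: glue_pair L T S "compose (carrier T) \<iota>' g" "compose (carrier S) j' ?h" by (rule Q)
    have "glue_map L T S \<iota> j = glue_map L T S (compose (carrier T) \<iota>' g) (compose (carrier S) j' ?h)"
    proof (rule extensionalityI[of _ "carrier (disc_group T)"])
      fix c assume c: "c \<in> carrier (disc_group T)"
      let ?d = "glue_map L T S (compose (carrier T) \<iota>' g) (compose (carrier S) j' ?h) c"
      have d: "?d \<in> carrier (disc_group S)" using quad_isometriesD(5)[OF Q.glue_map_isometry c] .
      have "disc_map S ?h ?d = \<sigma>' (\<phi> (disc_map T g c))"
        using glue_map_precompose[OF j'(1) gI hI c] j'(2)[OF dT[OF hg(2) c]] by simp
      then have "\<sigma> (\<phi> c) = disc_map S h (disc_map S ?h ?d)" using hg(3)[OF c] by simp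
      also have "\<dots> = ?d" by (rule disc_map_inverse(2)[OF S.integral_lattice_axioms hg(1) d])
      finally show "glue_map L T S \<iota> j c = ?d" using j(2)[OF c] by simp
    qed (simp_all add: glue_map_def)
    from glue_map_determines[OF j(1) Q this] obtain f where "f \<in> isometries L L"
      "\<forall>t\<in>carrier T. f (\<iota> t) = compose (carrier T) \<iota>' g t" by blast
    then show "(\<iota>, \<iota>') \<in> G_equiv T L G" unfolding G_equiv_iff using i hg(2) by (auto simp: compose_def)
  qed
qed

end

section \<open>Counting embeddings\<close>

lemma (in coord_lattice) form_frame_expansion:
  assumes F: "lattice_frame L F" and x: "x \<in> carrier L"
  shows "rat_of_int (form L x x) = (\<Sum>f\<in>F. (of_int (form L x f))\<^sup>2 / of_int (form L f f))"
proof -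
  have FL: "F \<subseteq> carrier L" using F by (simp add: lattice_frame_def)
  have inj: "inj_on (vec :: _ \<Rightarrow> _ \<Rightarrow> rat) F" using vec_inj FL inj_on_subset by blast
  have "rat_of_int (form L x x) = bil (vec x) (vec x)" using bil_vec[OF x x, where 'k = rat] by simp
  also have "\<dots> = (\<Sum>f\<in>vec ` F. bil (vec x) f * bil (vec x) f / bil f f)"
    using Q.frame_norm[OF lattice_frame_Q[OF F] Q_subspace vec_supp vec_supp] .
  also have "\<dots> = (\<Sum>f\<in>F. bil (vec x) (vec f) * bil (vec x) (vec f) / bil (vec f) (vec f))"
    using sum.reindex[OF inj] by (simp add: comp_def)
  also have "\<dots> = (\<Sum>f\<in>F. (of_int (form L x f))\<^sup>2 / of_int (form L f f))"
    using FL x by (intro sum.cong) (auto simp: bil_vec power2_eq_square subset_iff)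
  finally show ?thesis .
qed

text \<open>The norm of \<open>x\<close> is a sum of squares divided by the frame norms, so a vector
  of some sign forces a frame member of that sign.\<close>

lemma indefinite_iff_frame_signature:
  assumes L: "zlattice L" and F: "lattice_frame L F" and sg: "frame_signature L F = (p, q)"
  shows "indefinite L \<longleftrightarrow> p > 0 \<and> q > 0"
proof -
  interpret integral_lattice L using L by (rule integral_latticeI)
  obtain n e c where "coordinates L n e c" using coordinates_ex by blast
  then interpret coord_lattice L n e c by unfold_locales
  have fin: "finite F" "F \<subseteq> carrier L" using F by (auto simp: lattice_frame_def)
  have p: "p > 0 \<longleftrightarrow> (\<exists>f\<in>F. form L f f > 0)" and q: "q > 0 \<longleftrightarrow> (\<exists>f\<in>F. form L f f < 0)"
    using sg fin by (auto simp: frame_signature_def card_gt_0_iff)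
  have "\<exists>f\<in>F. form L f f > 0" if x: "x \<in> carrier L" "form L x x > 0" for x
  proof (rule ccontr)
    assume "\<not> ?thesis"
    then have "(\<Sum>f\<in>F. (of_int (form L x f))\<^sup>2 / of_int (form L f f) :: rat) \<le> 0"
      by (intro sum_nonpos divide_nonneg_nonpos) (auto simp: not_less)
    then show False using form_frame_expansion[OF F x(1)] x(2) by simp
  qed
  moreover have "\<exists>f\<in>F. form L f f < 0" if x: "x \<in> carrier L" "form L x x < 0" for x
  proof (rule ccontr)
    assume "\<not> ?thesis"
    then have "(\<Sum>f\<in>F. (of_int (form L x f))\<^sup>2 / of_int (form L f f) :: rat) \<ge> 0"
      by (intro sum_nonneg divide_nonneg_nonneg) (auto simp: not_less)
    then show False using form_frame_expansion[OF F x(1)] x(2) by simp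
  qed
  ultimately show ?thesis unfolding p q indefinite_def using fin(2) by blast
qed

lemma isometric_frame_signature:
  assumes "isometric L M" "zlattice L" "zlattice M" "lattice_frame L F" "lattice_frame M F'"
  shows "frame_signature L F = frame_signature M F'"
proof -
  obtain f where "f \<in> isometries L M" using assms(1) by (auto simp: isometric_def)
  from isometry_lattice_frame[OF this assms(2-4)] show ?thesis
    using frame_signature_unique[OF assms(3) _ assms(5)] by metis
qed

lemma glue_pair_isometric:
  assumes "glue_pair L T S i j"
  shows "isometric S (orth_compl L (i ` carrier T))"
proof -
  interpret glue_pair L T S i j by fact
  have j: "restrict j (carrier S) \<in> isometries S (orth_compl L (i ` carrier T))"
  proof (rule isometriesI)
    have "inj_on j (carrier S)" using S.inj_on_form[where f=j and B="form L"] j_form .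
    then show "bij_betw (restrict j (carrier S)) (carrier S) (carrier (orth_compl L (i ` carrier T)))"
      using j_image by (simp add: bij_betw_def orth_compl_def inj_on_restrict_eq)
  qed (auto simp: orth_compl_def j_form)
  then show ?thesis by (auto simp: isometric_def)
qed

text \<open>Lattices of equal rank have isomorphic groups, so the form of \<open>K\<close> can be
  transported to the carrier of \<open>S\<close>. Complements of embeddings live on type
  \<open>'a\<close>, whereas the genus collects lattices on \<open>'c\<close>.\<close>

lemma zlattice_on_carrier:
  fixes K :: "'a zlat" and S :: "'c zlat"
  assumes K: "zlattice K" "lattice_frame K F" and S: "zlattice S" "lattice_frame S F'" and card: "card F = card F'"
  shows "\<exists>S'::'c zlat. zlattice S' \<and> isometric S' K"
proof -
  interpret K: integral_lattice K using K(1) by (rule integral_latticeI)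
  interpret S: integral_lattice S using S(1) by (rule integral_latticeI)
  obtain n e c where c: "coordinates K n e c" using K.coordinates_ex by blast
  obtain n' e' c' where c': "coordinates S n' e' c'" using S.coordinates_ex by blast
  interpret cK: coord_lattice K n e c using c by unfold_locales
  interpret cS: coord_lattice S n' e' c' using c' by unfold_locales
  have n: "n' = n" using cK.lattice_frame_card[OF K(2)] cS.lattice_frame_card[OF S(2)] card by simp
  obtain u where u: "u \<in> iso (free_Abelian_group {..<n}) K"
    using coordinates_imp_iso_free[OF K.comm_group_axioms c] by blast
  obtain v where v: "v \<in> iso (free_Abelian_group {..<n}) S"
    using coordinates_imp_iso_free[OF S.comm_group_axioms c'] n by blast
  let ?w = "inv_into (carrier (free_Abelian_group {..<n})) v"
  have w: "?w \<in> iso S (free_Abelian_group {..<n})"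
    using group.iso_set_sym[OF _ v] abelian_free_Abelian_group[of "{..<n}"] by (simp add: comm_group_def)
  define \<alpha> where "\<alpha> = compose (carrier S) u ?w"
  have \<alpha>: "\<alpha> \<in> iso S K" unfolding \<alpha>_def using iso_set_trans[OF w u] by (auto simp: iso_def hom_def bij_betw_def compose_def inj_on_def)
  have \<alpha>D: "\<alpha> ` carrier S = carrier K" "inj_on \<alpha> (carrier S)"
    using \<alpha> by (auto simp: iso_def bij_betw_def)
  interpret h: group_hom S K \<alpha> using \<alpha> by unfold_locales (simp add: iso_def)
  define S' where "S' = S\<lparr>form := \<lambda>x y. form K (\<alpha> x) (\<alpha> y)\<rparr>"
  have S's: "carrier S' = carrier S" "x \<otimes>\<^bsub>S'\<^esub> y = x \<otimes>\<^bsub>S\<^esub> y" "\<one>\<^bsub>S'\<^esub> = \<one>\<^bsub>S\<^esub>" "form S' x y = form K (\<alpha> x) (\<alpha> y)" for x y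
    by (simp_all add: S'_def)
  have cg: "comm_group S'"
  proof (rule comm_groupI)
    show "\<exists>y\<in>carrier S'. y \<otimes>\<^bsub>S'\<^esub> x = \<one>\<^bsub>S'\<^esub>" if "x \<in> carrier S'" for x
      using that S.l_inv S.inv_closed unfolding S's by blast
  qed (simp_all add: S's S.m_ac)
  have "zlattice S'" unfolding zlattice_def
  proof (intro conjI ballI impI)
    show "comm_group S'" by (rule cg)
    have "v \<in> iso (free_Abelian_group {..<n}) S'" using v by (simp add: iso_def hom_def S's)
    then show "\<exists>n::nat. free_Abelian_group {..<n} \<cong> S'" by (auto simp: is_iso_def)
    show "form S' x \<in> hom S' integer_group" if "x \<in> carrier S'" for x
      using that by (intro hom_integerI) (simp add: S's K.form_right)
    show "form S' x y = form S' y x" if "x \<in> carrier S'" "y \<in> carrier S'" for x y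
      using that by (simp add: S's K.form_sym)
    fix x assume x: "x \<in> carrier S'" "\<forall>y\<in>carrier S'. form S' x y = 0"
    have "\<alpha> x = \<one>\<^bsub>K\<^esub>"
    proof (rule K.form_nondegenerate)
      fix y assume "y \<in> carrier K"
      then obtain z where "z \<in> carrier S" "y = \<alpha> z" using \<alpha>D(1) by blast
      then show "form K (\<alpha> x) y = 0" using x(2) by (simp add: S's)
    qed (use x S's in simp)
    then have "\<alpha> x = \<alpha> \<one>\<^bsub>S\<^esub>" by simp
    then show "x = \<one>\<^bsub>S'\<^esub>" using inj_onD[OF \<alpha>D(2), of x "\<one>\<^bsub>S\<^esub>"] x(1) S's(1,3) by simp
  qed
  moreover have "\<alpha> \<in> isometries S' K"
  proof (rule isometriesI)
    show "\<alpha> \<in> extensional (carrier S')" by (simp add: \<alpha>_def S's)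
  qed (use \<alpha> in \<open>simp_all add: S's iso_def\<close>)
  ultimately show ?thesis by (auto simp: isometric_def)
qed

lemma isometric_even_lattice:
  assumes "isometric S K" "even_lattice K" "zlattice S"
  shows "even_lattice S"
proof -
  obtain f where "f \<in> isometries S K" using assms(1) by (auto simp: isometric_def)
  note F = isometriesD[OF this]
  have "even (form S x x)" if "x \<in> carrier S" for x
    using F(4,6) that assms(2) unfolding even_lattice_def by metis
  then show ?thesis using assms(3) by (simp add: even_lattice_def)
qed

lemma isometry_class_eq_iff:
  fixes M M' :: "'a zlat"
  assumes "even_lattice M" "even_lattice M'"
  shows "isometry_class M = isometry_class M' \<longleftrightarrow> isometric M M'"
proof -
  have g: "group N" if "even_lattice N" for N :: "'a zlat"
    using that by (simp add: even_lattice_def zlattice_def comm_group_def)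
  show ?thesis
  proof
    assume "isometry_class M = isometry_class M'"
    moreover have "M' \<in> isometry_class M'" using assms isometric_refl[OF g] by (simp add: isometry_class_def)
    ultimately show "isometric M M'" by (auto simp: isometry_class_def)
  next
    assume i: "isometric M M'"
    have "isometric M N \<longleftrightarrow> isometric M' N" for N :: "'a zlat"
      using isometric_trans[OF i _ g] isometric_trans[OF isometric_sym[OF i g] _ g] assms by blast
    then show "isometry_class M = isometry_class M'" by (simp add: isometry_class_def)
  qed
qed

lemma (in integral_lattice) finite_disc_orth: "finite (disc_orth L)"
proof (rule finite_subset)
  show "disc_orth L \<subseteq> carrier (disc_group L) \<rightarrow>\<^sub>E carrier (disc_group L)"
    by (auto simp: disc_orth_def quad_isometries_def iso_def hom_def PiE_def)
  show "finite (carrier (disc_group L) \<rightarrow>\<^sub>E carrier (disc_group L))"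
    using disc_finite by (intro finite_PiE) auto
qed

context embedding_data
begin

lemma glue_pair_of_isometric:
  fixes S :: "'c zlat"
  assumes i: "\<iota> \<in> prim_embeddings T L" and S: "even_lattice S" "isometric (orth_compl L (\<iota> ` carrier T)) S"
  obtains j where "glue_pair L T S \<iota> j"
proof -
  let ?K = "orth_compl L (\<iota> ` carrier T)"
  note K = glue_pair_orth_compl[OF L T i]
  interpret glue_pair L T ?K \<iota> "\<lambda>x. x" by (rule K(2))
  obtain h where h: "h \<in> isometries S ?K"
    using isometric_sym[OF S(2)] S.is_group by (auto simp: isometric_def)
  have "compose (carrier T) \<iota> (\<lambda>x\<in>carrier T. x) = \<iota>"
    using i by (intro extensionalityI[of _ "carrier T"]) (auto simp: prim_embeddings_def compose_def)
  moreover have "(\<lambda>x\<in>carrier T. x) \<in> isometries T T" using G_one G_isometries by blast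
  ultimately show ?thesis
    using glue_pair_precompose[OF K(2) _ even_integral_latticeI[OF S(1)] h] that by metis
qed

lemma glue_pair_G_equiv:
  fixes S :: "'c zlat"
  assumes R: "(\<iota>, \<iota>') \<in> G_equiv T L G" and S: "even_lattice S" "isometric (orth_compl L (\<iota> ` carrier T)) S"
  shows "isometric (orth_compl L (\<iota>' ` carrier T)) S"
proof -
  obtain f g where fg: "\<iota> \<in> prim_embeddings T L" "f \<in> isometries L L" "g \<in> G" "\<And>t. t \<in> carrier T \<Longrightarrow> f (\<iota> t) = \<iota>' (g t)"
    using R by (auto simp: G_equiv_iff)
  obtain j where j: "glue_pair L T S \<iota> j" using glue_pair_of_isometric[OF fg(1) S] .
  note P = glue_pair_transport(1)[OF j L.even_integral_lattice_axioms L(2) fg(2)]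
  have "compose (carrier T) f \<iota> = compose (carrier T) \<iota>' g" using fg(4) by (auto simp: compose_def fun_eq_iff)
  then have "compose (carrier T) f \<iota> ` carrier T = \<iota>' ` carrier T"
    using image_compose_bij_betw isometriesD(2)[OF G_isometries[OF fg(3)]] by metis
  then have "isometric S (orth_compl L (\<iota>' ` carrier T))" using glue_pair_isometric[OF P] by simp
  moreover have "group S" using S(1) by (simp add: even_lattice_def zlattice_def comm_group_def)
  ultimately show ?thesis by (rule isometric_sym)
qed

text \<open>Both complements have the signature of \<open>L\<close> minus that of
  \<open>T\<close>.\<close>

lemma glue_pair_frame_signature:
  assumes P: "glue_pair L T S i j" "glue_pair L T S' i' j'" and F: "lattice_frame S F" "lattice_frame S' F'"
  shows "frame_signature S F = frame_signature S' F'"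
proof -
  obtain FT where FT: "lattice_frame T FT" using lattice_frame_exists T.lattice by blast
  obtain p q where pq: "frame_signature T FT = (p, q)" by fastforce
  obtain a b where ab: "frame_signature S F = (a, b)" by fastforce
  obtain a' b' where ab': "frame_signature S' F' = (a', b')" by fastforce
  have "lattice_frame L (i ` FT \<union> j ` F) \<and> frame_signature L (i ` FT \<union> j ` F) = (p + a, q + b)"
    using glue_pair.lattice_frame_glue[OF P(1) FT F(1) pq ab] .
  moreover have "lattice_frame L (i' ` FT \<union> j' ` F') \<and> frame_signature L (i' ` FT \<union> j' ` F') = (p + a', q + b')"
    using glue_pair.lattice_frame_glue[OF P(2) FT F(2) pq ab'] .
  ultimately have "(p + a, q + b) = (p + a', q + b')" using frame_signature_unique[OF L.lattice] by metis
  then show ?thesis using ab ab' by simp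
qed

lemma corresponds_exists:
  fixes S :: "'c zlat"
  assumes P: "glue_pair L T S \<iota> j"
    and \<phi>: "\<phi> \<in> quad_isometries (disc_group T) (neg_disc_quad T) (disc_group S) (disc_quad S)"
  shows "\<exists>\<sigma>\<in>disc_orth S. corresponds S \<phi> \<iota> \<sigma>"
proof -
  interpret glue_pair L T S \<iota> j by fact
  have g: "group (disc_group T)" "group (disc_group S)"
    using T.disc_group_group S.disc_group_group by (auto simp: comm_group_def)
  let ?\<phi> = "restrict (inv_into (carrier (disc_group T)) \<phi>) (carrier (disc_group S))"
  let ?\<sigma> = "compose (carrier (disc_group S)) (glue_map L T S \<iota> j) ?\<phi>"
  have "?\<sigma> \<in> disc_orth S" unfolding disc_orth_def
    by (rule quad_isometries_compose[OF quad_isometries_inverse[OF \<phi> g] glue_map_isometry g(2)])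
  moreover have "glue_map L T S \<iota> j c = ?\<sigma> (\<phi> c)" if "c \<in> carrier (disc_group T)" for c
    using that quad_isometriesD(2,5)[OF \<phi>] by (simp add: compose_def bij_betw_inv_into_left)
  ultimately show ?thesis using P unfolding corresponds_def by blast
qed

text \<open>\<open>T\<close> and \<open>S\<close> are glued along
  \<open>\<sigma> \<circ> \<phi>\<close>. The result has the signature of \<open>L\<close>, which is
  that of \<open>T\<close> plus that of \<open>K\<close>, so it is isometric to \<open>L\<close>,
  and the isometry moves the gluing pair into \<open>L\<close>. The given pair with \<open>K\<close>
  only provides the signature.\<close>

lemma corresponds_surj:
  fixes S :: "'c zlat"
  assumes S: "even_lattice S" and P: "glue_pair L T K i j" and F: "lattice_frame K F" "lattice_frame S F'" "frame_signature K F = frame_signature S F'"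
    and \<phi>: "\<phi> \<in> quad_isometries (disc_group T) (neg_disc_quad T) (disc_group S) (disc_quad S)" and \<sigma>: "\<sigma> \<in> disc_orth S"
  shows "\<exists>\<iota>\<in>prim_embeddings T L. isometric (orth_compl L (\<iota> ` carrier T)) S \<and> corresponds S \<phi> \<iota> \<sigma>"
proof -
  interpret S: even_integral_lattice S using S by (rule even_integral_latticeI)
  have g: "group (disc_group T)" using T.disc_group_group by (auto simp: comm_group_def)
  define \<gamma> where "\<gamma> = compose (carrier (disc_group T)) \<sigma> \<phi>"
  have \<gamma>: "\<gamma> \<in> quad_isometries (disc_group T) (neg_disc_quad T) (disc_group S) (disc_quad S)"
    unfolding \<gamma>_def using quad_isometries_compose[OF \<phi> \<sigma>[unfolded disc_orth_def] g] .
  interpret D: glue_data T S \<gamma> using \<gamma> by unfold_locales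
  let ?M = "glue_lattice T S \<gamma>"
  obtain FT where FT: "lattice_frame T FT" using lattice_frame_exists T.lattice by blast
  obtain p q where pq: "frame_signature T FT = (p, q)" by fastforce
  obtain a b where ab: "frame_signature K F = (a, b)" by fastforce
  then have ab': "frame_signature S F' = (a, b)" using F(3) by simp
  have FL: "lattice_frame L (i ` FT \<union> j ` F)" "frame_signature L (i ` FT \<union> j ` F) = (p + a, q + b)"
    using glue_pair.lattice_frame_glue[OF P FT F(1) pq ab] by blast+
  have FM: "lattice_frame ?M (D.iT ` FT \<union> D.jS ` F')" "frame_signature ?M (D.iT ` FT \<union> D.jS ` F') = (p + a, q + b)"
    using glue_pair.lattice_frame_glue[OF D.M_glue_pair FT F(2) pq ab'] by blast+
  have zM: "zlattice ?M" using D.M_even_lattice by (simp add: even_lattice_def)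
  have "indefinite ?M"
    using indef indefinite_iff_frame_signature[OF L.lattice FL] indefinite_iff_frame_signature[OF zM FM] by simp
  then have "isometric ?M L"
    using even_unimodular_indefinite_isometric[OF D.M_even_lattice D.M_unimodular _ L indef FM(1) FL(1)] FM(2) FL(2) by simp
  then obtain f where f: "f \<in> isometries ?M L" by (auto simp: isometric_def)
  let ?i = "compose (carrier T) f D.iT" and ?j = "compose (carrier S) f D.jS"
  note Q = glue_pair_transport[OF D.M_glue_pair L.even_integral_lattice_axioms L(2) f]
  have "?i \<in> prim_embeddings T L" using glue_pair_prim_embeddings[OF Q(1)] by simp
  moreover have "isometric (orth_compl L (?i ` carrier T)) S"
    using isometric_sym[OF glue_pair_isometric[OF Q(1)]] S.is_group by blast
  moreover have "glue_map L T S ?i ?j c = \<sigma> (\<phi> c)" if "c \<in> carrier (disc_group T)" for c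
    using that unfolding Q(2) D.M_glue_map by (simp add: \<gamma>_def compose_def)
  ultimately show ?thesis using Q(1) unfolding corresponds_def by blast
qed

lemma emb_classes_with_eq:
  "emb_classes_with T L G S =
     (\<lambda>a. G_equiv T L G `` {a}) ` {\<iota>\<in>prim_embeddings T L. isometric (orth_compl L (\<iota> ` carrier T)) S}"
proof (intro equalityI subsetI)
  fix C assume "C \<in> emb_classes_with T L G S"
  then obtain \<iota> where C: "C \<in> prim_embeddings T L // G_equiv T L G" "\<iota> \<in> C" "isometric (orth_compl L (\<iota> ` carrier T)) S"
    by (auto simp: emb_classes_with_def emb_classes_def)
  then obtain a where a: "C = G_equiv T L G `` {a}" "(a, \<iota>) \<in> G_equiv T L G" by (auto simp: quotient_def)
  then have "C = G_equiv T L G `` {\<iota>}" using equiv_class_eq[OF equiv_G_equiv] by blast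
  moreover have "\<iota> \<in> prim_embeddings T L" using a(2) by (simp add: G_equiv_def)
  ultimately show "C \<in> (\<lambda>a. G_equiv T L G `` {a}) ` {\<iota>\<in>prim_embeddings T L. isometric (orth_compl L (\<iota> ` carrier T)) S}"
    using C(3) by blast
next
  fix C assume "C \<in> (\<lambda>a. G_equiv T L G `` {a}) ` {\<iota>\<in>prim_embeddings T L. isometric (orth_compl L (\<iota> ` carrier T)) S}"
  then obtain \<iota> where i: "\<iota> \<in> prim_embeddings T L" "isometric (orth_compl L (\<iota> ` carrier T)) S" "C = G_equiv T L G `` {\<iota>}" by blast
  then have "\<iota> \<in> C" using equiv_class_self[OF equiv_G_equiv i(1)] by simp
  then show "C \<in> emb_classes_with T L G S"
    using i quotientI[OF i(1), of "G_equiv T L G"] unfolding emb_classes_with_def emb_classes_def by blast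
qed

lemma card_emb_classes_with:
  fixes S :: "'c zlat"
  assumes S: "even_lattice S" and P: "glue_pair L T K i j" and F: "lattice_frame K F" "lattice_frame S F'" "frame_signature K F = frame_signature S F'"
    and \<phi>: "\<phi> \<in> quad_isometries (disc_group T) (neg_disc_quad T) (disc_group S) (disc_quad S)"
  shows "finite (emb_classes_with T L G S) \<and> finite (double_cosets T G S \<phi>) \<and>
    card (emb_classes_with T L G S) = card (double_cosets T G S \<phi>)"
proof -
  interpret S: even_integral_lattice S using S by (rule even_integral_latticeI)
  let ?A = "{\<iota>\<in>prim_embeddings T L. isometric (orth_compl L (\<iota> ` carrier T)) S}"
  have R': "double_coset_rel T G S \<phi> \<subseteq> disc_orth S \<times> disc_orth S" by (auto simp: double_coset_rel_def)
  have 1: "\<exists>\<sigma>\<in>disc_orth S. corresponds S \<phi> \<iota> \<sigma>" if "\<iota> \<in> ?A" for \<iota>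
  proof -
    have i: "\<iota> \<in> prim_embeddings T L" "isometric (orth_compl L (\<iota> ` carrier T)) S" using that by auto
    obtain j where "glue_pair L T S \<iota> j" using glue_pair_of_isometric[OF i(1) S i(2)] .
    then show ?thesis using corresponds_exists \<phi> by blast
  qed
  have 2: "\<exists>\<iota>\<in>?A. corresponds S \<phi> \<iota> \<sigma>" if "\<sigma> \<in> disc_orth S" for \<sigma>
    using corresponds_surj[OF S P F \<phi> that] by blast
  have "\<exists>f. bij_betw f (double_cosets T G S \<phi>) (emb_classes_with T L G S)"
    unfolding emb_classes_with_eq double_cosets_def
  proof (rule quotient_correspondence[OF equiv_G_equiv _ R' 1 2])
    show "(\<iota>, \<iota>') \<in> G_equiv T L G \<longleftrightarrow> (\<sigma>', \<sigma>) \<in> double_coset_rel T G S \<phi>"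
      if "\<iota> \<in> ?A" "\<iota>' \<in> ?A" "\<sigma> \<in> disc_orth S" "\<sigma>' \<in> disc_orth S" "corresponds S \<phi> \<iota> \<sigma>" "corresponds S \<phi> \<iota>' \<sigma>'" for \<iota> \<sigma> \<iota>' \<sigma>'
      using corresponds_iff[OF S \<phi>] that by blast
  qed auto
  then obtain f where f: "bij_betw f (double_cosets T G S \<phi>) (emb_classes_with T L G S)" by blast
  have "double_cosets T G S \<phi> \<subseteq> Pow (disc_orth S)" unfolding double_cosets_def quotient_def using R' by blast
  then have "finite (double_cosets T G S \<phi>)" using S.finite_disc_orth finite_subset by blast
  then show ?thesis using bij_betw_same_card[OF f] bij_betw_finite[OF f] by simp
qed

text \<open>The discriminant forms of both complements are identified with the negative of that of
  \<open>T\<close> through the gluing maps, and the signatures agree by subtraction.\<close>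

lemma complement_in_genus:
  fixes S :: "'c zlat"
  assumes S: "even_lattice S" and P: "glue_pair L T S \<iota>\<^sub>0 j\<^sub>0" and i: "\<iota> \<in> prim_embeddings T L"
  shows "\<exists>S'::'c zlat. even_lattice S' \<and> same_genus S S' \<and> isometric (orth_compl L (\<iota> ` carrier T)) S'"
proof -
  let ?K = "orth_compl L (\<iota> ` carrier T)"
  note K = glue_pair_orth_compl[OF L T i]
  have zK: "zlattice ?K" and zS: "zlattice S" using K(1) S by (auto simp: even_lattice_def)
  obtain FK FS where FK: "lattice_frame ?K FK" and FS: "lattice_frame S FS"
    using lattice_frame_exists[OF zK] lattice_frame_exists[OF zS] by blast
  have sg: "frame_signature ?K FK = frame_signature S FS" by (rule glue_pair_frame_signature[OF K(2) P FK FS])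
  obtain p q where pq: "frame_signature S FS = (p, q)" by fastforce
  have "card FK = card FS" using frame_signature_card[OF FK] frame_signature_card[OF FS] sg pq by simp
  then obtain S' :: "'c zlat" where S': "zlattice S'" "isometric S' ?K"
    using zlattice_on_carrier[OF zK FK zS FS] by blast
  have ev: "even_lattice S'" by (rule isometric_even_lattice[OF S'(2) K(1) S'(1)])
  interpret S': even_integral_lattice S' using ev by (rule even_integral_latticeI)
  have iso: "isometric ?K S'" by (rule isometric_sym[OF S'(2) S'.is_group])
  obtain j where P': "glue_pair L T S' \<iota> j" using glue_pair_of_isometric[OF i ev iso] .
  interpret P: glue_pair L T S \<iota>\<^sub>0 j\<^sub>0 by (rule P)
  interpret P': glue_pair L T S' \<iota> j by (rule P')
  have g: "group (disc_group T)" "group (disc_group S')"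
    using T.disc_group_group S'.disc_group_group by (auto simp: comm_group_def)
  have "quad_isometries (disc_group S') (disc_quad S') (disc_group S) (disc_quad S) \<noteq> {}"
    using quad_isometries_compose[OF quad_isometries_inverse[OF P'.glue_map_isometry g] P.glue_map_isometry g(2)] by blast
  moreover obtain F' where F': "lattice_frame S' F'" using lattice_frame_exists[OF S'(1)] by blast
  have "frame_signature S' F' = (p, q)" using glue_pair_frame_signature[OF P' P F' FS] pq by simp
  then have "has_signature S p q \<and> has_signature S' p q"
    using has_signature_iff_frame[OF zS FS] has_signature_iff_frame[OF S'(1) F'] pq by simp
  ultimately have "same_genus S S'" unfolding same_genus_def by blast
  then show ?thesis using ev iso by blast
qed

end

theorem theorem1p4:
  fixes \<Lambda> :: "'a zlat" and T :: "'b zlat" and G :: "('b \<Rightarrow> 'b) set"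
    and \<iota>\<^sub>0 :: "'b \<Rightarrow> 'a" and S :: "'c zlat"
    and m :: nat and Sg :: "nat \<Rightarrow> 'c zlat"
    and \<phi> :: "nat \<Rightarrow> ('b \<Rightarrow> int) set \<Rightarrow> ('c \<Rightarrow> int) set"
  assumes "even_lattice \<Lambda>" and "unimodular \<Lambda>" and "indefinite \<Lambda>"
    and "even_lattice T"
    and "\<iota>\<^sub>0 \<in> prim_embeddings T \<Lambda>"
    and "subgroup G (orth_group T)"
    and "zlattice S" and "isometric S (orth_compl \<Lambda> (\<iota>\<^sub>0 ` carrier T))"
    and "\<And>j. j \<in> {1..m} \<Longrightarrow> even_lattice (Sg j)"
    and "Sg 1 = S"
    and "bij_betw (\<lambda>j. isometry_class (Sg j)) {1..m} (genus S)"
    and "\<And>j. j \<in> {1..m} \<Longrightarrow>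
           \<phi> j \<in> quad_isometries (disc_group T) (neg_disc_quad T)
                    (disc_group (Sg j)) (disc_quad (Sg j))"
  shows "(\<forall>j\<in>{1..m}.
            finite (emb_classes_with T \<Lambda> G (Sg j)) \<and>
            finite (double_cosets T G (Sg j) (\<phi> j)) \<and>
            card (emb_classes_with T \<Lambda> G (Sg j)) = card (double_cosets T G (Sg j) (\<phi> j))) \<and>
         finite (emb_classes T \<Lambda> G) \<and>
         card (emb_classes T \<Lambda> G) = (\<Sum>j\<in>{1..m}. card (double_cosets T G (Sg j) (\<phi> j)))"
proof -
  interpret embedding_data \<Lambda> T G by (rule embedding_data.intro[OF assms(1-4,6)])
  note ev = assms(9)
  have z: "zlattice M" "group M" if "even_lattice M" for M :: "'c zlat"
    using that by (auto simp: even_lattice_def zlattice_def comm_group_def)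
  note K = glue_pair_orth_compl[OF assms(1,2,4,5)]
  have evS: "even_lattice S" by (rule isometric_even_lattice[OF assms(8) K(1) assms(7)])
  have "isometric (orth_compl \<Lambda> (\<iota>\<^sub>0 ` carrier T)) S" by (rule isometric_sym[OF assms(8) z(2)[OF evS]])
  then obtain j\<^sub>0 where P: "glue_pair \<Lambda> T S \<iota>\<^sub>0 j\<^sub>0" using glue_pair_of_isometric[OF assms(5) evS] by blast
  obtain F where F: "lattice_frame S F" using lattice_frame_exists[OF assms(7)] by blast
  \<comment> \<open>Only the signature of \<open>Sg j\<close> is taken from the genus; the
    discriminant form is already supplied by \<open>\<phi> j\<close>.\<close>
  have each: "finite (emb_classes_with T \<Lambda> G (Sg j)) \<and> finite (double_cosets T G (Sg j) (\<phi> j)) \<and>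
      card (emb_classes_with T \<Lambda> G (Sg j)) = card (double_cosets T G (Sg j) (\<phi> j))" if j: "j \<in> {1..m}" for j
  proof -
    have "isometry_class (Sg j) \<in> genus S" using assms(11) j by (auto simp: bij_betw_def)
    then obtain M where M: "even_lattice M" "same_genus S M" "isometry_class M = isometry_class (Sg j)"
      unfolding genus_def by force
    have iso: "isometric M (Sg j)" using isometry_class_eq_iff[OF M(1) ev[OF j]] M(3) by simp
    obtain FM Fj where FM: "lattice_frame M FM" and Fj: "lattice_frame (Sg j) Fj"
      using lattice_frame_exists z(1)[OF M(1)] z(1)[OF ev[OF j]] by blast
    obtain p q where "has_signature S p q" "has_signature M p q" using M(2) by (auto simp: same_genus_def)
    then have "frame_signature S F = frame_signature M FM"
      using has_signature_iff_frame[OF assms(7) F] has_signature_iff_frame[OF z(1)[OF M(1)] FM] by simp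
    also have "\<dots> = frame_signature (Sg j) Fj"
      by (rule isometric_frame_signature[OF iso z(1)[OF M(1)] z(1)[OF ev[OF j]] FM Fj])
    finally show ?thesis using card_emb_classes_with[OF ev[OF j] P F Fj _ assms(12)[OF j]] by blast
  qed
  \<comment> \<open>Every complement is isometric to a member of the genus, hence to some
    \<open>Sg j\<close>.\<close>
  have un: "emb_classes T \<Lambda> G = (\<Union>j\<in>{1..m}. emb_classes_with T \<Lambda> G (Sg j))"
  proof (intro equalityI subsetI)
    fix C assume C: "C \<in> emb_classes T \<Lambda> G"
    then obtain \<iota> where i: "\<iota> \<in> prim_embeddings T \<Lambda>" "C = G_equiv T \<Lambda> G `` {\<iota>}" by (auto simp: emb_classes_def quotient_def)
    obtain M :: "'c zlat" where M: "even_lattice M" "same_genus S M" "isometric (orth_compl \<Lambda> (\<iota> ` carrier T)) M"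
      using complement_in_genus[OF evS P i(1)] by blast
    have "isometry_class M \<in> genus S" using M by (auto simp: genus_def)
    then have "isometry_class M \<in> (\<lambda>j. isometry_class (Sg j)) ` {1..m}" using assms(11) by (simp add: bij_betw_def)
    then obtain j where j: "j \<in> {1..m}" "isometry_class M = isometry_class (Sg j)" by blast
    then have "isometric M (Sg j)" using isometry_class_eq_iff[OF M(1) ev[OF j(1)]] by simp
    moreover have "group (orth_compl \<Lambda> (\<iota> ` carrier T))"
      using glue_pair_orth_compl(1)[OF assms(1,2,4) i(1)] by (simp add: even_lattice_def zlattice_def comm_group_def)
    ultimately have "isometric (orth_compl \<Lambda> (\<iota> ` carrier T)) (Sg j)" using isometric_trans[OF M(3)] by blast
    then show "C \<in> (\<Union>j\<in>{1..m}. emb_classes_with T \<Lambda> G (Sg j))" unfolding emb_classes_with_eq using i j(1) by blast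
  qed (auto simp: emb_classes_with_def)
  \<comment> \<open>A class determines its complement up to isometry, while different
    \<open>Sg j\<close> have different isometry classes.\<close>
  have disj: "emb_classes_with T \<Lambda> G (Sg k) \<inter> emb_classes_with T \<Lambda> G (Sg l) = {}"
    if kl: "k \<in> {1..m}" "l \<in> {1..m}" "k \<noteq> l" for k l
  proof (rule ccontr)
    assume "\<not> ?thesis"
    then obtain C where "C \<in> emb_classes_with T \<Lambda> G (Sg k)" "C \<in> emb_classes_with T \<Lambda> G (Sg l)" by blast
    then obtain \<iota> \<iota>' where i: "\<iota> \<in> prim_embeddings T \<Lambda>" "isometric (orth_compl \<Lambda> (\<iota> ` carrier T)) (Sg k)" "C = G_equiv T \<Lambda> G `` {\<iota>}"
      and i': "\<iota>' \<in> prim_embeddings T \<Lambda>" "isometric (orth_compl \<Lambda> (\<iota>' ` carrier T)) (Sg l)" "C = G_equiv T \<Lambda> G `` {\<iota>'}"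
      unfolding emb_classes_with_eq by blast
    have "(\<iota>, \<iota>') \<in> G_equiv T \<Lambda> G" using equiv_class_self[OF equiv_G_equiv i'(1)] i(3) i'(3) by blast
    then have "isometric (orth_compl \<Lambda> (\<iota>' ` carrier T)) (Sg k)" using glue_pair_G_equiv ev[OF kl(1)] i(2) by blast
    moreover have g: "group (orth_compl \<Lambda> (\<iota>' ` carrier T))"
      using glue_pair_orth_compl(1)[OF assms(1,2,4) i'(1)] by (simp add: even_lattice_def zlattice_def comm_group_def)
    ultimately have "isometric (Sg k) (Sg l)"
      using isometric_trans[OF isometric_sym i'(2)] z(2)[OF ev[OF kl(1)]] by blast
    then have "isometry_class (Sg k) = isometry_class (Sg l)" using isometry_class_eq_iff ev kl by blast
    then show False using assms(11) kl by (auto simp: bij_betw_def dest: inj_onD)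
  qed
  have "finite (emb_classes T \<Lambda> G)" unfolding un using each by blast
  moreover have "card (emb_classes T \<Lambda> G) = (\<Sum>j\<in>{1..m}. card (emb_classes_with T \<Lambda> G (Sg j)))"
    unfolding un using each disj by (intro card_UN_disjoint) auto
  ultimately show ?thesis using each by simp
qed

end
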